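(* Let $S$ be a finite set of simple steps. Let $u^-$ be the largest $u$ such that $(1,-u)\in S$ and $u^+$ the largest $u$ such that $(1,u)\in S$, assume that $u^-$ and $u^+$ are both positive, and let $d=u^-+u^+$. Let $B_S$, $E_S$, $M_S$ be the generating series (by length) of bridges, excursions and meanders with step set $S$. Then, after a pre-computation costing $\tilde{O}(d^5)$ arithmetic operations, the series $B_S$ can be expanded at order $N$ (i.e. its first $N$ terms computed) in $O(d^2N)$ arithmetic operations, and each of the series $E_S$ and $M_S$ can be expanded at order $N$ in $\tilde{O}(d^2N)$ arithmetic operations.
   Context: A simple step is a vector $(1,u)$ with $u\in\mathbb{Z}$; a step set is a finite set of simple steps. A (unidimensional) walk of length $n$ with step set $S$ is a sequence $(A_0,\dots,A_n)$ of points of $\mathbb{Z}^2$ with $A_0=(0,0)$ and $\overrightarrow{A_{k-1}A_k}=(1,u_k)\in S$ for all $k$; its final altitude is the $y$-coordinate $\sum_{i=1}^nu_i$ of $A_n$. Bridges are walks with final altitude $0$; meanders are walks confined to the upper half plane (all points have $y$-coordinate $\ge0$); excursions are bridges that are also meanders. $B_S(x)$ (resp. $E_S(x)$, $M_S(x)$) is the power series $\sum_{n\ge0}u_nx^n$, where $u_n$ is the number of bridges (resp. excursions, meanders) of length $n$ with step set $S$. Complexity: cost is the number of arithmetic operations in the base field of characteristic zero (e.g. $\mathbb{Q}$), at unit cost; $\tilde{O}(\cdot)$ means that polylogarithmic factors are omitted. *)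

theory Defs
  imports
    Complex_Main
    "HOL-Library.Product_Plus"
    "HOL-Computational_Algebra.Formal_Power_Series"
begin

section \<open>Walks and their generating series\<close>

type_synonym point = "int \<times> int"

definition step_set :: "point set \<Rightarrow> bool" where
  "step_set S \<longleftrightarrow> finite S \<and> (\<forall>s\<in>S. fst s = 1)"

text \<open>For a nonempty step set \<open>S\<close> both maxima are taken over nonempty finite sets; they may be
  negative. For \<open>S = {}\<close> they are unspecified.\<close>

definition u_minus :: "point set \<Rightarrow> int" where
  "u_minus S = Max {u. (1, - u) \<in> S}"

definition u_plus :: "point set \<Rightarrow> int" where
  "u_plus S = Max {u. (1, u) \<in> S}"

definition walks :: "point set \<Rightarrow> nat \<Rightarrow> point list set" where
  "walks S n = {A. length A = Suc n \<and> A ! 0 = (0, 0) \<and>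
                   (\<forall>k\<in>{1..n}. A ! k - A ! (k - 1) \<in> S)}"

definition final_altitude :: "point list \<Rightarrow> int" where
  "final_altitude A = snd (last A)"

definition bridges :: "point set \<Rightarrow> nat \<Rightarrow> point list set" where
  "bridges S n = {A \<in> walks S n. final_altitude A = 0}"

definition meanders :: "point set \<Rightarrow> nat \<Rightarrow> point list set" where
  "meanders S n = {A \<in> walks S n. \<forall>P\<in>set A. snd P \<ge> 0}"

definition excursions :: "point set \<Rightarrow> nat \<Rightarrow> point list set" where
  "excursions S n = bridges S n \<inter> meanders S n"

definition bridge_series :: "point set \<Rightarrow> 'k::field_char_0 fps" where
  "bridge_series S = Abs_fps (\<lambda>n. of_nat (card (bridges S n)))"

definition excursion_series :: "point set \<Rightarrow> 'k::field_char_0 fps" where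
  "excursion_series S = Abs_fps (\<lambda>n. of_nat (card (excursions S n)))"

definition meander_series :: "point set \<Rightarrow> 'k::field_char_0 fps" where
  "meander_series S = Abs_fps (\<lambda>n. of_nat (card (meanders S n)))"


section \<open>Arithmetic random access machines over a field\<close>

text \<open>
  The machine has a field memory, on which it can perform the four field operations and test
  for zero, and an index memory of natural numbers for addresses and loop counters. Field
  cells are always addressed indirectly, through index cells. The only field constants
  are 0 and 1, and there is no instruction that converts an index into a field element.

  Every executed instruction is charged one unit: the field operations, but also copies, tests,
  jumps and index operations. This total bounds the number of field operations from above.
  Charging the field operations alone would let a program carry out arbitrary computations in
  the index memory free of charge. For the same reason, index cells can only be added,
  subtracted and compared.
\<close>

datatype instr =
    IConst nat nat
  | IAdd nat nat nat
  | ISub nat nat nat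
  | ILoad nat nat
  | IStore nat nat
  | JumpLe nat nat nat
  | FZero nat
  | FOne nat
  | FCopy nat nat
  | FAdd nat nat nat
  | FSub nat nat nat
  | FMul nat nat nat
  | FDiv nat nat nat
  | JumpZero nat nat

record 'k state =
  pc :: nat
  idx :: "nat \<Rightarrow> nat"
  fld :: "nat \<Rightarrow> 'k"

definition set_idx :: "nat \<Rightarrow> nat \<Rightarrow> 'k state \<Rightarrow> 'k state" where
  "set_idx a v s = s\<lparr>pc := Suc (pc s), idx := (idx s)(a := v)\<rparr>"

definition set_fld :: "nat \<Rightarrow> 'k \<Rightarrow> 'k state \<Rightarrow> 'k state" where
  "set_fld a v s = s\<lparr>pc := Suc (pc s), fld := (fld s)(idx s a := v)\<rparr>"

definition get_fld :: "'k state \<Rightarrow> nat \<Rightarrow> 'k" where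
  "get_fld s a = fld s (idx s a)"

definition jump_if :: "bool \<Rightarrow> nat \<Rightarrow> 'k state \<Rightarrow> 'k state" where
  "jump_if b l s = s\<lparr>pc := (if b then l else Suc (pc s))\<rparr>"

text \<open>Index subtraction is truncated at 0. Division by zero is an error: the
  machine gets stuck.\<close>

fun exec_instr :: "instr \<Rightarrow> 'k::field state \<Rightarrow> 'k state option" where
  "exec_instr (IConst a c) s = Some (set_idx a c s)"
| "exec_instr (IAdd a b c) s = Some (set_idx a (idx s b + idx s c) s)"
| "exec_instr (ISub a b c) s = Some (set_idx a (idx s b - idx s c) s)"
| "exec_instr (ILoad a b) s = Some (set_idx a (idx s (idx s b)) s)"
| "exec_instr (IStore a b) s = Some (set_idx (idx s a) (idx s b) s)"
| "exec_instr (JumpLe a b l) s = Some (jump_if (idx s a \<le> idx s b) l s)"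
| "exec_instr (FZero a) s = Some (set_fld a 0 s)"
| "exec_instr (FOne a) s = Some (set_fld a 1 s)"
| "exec_instr (FCopy a b) s = Some (set_fld a (get_fld s b) s)"
| "exec_instr (FAdd a b c) s = Some (set_fld a (get_fld s b + get_fld s c) s)"
| "exec_instr (FSub a b c) s = Some (set_fld a (get_fld s b - get_fld s c) s)"
| "exec_instr (FMul a b c) s = Some (set_fld a (get_fld s b * get_fld s c) s)"
| "exec_instr (FDiv a b c) s =
     (if get_fld s c = 0 then None else Some (set_fld a (get_fld s b / get_fld s c) s))"
| "exec_instr (JumpZero a l) s = Some (jump_if (get_fld s a = 0) l s)"

text \<open>\<open>exec P s t s'\<close>: started in \<open>s\<close>, program \<open>P\<close> halts in \<open>s'\<close> after exactly \<open>t\<close>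
  instructions. A program halts when the program counter leaves it.\<close>

inductive exec :: "instr list \<Rightarrow> 'k::field state \<Rightarrow> nat \<Rightarrow> 'k state \<Rightarrow> bool" for P where
  halt: "length P \<le> pc s \<Longrightarrow> exec P s 0 s"
| step: "pc s < length P \<Longrightarrow> exec_instr (P ! pc s) s = Some s' \<Longrightarrow> exec P s' t s'' \<Longrightarrow>
         exec P s (Suc t) s''"

text \<open>The step set is passed to the machine as \<open>u_minus S\<close> and \<open>u_plus S\<close>, in the index cells 0 and 1,
  together with the coefficients of the polynomial \<open>\<Sum>(1,u)\<in>S. y^(u_minus S + u)\<close>, in the
  field cells 0, 1, and so on. All other cells are 0.\<close>

definition step_set_input :: "point set \<Rightarrow> 'k::field_char_0 state" where
  "step_set_input S =
     \<lparr>pc = 0,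
      idx = (\<lambda>_. 0)(0 := nat (u_minus S), 1 := nat (u_plus S)),
      fld = (\<lambda>i. if (1, int i - u_minus S) \<in> S then 1 else 0)\<rparr>"

text \<open>An expansion program starts with both memories as the pre-computation left them, except
  that index cell 0 receives \<open>N\<close>. On halting, index cell 0 holds the address of the first of
  \<open>N\<close> consecutive field cells containing the coefficients of \<open>x^0, \<dots>, x^(N-1)\<close>.\<close>

definition expands_within ::
    "instr list \<Rightarrow> 'k::field_char_0 state \<Rightarrow> nat \<Rightarrow> 'k fps \<Rightarrow> real \<Rightarrow> bool" where
  "expands_within P s N f c \<longleftrightarrow>
     (\<exists>t s'. exec P (s\<lparr>pc := 0, idx := (idx s)(0 := N)\<rparr>) t s' \<and> real t \<le> c \<and>
             (\<forall>n<N. fld s' (idx s' 0 + n) = fps_nth f n))"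

end

theory Submission
  imports Defs "HOL-Computational_Algebra.Formal_Laurent_Series" "HOL-Computational_Algebra.Polynomial_FPS"
    "HOL-Number_Theory.Cong"
begin

text \<open>
  Let \<open>c = u_minus S\<close>, \<open>e = u_plus S\<close>, \<open>d = c + e\<close>, and let \<open>w(n, h)\<close> be the number of walks of length \<open>n\<close>
  that end at height \<open>h\<close>. By symmetry every step contributes the same to the final altitude, so
  \<open>h w(n + 1, h) = (n + 1) (\<Sum>u. u w(n, h - u))\<close>; since also \<open>w(n + 1, h) = (\<Sum>u. w(n, h - u))\<close>, the
  row \<open>w(n, _)\<close> satisfies a linear recurrence of order \<open>d\<close>. A window of \<open>d\<close> consecutive entries
  around height 0 can therefore be extended to \<open>2 d\<close> entries in \<open>O(d^2)\<close> operations, and from those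
  the window of row \<open>n + 1\<close> is read off. This yields the numbers \<open>b(n)\<close> of bridges, and also the
  numbers \<open>p(n)\<close> of walks ending at height \<open>\<ge> 0\<close>, because \<open>p(n + 1)\<close> differs from a combination of
  copies of \<open>p(n)\<close> by entries of the window.

  By the factorization of walks at their minimum, the excursion and the meander numbers satisfy
  \<open>n E(n) = (\<Sum>k=1..n. b(k) E(n - k))\<close> and \<open>n M(n) = (\<Sum>k=1..n. p(k) M(n - k))\<close>. Both recurrences are
  solved online: block products of doubling sizes, each computed by Schoenhage's negacyclic
  multiplication, add every product to its target just before it is needed. No pre-computation
  beyond copying \<open>u_minus S\<close> out of index cell 0 is required.
\<close>

section \<open>Structured programs\<close>

text \<open>The machine shapes the construction. Indices can be neither multiplied nor divided, so
  the sizes in the multiplication are powers of two found by doubling, and addresses advance by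
  addition. An index cannot become a field element, so \<open>n + 1\<close>, \<open>c n\<close> and
  the divisor of the online recurrence are counted along in field cells. A field of characteristic
  zero may have no roots of unity beyond -1; powers of \<open>X\<close> modulo
  \<open>X^w + 1\<close> take their place, and multiplying by them is a signed rotation.
  Characteristic zero is what makes 1/2, the pivots of the row recurrence and the division by
  \<open>n\<close> available. A product of size \<open>2^s\<close> is charged
  \<open>s^2 2^s\<close>: padding doubles the data at every level of the recursion, but the exponent
  of the size is about halved, so a level costs a multiple of \<open>s 2^s\<close>, and there are at
  most \<open>s\<close> levels. The online schedule adds one more factor \<open>s\<close>, whence
  the third power of the logarithm.\<close>

datatype com = Instrs "instr list" | Seq com com (infixr \<open>;;\<close> 60) | While nat nat com

text \<open>Index cells from 100 on are reserved for stores through an address, so that such a store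
  never overwrites one of the cells used as registers.\<close>

fun eff :: "instr \<Rightarrow> (nat \<Rightarrow> nat) \<Rightarrow> (nat \<Rightarrow> 'k::field) \<Rightarrow> ((nat \<Rightarrow> nat) \<times> (nat \<Rightarrow> 'k)) option" where
  "eff (IConst a c) i f = Some (i(a := c), f)"
| "eff (IAdd a b c) i f = Some (i(a := i b + i c), f)"
| "eff (ISub a b c) i f = Some (i(a := i b - i c), f)"
| "eff (ILoad a b) i f = Some (i(a := i (i b)), f)"
| "eff (IStore a b) i f = (if i a < 100 then None else Some (i(i a := i b), f))"
| "eff (FZero a) i f = Some (i, f(i a := 0))"
| "eff (FOne a) i f = Some (i, f(i a := 1))"
| "eff (FCopy a b) i f = Some (i, f(i a := f (i b)))"
| "eff (FAdd a b c) i f = Some (i, f(i a := f (i b) + f (i c)))"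
| "eff (FSub a b c) i f = Some (i, f(i a := f (i b) - f (i c)))"
| "eff (FMul a b c) i f = Some (i, f(i a := f (i b) * f (i c)))"
| "eff (FDiv a b c) i f = (if f (i c) = 0 then None else Some (i, f(i a := f (i b) / f (i c))))"
| "eff (JumpLe a b l) i f = None"
| "eff (JumpZero a l) i f = None"

fun effs :: "instr list \<Rightarrow> (nat \<Rightarrow> nat) \<Rightarrow> (nat \<Rightarrow> 'k::field) \<Rightarrow> ((nat \<Rightarrow> nat) \<times> (nat \<Rightarrow> 'k)) option" where
  "effs [] i f = Some (i, f)"
| "effs (x # xs) i f = (case eff x i f of None \<Rightarrow> None | Some (i', f') \<Rightarrow> effs xs i' f')"

text \<open>Costs mirror the compiled code: the test is one conditional jump, and an iteration that
  is carried out also pays for the jump back. Leaving a loop thus costs 1, and each round costs 2 on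
  top of its body.\<close>

inductive run :: "com \<Rightarrow> (nat \<Rightarrow> nat) \<Rightarrow> (nat \<Rightarrow> 'k::field) \<Rightarrow> nat \<Rightarrow> (nat \<Rightarrow> nat) \<Rightarrow> (nat \<Rightarrow> 'k) \<Rightarrow> bool" where
  run_Instrs: "effs xs i f = Some (i', f') \<Longrightarrow> run (Instrs xs) i f (length xs) i' f'"
| run_Seq: "run c1 i f t i' f' \<Longrightarrow> run c2 i' f' u i'' f'' \<Longrightarrow> run (c1 ;; c2) i f (t + u) i'' f''"
| run_done: "i b \<le> i a \<Longrightarrow> run (While a b c) i f 1 i f"
| run_loop: "i a < i b \<Longrightarrow> run c i f t i' f' \<Longrightarrow> run (While a b c) i' f' u i'' f'' \<Longrightarrow>
    run (While a b c) i f (t + u + 2) i'' f''"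

fun csize :: "com \<Rightarrow> nat" where
  "csize (Instrs xs) = length xs"
| "csize (c1 ;; c2) = csize c1 + csize c2"
| "csize (While a b c) = csize c + 2"

text \<open>Jump targets are absolute, so \<open>o1\<close> carries the address at which the code
  will stand. \<open>JumpLe 0 0\<close> is the unconditional jump, a cell being at most
  itself.\<close>

fun comp :: "nat \<Rightarrow> com \<Rightarrow> instr list" where
  "comp o1 (Instrs xs) = xs"
| "comp o1 (c1 ;; c2) = comp o1 c1 @ comp (o1 + csize c1) c2"
| "comp o1 (While a b c) = JumpLe b a (o1 + csize c + 2) # comp (Suc o1) c @ [JumpLe 0 0 o1]"

lemma length_comp [simp]: "length (comp o1 c) = csize c"
  by (induction c arbitrary: o1) auto

lemma eff_exec_instr:
  "eff x i f = Some (i', f') \<Longrightarrow>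
   exec_instr x \<lparr>pc = p, idx = i, fld = f\<rparr> = Some \<lparr>pc = Suc p, idx = i', fld = f'\<rparr>"
  by (cases x) (auto simp: set_idx_def set_fld_def get_fld_def split: if_splits)

lemma effs_exec:
  assumes "effs xs i f = Some (i', f')" "P = pre @ xs @ post"
    "exec P \<lparr>pc = length pre + length xs, idx = i', fld = f'\<rparr> u s"
  shows "exec P \<lparr>pc = length pre, idx = i, fld = f\<rparr> (length xs + u) s"
  using assms
proof (induction xs arbitrary: i f pre)
  case Nil
  then show ?case by simp
next
  case (Cons x xs)
  obtain i1 f1 where e: "eff x i f = Some (i1, f1)" "effs xs i1 f1 = Some (i', f')"
    using Cons.prems(1) by (auto split: option.splits)
  have "exec P \<lparr>pc = length (pre @ [x]), idx = i1, fld = f1\<rparr> (length xs + u) s"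
    by (rule Cons.IH[OF e(2)]) (use Cons.prems in auto)
  then have "exec P \<lparr>pc = Suc (length pre), idx = i1, fld = f1\<rparr> (length xs + u) s"
    by simp
  then have "exec P \<lparr>pc = length pre, idx = i, fld = f\<rparr> (Suc (length xs + u)) s"
    by (rule exec.step[rotated 2]) (use Cons.prems(2) eff_exec_instr[OF e(1)] in auto)
  then show ?case by simp
qed

text \<open>A relation \<open>exec\<close> always extends to the halting state, so executions cannot
  be cut at the end of a fragment. Composing with an arbitrary execution from that point on is the
  form that survives the induction.\<close>

lemma run_exec_context:
  assumes "run c i f t i' f'" "P = pre @ comp (length pre) c @ post"
    "exec P \<lparr>pc = length pre + csize c, idx = i', fld = f'\<rparr> u s"
  shows "exec P \<lparr>pc = length pre, idx = i, fld = f\<rparr> (t + u) s"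
  using assms
proof (induction arbitrary: pre post u rule: run.induct)
  case (run_Instrs xs i f i' f')
  then show ?case using effs_exec[of xs i f i' f' P pre post u s] by simp
next
  case (run_Seq c1 i f t i' f' c2 v i'' f'')
  have "exec P \<lparr>pc = length (pre @ comp (length pre) c1), idx = i', fld = f'\<rparr> (v + u) s"
    by (rule run_Seq.IH(2)) (use run_Seq.prems in \<open>auto simp: add_ac\<close>)
  then have "exec P \<lparr>pc = length pre, idx = i, fld = f\<rparr> (t + (v + u)) s"
    by (intro run_Seq.IH(1)) (use run_Seq.prems in auto)
  then show ?case by (simp add: add_ac)
next
  case (run_done i b a c f)
  have "exec P \<lparr>pc = length pre, idx = i, fld = f\<rparr> (Suc u) s"
    by (rule exec.step[rotated 2], rule run_done.prems(2))
      (use run_done in \<open>auto simp: jump_if_def nth_append add_ac\<close>)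
  then show ?case by simp
next
  case (run_loop i a b c f t i' f' v i'' f'')
  have "exec P \<lparr>pc = length pre, idx = i', fld = f'\<rparr> (v + u) s"
    by (rule run_loop.IH(2)[OF run_loop.prems])
  then have "exec P \<lparr>pc = Suc (length pre) + csize c, idx = i', fld = f'\<rparr> (Suc (v + u)) s"
    by (rule exec.step[rotated 2])
      (use run_loop.prems(1) in \<open>auto simp: jump_if_def nth_append\<close>)
  then have "exec P \<lparr>pc = length (pre @ [JumpLe b a (length pre + csize c + 2)]), idx = i, fld = f\<rparr>
      (t + Suc (v + u)) s"
    by (intro run_loop.IH(1)) (use run_loop.prems(1) in auto)
  then have "exec P \<lparr>pc = length pre, idx = i, fld = f\<rparr> (Suc (t + Suc (v + u))) s"
    by (intro exec.step[rotated 2], simp)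
      (use run_loop in \<open>auto simp: jump_if_def nth_append\<close>)
  then show ?case by (simp add: add_ac)
qed

lemma run_exec:
  assumes "run c i f t i' f'"
  shows "exec (comp 0 c) \<lparr>pc = 0, idx = i, fld = f\<rparr> t \<lparr>pc = csize c, idx = i', fld = f'\<rparr>"
  using run_exec_context[OF assms, of "comp 0 c" "[]" "[]" 0] by (simp add: exec.halt)

text \<open>The third argument of the postcondition of \<open>wp\<close> is a clock; the last argument of \<open>wp\<close> is its initial
  value. A bound on the running time is thus part of an invariant like any other.\<close>

definition wp :: "com \<Rightarrow> ((nat \<Rightarrow> nat) \<Rightarrow> (nat \<Rightarrow> 'k::field) \<Rightarrow> nat \<Rightarrow> bool) \<Rightarrow>
    (nat \<Rightarrow> nat) \<Rightarrow> (nat \<Rightarrow> 'k) \<Rightarrow> nat \<Rightarrow> bool" where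
  "wp c Q i f t \<longleftrightarrow> (\<exists>i' f' u. run c i f u i' f' \<and> Q i' f' (t + u))"

text \<open>A syntactic overapproximation of the index cells that may change. The target of
  \<open>IStore\<close> is known only at run time; the test in \<open>eff\<close> makes
  \<open>{100..}\<close> a sound answer.\<close>

fun wri :: "instr \<Rightarrow> nat set" where
  "wri (IConst a c) = {a}"
| "wri (IAdd a b c) = {a}"
| "wri (ISub a b c) = {a}"
| "wri (ILoad a b) = {a}"
| "wri (IStore a b) = {100..}"
| "wri _ = {}"

fun wrs :: "instr list \<Rightarrow> nat set" where
  "wrs [] = {}"
| "wrs (x # xs) = wri x \<union> wrs xs"

lemma wrs_append [simp]: "wrs (xs @ ys) = wrs xs \<union> wrs ys"
  by (induction xs) auto

fun wr :: "com \<Rightarrow> nat set" where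
  "wr (Instrs xs) = wrs xs"
| "wr (c1 ;; c2) = wr c1 \<union> wr c2"
| "wr (While a b c) = wr c"

lemma eff_frame: "eff x i f = Some (i', f') \<Longrightarrow> r \<notin> wri x \<Longrightarrow> i' r = i r"
  by (cases x) (auto split: if_splits)

lemma effs_frame: "effs xs i f = Some (i', f') \<Longrightarrow> r \<notin> wrs xs \<Longrightarrow> i' r = i r"
  by (induction xs arbitrary: i f) (auto split: option.splits dest!: eff_frame)

lemma run_frame: "run c i f t i' f' \<Longrightarrow> r \<notin> wr c \<Longrightarrow> i' r = i r"
  by (induction rule: run.induct) (auto dest: effs_frame)

text \<open>The frame is handed over together with the postcondition, so specifications list only
  the registers that change.\<close>

lemma wp_conseq:
  assumes "wp c Q i f t"
    "\<And>i' f' t'. Q i' f' t' \<Longrightarrow> (\<And>r. r \<notin> wr c \<Longrightarrow> i' r = i r) \<Longrightarrow> Q' i' f' t'"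
  shows "wp c Q' i f t"
  using assms run_frame unfolding wp_def by meson

lemma wp_Seq [simp]: "wp (c1 ;; c2) Q i f t = wp c1 (wp c2 Q) i f t"
proof
  assume "wp (c1 ;; c2) Q i f t"
  then show "wp c1 (wp c2 Q) i f t"
    unfolding wp_def by (auto elim!: run.cases[of "c1 ;; c2"]) (metis add.assoc)
next
  assume "wp c1 (wp c2 Q) i f t"
  then show "wp (c1 ;; c2) Q i f t"
    unfolding wp_def by (metis run_Seq add.assoc)
qed

lemma wp_Seq_eq: "wp (c1 ;; c2) Q = wp c1 (wp c2 Q)"
  by (intro ext) simp

lemma wp_Instrs: "wp (Instrs xs) Q i f t \<longleftrightarrow>
    (case effs xs i f of None \<Rightarrow> False | Some (i', f') \<Rightarrow> Q i' f' (t + length xs))"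
  unfolding wp_def by (auto elim!: run.cases[of "Instrs xs"] intro: run_Instrs split: option.splits)

lemma wp_Nil [simp]: "wp (Instrs []) Q i f t = Q i f t"
  by (simp add: wp_Instrs)

lemma wp_Cons: "wp (Instrs (x # xs)) Q i f t \<longleftrightarrow>
    (case eff x i f of None \<Rightarrow> False | Some (i', f') \<Rightarrow> wp (Instrs xs) Q i' f' (Suc t))"
  by (auto simp: wp_Instrs split: option.splits)

lemma wp_prims [simp]:
  "wp (Instrs (IConst a c # xs)) Q i f t = wp (Instrs xs) Q (i(a := c)) f (Suc t)"
  "wp (Instrs (IAdd a b d # xs)) Q i f t = wp (Instrs xs) Q (i(a := i b + i d)) f (Suc t)"
  "wp (Instrs (ISub a b d # xs)) Q i f t = wp (Instrs xs) Q (i(a := i b - i d)) f (Suc t)"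
  "wp (Instrs (ILoad a b # xs)) Q i f t = wp (Instrs xs) Q (i(a := i (i b))) f (Suc t)"
  "wp (Instrs (IStore a b # xs)) Q i f t \<longleftrightarrow> 100 \<le> i a \<and> wp (Instrs xs) Q (i(i a := i b)) f (Suc t)"
  "wp (Instrs (FZero a # xs)) Q i f t = wp (Instrs xs) Q i (f(i a := 0)) (Suc t)"
  "wp (Instrs (FOne a # xs)) Q i f t = wp (Instrs xs) Q i (f(i a := 1)) (Suc t)"
  "wp (Instrs (FCopy a b # xs)) Q i f t = wp (Instrs xs) Q i (f(i a := f (i b))) (Suc t)"
  "wp (Instrs (FAdd a b d # xs)) Q i f t = wp (Instrs xs) Q i (f(i a := f (i b) + f (i d))) (Suc t)"
  "wp (Instrs (FSub a b d # xs)) Q i f t = wp (Instrs xs) Q i (f(i a := f (i b) - f (i d))) (Suc t)"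
  "wp (Instrs (FMul a b d # xs)) Q i f t = wp (Instrs xs) Q i (f(i a := f (i b) * f (i d))) (Suc t)"
  "wp (Instrs (FDiv a b d # xs)) Q i f t \<longleftrightarrow>
     f (i d) \<noteq> 0 \<and> wp (Instrs xs) Q i (f(i a := f (i b) / f (i d))) (Suc t)"
  by (auto simp: wp_Cons not_less)

text \<open>Total correctness by announcing the number \<open>n\<close> of rounds in advance;
  \<open>I\<close> is indexed by the rounds done. The two extra ticks of the clock are the test
  before the body and the jump after it, and the frame facts always refer to the state at loop
  entry.\<close>

lemma wp_while:
  assumes "I 0 i f t"
    "\<And>k i' f' t'. k < n \<Longrightarrow> I k i' f' t' \<Longrightarrow> (\<And>r. r \<notin> wr body \<Longrightarrow> i' r = i r) \<Longrightarrow>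
       i' a < i' b \<and> wp body (\<lambda>i f t. I (Suc k) i f (Suc t)) i' f' (Suc t')"
    "\<And>i' f' t'. I n i' f' t' \<Longrightarrow> (\<And>r. r \<notin> wr body \<Longrightarrow> i' r = i r) \<Longrightarrow>
       i' b \<le> i' a \<and> Q i' f' (Suc t')"
  shows "wp (While a b body) Q i f t"
proof -
  have "wp (While a b body) Q i' f' t'"
    if "I k i' f' t'" "k \<le> n" "\<And>r. r \<notin> wr body \<Longrightarrow> i' r = i r" for k i' f' t'
    using that
  proof (induction "n - k" arbitrary: k i' f' t')
    case 0
    then have "k = n" by simp
    with 0 have "i' b \<le> i' a \<and> Q i' f' (Suc t')"
      using assms(3) by blast
    then show ?case
      unfolding wp_def by (metis Suc_eq_plus1 run_done)
  next
    case (Suc m)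
    then have k: "k < n" by simp
    have s: "i' a < i' b \<and> wp body (\<lambda>i f t. I (Suc k) i f (Suc t)) i' f' (Suc t')"
      by (rule assms(2)[OF k Suc.prems(1,3)])
    then obtain i1 f1 u where r: "run body i' f' u i1 f1" "I (Suc k) i1 f1 (Suc (Suc t' + u))"
      unfolding wp_def by auto
    have fr: "i1 r = i r" if "r \<notin> wr body" for r
      using run_frame[OF r(1) that] Suc.prems(3)[OF that] by simp
    have "wp (While a b body) Q i1 f1 (Suc (Suc t' + u))"
      by (rule Suc.hyps(1)[of "Suc k"]) (use Suc.hyps k r(2) fr in auto)
    then obtain i2 f2 v where v: "run (While a b body) i1 f1 v i2 f2" "Q i2 f2 (Suc (Suc t' + u) + v)"
      unfolding wp_def by blast
    have "run (While a b body) i' f' (u + v + 2) i2 f2"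
      using run_loop[OF conjunct1[OF s] r(1) v(1)] .
    moreover have "Q i2 f2 (t' + (u + v + 2))"
      using v(2) by (simp add: add_ac)
    ultimately show ?case unfolding wp_def by blast
  qed
  from this[OF assms(1)] show ?thesis by simp
qed

text \<open>Index cells have no copy instruction. This sequence copies only between distinct cells,
  as it clears the target before adding.\<close>

abbreviation mov :: "nat \<Rightarrow> nat \<Rightarrow> instr list" where
  "mov a b \<equiv> [IConst a 0, IAdd a a b]"

abbreviation inc :: "nat \<Rightarrow> instr list" where
  "inc a \<equiv> [IConst 99 (Suc 0), IAdd a a 99]"

section \<open>Array operations\<close>

definition upd_arr :: "(nat \<Rightarrow> 'k) \<Rightarrow> nat \<Rightarrow> nat \<Rightarrow> (nat \<Rightarrow> 'k) \<Rightarrow> nat \<Rightarrow> 'k" where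
  "upd_arr f a l g = (\<lambda>y. if a \<le> y \<and> y < a + l then g (y - a) else f y)"

lemma upd_arr_0 [simp]: "upd_arr f a 0 g = f"
  by (auto simp: upd_arr_def fun_eq_iff)

lemma upd_arr_Suc: "upd_arr f a (Suc l) g = (upd_arr f a l g)(a + l := g l)"
  by (auto simp: upd_arr_def fun_eq_iff)

lemma upd_arr_outside: "y < a \<or> a + l \<le> y \<Longrightarrow> upd_arr f a l g y = f y"
  by (auto simp: upd_arr_def)

lemma upd_arr_inside: "k < l \<Longrightarrow> upd_arr f a l g (a + k) = g k"
  by (auto simp: upd_arr_def)

definition pol :: "(nat \<Rightarrow> 'k::field) \<Rightarrow> nat \<Rightarrow> nat \<Rightarrow> 'k poly" where
  "pol f a l = (\<Sum>k<l. monom (f (a + k)) k)"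

abbreviation xp :: "nat \<Rightarrow> 'k::field poly" where
  "xp k \<equiv> monom 1 k"

lemma coeff_pol: "coeff (pol f a l) k = (if k < l then f (a + k) else 0)"
  by (auto simp: pol_def coeff_sum)

lemma pol_0 [simp]: "pol f a 0 = 0"
  by (simp add: pol_def)

lemma pol_Suc: "pol f a (Suc l) = pol f a l + monom (f (a + l)) l"
  by (simp add: pol_def)

lemma pol_cong: "(\<And>k. k < l \<Longrightarrow> f (a + k) = g (b + k)) \<Longrightarrow> pol f a l = pol g b l"
  unfolding pol_def by (auto intro: sum.cong)

lemma degree_pol: "l > 0 \<Longrightarrow> degree (pol f a l) < l"
  by (rule degree_lessI) (auto simp: coeff_pol)

lemma xp_add: "xp (a + b) = (xp a * xp b :: 'k::field poly)"
  by (simp add: mult_monom)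

lemma xp_mult: "xp (a * b) = (xp a :: 'k::field poly) ^ b"
  by (simp add: monom_power)

lemma monom_xp: "monom c k = smult c (xp k)"
  by (simp add: smult_monom)

lemma pol_append: "pol f a (l + m) = pol f a l + xp l * pol f (a + l) m"
  by (induction m) (simp_all add: pol_Suc algebra_simps mult_monom)

lemma pol_upd_outside:
  "b + m \<le> a \<or> a + l \<le> b \<Longrightarrow> pol (upd_arr f a l g) b m = pol f b m"
  by (rule pol_cong) (auto simp: upd_arr_def)

text \<open>Registers 60, 61 and 62 run through the destination and the two sources, and 63 is the
  end of the destination. Fixing them lets all array operations share one loop.\<close>

definition vec :: "instr list \<Rightarrow> com" where
  "vec ops = Instrs [IAdd 63 60 64] ;; While 60 63 (Instrs (ops @ inc 60 @ inc 61 @ inc 62))"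

definition arr :: "instr list \<Rightarrow> nat \<Rightarrow> nat \<Rightarrow> nat \<Rightarrow> nat \<Rightarrow> com" where
  "arr ops d a b l = Instrs (mov 60 d @ mov 61 a @ mov 62 b @ mov 64 l) ;; vec ops"

lemma wr_arr: "wrs ops = {} \<Longrightarrow> wr (arr ops d a b l) = {60, 61, 62, 63, 64, 99}"
  by (auto simp: arr_def vec_def)

lemma wp_Instrs_append:
  "effs xs i f = Some (i', f') \<Longrightarrow>
   wp (Instrs (xs @ ys)) Q i f t = wp (Instrs ys) Q i' f' (t + length xs)"
  by (induction xs arbitrary: i f t) (auto simp: wp_Cons split: option.splits)

text \<open>Cells are processed in ascending order: a source that starts at or above the destination
  is read before it is overwritten, and one that ends below it is never hit. The factor 12 is 4 for
  the operation, 6 for the three pointers and 2 for the loop.\<close>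

lemma arr_spec:
  assumes regs: "d < 60" "a < 60" "b < 60" "l < 60"
    and ops: "wrs ops = {}" "length ops \<le> 4"
    and eff: "\<And>i' f'. (\<And>r. r < 60 \<Longrightarrow> i' r = i r) \<Longrightarrow>
       (\<And>y. y < i d \<or> i d + i l \<le> y \<Longrightarrow> f' y = f y) \<Longrightarrow> i d \<le> i' 60 \<Longrightarrow> i' 60 < i d + i l \<Longrightarrow>
       effs ops i' f' = Some (i', f'(i' 60 := opr (f' (i' 61)) (f' (i' 62))))"
    and a: "i d \<le> i a \<or> i a + i l \<le> i d"
    and b: "i d \<le> i b \<or> i b + i l \<le> i d"
  shows "wp (arr ops d a b l)
    (\<lambda>i' f' t'. f' = upd_arr f (i d) (i l) (\<lambda>k. opr (f (i a + k)) (f (i b + k))) \<and>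
       t' \<le> t + 12 * i l + 10) i f t"
proof -
  define g where "g = (\<lambda>k. opr (f (i a + k)) (f (i b + k)))"
  define I where "I = (\<lambda>k (i' :: nat \<Rightarrow> nat) f' t'. i' 60 = i d + k \<and> i' 61 = i a + k \<and> i' 62 = i b + k \<and>
    f' = upd_arr f (i d) k g \<and> t' \<le> t + 9 + 12 * k)"
  define i0 where "i0 = i(60 := i d, 61 := i a, 62 := i b, 64 := i l, 63 := i d + i l)"
  have wrb: "wr (Instrs (ops @ inc 60 @ inc 61 @ inc 62)) = {60, 61, 62, 99}"
    using ops(1) by auto
  have W: "wp (While 60 63 (Instrs (ops @ inc 60 @ inc 61 @ inc 62)))
    (\<lambda>i' f' t'. f' = upd_arr f (i d) (i l) g \<and> t' \<le> t + 12 * i l + 10) i0 f (Suc (length (mov 60 d @ mov 61 a @ mov 62 b @ mov 64 l)) + t)"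
  proof (rule wp_while[where I = I and n = "i l"])
    show "I 0 i0 f (Suc (length (mov 60 d @ mov 61 a @ mov 62 b @ mov 64 l)) + t)" by (simp add: I_def i0_def)
  next
    fix k i' f' t'
    assume k: "k < i l" and I: "I k i' f' t'"
      and fr: "\<And>r. r \<notin> wr (Instrs (ops @ inc 60 @ inc 61 @ inc 62)) \<Longrightarrow> i' r = i0 r"
    have e: "effs ops i' f' = Some (i', f'(i' 60 := opr (f' (i' 61)) (f' (i' 62))))"
    proof (rule eff)
      show "i' r = i r" if "r < 60" for r
        using that fr[of r] unfolding wrb by (simp add: i0_def)
    qed (use I k in \<open>auto simp: I_def upd_arr_def\<close>)
    have 63: "i' 63 = i d + i l"
      using fr[of 63] unfolding wrb by (simp add: i0_def)
    have fa: "upd_arr f (i d) k g (i a + k) = f (i a + k)" "upd_arr f (i d) k g (i b + k) = f (i b + k)"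
      using k a b by (auto simp: upd_arr_def)
    have gk: "opr (f (i a + k)) (f (i b + k)) = g k"
      by (simp add: g_def)
    show "i' 60 < i' 63 \<and> wp (Instrs (ops @ inc 60 @ inc 61 @ inc 62)) (\<lambda>i f t. I (Suc k) i f (Suc t)) i' f' (Suc t')"
      unfolding wp_Instrs_append[OF e]
      using I k ops(2) by (auto simp: I_def 63 upd_arr_Suc fa gk)
  next
    fix i' f' t'
    assume I: "I (i l) i' f' t'"
      and fr: "\<And>r. r \<notin> wr (Instrs (ops @ inc 60 @ inc 61 @ inc 62)) \<Longrightarrow> i' r = i0 r"
    have 63: "i' 63 = i d + i l"
      using fr[of 63] unfolding wrb by (simp add: i0_def)
    show "i' 63 \<le> i' 60 \<and> f' = upd_arr f (i d) (i l) g \<and> Suc t' \<le> t + 12 * i l + 10"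
      using I by (simp add: I_def 63)
  qed
  show ?thesis
    using W regs unfolding arr_def vec_def g_def i0_def by simp
qed

definition "op_copy = [FCopy 60 61]"
definition "op_zero = [FZero 60]"
definition "op_add = [FAdd 60 61 62]"
definition "op_sub = [FSub 60 61 62]"
definition "op_half_add = [FAdd 60 61 62, FMul 60 60 10]"
definition "op_half_sub = [FSub 60 61 62, FMul 60 60 10]"
definition "op_scale = [FMul 60 59 62]"

lemmas op_defs = op_copy_def op_zero_def op_add_def op_sub_def op_half_add_def op_half_sub_def op_scale_def

lemma wr_arr_ops [simp]: "opn \<in> {op_copy, op_zero, op_add, op_sub, op_half_add, op_half_sub, op_scale} \<Longrightarrow>
   wr (arr opn d a b l) = {60, 61, 62, 63, 64, 99}"
  by (rule wr_arr) (auto simp: op_defs)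

lemma arr_specs:
  assumes regs: "d < 60" "a < 60" "b < 60" "l < 60"
    and a: "i d \<le> i a \<or> i a + i l \<le> i d"
    and b: "i d \<le> i b \<or> i b + i l \<le> i d"
    and res: "res = (\<lambda>g i' f' t'. f' = upd_arr f (i d) (i l) g \<and> t' \<le> t + 12 * i l + 10)"
  shows "wp (arr op_copy d a b l) (res (\<lambda>k. f (i a + k))) i f t"
    and "wp (arr op_zero d a b l) (res (\<lambda>k. 0)) i f t"
    and "wp (arr op_add d a b l) (res (\<lambda>k. f (i a + k) + f (i b + k))) i f t"
    and "wp (arr op_sub d a b l) (res (\<lambda>k. f (i a + k) - f (i b + k))) i f t"
    and "i 10 < i d \<or> i d + i l \<le> i 10 \<Longrightarrow>
      wp (arr op_half_add d a b l) (res (\<lambda>k. (f (i a + k) + f (i b + k)) * f (i 10))) i f t"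
    and "i 10 < i d \<or> i d + i l \<le> i 10 \<Longrightarrow>
      wp (arr op_half_sub d a b l) (res (\<lambda>k. (f (i a + k) - f (i b + k)) * f (i 10))) i f t"
    and "i 59 < i d \<or> i d + i l \<le> i 59 \<Longrightarrow>
      wp (arr op_scale d a b l) (res (\<lambda>k. f (i 59) * f (i b + k))) i f t"
  unfolding res
        apply (rule arr_spec[OF regs _ _ _ a b, where opr = "\<lambda>x y. x"]; simp add: op_defs)
       apply (rule arr_spec[OF regs _ _ _ a b, where opr = "\<lambda>x y. 0"]; simp add: op_defs)
      apply (rule arr_spec[OF regs _ _ _ a b, where opr = "\<lambda>x y. x + y"]; simp add: op_defs)
     apply (rule arr_spec[OF regs _ _ _ a b, where opr = "\<lambda>x y. x - y"]; simp add: op_defs)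
    apply (rule arr_spec[OF regs _ _ _ a b, where opr = "\<lambda>x y. (x + y) * f (i 10)"]; auto simp add: op_defs)
   apply (rule arr_spec[OF regs _ _ _ a b, where opr = "\<lambda>x y. (x - y) * f (i 10)"]; auto simp add: op_defs)
  apply (rule arr_spec[OF regs _ _ _ a b, where opr = "\<lambda>x y. f (i 59) * y"]; auto simp add: op_defs)
  done

lemma pol_upd_ops:
  "pol (upd_arr f a l (\<lambda>k. g (b + k))) a l = pol g b l"
  "pol (upd_arr f a l (\<lambda>k. 0)) a l = 0"
  "pol (upd_arr f a l (\<lambda>k. g (b + k) + h (c + k))) a l = pol g b l + pol h c l"
  "pol (upd_arr f a l (\<lambda>k. g (b + k) - h (c + k))) a l = pol g b l - pol h c l"
  "pol (upd_arr f a l (\<lambda>k. (g (b + k) + h (c + k)) * x)) a l = smult x (pol g b l + pol h c l)"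
  "pol (upd_arr f a l (\<lambda>k. (g (b + k) - h (c + k)) * x)) a l = smult x (pol g b l - pol h c l)"
  "pol (upd_arr f a l (\<lambda>k. x * h (c + k))) a l = smult x (pol h c l)"
  by (rule poly_eqI; auto simp: coeff_pol upd_arr_def)+

section \<open>Fourier transforms modulo \<open>X^w + 1\<close>\<close>

definition mu :: "nat \<Rightarrow> 'k::field poly" where
  "mu w = xp w + 1"

text \<open>A butterfly: from the rows \<open>lo\<close> and \<open>hi\<close> it forms
  \<open>lo + X^c hi\<close> and \<open>lo - X^c hi\<close> modulo \<open>X^w + 1\<close>.
  Multiplying by \<open>X^c\<close> moves the lower \<open>w - c\<close> coefficients up and brings
  the upper \<open>c\<close> back with a minus sign, so no field multiplication occurs.\<close>

definition row_fwd :: com where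
  "row_fwd =
    Instrs [ISub 45 23 34, IAdd 46 32 45, IAdd 47 29 34, IAdd 48 31 34, IAdd 49 30 34] ;;
    arr op_sub 29 31 46 34 ;; arr op_add 47 48 32 45 ;;
    arr op_add 30 31 46 34 ;; arr op_sub 49 48 32 45 ;;
    Instrs [IAdd 29 29 23, IAdd 30 30 23, IAdd 31 31 23, IAdd 32 32 23]"

text \<open>The inverse butterfly. The difference is turned back by
  \<open>X^(-c) = - X^(w - c)\<close>, which is why its first \<open>c\<close> coefficients enter
  with exchanged signs.\<close>

definition row_inv :: com where
  "row_inv =
    Instrs [ISub 45 23 34, IAdd 46 32 45, IAdd 47 29 34, IAdd 49 30 34] ;;
    arr op_half_add 31 29 30 23 ;; arr op_half_sub 46 30 29 34 ;; arr op_half_sub 32 47 49 45 ;;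
    Instrs [IAdd 29 29 23, IAdd 30 30 23, IAdd 31 31 23, IAdd 32 32 23]"

lemma wr_row [simp]:
  "wr row_fwd = {29, 30, 31, 32, 45, 46, 47, 48, 49, 60, 61, 62, 63, 64, 99}"
  "wr row_inv = {29, 30, 31, 32, 45, 46, 47, 49, 60, 61, 62, 63, 64, 99}"
  unfolding row_fwd_def row_inv_def by auto

lemma rotate_split:
  assumes "w = c + e"
  shows "pol f a w = pol f a c + xp c * pol f (a + c) e"
  using pol_append[of f a c e] assms by simp

lemma cong_mu_I: "p = q + mu w * r \<Longrightarrow> [p = q] (mod mu w)"
  by (simp add: cong_iff_dvd_diff)

lemma row_fwd_pol:
  fixes f :: "nat \<Rightarrow> 'k::field"
  assumes w: "w = c + e" and d: "a + w \<le> b"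
    and p: "lo + w \<le> a \<and> hi + w \<le> a \<or> b + w \<le> lo \<and> b + w \<le> hi"
    and f1: "f1 = upd_arr f a c (\<lambda>k. f (lo + k) - f (hi + e + k))"
    and f2: "f2 = upd_arr f1 (a + c) e (\<lambda>k. f1 (lo + c + k) + f1 (hi + k))"
    and f3: "f3 = upd_arr f2 b c (\<lambda>k. f2 (lo + k) + f2 (hi + e + k))"
    and f4: "f4 = upd_arr f3 (b + c) e (\<lambda>k. f3 (lo + c + k) - f3 (hi + k))"
  shows "[pol f4 a w = pol f lo w + xp c * pol f hi w] (mod mu w)"
    and "[pol f4 b w = pol f lo w - xp c * pol f hi w] (mod mu w)"
    and "\<And>y. (y < a \<or> a + w \<le> y) \<Longrightarrow> (y < b \<or> b + w \<le> y) \<Longrightarrow> f4 y = f y"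
proof -
  have lo: "pol f lo w = pol f lo c + xp c * pol f (lo + c) e"
    by (rule rotate_split[OF w])
  have hi: "pol f hi w = pol f hi e + xp e * pol f (hi + e) c"
    by (rule rotate_split) (simp add: w)
  have xw: "xp w = (xp c * xp e :: 'k poly)"
    by (simp add: w xp_add)
  note out = pol_upd_outside
  have L1: "pol f4 a c = pol f lo c - pol f (hi + e) c"
    unfolding f4 f3 f2 using d w by (simp add: out f1 pol_upd_ops)
  have L2: "pol f4 (a + c) e = pol f (lo + c) e + pol f hi e"
  proof -
    have "pol f4 (a + c) e = pol f1 (lo + c) e + pol f1 hi e"
      unfolding f4 f3 using d w by (simp add: out f2 pol_upd_ops)
    also have "\<dots> = pol f (lo + c) e + pol f hi e"
      unfolding f1 using p w d by (subst (1 2) out) auto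
    finally show ?thesis .
  qed
  have L3: "pol f4 b c = pol f lo c + pol f (hi + e) c"
  proof -
    have "pol f4 b c = pol f2 lo c + pol f2 (hi + e) c"
      unfolding f4 using d w by (simp add: out f3 pol_upd_ops)
    also have "\<dots> = pol f1 lo c + pol f1 (hi + e) c"
      unfolding f2 using p w d by (subst (1 2) out) auto
    also have "\<dots> = pol f lo c + pol f (hi + e) c"
      unfolding f1 using p w d by (subst (1 2) out) auto
    finally show ?thesis .
  qed
  have L4: "pol f4 (b + c) e = pol f (lo + c) e - pol f hi e"
  proof -
    have "pol f4 (b + c) e = pol f3 (lo + c) e - pol f3 hi e"
      by (simp add: f4 pol_upd_ops)
    also have "\<dots> = pol f2 (lo + c) e - pol f2 hi e"
      unfolding f3 using p w d by (subst (1 2) out) auto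
    also have "\<dots> = pol f1 (lo + c) e - pol f1 hi e"
      unfolding f2 using p w d by (subst (1 2) out) auto
    also have "\<dots> = pol f (lo + c) e - pol f hi e"
      unfolding f1 using p w d by (subst (1 2) out) auto
    finally show ?thesis .
  qed
  \<comment> \<open>The quotient is the part of the rotated row that passes
    \<open>X^w\<close>.\<close>
  show "[pol f4 a w = pol f lo w + xp c * pol f hi w] (mod mu w)"
    by (rule cong_mu_I[of _ _ _ "- pol f (hi + e) c"])
      (simp add: rotate_split[OF w, of f4] L1 L2 lo hi mu_def xw algebra_simps)
  show "[pol f4 b w = pol f lo w - xp c * pol f hi w] (mod mu w)"
    by (rule cong_mu_I[of _ _ _ "pol f (hi + e) c"])
      (simp add: rotate_split[OF w, of f4] L3 L4 lo hi mu_def xw algebra_simps)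
  show "f4 y = f y" if "y < a \<or> a + w \<le> y" "y < b \<or> b + w \<le> y" for y
  proof -
    have "f4 y = f3 y" unfolding f4 by (rule upd_arr_outside) (use that w in linarith)
    also have "\<dots> = f2 y" unfolding f3 by (rule upd_arr_outside) (use that w in linarith)
    also have "\<dots> = f1 y" unfolding f2 by (rule upd_arr_outside) (use that w in linarith)
    also have "\<dots> = f y" unfolding f1 by (rule upd_arr_outside) (use that w in linarith)
    finally show ?thesis .
  qed
qed

lemma row_fwd_spec:
  fixes f :: "nat \<Rightarrow> 'k::field"
  assumes r: "i 23 = w" "i 34 = c" "i 29 = a" "i 30 = b" "i 31 = lo" "i 32 = hi"
    and c: "c \<le> w" and d: "a + w \<le> b"
    and p: "lo + w \<le> a \<and> hi + w \<le> a \<or> b + w \<le> lo \<and> b + w \<le> hi"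
  shows "wp row_fwd (\<lambda>i' f' t'.
      [pol f' a w = pol f lo w + xp c * pol f hi w] (mod mu w) \<and>
      [pol f' b w = pol f lo w - xp c * pol f hi w] (mod mu w) \<and>
      (\<forall>y. (y < a \<or> a + w \<le> y) \<longrightarrow> (y < b \<or> b + w \<le> y) \<longrightarrow> f' y = f y) \<and>
      i' 29 = a + w \<and> i' 30 = b + w \<and> i' 31 = lo + w \<and> i' 32 = hi + w \<and>
      t' \<le> t + 24 * w + 49) i f t"
proof -
  define e where "e = w - c"
  have w: "w = c + e" using c by (simp add: e_def)
  note [simp] = r
  have rw: "i 23 - i 34 = e" by (simp add: e_def)
  show ?thesis
    apply (simp add: row_fwd_def rw e_def[symmetric])
    apply (rule wp_conseq[OF arr_specs(4)[OF _ _ _ _ _ _ refl]])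
          apply (use p w d in \<open>auto\<close>)[6]
    apply simp
    apply (rule wp_conseq[OF arr_specs(3)[OF _ _ _ _ _ _ refl]])
          apply (use p w d in \<open>auto\<close>)[6]
    apply simp
    apply (rule wp_conseq[OF arr_specs(3)[OF _ _ _ _ _ _ refl]])
          apply (use p w d in \<open>auto\<close>)[6]
    apply simp
    apply (rule wp_conseq[OF arr_specs(4)[OF _ _ _ _ _ _ refl]])
          apply (use p w d in \<open>auto\<close>)[6]
    apply simp
    using row_fwd_pol[OF w d p refl refl refl refl, where f = f] w
    apply (simp add: add_ac)
    done
qed

lemma row_inv_pol:
  fixes f :: "nat \<Rightarrow> 'k::field_char_0"
  assumes w: "w = c + e" and d: "a + w \<le> b" and lh: "lo + w \<le> hi"
    and p: "hi + w \<le> a \<or> b + w \<le> lo"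
    and f1: "f1 = upd_arr f lo w (\<lambda>k. (f (a + k) + f (b + k)) * v)"
    and f2: "f2 = upd_arr f1 (hi + e) c (\<lambda>k. (f1 (b + k) - f1 (a + k)) * v)"
    and f3: "f3 = upd_arr f2 hi e (\<lambda>k. (f2 (a + c + k) - f2 (b + c + k)) * v)"
    and v: "v + v = 1"
    and A: "[pol f a w = A + xp c * B] (mod mu w)" and B: "[pol f b w = A - xp c * B] (mod mu w)"
  shows "[pol f3 lo w = A] (mod mu w)" and "[pol f3 hi w = B] (mod mu w)"
    and "\<And>y. (y < lo \<or> lo + w \<le> y) \<Longrightarrow> (y < hi \<or> hi + w \<le> y) \<Longrightarrow> f3 y = f y"
proof -
  note out = pol_upd_outside
  have a: "pol f a w = pol f a c + xp c * pol f (a + c) e"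
    by (rule rotate_split[OF w])
  have b: "pol f b w = pol f b c + xp c * pol f (b + c) e"
    by (rule rotate_split[OF w])
  have hi: "pol f3 hi w = pol f3 hi e + xp e * pol f3 (hi + e) c"
    by (rule rotate_split) (simp add: w)
  have xw: "xp w = (xp c * xp e :: 'k poly)"
    by (simp add: w xp_add)
  have L1: "pol f3 lo w = smult v (pol f a w + pol f b w)"
  proof -
    have "pol f3 lo w = pol f1 lo w"
      unfolding f3 f2 using lh w by (simp add: out)
    then show ?thesis by (simp add: f1 pol_upd_ops)
  qed
  have L2: "pol f3 (hi + e) c = smult v (pol f b c - pol f a c)"
  proof -
    have "pol f3 (hi + e) c = pol f2 (hi + e) c"
      unfolding f3 by (simp add: out)
    also have "\<dots> = smult v (pol f1 b c - pol f1 a c)"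
      unfolding f2 by (rule pol_upd_ops)
    also have "\<dots> = smult v (pol f b c - pol f a c)"
      unfolding f1 using p w d lh by (subst (1 2) out) auto
    finally show ?thesis .
  qed
  have L3: "pol f3 hi e = smult v (pol f (a + c) e - pol f (b + c) e)"
  proof -
    have "pol f3 hi e = smult v (pol f2 (a + c) e - pol f2 (b + c) e)"
      unfolding f3 by (rule pol_upd_ops)
    also have "\<dots> = smult v (pol f1 (a + c) e - pol f1 (b + c) e)"
      unfolding f2 using p w d lh by (subst (1 2) out) auto
    also have "\<dots> = smult v (pol f (a + c) e - pol f (b + c) e)"
      unfolding f1 using p w d lh by (subst (1 2) out) auto
    finally show ?thesis .
  qed
  have half: "smult v ((x::'k poly) + x) = x" for x
    by (metis smult_add_left smult_add_right smult_1_left v)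
  have sm: "[smult v x = smult v y] (mod mu w)" if "[x = y] (mod mu w)" for x y :: "'k poly"
    using cong_mult[OF cong_refl[of "[:v:]"] that] by simp
  have "[pol f a w + pol f b w = (A + xp c * B) + (A - xp c * B)] (mod mu w)"
    by (rule cong_add[OF A B])
  from sm[OF this] show "[pol f3 lo w = A] (mod mu w)"
    using half[of A] by (simp add: L1)
  have "[pol f a w - pol f b w = (A + xp c * B) - (A - xp c * B)] (mod mu w)"
    by (rule cong_diff[OF A B])
  from sm[OF this] have "[smult v (pol f a w - pol f b w) = xp c * B] (mod mu w)"
    using half[of "xp c * B"] by simp
  moreover have "[xp c * pol f3 hi w = smult v (pol f a w - pol f b w)] (mod mu w)"
    by (rule cong_mu_I[of _ _ _ "smult v (pol f b c - pol f a c)"])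
      (unfold a b hi L2 L3 mu_def xw, simp add: algebra_simps smult_diff_right smult_add_right)
  ultimately have "[xp c * pol f3 hi w = xp c * B] (mod mu w)"
    using cong_trans by blast
  \<comment> \<open>\<open>X^c\<close> is a unit modulo \<open>X^w + 1\<close>, because
    \<open>X^c X^e = X^w = -1\<close>; multiplying by \<open>X^e\<close> cancels it up to
    sign.\<close>
  from cong_mult[OF cong_refl[of "xp e"] this]
  have 1: "[xp w * pol f3 hi w = xp w * B] (mod mu w)"
    by (simp add: xw mult_ac)
  have 2: "[xp w * x = - x] (mod mu w)" for x :: "'k poly"
    by (rule cong_mu_I[of _ _ _ x]) (simp add: mu_def algebra_simps)
  have "[- pol f3 hi w = - B] (mod mu w)"
    using 1 2 cong_sym cong_trans by blast
  from cong_mult[OF cong_refl[of "-1"] this] show "[pol f3 hi w = B] (mod mu w)"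
    by simp
  show "f3 y = f y" if "y < lo \<or> lo + w \<le> y" "y < hi \<or> hi + w \<le> y" for y
  proof -
    have "f3 y = f2 y" unfolding f3 by (rule upd_arr_outside) (use that w lh in linarith)
    also have "\<dots> = f1 y" unfolding f2 by (rule upd_arr_outside) (use that w lh in linarith)
    also have "\<dots> = f y" unfolding f1 by (rule upd_arr_outside) (use that w lh in linarith)
    finally show ?thesis .
  qed
qed

lemma row_inv_spec:
  fixes f :: "nat \<Rightarrow> 'k::field_char_0"
  assumes r: "i 23 = w" "i 34 = c" "i 29 = a" "i 30 = b" "i 31 = lo" "i 32 = hi"
    and half: "f (i 10) + f (i 10) = 1" "i 10 < lo"
    and c: "c \<le> w" and d: "a + w \<le> b" and lh: "lo + w \<le> hi"
    and p: "hi + w \<le> a \<or> b + w \<le> lo"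
    and A: "[pol f a w = A + xp c * B] (mod mu w)" and B: "[pol f b w = A - xp c * B] (mod mu w)"
  shows "wp row_inv (\<lambda>i' f' t'.
      [pol f' lo w = A] (mod mu w) \<and> [pol f' hi w = B] (mod mu w) \<and>
      (\<forall>y. (y < lo \<or> lo + w \<le> y) \<longrightarrow> (y < hi \<or> hi + w \<le> y) \<longrightarrow> f' y = f y) \<and>
      i' 29 = a + w \<and> i' 30 = b + w \<and> i' 31 = lo + w \<and> i' 32 = hi + w \<and>
      t' \<le> t + 24 * w + 49) i f t"
proof -
  define e where "e = w - c"
  have w: "w = c + e" using c by (simp add: e_def)
  note [simp] = r
  have rw: "i 23 - i 34 = e" by (simp add: e_def)
  show ?thesis
    apply (simp add: row_inv_def rw e_def[symmetric])
    apply (rule wp_conseq[OF arr_specs(5)[OF _ _ _ _ _ _ refl]])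
          apply (use p w d lh half in \<open>auto\<close>)[7]
    apply simp
    apply (rule wp_conseq[OF arr_specs(6)[OF _ _ _ _ _ _ refl]])
          apply (use p w d lh half in \<open>auto\<close>)[7]
    apply simp
    apply (rule wp_conseq[OF arr_specs(6)[OF _ _ _ _ _ _ refl]])
          apply (use p w d lh half in \<open>auto\<close>)[7]
    apply simp
    using row_inv_pol[OF w d lh p refl refl refl half(1) A B] w half lh
    apply (simp add: upd_arr_outside add_ac)
    done
qed

section \<open>One pass of the Fourier transform over all rows\<close>

definition sweep :: "nat \<Rightarrow> nat \<Rightarrow> com \<Rightarrow> com" where
  "sweep rO rP R =
    Instrs (mov 29 rO @ [IAdd 30 29 25] @ mov 35 30 @ mov 31 rP @ mov 34 28) ;;
    While 29 35 (
      Instrs [IAdd 36 29 26] ;;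
      While 29 36 (
        Instrs ([IAdd 32 31 27] @ mov 37 32) ;;
        While 31 37 R ;;
        Instrs (mov 31 32)) ;;
      Instrs [IAdd 34 34 28, IAdd 34 34 28])"

lemma wr_sweep [simp]: "wr (sweep rO rP R) = {29, 30, 31, 32, 34, 35, 36, 37} \<union> wr R"
  unfolding sweep_def by auto

text \<open>Stated once for both directions. In the buffer of \<open>rO\<close> partners lie half a
  buffer apart, in that of \<open>rP\<close> they lie \<open>h\<close> rows apart; one buffer is
  read and the other written. Sums and differences of group \<open>g\<close> become the groups
  \<open>g\<close> and \<open>g + G\<close>, so the pass is self-sorting and no bit reversal arises.
  \<open>J\<close> is indexed by the number of butterflies done.\<close>

lemma sweep_spec:
  fixes G B h w u out src :: nat and J :: "nat \<Rightarrow> (nat \<Rightarrow> 'k::field) \<Rightarrow> bool"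
  assumes rOP: "rO \<in> {20, 21}" "rP \<in> {20, 21}"
    and out: "i rO = out" and src: "i rP = src"
    and regs: "i 25 = G * (B * (h * w))" "i 26 = B * (h * w)" "i 27 = h * w" "i 28 = u"
    and pos: "0 < w" "0 < h" "0 < B"
    and wrR: "\<And>r. r \<in> wr R \<Longrightarrow> r \<in> {29, 30, 31, 32} \<or> 45 \<le> r"
    and R: "\<And>g b j i' f' t'. g < G \<Longrightarrow> b < B \<Longrightarrow> j < h \<Longrightarrow>
        i' 29 = out + ((g * B + b) * h + j) * w \<Longrightarrow>
        i' 30 = out + G * (B * (h * w)) + ((g * B + b) * h + j) * w \<Longrightarrow>
        i' 31 = src + ((g * B + b) * (2 * h) + j) * w \<Longrightarrow>
        i' 32 = src + ((g * B + b) * (2 * h) + h + j) * w \<Longrightarrow>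
        i' 34 = (2 * g + 1) * u \<Longrightarrow> (\<And>r. r < 29 \<Longrightarrow> i' r = i r) \<Longrightarrow>
        J ((g * B + b) * h + j) f' \<Longrightarrow>
        wp R (\<lambda>i'' f'' t''. J (Suc ((g * B + b) * h + j)) f'' \<and> i'' 29 = i' 29 + w \<and>
          i'' 30 = i' 30 + w \<and> i'' 31 = i' 31 + w \<and> i'' 32 = i' 32 + w \<and>
          t'' \<le> t' + 24 * w + 49) i' f' t'"
    and J0: "J 0 f"
  shows "wp (sweep rO rP R) (\<lambda>i' f' t'. J (G * B * h) f' \<and>
    t' \<le> t + 95 * (G * (B * (h * w))) + 20) i f t"
proof -
  define hw where "hw = h * w"
  define span where "span = B * hw"
  define half where "half = G * span"
  have nw: "r \<notin> wr R" if "r < 29 \<or> 33 \<le> r \<and> r < 45" for r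
    using wrR[of r] that by auto
  have hwpos: "0 < hw" using pos by (simp add: hw_def)
  have spanpos: "0 < span" using pos hwpos by (simp add: span_def)
  define RB where "RB = Instrs ([IAdd 32 31 27] @ mov 37 32) ;; While 31 37 R ;; Instrs (mov 31 32)"
  have wrb: "r \<in> wr RB \<Longrightarrow> r \<in> {29, 30, 31, 32, 37} \<or> 45 \<le> r" for r
    using wrR[of r] by (auto simp: RB_def)
  \<comment> \<open>As \<open>w\<close> is positive, constant overheads are charged to the row
    width; this turns \<open>24 w + 49\<close> into 75 per cell here, and into 85 and 95 in the two
    enclosing loops.\<close>
  have rows: "wp (While 31 37 R) (\<lambda>i'' f'' t''. J ((g * B + Suc b) * h) f'' \<and>
      i'' 29 = i' 29 + hw \<and> i'' 30 = i' 30 + hw \<and> i'' 32 = i' 32 + hw \<and>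
      t'' \<le> t' + 75 * hw + 1) i' f' t'"
    if g: "g < G" and b: "b < B"
      and r29: "i' 29 = out + g * span + b * hw" "i' 30 = out + half + g * span + b * hw"
      and r31: "i' 31 = src + 2 * (g * span) + 2 * (b * hw)" "i' 32 = i' 31 + hw" "i' 37 = i' 31 + hw"
      and r34: "i' 34 = (2 * g + 1) * u" and fr: "\<And>r. r < 29 \<Longrightarrow> i' r = i r"
      and J: "J ((g * B + b) * h) f'"
    for g b i' f' t'
  proof (rule wp_while[where n = h and I = "\<lambda>k i'' f'' t''. J ((g * B + b) * h + k) f'' \<and>
      i'' 29 = i' 29 + k * w \<and> i'' 30 = i' 30 + k * w \<and> i'' 31 = i' 31 + k * w \<and>
      i'' 32 = i' 32 + k * w \<and> t'' \<le> t' + 75 * (k * w)"], goal_cases)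
    case 1
    then show ?case using J by simp
  next
    case (2 k i1 f1 t1)
    have fr1: "i1 r = i' r" if "r < 29 \<or> r = 37 \<or> r = 34" for r
      using 2(3)[OF nw[of r]] that by auto
    have kw: "k * w < hw"
      using 2(1) pos by (simp add: hw_def)
    have "wp R (\<lambda>i'' f'' t''. J (Suc ((g * B + b) * h + k)) f'' \<and> i'' 29 = i1 29 + w \<and>
          i'' 30 = i1 30 + w \<and> i'' 31 = i1 31 + w \<and> i'' 32 = i1 32 + w \<and>
          t'' \<le> Suc t1 + 24 * w + 49) i1 f1 (Suc t1)"
      by (rule R[OF g b 2(1)])
        (use 2(2) r29 r31 r34 fr fr1 in \<open>auto simp: half_def span_def hw_def algebra_simps\<close>)
    then show ?case
      apply (intro conjI)
      subgoal using 2(2) r31 kw fr1[of 37] by simp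
      apply (erule wp_conseq)
      using 2(2) pos by (auto simp: algebra_simps)
  next
    case (3 i1 f1 t1)
    have "i1 37 = i' 37"
      using 3(2)[OF nw[of 37]] by auto
    then show ?case using 3(1) r31 by (auto simp: hw_def algebra_simps)
  qed
  have nwb: "r \<notin> wr RB" if "r < 29 \<or> 33 \<le> r \<and> r < 45 \<and> r \<noteq> 37" for r
    using wrb[of r] that by auto
  have blocks: "wp (While 29 36 RB) (\<lambda>i'' f'' t''. J (Suc g * B * h) f'' \<and>
      i'' 29 = i' 29 + span \<and> i'' 30 = i' 30 + span \<and> i'' 31 = i' 31 + 2 * span \<and>
      t'' \<le> t' + 85 * span + 1) i' f' t'"
    if g: "g < G"
      and r29: "i' 29 = out + g * span" "i' 30 = out + half + g * span"
      and r31: "i' 31 = src + 2 * (g * span)" "i' 36 = i' 29 + span"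
      and r34: "i' 34 = (2 * g + 1) * u" and fr: "\<And>r. r < 29 \<Longrightarrow> i' r = i r"
      and J: "J (g * B * h) f'"
    for g i' f' t'
  proof (rule wp_while[where n = B and I = "\<lambda>k i'' f'' t''. J ((g * B + k) * h) f'' \<and>
      i'' 29 = i' 29 + k * hw \<and> i'' 30 = i' 30 + k * hw \<and> i'' 31 = i' 31 + 2 * (k * hw) \<and>
      t'' \<le> t' + 85 * (k * hw)"], goal_cases)
    case 1
    then show ?case using J by simp
  next
    case (2 k i1 f1 t1)
    have fr1: "i1 r = i' r" if "r < 29 \<or> r = 36 \<or> r = 34" for r
      using 2(3)[OF nwb[of r]] that by auto
    have khw: "k * hw < span"
      using 2(1) hwpos by (simp add: span_def)
    have i27: "i1 27 = hw"
      using fr1[of 27] fr[of 27] regs by (simp add: hw_def)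
    have W: "wp (While 31 37 R) (\<lambda>i'' f'' t''. J ((g * B + Suc k) * h) f'' \<and>
      i'' 29 = i1 29 + hw \<and> i'' 30 = i1 30 + hw \<and> i'' 32 = i1 31 + hw + hw \<and>
      t'' \<le> t1 + 4 + 75 * hw + 1) (i1(32 := i1 31 + hw, 37 := i1 31 + hw)) f1 (Suc (Suc (Suc (Suc t1))))"
      by (rule wp_conseq[OF rows[OF g 2(1)]])
        (use 2(2) r29 r31 r34 fr fr1 in \<open>auto simp: algebra_simps\<close>)
    show ?case
      apply (intro conjI)
      subgoal using 2(2) r31 khw fr1[of 36] by simp
      apply (simp add: RB_def i27)
      apply (rule wp_conseq[OF W])
      using 2(2) hwpos by (auto simp: algebra_simps)
  next
    case (3 i1 f1 t1)
    have "i1 36 = i' 36"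
      using 3(2)[OF nwb[of 36]] by auto
    then show ?case using 3(1) r31 by (auto simp: span_def algebra_simps)
  qed
  define GB where "GB = Instrs [IAdd 36 29 26] ;; While 29 36 RB ;; Instrs [IAdd 34 34 28, IAdd 34 34 28]"
  have wrg: "r \<in> wr GB \<Longrightarrow> r \<in> {29, 30, 31, 32, 34, 36, 37} \<or> 45 \<le> r" for r
    using wrb[of r] by (auto simp: GB_def)
  have nwg: "r \<notin> wr GB" if "r < 29 \<or> r = 33 \<or> r = 35 \<or> 38 \<le> r \<and> r < 45" for r
    using wrg[of r] that by auto
  have groups: "wp (While 29 35 GB) (\<lambda>i'' f'' t''. J (G * B * h) f'' \<and> t'' \<le> t' + 95 * half + 1) i' f t'"
    if r29: "i' 29 = out" "i' 30 = out + half" "i' 31 = src" "i' 35 = out + half"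
      and r34: "i' 34 = u" and fr: "\<And>r. r < 29 \<Longrightarrow> i' r = i r"
    for i' t'
  proof (rule wp_while[where n = G and I = "\<lambda>k i'' f'' t''. J (k * B * h) f'' \<and>
      i'' 29 = i' 29 + k * span \<and> i'' 30 = i' 30 + k * span \<and> i'' 31 = i' 31 + 2 * (k * span) \<and>
      i'' 34 = (2 * k + 1) * u \<and>
      t'' \<le> t' + 95 * (k * span)"], goal_cases)
    case 1
    then show ?case using J0 r34 by simp
  next
    case (2 k i1 f1 t1)
    have fr1: "i1 r = i' r" if "r < 29 \<or> r = 35" for r
      using 2(3)[OF nwg[of r]] that by auto
    have ks: "k * span < half"
      using 2(1) spanpos by (simp add: half_def)
    have i26: "i1 26 = span"
      using fr1[of 26] fr[of 26] regs by (simp add: span_def hw_def)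
    have i28: "i1 28 = u"
      using fr1[of 28] fr[of 28] regs by simp
    have W: "wp (While 29 36 RB) (\<lambda>i'' f'' t''. J (Suc k * B * h) f'' \<and>
      i'' 29 = i1 29 + span \<and> i'' 30 = i1 30 + span \<and> i'' 31 = i1 31 + 2 * span \<and>
      i'' 34 = (2 * k + 1) * u \<and> i'' 28 = u \<and>
      t'' \<le> t1 + 2 + 85 * span + 1) (i1(36 := i1 29 + span)) f1 (Suc (Suc t1))"
      apply (rule wp_conseq[OF blocks[OF 2(1)]])
      subgoal using 2(2) r29 r34 fr fr1 by auto
      subgoal using 2(2) r29 r34 fr fr1 by auto
      subgoal using 2(2) r29 r34 fr fr1 by auto
      subgoal using 2(2) r29 r34 fr fr1 by auto
      subgoal using 2(2) r29 r34 fr fr1 by auto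
      subgoal using 2(2) r29 r34 fr fr1 by auto
      subgoal using 2(2) by auto
      subgoal premises p for i2 f2 t2
        using p(1) p(2)[of 34] p(2)[of 28] nwb[of 34] nwb[of 28] 2(2) i28 by auto
      done
    show ?case
      apply (intro conjI)
      subgoal using 2(2) r29 ks fr1[of 35] by simp
      apply (simp add: GB_def i26)
      apply (rule wp_conseq[OF W])
      using 2(2) spanpos by (auto simp: algebra_simps)
  next
    case (3 i1 f1 t1)
    have "i1 35 = i' 35"
      using 3(2)[OF nwg[of 35]] by auto
    then show ?case using 3(1) r29 by (auto simp: half_def algebra_simps)
  qed
  have e: "sweep rO rP R = Instrs (mov 29 rO @ [IAdd 30 29 25] @ mov 35 30 @ mov 31 rP @ mov 34 28) ;; While 29 35 GB"
    by (simp add: sweep_def GB_def RB_def)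
  have half: "i 25 = half"
    using regs by (simp add: half_def span_def hw_def)
  show ?thesis
    unfolding e
    apply (insert rOP out src half regs(4))
    apply (elim insertE emptyE; simp)
       apply (rule wp_conseq[OF groups]; simp add: half_def span_def hw_def)+
    done
qed

lemma row_disjoint:
  fixes r r' w :: nat
  assumes "r \<noteq> r'"
  shows "r * w + w \<le> r' * w \<or> r' * w + w \<le> r * w"
proof -
  have "Suc r \<le> r' \<or> Suc r' \<le> r" using assms by linarith
  then have "Suc r * w \<le> r' * w \<or> Suc r' * w \<le> r * w"
    using mult_le_mono1 by blast
  then show ?thesis by (simp add: add.commute)
qed

text \<open>The lower partner of output row \<open>r\<close> in a block of \<open>2 h\<close> input rows; the upper one is \<open>h\<close> rows further.\<close>

definition lor :: "nat \<Rightarrow> nat \<Rightarrow> nat" where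
  "lor h r = r + (r div h) * h"

lemma lor_block: "j < h \<Longrightarrow> lor h (k * h + j) = k * (2 * h) + j"
  by (simp add: lor_def)

lemma lor_less: "0 < h \<Longrightarrow> r < r' \<Longrightarrow> lor h r < lor h r'"
  unfolding lor_def by (intro add_less_le_mono mult_le_mono1 div_le_mono) auto

lemma lor_eq: "0 < h \<Longrightarrow> lor h r = lor h r' \<longleftrightarrow> r = r'"
  by (metis lor_less linorder_neq_iff)

text \<open>Modulo \<open>2 h\<close>, lower partners have remainder below \<open>h\<close>, and
  adding \<open>h\<close> makes the remainder at least \<open>h\<close>.\<close>

lemma lor_upper: "0 < h \<Longrightarrow> lor h r + h \<noteq> lor h r'"
proof
  assume h: "0 < h" and e: "lor h r + h = lor h r'"
  have l: "lor h x = (x div h) * (2 * h) + x mod h" for x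
    unfolding lor_def by (metis div_mult_mod_eq distrib_left mult_2 add.assoc add.commute)
  have "(lor h r + h) div (2 * h) = r div h"
    using h unfolding l by (simp add: add.assoc)
  moreover have "lor h r' div (2 * h) = r' div h"
    using h unfolding l by (simp add: less_le_trans[OF mod_less_divisor])
  ultimately have "r div h = r' div h" using e by simp
  with e have "r mod h + h = r' mod h" unfolding l by simp
  then show False using mod_less_divisor[OF h, of r'] by linarith
qed

lemma lor_bound: "0 < h \<Longrightarrow> r < k * h \<Longrightarrow> lor h r + h < k * (2 * h)"
proof -
  assume h: "0 < h" and r: "r < k * h"
  have "Suc (r div h) \<le> k" using h r by (simp add: less_mult_imp_div_less Suc_le_eq)
  then have "Suc (r div h) * h \<le> k * h" by (rule mult_le_mono1)
  with r have "r + r div h * h + h < k * h + k * h" by simp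
  then show ?thesis by (simp add: lor_def mult_2 distrib_left)
qed

text \<open>The exponent of the twiddle factor at row \<open>r\<close>. Only the group matters, and
  the multiples of \<open>u\<close> are odd because the roots in question are those of -1.\<close>

definition twid :: "nat \<Rightarrow> nat \<Rightarrow> nat \<Rightarrow> nat \<Rightarrow> nat" where
  "twid u B h r = (2 * (r div h div B) + 1) * u"

lemma twid_block: "j < h \<Longrightarrow> b < B \<Longrightarrow> twid u B h ((g * B + b) * h + j) = (2 * g + 1) * u"
  by (simp add: twid_def)

definition swap_bufs :: com where
  "swap_bufs = Instrs (mov 40 20 @ mov 20 21 @ mov 21 40)"

definition pass_fwd :: com where
  "pass_fwd = sweep 21 20 row_fwd ;; swap_bufs"

definition pass_inv :: com where
  "pass_inv = sweep 20 21 row_inv ;; swap_bufs"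

lemma wr_pass [simp]:
  "wr pass_fwd = {20, 21, 29, 30, 31, 32, 34, 35, 36, 37, 40, 45, 46, 47, 48, 49, 60, 61, 62, 63, 64, 99}"
  "wr pass_inv = {20, 21, 29, 30, 31, 32, 34, 35, 36, 37, 40, 45, 46, 47, 49, 60, 61, 62, 63, 64, 99}"
  unfolding pass_fwd_def pass_inv_def swap_bufs_def by auto

lemma index_bound:
  fixes g G b B h j :: nat
  assumes "g < G" "b < B" "j < h"
  shows "(g * B + b) * h + j < G * B * h"
proof -
  have "g * B + b < G * B"
    using assms by (metis add_less_cancel_left mult_Suc_right mult.commute Suc_leI mult_le_mono1 less_le_trans add.commute)
  then have "Suc (g * B + b) * h \<le> (G * B) * h"
    by (intro mult_le_mono1) simp
  then show ?thesis using assms(3) by simp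
qed

lemma pass_fwd_spec:
  fixes f :: "nat \<Rightarrow> 'k::field"
  assumes regs: "i 20 = cur" "i 21 = oth" "i 25 = G * (B * (h * w))" "i 26 = B * (h * w)"
      "i 27 = h * w" "i 28 = u" "i 23 = w"
    and pos: "0 < w" "0 < h" "0 < B" and u: "2 * G * u \<le> w"
    and disj: "cur + 2 * (G * (B * (h * w))) \<le> oth \<or> oth + 2 * (G * (B * (h * w))) \<le> cur"
  shows "wp pass_fwd (\<lambda>i' f' t'.
    (\<forall>r < G * B * h.
      [pol f' (oth + r * w) w = pol f (cur + lor h r * w) w +
         xp (twid u B h r) * pol f (cur + (lor h r + h) * w) w] (mod mu w) \<and>
      [pol f' (oth + (G * B * h + r) * w) w = pol f (cur + lor h r * w) w -
         xp (twid u B h r) * pol f (cur + (lor h r + h) * w) w] (mod mu w)) \<and>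
    (\<forall>y. y < oth \<or> oth + 2 * (G * (B * (h * w))) \<le> y \<longrightarrow> f' y = f y) \<and>
    i' 20 = oth \<and> i' 21 = cur \<and> t' \<le> t + 95 * (G * (B * (h * w))) + 30) i f t"
proof -
  define M where "M = G * B * h"
  have M: "G * (B * (h * w)) = M * w" by (simp add: M_def mult.assoc)
  define J where "J = (\<lambda>m f'. (\<forall>r < m.
      [pol f' (oth + r * w) w = pol f (cur + lor h r * w) w +
         xp (twid u B h r) * pol f (cur + (lor h r + h) * w) w] (mod mu w) \<and>
      [pol f' (oth + (M + r) * w) w = pol f (cur + lor h r * w) w -
         xp (twid u B h r) * pol f (cur + (lor h r + h) * w) w] (mod mu w)) \<and>
    (\<forall>y. y < oth \<or> oth + 2 * (M * w) \<le> y \<longrightarrow> f' y = f y))"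
  have "wp (sweep 21 20 row_fwd) (\<lambda>i' f' t'. J (G * B * h) f' \<and>
    t' \<le> t + 95 * (G * (B * (h * w))) + 20) i f t"
  proof (rule sweep_spec[where u = u and J = J and out = oth and src = cur])
    fix g b j i' f' t'
    assume gbj: "g < G" "b < B" "j < h"
      and r: "i' 29 = oth + ((g * B + b) * h + j) * w"
        "i' 30 = oth + G * (B * (h * w)) + ((g * B + b) * h + j) * w"
        "i' 31 = cur + ((g * B + b) * (2 * h) + j) * w"
        "i' 32 = cur + ((g * B + b) * (2 * h) + h + j) * w"
        "i' 34 = (2 * g + 1) * u" and fr: "\<And>r. r < 29 \<Longrightarrow> i' r = i r"
      and J: "J ((g * B + b) * h + j) f'"
    define m where "m = (g * B + b) * h + j"
    have mM: "m < M"
      unfolding m_def M_def by (rule index_bound[OF gbj])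
    have mw: "m * w + w \<le> M * w"
      using mult_le_mono1[of "Suc m" M w] mM by simp
    have lo: "(g * B + b) * (2 * h) + j = lor h m"
      unfolding m_def using gbj by (simp add: lor_block)
    have hi: "(g * B + b) * (2 * h) + h + j = lor h m + h"
      using lo by simp
    have c: "(2 * g + 1) * u = twid u B h m"
      unfolding m_def using gbj by (simp add: twid_block)
    have "lor h m + h < G * B * (2 * h)"
      by (rule lor_bound) (use pos mM in \<open>auto simp: M_def\<close>)
    then have lM: "lor h m + h < 2 * M"
      by (simp add: M_def)
    then have lw: "(lor h m + h) * w + w \<le> 2 * (M * w)"
      using mult_le_mono1[of "Suc (lor h m + h)" "2 * M" w] by simp
    have low: "lor h m * w + w \<le> 2 * (M * w)"
      using lw by (simp add: add_mult_distrib)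
    \<comment> \<open>A row is split only once, so the rotation must not exceed its width.\<close>
    have cw: "twid u B h m \<le> w"
    proof -
      have "(2 * g + 1) * u \<le> 2 * G * u"
        using gbj by (intro mult_le_mono1) simp
      then show ?thesis using u c by simp
    qed
    have Jm: "J m f'" using J by (simp add: m_def)
    have fcur: "pol f' (cur + k * w) w = pol f (cur + k * w) w" if "k * w + w \<le> 2 * (M * w)" for k
      by (rule pol_cong) (use Jm that disj in \<open>auto simp: J_def M\<close>)
    have r': "i' 29 = oth + m * w" "i' 30 = oth + (M + m) * w" "i' 31 = cur + lor h m * w"
      "i' 32 = cur + (lor h m + h) * w" "i' 34 = twid u B h m" "i' 23 = w"
      using r[unfolded lo hi c M m_def[symmetric]] fr[of 23] regs by (simp_all add: add_mult_distrib)
    have d: "oth + m * w + w \<le> oth + (M + m) * w"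
      using mw unfolding add_mult_distrib by linarith
    have "oth + (M + m) * w + w \<le> oth + 2 * (M * w)"
      using mw unfolding add_mult_distrib by linarith
    then have p: "cur + lor h m * w + w \<le> oth + m * w \<and> cur + (lor h m + h) * w + w \<le> oth + m * w \<or>
      oth + (M + m) * w + w \<le> cur + lor h m * w \<and> oth + (M + m) * w + w \<le> cur + (lor h m + h) * w"
      using disj[unfolded M] lw low by linarith
    show "wp row_fwd (\<lambda>i'' f'' t''. J (Suc ((g * B + b) * h + j)) f'' \<and> i'' 29 = i' 29 + w \<and>
          i'' 30 = i' 30 + w \<and> i'' 31 = i' 31 + w \<and> i'' 32 = i' 32 + w \<and>
          t'' \<le> t' + 24 * w + 49) i' f' t'"
      unfolding m_def[symmetric]
    proof (rule wp_conseq[OF row_fwd_spec[OF r'(6,5,1,2,3,4) cw d p]], goal_cases)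
      case (1 i2 f2 t2)
      have new: "\<And>y. (y < oth + m * w \<or> oth + m * w + w \<le> y) \<Longrightarrow>
          (y < oth + (M + m) * w \<or> oth + (M + m) * w + w \<le> y) \<Longrightarrow> f2 y = f' y"
        using 1(1) by blast
      have "J (Suc m) f2"
        unfolding J_def
      proof (intro conjI allI impI)
        fix k assume k: "k < Suc m"
        have "pol f2 (oth + k * w) w = pol f' (oth + k * w) w" if "k \<noteq> m"
          by (rule pol_cong, rule new)
            (use row_disjoint[OF that, of w] row_disjoint[of k "M + m" w] k mM in linarith)+
        then show "[pol f2 (oth + k * w) w = pol f (cur + lor h k * w) w +
           xp (twid u B h k) * pol f (cur + (lor h k + h) * w) w] (mod mu w)"
          using 1(1) k Jm fcur[OF lw] fcur[OF low] by (cases "k = m") (auto simp: J_def)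
        have "pol f2 (oth + (M + k) * w) w = pol f' (oth + (M + k) * w) w" if "k \<noteq> m"
          by (rule pol_cong, rule new)
            (use row_disjoint[of "M + k" "M + m" w] row_disjoint[of "M + k" "m" w] k mM that in linarith)+
        then show "[pol f2 (oth + (M + k) * w) w = pol f (cur + lor h k * w) w -
           xp (twid u B h k) * pol f (cur + (lor h k + h) * w) w] (mod mu w)"
          using 1(1) k Jm fcur[OF lw] fcur[OF low] by (cases "k = m") (auto simp: J_def)
      next
        fix y assume y: "y < oth \<or> oth + 2 * (M * w) \<le> y"
        have "f2 y = f' y"
          by (rule new) (use y mw in \<open>auto simp: algebra_simps\<close>)
        then show "f2 y = f y" using Jm y by (auto simp: J_def)
      qed
      then show ?case using 1(1) r' by simp
    qed
  qed (use regs pos in \<open>auto simp: J_def\<close>)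
  then show ?thesis
    unfolding pass_fwd_def wp_Seq
    by (rule wp_conseq) (use regs in \<open>auto simp: swap_bufs_def J_def M M_def[symmetric]\<close>)
qed

lemma pass_inv_spec:
  fixes f :: "nat \<Rightarrow> 'k::field_char_0"
  assumes regs: "i 20 = cur" "i 21 = oth" "i 25 = G * (B * (h * w))" "i 26 = B * (h * w)"
      "i 27 = h * w" "i 28 = u" "i 23 = w"
    and half: "f (i 10) + f (i 10) = 1" "i 10 < oth"
    and pos: "0 < w" "0 < h" "0 < B" and u: "2 * G * u \<le> w"
    and disj: "cur + 2 * (G * (B * (h * w))) \<le> oth \<or> oth + 2 * (G * (B * (h * w))) \<le> cur"
    and X: "\<And>r. r < G * B * h \<Longrightarrow> [pol f (cur + r * w) w = X r + xp (twid u B h r) * Y r] (mod mu w)"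
    and Y: "\<And>r. r < G * B * h \<Longrightarrow>
      [pol f (cur + (G * B * h + r) * w) w = X r - xp (twid u B h r) * Y r] (mod mu w)"
  shows "wp pass_inv (\<lambda>i' f' t'.
    (\<forall>r < G * B * h. [pol f' (oth + lor h r * w) w = X r] (mod mu w) \<and>
      [pol f' (oth + (lor h r + h) * w) w = Y r] (mod mu w)) \<and>
    (\<forall>y. y < oth \<or> oth + 2 * (G * (B * (h * w))) \<le> y \<longrightarrow> f' y = f y) \<and>
    i' 20 = oth \<and> i' 21 = cur \<and> t' \<le> t + 95 * (G * (B * (h * w))) + 30) i f t"
proof -
  define M where "M = G * B * h"
  have M: "G * (B * (h * w)) = M * w" by (simp add: M_def mult.assoc)
  define J where "J = (\<lambda>m f'. (\<forall>r < m.
      [pol f' (oth + lor h r * w) w = X r] (mod mu w) \<and>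
      [pol f' (oth + (lor h r + h) * w) w = Y r] (mod mu w)) \<and>
    (\<forall>y. y < oth \<or> oth + 2 * (M * w) \<le> y \<longrightarrow> f' y = f y))"
  have "wp (sweep 20 21 row_inv) (\<lambda>i' f' t'. J (G * B * h) f' \<and>
    t' \<le> t + 95 * (G * (B * (h * w))) + 20) i f t"
  proof (rule sweep_spec[where u = u and J = J and out = cur and src = oth])
    fix g b j i' f' t'
    assume gbj: "g < G" "b < B" "j < h"
      and r: "i' 29 = cur + ((g * B + b) * h + j) * w"
        "i' 30 = cur + G * (B * (h * w)) + ((g * B + b) * h + j) * w"
        "i' 31 = oth + ((g * B + b) * (2 * h) + j) * w"
        "i' 32 = oth + ((g * B + b) * (2 * h) + h + j) * w"
        "i' 34 = (2 * g + 1) * u" and fr: "\<And>r. r < 29 \<Longrightarrow> i' r = i r"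
      and J: "J ((g * B + b) * h + j) f'"
    define m where "m = (g * B + b) * h + j"
    have mM: "m < M"
      unfolding m_def M_def by (rule index_bound[OF gbj])
    have mw: "m * w + w \<le> M * w"
      using mult_le_mono1[of "Suc m" M w] mM by simp
    have lo: "(g * B + b) * (2 * h) + j = lor h m"
      unfolding m_def using gbj by (simp add: lor_block)
    have hi: "(g * B + b) * (2 * h) + h + j = lor h m + h"
      using lo by simp
    have c: "(2 * g + 1) * u = twid u B h m"
      unfolding m_def using gbj by (simp add: twid_block)
    have "lor h m + h < G * B * (2 * h)"
      by (rule lor_bound) (use pos mM in \<open>auto simp: M_def\<close>)
    then have lM: "lor h m + h < 2 * M"
      by (simp add: M_def)
    then have lw: "(lor h m + h) * w + w \<le> 2 * (M * w)"
      using mult_le_mono1[of "Suc (lor h m + h)" "2 * M" w] by simp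
    have hw: "w \<le> h * w" using pos by simp
    have low: "lor h m * w + w \<le> (lor h m + h) * w"
      using hw by (simp add: add_mult_distrib)
    have cw: "twid u B h m \<le> w"
    proof -
      have "(2 * g + 1) * u \<le> 2 * G * u"
        using gbj by (intro mult_le_mono1) simp
      then show ?thesis using u c by simp
    qed
    have Jm: "J m f'" using J by (simp add: m_def)
    have fcur: "pol f' (cur + k * w) w = pol f (cur + k * w) w" if "k * w + w \<le> 2 * (M * w)" for k
      by (rule pol_cong) (use Jm that disj in \<open>auto simp: J_def M\<close>)
    have i10: "i' 10 = i 10" by (rule fr) simp
    have f10: "f' (i 10) = f (i 10)" using Jm half by (simp add: J_def)
    have mX: "[pol f' (cur + m * w) w = X m + xp (twid u B h m) * Y m] (mod mu w)"
      using X[of m] mM mw by (subst fcur) (auto simp: M_def)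
    have mY: "[pol f' (cur + (M + m) * w) w = X m - xp (twid u B h m) * Y m] (mod mu w)"
    proof -
      have "(M + m) * w + w \<le> 2 * (M * w)"
        using mw unfolding add_mult_distrib by linarith
      from fcur[OF this] show ?thesis using Y[of m] mM by (simp add: M_def)
    qed
    have r': "i' 29 = cur + m * w" "i' 30 = cur + (M + m) * w" "i' 31 = oth + lor h m * w"
      "i' 32 = oth + (lor h m + h) * w" "i' 34 = twid u B h m" "i' 23 = w"
      using r[unfolded lo hi c M m_def[symmetric]] fr[of 23] regs by (simp_all add: add_mult_distrib)
    have d: "cur + m * w + w \<le> cur + (M + m) * w"
      using mw unfolding add_mult_distrib by linarith
    have d': "oth + lor h m * w + w \<le> oth + (lor h m + h) * w"
      using low by simp
    have i10': "f' (i' 10) + f' (i' 10) = 1" "i' 10 < oth + lor h m * w"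
      using half f10 i10 by simp_all
    have "cur + (M + m) * w + w \<le> cur + 2 * (M * w)"
      using mw unfolding add_mult_distrib by linarith
    then have p: "oth + (lor h m + h) * w + w \<le> cur + m * w \<or> cur + (M + m) * w + w \<le> oth + lor h m * w"
      using disj[unfolded M] lw low by linarith
    show "wp row_inv (\<lambda>i'' f'' t''. J (Suc ((g * B + b) * h + j)) f'' \<and> i'' 29 = i' 29 + w \<and>
          i'' 30 = i' 30 + w \<and> i'' 31 = i' 31 + w \<and> i'' 32 = i' 32 + w \<and>
          t'' \<le> t' + 24 * w + 49) i' f' t'"
      unfolding m_def[symmetric]
    proof (rule wp_conseq[OF row_inv_spec[OF r'(6,5,1,2,3,4) i10' cw d d' p mX mY]], goal_cases)
      case (1 i2 f2 t2)
      have new: "\<And>y. (y < oth + lor h m * w \<or> oth + lor h m * w + w \<le> y) \<Longrightarrow>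
          (y < oth + (lor h m + h) * w \<or> oth + (lor h m + h) * w + w \<le> y) \<Longrightarrow> f2 y = f' y"
        using 1(1) by blast
      have "J (Suc m) f2"
        unfolding J_def
      proof (intro conjI allI impI)
        fix k assume k: "k < Suc m"
        \<comment> \<open>Lower rows never meet upper rows, so writing pair \<open>m\<close> leaves
          the finished pairs intact.\<close>
        have ne: "lor h k \<noteq> lor h m + h" "lor h k + h \<noteq> lor h m"
          using lor_upper[of h] pos by metis+
        have ne': "lor h k \<noteq> lor h m" if "k \<noteq> m"
          using that lor_eq[of h] pos by metis
        have "pol f2 (oth + lor h k * w) w = pol f' (oth + lor h k * w) w" if "k \<noteq> m"
          by (rule pol_cong, rule new)
            (use row_disjoint[OF ne'[OF that], of w] row_disjoint[OF ne(1), of w] in linarith)+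
        then show "[pol f2 (oth + lor h k * w) w = X k] (mod mu w)"
          using 1(1) k Jm by (cases "k = m") (auto simp: J_def)
        have "pol f2 (oth + (lor h k + h) * w) w = pol f' (oth + (lor h k + h) * w) w" if "k \<noteq> m"
          by (rule pol_cong, rule new)
            (use row_disjoint[of "lor h k + h" "lor h m + h" w] ne'[OF that] row_disjoint[OF ne(2), of w] in linarith)+
        then show "[pol f2 (oth + (lor h k + h) * w) w = Y k] (mod mu w)"
          using 1(1) k Jm by (cases "k = m") (auto simp: J_def)
      next
        fix y assume y: "y < oth \<or> oth + 2 * (M * w) \<le> y"
        have "f2 y = f' y"
          by (rule new) (use y lw low in \<open>auto simp: algebra_simps\<close>)
        then show "f2 y = f y" using Jm y by (auto simp: J_def)
      qed
      then show ?case using 1(1) r' by simp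
    qed
  qed (use regs pos in \<open>auto simp: J_def\<close>)
  then show ?thesis
    unfolding pass_inv_def wp_Seq
    by (rule wp_conseq) (use regs in \<open>auto simp: swap_bufs_def J_def M M_def[symmetric]\<close>)
qed

section \<open>Complete forward and inverse transforms\<close>

definition halve :: "nat \<Rightarrow> com" where
  "halve a = Instrs [IConst 41 1, IConst 42 2] ;;
     While 42 a (Instrs [IAdd 41 41 41, IAdd 42 41 41]) ;; Instrs (mov a 41)"

lemma wr_halve [simp]: "wr (halve a) = {41, 42, a}"
  by (auto simp: halve_def)

text \<open>The machine can only double, so the half of a power of two is searched from 1 upwards.
  The logarithmic time is relaxed to a multiple of the result, which the cost of a pass
  absorbs.\<close>

lemma halve_spec:
  assumes "i a = 2 * 2 ^ k" "a \<noteq> 41" "a \<noteq> 42"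
  shows "wp (halve a) (\<lambda>i' f' t'. i' a = 2 ^ k \<and> f' = f \<and> t' \<le> t + 4 * 2 ^ k + 5) i f t"
proof -
  have W: "wp (While 42 a (Instrs [IAdd 41 41 41, IAdd 42 41 41]))
     (\<lambda>i' f' t'. i' 41 = 2 ^ k \<and> f' = f \<and> t' \<le> t + 4 * k + 3) (i(41 := 1, 42 := 2)) f (Suc (Suc t))"
  proof (rule wp_while[where n = k and I = "\<lambda>m i' f' t'. i' 41 = 2 ^ m \<and> i' 42 = 2 * 2 ^ m \<and>
      f' = f \<and> t' \<le> t + 2 + 4 * m"], goal_cases)
    case 1
    then show ?case by simp
  next
    case (2 m i' f' t')
    have "i' a = i a" using 2(3)[of a] assms by simp
    moreover have "(2::nat) ^ m < 2 ^ k" using 2(1) by simp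
    ultimately show ?case using 2(2) assms by simp
  next
    case (3 i' f' t')
    have "i' a = i a" using 3(2)[of a] assms by simp
    then show ?case using 3(1) assms by simp
  qed
  have "Suc k \<le> 2 ^ k" using less_exp[of k] by (rule Suc_leI)
  then show ?thesis
    unfolding halve_def using assms
    by simp (rule wp_conseq[OF W[simplified]], auto)
qed

text \<open>Register 27 is the partner distance, halved until it equals the row width in register
  23; the number of passes is thus never stored.\<close>

definition fft_fwd :: com where
  "fft_fwd = While 23 27 (halve 26 ;; halve 27 ;; halve 28 ;; pass_fwd)"

definition fft_inv :: com where
  "fft_inv = While 27 38 (pass_inv ;; Instrs [IAdd 26 26 26, IAdd 27 27 27, IAdd 28 28 28])"

lemma wr_fft [simp]:
  "wr fft_fwd = {20, 21, 26, 27, 28, 29, 30, 31, 32, 34, 35, 36, 37, 40, 41, 42, 45, 46, 47, 48, 49, 60, 61, 62, 63, 64, 99}"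
  "wr fft_inv = {20, 21, 26, 27, 28, 29, 30, 31, 32, 34, 35, 36, 37, 40, 45, 46, 47, 49, 60, 61, 62, 63, 64, 99}"
  unfolding fft_fwd_def fft_inv_def by auto

text \<open>After \<open>r\<close> of \<open>R\<close> passes, entry \<open>j\<close> of group \<open>g\<close> of block \<open>b\<close>: the coefficient of \<open>y^j\<close> in
  \<open>\<Sum>l. X b l y^l\<close> modulo \<open>y^T - z^((2 g + 1) T v)\<close>, where \<open>T = 2^(R - r)\<close>.\<close>

definition fft_sum :: "nat \<Rightarrow> nat \<Rightarrow> (nat \<Rightarrow> nat \<Rightarrow> 'k::field poly) \<Rightarrow> nat \<Rightarrow> nat \<Rightarrow> nat \<Rightarrow> nat \<Rightarrow> 'k poly" where
  "fft_sum R v X r g b j =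
     (\<Sum>l<2 ^ r. xp ((2 * g + 1) * 2 ^ (R - r) * v * l) * X b (l * 2 ^ (R - r) + j))"

lemma sum_even_odd: "(\<Sum>l<2 * m. f l) = (\<Sum>l<m. f (2 * l) + f (2 * l + 1 :: nat) :: 'a::comm_monoid_add)"
  by (induction m) (auto simp: add_ac)

lemma xp_w_mult_cong: "[xp (w * l) = (- 1) ^ l] (mod mu w :: 'k::field poly)"
proof -
  have "[xp w = (- 1 :: 'k poly)] (mod mu w)"
    by (rule cong_mu_I[of _ _ _ 1]) (simp add: mu_def)
  from cong_pow[OF this, of l] show ?thesis by (simp add: xp_mult)
qed

text \<open>Splitting by the parity of \<open>l\<close>: with the stride halved to \<open>h\<close>,
  even terms read the entries \<open>j\<close> and odd terms the entries \<open>h + j\<close>, the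
  latter with one extra twiddle factor.\<close>

lemma fft_sum_add:
  assumes "r < R" "h = 2 ^ (R - Suc r)"
  shows "fft_sum R v X r g b j + xp ((2 * g + 1) * (h * v)) * fft_sum R v X r g b (h + j) =
    fft_sum R v X (Suc r) g b j"
proof -
  have T: "2 ^ (R - r) = 2 * h"
    using assms by (simp flip: power_Suc add: Suc_diff_Suc)
  have "fft_sum R v X (Suc r) g b j = (\<Sum>l<2 * 2 ^ r. xp ((2 * g + 1) * h * v * l) * X b (l * h + j))"
    by (simp add: fft_sum_def assms(2))
  also have "\<dots> = (\<Sum>l<2 ^ r. xp ((2 * g + 1) * (2 * h) * v * l) * X b (l * (2 * h) + j) +
      xp ((2 * g + 1) * (h * v)) * (xp ((2 * g + 1) * (2 * h) * v * l) * X b (l * (2 * h) + (h + j))))"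
    unfolding sum_even_odd
  proof (rule sum.cong[OF refl])
    fix l
    have 1: "(2 * g + 1) * h * v * (2 * l) = (2 * g + 1) * (2 * h) * v * l"
      "(2 * g + 1) * h * v * (2 * l + 1) = (2 * g + 1) * (h * v) + (2 * g + 1) * (2 * h) * v * l"
      "2 * l * h + j = l * (2 * h) + j" "(2 * l + 1) * h + j = l * (2 * h) + (h + j)"
      by (simp_all add: algebra_simps)
    show "xp ((2 * g + 1) * h * v * (2 * l)) * X b (2 * l * h + j) +
        xp ((2 * g + 1) * h * v * (2 * l + 1)) * X b ((2 * l + 1) * h + j) =
      xp ((2 * g + 1) * (2 * h) * v * l) * X b (l * (2 * h) + j) +
        xp ((2 * g + 1) * (h * v)) * (xp ((2 * g + 1) * (2 * h) * v * l) * X b (l * (2 * h) + (h + j)))"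
      unfolding 1 xp_add by (simp only: mult.assoc)
  qed
  finally show ?thesis
    by (simp add: fft_sum_def T sum.distrib sum_distrib_left)
qed

text \<open>The other square root is the negative one: replacing \<open>g\<close> by
  \<open>g + 2^r\<close> inserts the factor \<open>X^(w l)\<close>, which is \<open>(-1)^l\<close>
  modulo \<open>mu w\<close>, so just the odd terms change sign.\<close>

lemma fft_sum_diff:
  fixes X :: "nat \<Rightarrow> nat \<Rightarrow> 'k::field poly"
  assumes "r < R" "h = 2 ^ (R - Suc r)" "w = 2 ^ R * v"
  shows "[fft_sum R v X r g b j - xp ((2 * g + 1) * (h * v)) * fft_sum R v X r g b (h + j) =
    fft_sum R v X (Suc r) (g + 2 ^ r) b j] (mod mu w)"
proof -
  have T: "2 ^ (R - r) = 2 * h"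
    using assms by (simp flip: power_Suc add: Suc_diff_Suc)
  have w: "w = 2 * 2 ^ r * (h * v)"
    using assms by (simp flip: power_Suc power_add mult.assoc)
  define c where "c = (2 * g + 1) * (h * v)"
  have e: "xp ((2 * (g + 2 ^ r) + 1) * h * v * l) = (xp (w * l) * xp (c * l) :: 'k poly)" for l
  proof -
    have "(2 * (g + 2 ^ r) + 1) * h * v * l = w * l + c * l"
      unfolding w c_def by (simp add: algebra_simps)
    then show ?thesis by (simp add: xp_add)
  qed
  have c1: "[xp (w * (2 * l)) = (1 :: 'k poly)] (mod mu w)" for l
    using xp_w_mult_cong[of w "2 * l"] by simp
  have c2: "[xp (w * (2 * l + 1)) = (- 1 :: 'k poly)] (mod mu w)" for l
    using xp_w_mult_cong[of w "2 * l + 1"] by simp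
  have "fft_sum R v X (Suc r) (g + 2 ^ r) b j =
      (\<Sum>l<2 * 2 ^ r. xp (w * l) * xp (c * l) * X b (l * h + j))"
    unfolding e[symmetric] by (simp add: fft_sum_def assms(2))
  also have "\<dots> = (\<Sum>l<2 ^ r. xp (w * (2 * l)) * xp (c * (2 * l)) * X b (2 * l * h + j) +
      xp (w * (2 * l + 1)) * xp (c * (2 * l + 1)) * X b ((2 * l + 1) * h + j))"
    unfolding sum_even_odd ..
  finally have A: "fft_sum R v X (Suc r) (g + 2 ^ r) b j =
    (\<Sum>l<2 ^ r. xp (w * (2 * l)) * xp (c * (2 * l)) * X b (2 * l * h + j) +
      xp (w * (2 * l + 1)) * xp (c * (2 * l + 1)) * X b ((2 * l + 1) * h + j))" .
  have B: "[(\<Sum>l<2 ^ r. xp (w * (2 * l)) * xp (c * (2 * l)) * X b (2 * l * h + j) +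
      xp (w * (2 * l + 1)) * xp (c * (2 * l + 1)) * X b ((2 * l + 1) * h + j)) = (\<Sum>l<2 ^ r. 1 * xp (c * (2 * l)) * X b (2 * l * h + j) +
      (- 1) * xp (c * (2 * l + 1)) * X b ((2 * l + 1) * h + j))] (mod mu w)"
    by (intro cong_sum cong_add cong_mult c1 c2 cong_refl)
  have "(\<Sum>l<2 ^ r. 1 * xp (c * (2 * l)) * X b (2 * l * h + j) +
      (- 1) * xp (c * (2 * l + 1)) * X b ((2 * l + 1) * h + j)) =
     (\<Sum>l<2 ^ r. xp ((2 * g + 1) * (2 * h) * v * l) * X b (l * (2 * h) + j) -
      xp c * (xp ((2 * g + 1) * (2 * h) * v * l) * X b (l * (2 * h) + (h + j))))"
  proof (rule sum.cong[OF refl])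
    fix l
    have 1: "c * (2 * l) = (2 * g + 1) * (2 * h) * v * l"
      "c * (2 * l + 1) = c + (2 * g + 1) * (2 * h) * v * l"
      "2 * l * h + j = l * (2 * h) + j" "(2 * l + 1) * h + j = l * (2 * h) + (h + j)"
      by (simp_all add: c_def algebra_simps)
    show "1 * xp (c * (2 * l)) * X b (2 * l * h + j) +
        (- 1) * xp (c * (2 * l + 1)) * X b ((2 * l + 1) * h + j) =
      xp ((2 * g + 1) * (2 * h) * v * l) * X b (l * (2 * h) + j) -
        xp c * (xp ((2 * g + 1) * (2 * h) * v * l) * X b (l * (2 * h) + (h + j)))"
      unfolding 1 xp_add by (simp only: mult.assoc mult_1 mult_minus1 mult_minus_left diff_conv_add_uminus)
  qed
  also have "\<dots> = fft_sum R v X r g b j - xp c * fft_sum R v X r g b (h + j)"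
    by (simp add: fft_sum_def T sum_subtractf sum_distrib_left)
  finally have C: "(\<Sum>l<2 ^ r. 1 * xp (c * (2 * l)) * X b (2 * l * h + j) +
      (- 1) * xp (c * (2 * l + 1)) * X b ((2 * l + 1) * h + j)) =
      fft_sum R v X r g b j - xp c * fft_sum R v X r g b (h + j)" .
  show ?thesis
    using cong_sym[OF B] unfolding A[symmetric] C by (simp only: c_def)
qed

lemma fft_sum_0: "fft_sum R v X 0 0 b j = X b j"
  by (simp add: fft_sum_def)

lemma fft_sum_R: "fft_sum R v X R g b 0 = (\<Sum>l<2 ^ R. xp ((2 * g + 1) * v * l) * X b l)"
  by (simp add: fft_sum_def)

lemma pass_fwd_fft:
  fixes f :: "nat \<Rightarrow> 'k::field"
  assumes regs: "i 20 = cur" "i 21 = oth" "i 25 = 2 ^ r * (B * (h * w))" "i 26 = B * (h * w)"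
      "i 27 = h * w" "i 28 = h * v" "i 23 = w"
    and pos: "0 < w" "0 < B" and r: "r < R" "h = 2 ^ (R - Suc r)" and w: "w = 2 ^ R * v"
    and disj: "cur + 2 ^ R * (B * w) \<le> oth \<or> oth + 2 ^ R * (B * w) \<le> cur"
    and X: "\<And>g b j. g < 2 ^ r \<Longrightarrow> b < B \<Longrightarrow> j < 2 * h \<Longrightarrow>
      [pol f (cur + ((g * B + b) * (2 * h) + j) * w) w = fft_sum R v X r g b j] (mod mu w)"
  shows "wp pass_fwd (\<lambda>i' f' t'.
    (\<forall>g b j. g < 2 ^ Suc r \<longrightarrow> b < B \<longrightarrow> j < h \<longrightarrow>
      [pol f' (oth + ((g * B + b) * h + j) * w) w = fft_sum R v X (Suc r) g b j] (mod mu w)) \<and>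
    (\<forall>y. y < oth \<or> oth + 2 ^ R * (B * w) \<le> y \<longrightarrow> f' y = f y) \<and>
    i' 20 = oth \<and> i' 21 = cur \<and> t' \<le> t + 95 * i 25 + 30) i f t"
proof -
  have R: "2 ^ R = 2 * 2 ^ r * h"
    using r by (simp flip: power_Suc power_add)
  have tot: "2 * (2 ^ r * (B * (h * w))) = 2 ^ R * (B * w)"
    by (simp add: R)
  have h: "0 < h" using r by simp
  have hu: "2 * 2 ^ r * (h * v) \<le> w"
    by (simp add: w R mult.assoc)
  note S = pass_fwd_spec[OF regs pos(1) h pos(2) hu disj[folded tot]]
  show ?thesis
  proof (rule wp_conseq[OF S], goal_cases)
    case (1 i' f' t')
    have "[pol f' (oth + ((g * B + b) * h + j) * w) w = fft_sum R v X (Suc r) g b j] (mod mu w)"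
      if g: "g < 2 ^ Suc r" and b: "b < B" and j: "j < h" for g b j
    proof -
      \<comment> \<open>The group of the butterfly behind group \<open>g\<close>: sums keep its
        number, differences add \<open>2^r\<close> to it.\<close>
      define g0 where "g0 = g mod 2 ^ r"
      have g0: "g0 < 2 ^ r" by (simp add: g0_def)
      have gc: "g = g0 \<or> g = g0 + 2 ^ r"
        using g unfolding g0_def
        by (metis add.commute le_add_diff_inverse mod_less le_mod_geq less_diff_conv2 linorder_not_less mult_2 power_Suc)
      define m where "m = (g0 * B + b) * h + j"
      have m: "m < 2 ^ r * B * h"
        unfolding m_def by (rule index_bound[OF g0 b j])
      have lo: "lor h m = (g0 * B + b) * (2 * h) + j"
        unfolding m_def by (rule lor_block[OF j])
      have tw: "twid (h * v) B h m = (2 * g0 + 1) * (h * v)"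
        unfolding m_def by (rule twid_block[OF j b])
      have P: "[pol f (cur + lor h m * w) w = fft_sum R v X r g0 b j] (mod mu w)"
        unfolding lo by (rule X[OF g0 b]) (use j in simp)
      have Q: "[pol f (cur + (lor h m + h) * w) w = fft_sum R v X r g0 b (h + j)] (mod mu w)"
        using X[OF g0 b, of "h + j"] j unfolding lo by (simp add: add_ac)
      show ?thesis
      proof (cases "g = g0")
        case True
        have n1: "[pol f' (oth + m * w) w = pol f (cur + lor h m * w) w +
            xp (twid (h * v) B h m) * pol f (cur + (lor h m + h) * w) w] (mod mu w)"
          using 1 m by blast
        have n2: "[pol f (cur + lor h m * w) w +
            xp (twid (h * v) B h m) * pol f (cur + (lor h m + h) * w) w =
            fft_sum R v X r g0 b j + xp (twid (h * v) B h m) * fft_sum R v X r g0 b (h + j)] (mod mu w)"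
          by (intro cong_add cong_mult P Q cong_refl)
        show ?thesis
          using cong_trans[OF n1 n2] unfolding tw fft_sum_add[OF r] unfolding m_def True .
      next
        case False
        have n1: "[pol f' (oth + (2 ^ r * B * h + m) * w) w = pol f (cur + lor h m * w) w -
            xp (twid (h * v) B h m) * pol f (cur + (lor h m + h) * w) w] (mod mu w)"
          using 1 m by blast
        have n2: "[pol f (cur + lor h m * w) w -
            xp (twid (h * v) B h m) * pol f (cur + (lor h m + h) * w) w =
            fft_sum R v X r g0 b j - xp (twid (h * v) B h m) * fft_sum R v X r g0 b (h + j)] (mod mu w)"
          by (intro cong_diff cong_mult P Q cong_refl)
        have ix: "2 ^ r * B * h + m = (g * B + b) * h + j" and g: "g = g0 + 2 ^ r"
          using gc False by (auto simp: m_def algebra_simps)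
        show ?thesis
          using cong_trans[OF cong_trans[OF n1 n2] fft_sum_diff[OF r w, of X g0 b j, folded tw]]
          unfolding ix g[symmetric] .
      qed
    qed
    then show ?case using 1 regs(3) tot by auto
  qed
qed

lemma fft_fwd_spec:
  fixes f :: "nat \<Rightarrow> 'k::field"
  assumes regs: "i 20 = cur" "i 21 = oth" "2 * i 25 = 2 ^ R * (B * w)" "i 26 = 2 ^ R * (B * w)"
      "i 27 = 2 ^ R * w" "i 28 = w" "i 23 = w"
    and pow: "B = 2 ^ \<beta>" "v = 2 ^ \<nu>" and w: "w = 2 ^ R * v"
    and disj: "cur + 2 ^ R * (B * w) \<le> oth \<or> oth + 2 ^ R * (B * w) \<le> cur"
    and X: "\<And>b j. b < B \<Longrightarrow> j < 2 ^ R \<Longrightarrow> [pol f (cur + (b * 2 ^ R + j) * w) w = X b j] (mod mu w)"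
  shows "wp fft_fwd (\<lambda>i' f' t'.
    (\<forall>g b. g < 2 ^ R \<longrightarrow> b < B \<longrightarrow>
      [pol f' (i' 20 + (g * B + b) * w) w = (\<Sum>l<2 ^ R. xp ((2 * g + 1) * v * l) * X b l)] (mod mu w)) \<and>
    (\<forall>y. (y < oth \<or> oth + 2 ^ R * (B * w) \<le> y) \<longrightarrow> (y < cur \<or> cur + 2 ^ R * (B * w) \<le> y) \<longrightarrow> f' y = f y) \<and>
    (i' 20 = cur \<and> i' 21 = oth \<or> i' 20 = oth \<and> i' 21 = cur) \<and>
    i' 26 = B * w \<and> i' 27 = w \<and> i' 28 = v \<and> t' \<le> t + R * (170 * i 25) + 1) i f t"
proof -
  have pos: "0 < w" "0 < B" "0 < v" using pow w by auto
  define I where "I = (\<lambda>r i' (f' :: nat \<Rightarrow> 'k) t'.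
    (\<forall>g b j. g < 2 ^ r \<longrightarrow> b < B \<longrightarrow> j < 2 ^ (R - r) \<longrightarrow>
      [pol f' (i' 20 + ((g * B + b) * 2 ^ (R - r) + j) * w) w = fft_sum R v X r g b j] (mod mu w)) \<and>
    (\<forall>y. (y < oth \<or> oth + 2 ^ R * (B * w) \<le> y) \<longrightarrow> (y < cur \<or> cur + 2 ^ R * (B * w) \<le> y) \<longrightarrow> f' y = f y) \<and>
    (i' (20::nat) = cur \<and> i' 21 = oth \<or> i' 20 = oth \<and> i' 21 = cur) \<and>
    i' 26 = 2 ^ (R - r) * (B * w) \<and> i' 27 = 2 ^ (R - r) * w \<and> i' 28 = 2 ^ (R - r) * v \<and>
    t' \<le> t + r * (170 * i 25))"
  show ?thesis
    unfolding fft_fwd_def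
  proof (rule wp_while[where n = R and I = I], goal_cases)
    case 1
    show ?case using regs X w by (simp add: I_def fft_sum_0)
  next
    case (2 r i1 f1 t1)
    have I: "I r i1 f1 t1" by (rule 2(2))
    have i25: "i1 25 = i 25" and i23: "i1 23 = w" using 2(3) regs by simp_all
    define h where "h = (2::nat) ^ (R - Suc r)"
    have h: "(2::nat) ^ (R - r) = 2 * h"
      unfolding h_def using 2(1) by (simp flip: power_Suc add: Suc_diff_Suc)
    have R: "(2::nat) ^ R = 2 * 2 ^ r * h"
      using 2(1) by (simp add: h_def flip: power_Suc power_add)
    have half: "i 25 = 2 ^ r * (B * (h * w))"
      using regs(3) by (simp add: R)
    have bounds: "B * (h * w) \<le> i 25" "h * w \<le> i 25" "h * v \<le> i 25" "1 \<le> i 25"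
    proof -
      show 1: "B * (h * w) \<le> i 25" unfolding half by simp
      have "h * w \<le> B * (h * w)" using pos by (cases B) auto
      with 1 show 2: "h * w \<le> i 25" by (rule order_trans[rotated])
      have "h * v \<le> h * w" unfolding w by simp
      with 2 show "h * v \<le> i 25" by (rule order_trans[rotated])
      have "1 \<le> h * w" using pos by (simp add: h_def Suc_le_eq)
      with 2 show "1 \<le> i 25" by (rule order_trans[rotated])
    qed
    \<comment> \<open>\<open>halve\<close> needs its arguments as explicit powers of two; hence the
      assumption that the block count \<open>B\<close> is one.\<close>
    have e: "B * (h * w) = 2 ^ (\<beta> + (R - Suc r) + (R + \<nu>))" "h * w = 2 ^ ((R - Suc r) + (R + \<nu>))"
      "h * v = 2 ^ ((R - Suc r) + \<nu>)"
      by (simp_all add: h_def w pow power_add mult_ac)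
    have "w \<le> h * w" by (simp add: h_def)
    then have lt: "w < 2 * h * w" using pos unfolding mult_2 add_mult_distrib by linarith
    obtain cur' oth' where co: "i1 20 = cur'" "i1 21 = oth'"
      "cur' = cur \<and> oth' = oth \<or> cur' = oth \<and> oth' = cur"
      using I unfolding I_def by blast
    have "wp (halve 26 ;; halve 27 ;; halve 28 ;; pass_fwd) (\<lambda>i f t. I (Suc r) i f (Suc t)) i1 f1 (Suc t1)"
      unfolding wp_Seq
    proof (rule wp_conseq[OF halve_spec[where k = "\<beta> + (R - Suc r) + (R + \<nu>)"]], goal_cases)
      case 1
      show ?case using I e(1) by (simp add: I_def h mult_ac)
    next
      case (4 i2 f2 t2)
      show ?case
      proof (rule wp_conseq[OF halve_spec[where k = "(R - Suc r) + (R + \<nu>)"]], goal_cases)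
        case 1
        show ?case using I e(2) 4(2)[of 27] by (simp add: I_def h mult_ac)
      next
        case (4 i3 f3 t3)
        note p = 4 \<open>_ \<and> _ \<and> t2 \<le> _\<close> \<open>\<And>r. _ \<Longrightarrow> i2 r = _\<close>
        show ?case
        proof (rule wp_conseq[OF halve_spec[where k = "(R - Suc r) + \<nu>"]], goal_cases)
          case 1
          show ?case using I e(3) p(2)[of 28] p(4)[of 28] by (simp add: I_def h mult_ac)
        next
          case (4 i4 f4 t4)
          have f4: "f4 = f1" using p(1,3) 4(1) by simp
          have fr: "i4 r = i1 r" if "r \<notin> {26, 27, 28, 41, 42}" for r
            using that 4(2)[of r] p(2)[of r] p(4)[of r] by simp
          have i26: "i4 26 = B * (h * w)" using p(3) p(2)[of 26] 4(2)[of 26] e(1) by simp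
          have i27: "i4 27 = h * w" using p(1) 4(2)[of 27] e(2) by simp
          have i28: "i4 28 = h * v" using 4(1) e(3) by simp
          have t4: "t4 \<le> t1 + 12 * i 25 + 16"
            using p(1,3) 4(1) bounds e by simp
          have S: "wp pass_fwd (\<lambda>i' f' t'.
            (\<forall>g b j. g < 2 ^ Suc r \<longrightarrow> b < B \<longrightarrow> j < h \<longrightarrow>
              [pol f' (oth' + ((g * B + b) * h + j) * w) w = fft_sum R v X (Suc r) g b j] (mod mu w)) \<and>
            (\<forall>y. y < oth' \<or> oth' + 2 ^ R * (B * w) \<le> y \<longrightarrow> f' y = f4 y) \<and>
            i' 20 = oth' \<and> i' 21 = cur' \<and> t' \<le> t4 + 95 * i4 25 + 30) i4 f4 t4"
          proof (rule pass_fwd_fft[where v = v and w = w])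
            show "cur' + 2 ^ R * (B * w) \<le> oth' \<or> oth' + 2 ^ R * (B * w) \<le> cur'"
              using co(3) disj by auto
            show "[pol f4 (cur' + ((g * B + b) * (2 * h) + j) * w) w = fft_sum R v X r g b j] (mod mu w)"
              if "g < 2 ^ r" "b < B" "j < 2 * h" for g b j
              using I that co by (simp add: I_def h f4)
          qed (use co fr i25 i23 half i26 i27 i28 2(1) pos w in \<open>auto simp: h_def\<close>)
          have i425: "i4 25 = i 25" using fr[of 25] i25 by simp
          show ?case
          proof (rule wp_conseq[OF S], goal_cases)
            case (1 i5 f5 t5)
            have "i5 26 = i4 26" "i5 27 = i4 27" "i5 28 = i4 28"
              using 1(2) by simp_all
            then show ?case
              using 1(1) I t4 bounds(4) co f4 i26 i27 i28 i425
              by (auto simp: I_def h_def[symmetric] mult_ac)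
          qed
        qed simp_all
      qed simp_all
    qed simp_all
    then show ?case using I lt i23 by (simp add: I_def h)
  next
    case (3 i1 f1 t1)
    then show ?case using regs by (auto simp: I_def fft_sum_R)
  qed
qed

lemma fft_inv_spec:
  fixes f :: "nat \<Rightarrow> 'k::field_char_0"
  assumes regs: "i 20 = cur" "i 21 = oth" "2 * i 25 = 2 ^ R * (B * w)" "i 26 = B * w"
      "i 27 = w" "i 28 = v" "i 23 = w" "i 38 = 2 ^ R * w"
    and half: "f (i 10) + f (i 10) = 1" "i 10 < oth" "i 10 < cur"
    and pos: "0 < B" "0 < v" and w: "w = 2 ^ R * v"
    and disj: "cur + 2 ^ R * (B * w) \<le> oth \<or> oth + 2 ^ R * (B * w) \<le> cur"
    and X: "\<And>g b. g < 2 ^ R \<Longrightarrow> b < B \<Longrightarrow>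
      [pol f (cur + (g * B + b) * w) w = (\<Sum>l<2 ^ R. xp ((2 * g + 1) * v * l) * X b l)] (mod mu w)"
  shows "wp fft_inv (\<lambda>i' f' t'.
    (\<forall>b j. b < B \<longrightarrow> j < 2 ^ R \<longrightarrow> [pol f' (i' 20 + (b * 2 ^ R + j) * w) w = X b j] (mod mu w)) \<and>
    (\<forall>y. (y < oth \<or> oth + 2 ^ R * (B * w) \<le> y) \<longrightarrow> (y < cur \<or> cur + 2 ^ R * (B * w) \<le> y) \<longrightarrow> f' y = f y) \<and>
    (i' 20 = cur \<and> i' 21 = oth \<or> i' 20 = oth \<and> i' 21 = cur) \<and>
    t' \<le> t + R * (170 * i 25) + 1) i f t"
proof -
  have wpos: "0 < w" using pos w by auto
  define I where "I = (\<lambda>k i' (f' :: nat \<Rightarrow> 'k) t'.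
    (\<forall>g b j. g < 2 ^ (R - k) \<longrightarrow> b < B \<longrightarrow> j < 2 ^ k \<longrightarrow>
      [pol f' (i' 20 + ((g * B + b) * 2 ^ k + j) * w) w = fft_sum R v X (R - k) g b j] (mod mu w)) \<and>
    (\<forall>y. (y < oth \<or> oth + 2 ^ R * (B * w) \<le> y) \<longrightarrow> (y < cur \<or> cur + 2 ^ R * (B * w) \<le> y) \<longrightarrow> f' y = f y) \<and>
    (i' (20::nat) = cur \<and> i' 21 = oth \<or> i' 20 = oth \<and> i' 21 = cur) \<and>
    i' 26 = 2 ^ k * (B * w) \<and> i' 27 = 2 ^ k * w \<and> i' 28 = 2 ^ k * v \<and>
    t' \<le> t + k * (170 * i 25))"
  show ?thesis
    unfolding fft_inv_def
  proof (rule wp_while[where n = R and I = I], goal_cases)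
    case 1
    show ?case using regs X by (simp add: I_def fft_sum_R)
  next
    case (2 k i1 f1 t1)
    have I: "I k i1 f1 t1" by (rule 2(2))
    have i25: "i1 25 = i 25" and i23: "i1 23 = w" and i38: "i1 38 = 2 ^ R * w" and i10: "i1 10 = i 10"
      using 2(3) regs by simp_all
    define r where "r = R - Suc k"
    define h where "h = (2::nat) ^ k"
    have r: "r < R" "h = 2 ^ (R - Suc r)" "R - k = Suc r" "R - r = Suc k"
      using 2(1) by (auto simp: h_def r_def)
    have R: "(2::nat) ^ R = 2 * 2 ^ r * h"
      using r 2(1) by (simp flip: power_Suc power_add)
    have half25: "i 25 = 2 ^ r * (B * (h * w))"
      using regs(3) by (simp add: R)
    have tot: "2 * (2 ^ r * (B * (h * w))) = 2 ^ R * (B * w)"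
      by (simp add: R)
    have "1 \<le> i 25"
      unfolding half25 using pos wpos by (simp add: h_def Suc_le_eq)
    have hpos: "0 < h" by (simp add: h_def)
    have hu: "2 * 2 ^ r * (h * v) \<le> w"
      by (simp add: w R mult.assoc)
    obtain cur' oth' where co: "i1 20 = cur'" "i1 21 = oth'"
      "cur' = cur \<and> oth' = oth \<or> cur' = oth \<and> oth' = cur"
      using I unfolding I_def by blast
    \<comment> \<open>Row \<open>m\<close> is decoded into group, block and entry; \<open>d\<close>
      is 0 for the lower partner and \<open>h\<close> for the upper one.\<close>
    define Y where "Y = (\<lambda>d m. fft_sum R v X r (m div h div B) ((m div h) mod B) (d + m mod h))"
    have mm: "m mod h < h" "m div h mod B < B" for m using hpos pos by simp_all
    have md: "m = (m div h div B * B + m div h mod B) * h + m mod h" for m by simp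
    have ml: "m div h div B < 2 ^ r" if "m < 2 ^ r * B * h" for m
      using that hpos pos by (simp add: less_mult_imp_div_less)
    have f10: "f1 (i 10) = f (i 10)" using I half disj co by (auto simp: I_def)
    have S: "wp pass_inv (\<lambda>i' f' t'.
      (\<forall>m < 2 ^ r * B * h. [pol f' (oth' + lor h m * w) w = Y 0 m] (mod mu w) \<and>
        [pol f' (oth' + (lor h m + h) * w) w = Y h m] (mod mu w)) \<and>
      (\<forall>y. y < oth' \<or> oth' + 2 * (2 ^ r * (B * (h * w))) \<le> y \<longrightarrow> f' y = f1 y) \<and>
      i' 20 = oth' \<and> i' 21 = cur' \<and> t' \<le> Suc t1 + 95 * (2 ^ r * (B * (h * w))) + 30) i1 f1 (Suc t1)"
    proof (rule pass_inv_spec[where u = "h * v" and cur = cur'])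
      show "cur' + 2 * (2 ^ r * (B * (h * w))) \<le> oth' \<or> oth' + 2 * (2 ^ r * (B * (h * w))) \<le> cur'"
        using co(3) disj unfolding tot by blast
    next
      fix m assume m: "m < 2 ^ r * B * h"
      define g b j where gbj: "g = m div h div B" "b = m div h mod B" "j = m mod h"
      have mq: "m = (g * B + b) * h + j" and bj: "b < B" "j < h" and g: "g < 2 ^ r"
        using md mm ml[OF m] by (auto simp: gbj)
      have tw: "twid (h * v) B h m = (2 * g + 1) * (h * v)"
        unfolding mq by (rule twid_block[OF bj(2,1)])
      have old: "[pol f1 (cur' + ((g' * B + b) * h + j) * w) w = fft_sum R v X (Suc r) g' b j] (mod mu w)"
        if "g' < 2 ^ Suc r" for g'
        using I that bj co by (simp add: I_def r(3) h_def)
      have Y0: "Y 0 m = fft_sum R v X r g b j" "Y h m = fft_sum R v X r g b (h + j)"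
        by (simp_all add: Y_def gbj)
      show "[pol f1 (cur' + m * w) w = Y 0 m + xp (twid (h * v) B h m) * Y h m] (mod mu w)"
        using old[of g] g unfolding tw Y0 fft_sum_add[OF r(1,2)] mq[symmetric] by simp
      have ix: "(g + 2 ^ r) * B * h + (b * h + j) = 2 ^ r * B * h + m"
        by (simp add: mq algebra_simps)
      have "[pol f1 (cur' + (2 ^ r * B * h + m) * w) w = fft_sum R v X (Suc r) (g + 2 ^ r) b j] (mod mu w)"
        using old[of "g + 2 ^ r"] g unfolding ix[symmetric] by (simp add: algebra_simps)
      from cong_trans[OF this cong_sym[OF fft_sum_diff[OF r(1,2) w, of X g b j]]]
      show "[pol f1 (cur' + (2 ^ r * B * h + m) * w) w = Y 0 m - xp (twid (h * v) B h m) * Y h m] (mod mu w)"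
        unfolding tw Y0 .
    qed (use co I i25 i23 i10 f10 half half25 pos wpos hpos hu in \<open>auto simp: I_def h_def\<close>)
    have "wp (pass_inv ;; Instrs [IAdd 26 26 26, IAdd 27 27 27, IAdd 28 28 28])
        (\<lambda>i f t. I (Suc k) i f (Suc t)) i1 f1 (Suc t1)"
      unfolding wp_Seq
    proof (rule wp_conseq[OF S], goal_cases)
      case (1 i2 f2 t2)
      have fr: "i2 26 = i1 26" "i2 27 = i1 27" "i2 28 = i1 28"
        using 1(2) by simp_all
      have rows: "[pol f2 (oth' + ((g * B + b) * (2 * h) + j) * w) w = fft_sum R v X r g b j] (mod mu w)"
        if g: "g < 2 ^ r" and b: "b < B" and j: "j < 2 * h" for g b j
      proof -
        define j0 where "j0 = (if j < h then j else j - h)"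
        have j0: "j0 < h" "j = (if j < h then j0 else h + j0)" using j by (auto simp: j0_def)
        define m where "m = (g * B + b) * h + j0"
        have m: "m < 2 ^ r * B * h"
          unfolding m_def by (rule index_bound[OF g b j0(1)])
        have lo: "lor h m = (g * B + b) * (2 * h) + j0"
          unfolding m_def by (rule lor_block[OF j0(1)])
        have Y0: "Y d m = fft_sum R v X r g b (d + j0)" for d
          using j0(1) b by (simp add: Y_def m_def)
        show ?thesis
        proof (cases "j < h")
          case True
          then show ?thesis using 1(1) m Y0[of 0] lo j0(2) by auto
        next
          case False
          have "[pol f2 (oth' + (lor h m + h) * w) w = Y h m] (mod mu w)"
            using 1(1) m by blast
          moreover have "lor h m + h = (g * B + b) * (2 * h) + j"
            using lo j0(2) False by simp
          ultimately show ?thesis using Y0[of h] j0(2) False by simp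
        qed
      qed
      have "R - Suc k = r" by (simp add: r_def)
      then have Rk: "R - Suc k = r" and h2: "2 ^ Suc k = 2 * h" by (simp_all add: h_def)
      have i2: "i2 20 = oth'" "i2 21 = cur'" and t2: "t2 \<le> Suc t1 + 95 * i 25 + 30"
        using 1(1) unfolding half25[symmetric] by auto
      have t1: "t1 \<le> t + k * (170 * i 25)" using I by (simp add: I_def)
      show ?case
        unfolding wp_prims wp_Nil I_def
      proof (intro conjI allI impI, goal_cases)
        case (1 g b j)
        then show ?case using rows unfolding Rk h2 by (simp add: i2)
      next
        case (2 y)
        then have "f2 y = f1 y"
          using 1(1) co(3) unfolding tot by auto
        moreover have "f1 y = f y"
          using I 2 unfolding I_def by blast
        ultimately show ?case by simp
      next
        case 3
        then show ?case using co(3) by (auto simp: i2)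
      qed (use I fr t1 t2 \<open>1 \<le> i 25\<close> in \<open>auto simp: I_def\<close>)
    qed
    moreover have "(2::nat) ^ k < 2 ^ R" using 2(1) by simp
    ultimately show ?case using I i38 wpos by (simp add: I_def)
  next
    case (3 i1 f1 t1)
    then show ?case using regs by (auto simp: I_def fft_sum_0)
  qed
qed

section \<open>Negacyclic multiplication\<close>

text \<open>Coefficient \<open>i\<close> of the product of \<open>\<Sum>p. x p z^p\<close> and
  \<open>\<Sum>q. y q z^q\<close> modulo \<open>z^t + 1\<close>, with polynomials in
  \<open>X\<close> as coefficients.\<close>

definition negc :: "nat \<Rightarrow> (nat \<Rightarrow> 'k::field poly) \<Rightarrow> (nat \<Rightarrow> 'k poly) \<Rightarrow> nat \<Rightarrow> 'k poly" where
  "negc t x y i = (\<Sum>p<t. \<Sum>q<t. if p + q = i then x p * y q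
     else if p + q = i + t then - (x p * y q) else 0)"

lemma negc_cong:
  fixes x y :: "nat \<Rightarrow> 'k::field poly"
  assumes "[z ^ t = - 1] (mod M)"
  shows "[(\<Sum>i<t. z ^ i * negc t x y i) = (\<Sum>p<t. z ^ p * x p) * (\<Sum>q<t. z ^ q * y q)] (mod M)"
proof -
  have "(\<Sum>i<t. z ^ i * negc t x y i) = (\<Sum>i<t. \<Sum>p<t. \<Sum>q<t. z ^ i * (if p + q = i then x p * y q
     else if p + q = i + t then - (x p * y q) else 0))"
    by (simp only: negc_def sum_distrib_left)
  also have "\<dots> = (\<Sum>p<t. \<Sum>i<t. \<Sum>q<t. z ^ i * (if p + q = i then x p * y q
     else if p + q = i + t then - (x p * y q) else 0))"
    by (rule sum.swap)
  also have "\<dots> = (\<Sum>p<t. \<Sum>q<t. \<Sum>i<t. z ^ i * (if p + q = i then x p * y q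
     else if p + q = i + t then - (x p * y q) else 0))"
    by (rule sum.cong[OF refl], rule sum.swap)
  finally have L: "(\<Sum>i<t. z ^ i * negc t x y i) = (\<Sum>p<t. \<Sum>q<t. \<Sum>i<t. z ^ i * (if p + q = i then x p * y q
     else if p + q = i + t then - (x p * y q) else 0))" .
  have R: "(\<Sum>p<t. z ^ p * x p) * (\<Sum>q<t. z ^ q * y q) = (\<Sum>p<t. \<Sum>q<t. z ^ (p + q) * (x p * y q))"
    unfolding sum_product by (simp add: power_add mult_ac)
  show ?thesis
    unfolding L R
  proof (intro cong_sum)
    fix p q assume "p \<in> {..<t}" "q \<in> {..<t}"
    then have pq: "p < t" "q < t" by auto
    show "[(\<Sum>i<t. z ^ i * (if p + q = i then x p * y q
     else if p + q = i + t then - (x p * y q) else 0)) = z ^ (p + q) * (x p * y q)] (mod M)"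
    proof (cases "p + q < t")
      case True
      have "(\<Sum>i<t. z ^ i * (if p + q = i then x p * y q else if p + q = i + t then - (x p * y q) else 0)) =
          (\<Sum>i<t. if p + q = i then z ^ i * (x p * y q) else 0)"
        by (rule sum.cong) (use True in auto)
      then show ?thesis using True by (simp add: sum.delta)
    next
      case False
      then obtain j where j: "p + q = j + t" by (metis add.commute le_Suc_ex linorder_not_less)
      have jt: "j < t" using j pq by simp
      have "(\<Sum>i<t. z ^ i * (if p + q = i then x p * y q else if p + q = i + t then - (x p * y q) else 0)) =
          (\<Sum>i<t. if j = i then z ^ i * - (x p * y q) else 0)"
        by (rule sum.cong) (use j in auto)
      also have "\<dots> = z ^ j * (- 1) * (x p * y q)"
        using jt by (simp add: sum.delta)
      finally have e: "(\<Sum>i<t. z ^ i * (if p + q = i then x p * y q else if p + q = i + t then - (x p * y q) else 0)) =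
        z ^ j * (- 1) * (x p * y q)" .
      have "[z ^ j * z ^ t * (x p * y q) = z ^ j * (- 1) * (x p * y q)] (mod M)"
        by (intro cong_mult cong_refl assms)
      then show ?thesis unfolding e unfolding j power_add by (rule cong_sym)
    qed
  qed
qed

lemma degree_negc:
  assumes "\<And>p. p < t \<Longrightarrow> degree (x p) < m" "\<And>p. p < t \<Longrightarrow> degree (y p) < m"
  shows "degree (negc t x y i) \<le> 2 * m - 2"
proof -
  have d: "degree (x p * y q) \<le> 2 * m - 2" if "p < t" "q < t" for p q
    using degree_mult_le[of "x p" "y q"] assms(1)[OF that(1)] assms(2)[OF that(2)] by linarith
  show ?thesis
    unfolding negc_def by (intro degree_sum_le) (auto simp: d)
qed

lemma degree_mu: "0 < w \<Longrightarrow> degree (mu w :: 'k::field poly) = w"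
  by (simp add: mu_def degree_add_eq_left degree_monom_eq)

lemma cong_mu_eq:
  fixes p q :: "'k::field poly"
  assumes "[p = q] (mod mu w)" "degree p < w" "degree q < w"
  shows "p = q"
proof (rule ccontr)
  assume "p \<noteq> q"
  moreover have "mu w dvd p - q" using assms(1) by (simp add: cong_iff_dvd_diff)
  ultimately have "degree (mu w :: 'k poly) \<le> degree (p - q)"
    by (intro dvd_imp_degree_le) auto
  moreover have "degree (p - q) < w" using assms(2,3) by (rule degree_diff_less)
  ultimately show False using assms(2) degree_mu[of w, where 'k = 'k] by simp
qed

lemma pol_rows: "pol f a (t * m) = (\<Sum>l<t. xp (m * l) * pol f (a + l * m) m)"
proof (induction t)
  case (Suc t)
  have "pol f a (Suc t * m) = pol f a (t * m) + xp (m * t) * pol f (a + t * m) m"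
    using pol_append[of f a "t * m" m] by (simp add: add.commute mult.commute[of m t])
  then show ?case by (simp add: Suc.IH)
qed simp

text \<open>The three facts behind Schoenhage's method. The odd powers of \<open>X^v\<close> are
  \<open>t\<close>-th roots of -1 modulo \<open>X^w + 1\<close>, so transforms multiply pointwise;
  \<open>X^m\<close> is such a root modulo \<open>X^(t m) + 1\<close>, so the row products recombine
  to the wanted product; and rows of width \<open>w = 2 m\<close> are wide enough to determine the
  row products.\<close>

lemma transform_product:
  fixes X Y D :: "nat \<Rightarrow> 'k::field poly"
  assumes w: "w = 2 * m" "w = t * v" and m: "0 < m"
    and X: "\<And>l. l < t \<Longrightarrow> degree (X l) < m" and Y: "\<And>l. l < t \<Longrightarrow> degree (Y l) < m"
  shows "[(\<Sum>l<t. xp ((2 * g + 1) * v * l) * negc t X Y l) =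
      (\<Sum>l<t. xp ((2 * g + 1) * v * l) * X l) * (\<Sum>l<t. xp ((2 * g + 1) * v * l) * Y l)] (mod mu w)"
    and "[(\<Sum>l<t. xp (m * l) * negc t X Y l) = (\<Sum>l<t. xp (m * l) * X l) * (\<Sum>l<t. xp (m * l) * Y l)] (mod mu (t * m))"
    and "degree (negc t X Y l) < w"
proof -
  have "[xp ((2 * g + 1) * v) ^ t = (- 1 :: 'k poly)] (mod mu w)"
  proof -
    have "(2 * g + 1) * v * t = w * (2 * g + 1)" by (simp add: w(2) algebra_simps)
    then show ?thesis using xp_w_mult_cong[of w "2 * g + 1"] by (simp flip: xp_mult)
  qed
  from negc_cong[OF this, of X Y] show "[(\<Sum>l<t. xp ((2 * g + 1) * v * l) * negc t X Y l) =
      (\<Sum>l<t. xp ((2 * g + 1) * v * l) * X l) * (\<Sum>l<t. xp ((2 * g + 1) * v * l) * Y l)] (mod mu w)"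
    by (simp only: xp_mult)
  have "[xp m ^ t = (- 1 :: 'k poly)] (mod mu (t * m))"
    using xp_w_mult_cong[of "t * m" 1] by (simp add: mult_ac flip: xp_mult)
  from negc_cong[OF this, of X Y]
  show "[(\<Sum>l<t. xp (m * l) * negc t X Y l) = (\<Sum>l<t. xp (m * l) * X l) * (\<Sum>l<t. xp (m * l) * Y l)] (mod mu (t * m))"
    by (simp only: xp_mult)
  show "degree (negc t X Y l) < w"
    using degree_negc[of t X m Y l, OF X Y] m w by simp
qed

section \<open>Padding rows before the transform and recombining them after it\<close>

definition lift :: com where
  "lift = Instrs (mov 29 21 @ mov 31 20 @ [IAdd 35 31 25]) ;;
    While 31 35 (arr op_copy 29 31 31 24 ;; Instrs [IAdd 29 29 24, IAdd 31 31 24] ;;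
      arr op_zero 29 29 29 24 ;; Instrs [IAdd 29 29 24])"

lemma wr_lift [simp]: "wr lift = {29, 31, 35, 60, 61, 62, 63, 64, 99}"
  by (auto simp: lift_def)

text \<open>The zero upper halves make room for products of row polynomials, whose degree is below
  \<open>2 m\<close>; reduction modulo \<open>X^(2 m) + 1\<close> then loses nothing.\<close>

lemma lift_spec:
  fixes f :: "nat \<Rightarrow> 'k::field"
  assumes regs: "i 20 = cur" "i 21 = oth" "i 24 = m" "i 25 = K * m" and m: "0 < m"
    and disj: "cur + K * m \<le> oth \<or> oth + 2 * (K * m) \<le> cur"
  shows "wp lift (\<lambda>i' f' t'.
    (\<forall>r<K. pol f' (oth + r * (2 * m)) (2 * m) = pol f (cur + r * m) m) \<and>
    (\<forall>y. y < oth \<or> oth + 2 * (K * m) \<le> y \<longrightarrow> f' y = f y) \<and> t' \<le> t + 60 * (K * m) + 10) i f t"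
proof -
  define body where "body = arr op_copy 29 31 31 24 ;; Instrs [IAdd 29 29 24, IAdd 31 31 24] ;;
      arr op_zero 29 29 29 24 ;; Instrs [IAdd 29 29 24]"
  define I where "I = (\<lambda>k i' f' t'. i' 29 = oth + k * (2 * m) \<and> i' (31::nat) = cur + k * m \<and>
    (\<forall>r<k. pol f' (oth + r * (2 * m)) (2 * m) = pol f (cur + r * m) m) \<and>
    (\<forall>y. y < oth \<or> oth + 2 * (K * m) \<le> y \<longrightarrow> f' y = f y) \<and> t' \<le> t + 6 + 60 * (k * m))"
  have "wp (While 31 35 body) (\<lambda>i' f' t'.
    (\<forall>r<K. pol f' (oth + r * (2 * m)) (2 * m) = pol f (cur + r * m) m) \<and>
    (\<forall>y. y < oth \<or> oth + 2 * (K * m) \<le> y \<longrightarrow> f' y = f y) \<and> t' \<le> t + 60 * (K * m) + 10)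
    (i(29 := oth, 31 := cur, 35 := cur + K * m)) f (Suc (Suc (Suc (Suc (Suc t)))))"
  proof (rule wp_while[where n = K and I = I], goal_cases)
    case 1
    then show ?case by (simp add: I_def)
  next
    case (2 k i1 f1 t1)
    have I: "I k i1 f1 t1" by (rule 2(2))
    have r: "i1 24 = m" "i1 35 = cur + K * m"
      using 2(3)[of 24] 2(3)[of 35] regs by (simp_all add: body_def)
    have k: "k * m + m \<le> K * m" using 2(1) mult_le_mono1[of "Suc k" K m] by simp
    note p = I[unfolded I_def]
    have "wp body (\<lambda>i f t. I (Suc k) i f (Suc t)) i1 f1 (Suc t1)"
      unfolding body_def wp_Seq
    proof (rule wp_conseq[OF arr_specs(1)[OF _ _ _ _ _ _ refl]], goal_cases)
      case (7 i2 f2 t2)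
      have r2: "i2 24 = m" "i2 29 = oth + k * (2 * m)" "i2 31 = cur + k * m"
        using 7(2) p r by simp_all
      show ?case
        unfolding wp_prims wp_Nil
      proof (rule wp_conseq[OF arr_specs(2)[OF _ _ _ _ _ _ refl]], goal_cases)
        case (7 i3 f3 t3)
        note q = 7 \<open>f2 = _ \<and> _\<close>
        have f2: "f2 = upd_arr f1 (oth + k * (2 * m)) m (\<lambda>j. f1 (cur + k * m + j))"
          using q(3) p r by simp
        have f3: "f3 = upd_arr f2 (oth + k * (2 * m) + m) m (\<lambda>j. 0)"
          using q(1) r2 by simp
        have out: "f3 y = f1 y" if "y < oth + k * (2 * m) \<or> oth + Suc k * (2 * m) \<le> y" for y
          unfolding f3 f2 using that by (auto simp: upd_arr_outside)
        have new: "pol f3 (oth + k * (2 * m)) (2 * m) = pol f (cur + k * m) m"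
        proof -
          have "pol f3 (oth + k * (2 * m)) (m + m) = pol f1 (cur + k * m) m"
            unfolding pol_append f3 f2 by (simp add: pol_upd_ops pol_upd_outside)
          also have "\<dots> = pol f (cur + k * m) m"
            by (rule pol_cong) (use p k disj in auto)
          finally show ?thesis by (simp add: mult_2)
        qed
        have old: "pol f3 (oth + r * (2 * m)) (2 * m) = pol f (cur + r * m) m" if "r < k" for r
        proof -
          have "pol f3 (oth + r * (2 * m)) (2 * m) = pol f1 (oth + r * (2 * m)) (2 * m)"
            by (rule pol_cong, rule out) (use mult_le_mono1[of "Suc r" k "2 * m"] that in simp)
          then show ?thesis using p that by simp
        qed
        show ?case
          unfolding wp_prims wp_Nil I_def
        proof (intro conjI allI impI)
          fix r assume "r < Suc k"
          then show "pol f3 (oth + r * (2 * m)) (2 * m) = pol f (cur + r * m) m"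
            using new old less_Suc_eq by metis
        next
          fix y assume y: "y < oth \<or> oth + 2 * (K * m) \<le> y"
          have "f3 y = f1 y" by (rule out) (use y k in auto)
          then show "f3 y = f y" using p y by simp
        next
          show "Suc (Suc t3) \<le> t + 6 + 60 * (Suc k * m)"
            using q p r r2 m by simp
        qed (use q r2 in simp_all)
      qed simp_all
    qed (use p r k disj in auto)
    then show ?case using p r m 2(1) by simp
  next
    case (3 i1 f1 t1)
    have "i1 35 = cur + K * m"
      using 3(2)[of 35] regs by (simp add: body_def)
    then show ?case using 3(1) by (simp add: I_def)
  qed
  then show ?thesis
    unfolding lift_def using regs by (simp add: body_def)
qed

definition unlift :: com where
  "unlift = Instrs (mov 29 21 @ mov 31 20 @ [IAdd 35 29 25]) ;;
    While 29 35 (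
      Instrs [IAdd 32 31 38, ISub 32 32 24, IAdd 36 29 44] ;;
      arr op_sub 29 31 32 24 ;;
      Instrs [IAdd 29 29 24, IAdd 32 31 24, IAdd 31 31 23] ;;
      While 29 36 (arr op_add 29 31 32 24 ;; Instrs [IAdd 29 29 24, IAdd 31 31 23, IAdd 32 32 23]))"

lemma wr_unlift [simp]: "wr unlift = {29, 31, 32, 35, 36, 60, 61, 62, 63, 64, 99}"
  by (auto simp: unlift_def)

text \<open>The upper half of row \<open>j\<close> carries an additional \<open>X^m\<close> and so
  belongs to row \<open>j + 1\<close>. That of the last row passes \<open>X^(t m)\<close> and
  returns to row 0 with a minus sign.\<close>

lemma unlift_cong:
  fixes D :: "nat \<Rightarrow> 'k::field poly"
  assumes D: "\<And>j. j < t \<Longrightarrow> D j = L j + xp m * H j" and t: "0 < t"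
    and Z: "Z = (\<Sum>j<t. xp (m * j) * (if j = 0 then L 0 - H (t - 1) else L j + H (j - 1)))"
  shows "[Z = (\<Sum>j<t. xp (m * j) * D j)] (mod mu (t * m))"
proof (rule cong_mu_I[of _ _ _ "- H (t - 1)"])
  obtain s where s: "t = Suc s" using t by (cases t) auto
  have "Z = xp 0 * (L 0 - H s) + (\<Sum>j<s. xp (m * Suc j) * (L (Suc j) + H j))"
    unfolding Z s sum.lessThan_Suc_shift by simp
  also have "\<dots> = (L 0 + (\<Sum>j<s. xp (m * Suc j) * L (Suc j))) + (\<Sum>j<s. xp (m * Suc j) * H j) - H s"
    by (simp add: distrib_left sum.distrib)
  finally have 1: "Z = (L 0 + (\<Sum>j<s. xp (m * Suc j) * L (Suc j))) + (\<Sum>j<s. xp (m * Suc j) * H j) - H s" .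
  have "(\<Sum>j<t. xp (m * j) * D j) = (\<Sum>j<t. xp (m * j) * L j + xp (m * Suc j) * H j)"
    by (rule sum.cong) (auto simp: D distrib_left xp_add mult_ac)
  also have "\<dots> = (\<Sum>j<t. xp (m * j) * L j) + (\<Sum>j<t. xp (m * Suc j) * H j)"
    by (rule sum.distrib)
  also have "(\<Sum>j<t. xp (m * j) * L j) = L 0 + (\<Sum>j<s. xp (m * Suc j) * L (Suc j))"
    unfolding s sum.lessThan_Suc_shift by simp
  also have "(\<Sum>j<t. xp (m * Suc j) * H j) = (\<Sum>j<s. xp (m * Suc j) * H j) + xp (t * m) * H s"
    unfolding s sum.lessThan_Suc by (simp add: mult.commute)
  finally have 2: "(\<Sum>j<t. xp (m * j) * D j) = L 0 + (\<Sum>j<s. xp (m * Suc j) * L (Suc j)) +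
    ((\<Sum>j<s. xp (m * Suc j) * H j) + xp (t * m) * H s)" .
  show "Z = (\<Sum>j<t. xp (m * j) * D j) + mu (t * m) * - H (t - 1)"
    unfolding 1 2 by (simp add: s mu_def algebra_simps)
qed

lemma unlift_spec:
  fixes f :: "nat \<Rightarrow> 'k::field"
  assumes regs: "i 20 = cur" "i 21 = oth" "i 23 = 2 * m" "i 24 = m" "i 25 = B * (t * m)"
      "i 38 = 2 * (t * m)" "i 44 = t * m"
    and m: "0 < m" "0 < t"
    and disj: "cur + 2 * (B * (t * m)) \<le> oth \<or> oth + B * (t * m) \<le> cur"
  shows "wp unlift (\<lambda>i' f' t'.
    (\<forall>b<B. [pol f' (oth + b * (t * m)) (t * m) =
      (\<Sum>j<t. xp (m * j) * pol f (cur + (b * t + j) * (2 * m)) (2 * m))] (mod mu (t * m))) \<and>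
    (\<forall>y. y < oth \<or> oth + B * (t * m) \<le> y \<longrightarrow> f' y = f y) \<and> t' \<le> T0 + 60 * (B * (t * m)) + 10) i f T0"
proof -
  define n where "n = t * m"
  define inner where "inner = arr op_add 29 31 32 24 ;; Instrs [IAdd 29 29 24, IAdd 31 31 23, IAdd 32 32 23]"
  define body where "body = Instrs [IAdd 32 31 38, ISub 32 32 24, IAdd 36 29 44] ;;
      arr op_sub 29 31 32 24 ;;
      Instrs [IAdd 29 29 24, IAdd 32 31 24, IAdd 31 31 23] ;; While 29 36 inner"
  have wri [simp]: "wr inner = {29, 31, 32, 60, 61, 62, 63, 64, 99}" by (auto simp: inner_def)
  have wrb [simp]: "wr body = {29, 31, 32, 36, 60, 61, 62, 63, 64, 99}" by (auto simp: body_def)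
  have nm: "m \<le> n" using m by (simp add: n_def)
  define L where "L = (\<lambda>b j. pol f (cur + (b * t + j) * (2 * m)) m)"
  define H where "H = (\<lambda>b j. pol f (cur + (b * t + j) * (2 * m) + m) m)"
  define piece where "piece = (\<lambda>b j. if j = 0 then L b 0 - H b (t - 1) else L b j + H b (j - 1))"
  have row: "(b * t + j) * (2 * m) + 2 * m \<le> 2 * (B * n)" if "b < B" "j < t" for b j
  proof -
    have "b * t + j < 1 * B * t" using index_bound[of 0 1 b B j t] that by simp
    then have "Suc (b * t + j) * (2 * m) \<le> (B * t) * (2 * m)" by (intro mult_le_mono1) simp
    then show ?thesis by (simp add: n_def)
  qed
  define I where "I = (\<lambda>b i' f' t'. i' 29 = oth + b * n \<and> i' (31::nat) = cur + b * (2 * n) \<and>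
    (\<forall>b'<b. pol f' (oth + b' * n) n = (\<Sum>j<t. xp (m * j) * piece b' j)) \<and>
    (\<forall>y. y < oth \<or> oth + B * n \<le> y \<longrightarrow> f' y = f y) \<and> t' \<le> T0 + 6 + 60 * (b * n))"
  have W: "wp (While 29 35 body) (\<lambda>i' f' t'.
    (\<forall>b<B. pol f' (oth + b * n) n = (\<Sum>j<t. xp (m * j) * piece b j)) \<and>
    (\<forall>y. y < oth \<or> oth + B * n \<le> y \<longrightarrow> f' y = f y) \<and> t' \<le> T0 + 60 * (B * n) + 10)
    (i(29 := oth, 31 := cur, 35 := oth + B * n)) f (Suc (Suc (Suc (Suc (Suc T0)))))"
  proof (rule wp_while[where n = B and I = I], goal_cases)
    case 1
    then show ?case by (simp add: I_def)
  next
    case (2 b i1 f1 t1)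
    note p = 2(2)[unfolded I_def]
    have r: "i1 24 = m" "i1 35 = oth + B * n" "i1 23 = 2 * m" "i1 38 = 2 * n" "i1 44 = n"
      using 2(3)[of 24] 2(3)[of 35] 2(3)[of 23] 2(3)[of 38] 2(3)[of 44] regs by (simp_all add: n_def)
    have b: "b * n + n \<le> B * n" using 2(1) mult_le_mono1[of "Suc b" B n] by simp
    have out_cur: "f1 y = f y" if "cur \<le> y" "y < cur + 2 * (B * n)" for y
      using p that disj by (auto simp: n_def)
    define a where "a = oth + b * n"
    define c where "c = cur + b * (2 * n)"
    have crow: "cur + (b * t + j) * (2 * m) = c + j * (2 * m)" for j
      by (simp add: c_def n_def algebra_simps)
    have crow2: "c + j * (2 * m) + 2 * m \<le> cur + 2 * (B * n)" "cur \<le> c" if "j < t" for j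
      using row[OF 2(1) that] crow[of j] by (auto simp: c_def)
    have ca: "c + 2 * n \<le> oth \<or> oth + B * n \<le> c"
      using disj b by (auto simp: c_def n_def)
    have LH: "L b j = pol f1 (c + j * (2 * m)) m" "H b j = pol f1 (c + j * (2 * m) + m) m" if "j < t" for j
      unfolding L_def H_def crow
      by (rule pol_cong; use crow2[OF that] out_cur in force)+
    \<comment> \<open>Piece 0, the only one with a subtraction, is finished before the inner loop;
      after \<open>k\<close> rounds \<open>Suc k\<close> pieces are done.\<close>
    define J where "J = (\<lambda>k i' f' t'. i' (29::nat) = a + Suc k * m \<and> i' 31 = c + Suc k * (2 * m) \<and>
      i' 32 = c + m + k * (2 * m) \<and> (\<forall>j<Suc k. pol f' (a + j * m) m = piece b j) \<and>
      (\<forall>y. y < a \<or> a + n \<le> y \<longrightarrow> f' y = f1 y) \<and> t' \<le> t1 + 22 + 28 * (Suc k * m))"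
    have inner: "wp (While 29 36 inner) (\<lambda>i f t. I (Suc b) i f (Suc t)) i2 f2 t2"
      if "J 0 i2 f2 t2" and r2: "i2 24 = m" "i2 23 = 2 * m" "i2 36 = a + n" for i2 f2 t2
    proof (rule wp_while[where n = "t - 1" and I = J], goal_cases)
      case 1
      show ?case by (rule that)
    next
      case (2 k i3 f3 t3)
      note q = 2(2)[unfolded J_def]
      have r3: "i3 24 = m" "i3 23 = 2 * m" "i3 36 = a + n"
        using 2(3)[of 24] 2(3)[of 23] 2(3)[of 36] r2 by simp_all
      have kt: "Suc k < t" using 2(1) by simp
      have k: "Suc k * m + m \<le> n" unfolding n_def using kt mult_le_mono1[of "Suc (Suc k)" t m] by simp
      have an: "a + n \<le> oth + B * n" "oth \<le> a" using b by (auto simp: a_def)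
      have ck: "c + Suc k * (2 * m) + 2 * m \<le> c + 2 * n"
        using mult_le_mono1[of "Suc (Suc k)" t "2 * m"] kt by (simp add: n_def)
      have "wp inner (\<lambda>i f t. J (Suc k) i f (Suc t)) i3 f3 (Suc t3)"
        unfolding inner_def wp_Seq
      proof (rule wp_conseq[OF arr_specs(3)[OF _ _ _ _ _ _ refl]], goal_cases)
        case (7 i4 f4 t4)
        have f4: "f4 = upd_arr f3 (a + Suc k * m) m (\<lambda>x. f3 (c + Suc k * (2 * m) + x) + f3 (c + m + k * (2 * m) + x))"
          using 7(1) q r3 by simp
        have i4: "i4 29 = a + Suc k * m" "i4 31 = c + Suc k * (2 * m)" "i4 32 = c + m + k * (2 * m)"
          "i4 24 = m" "i4 23 = 2 * m" using 7(2) q r3 by simp_all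
        have same: "pol f3 (c + Suc k * (2 * m)) m = L b (Suc k)"
          "pol f3 (c + m + k * (2 * m)) m = H b k"
        proof -
          have "pol f3 (c + Suc k * (2 * m)) m = pol f1 (c + Suc k * (2 * m)) m"
            by (rule pol_cong) (use q ca an ck in auto)
          then show "pol f3 (c + Suc k * (2 * m)) m = L b (Suc k)" using LH kt by simp
          have "pol f3 (c + m + k * (2 * m)) m = pol f1 (c + m + k * (2 * m)) m"
            by (rule pol_cong) (use q ca an ck in auto)
          then show "pol f3 (c + m + k * (2 * m)) m = H b k" using LH(2)[of k] kt by (simp add: add_ac)
        qed
        have new: "pol f4 (a + Suc k * m) m = piece b (Suc k)"
          unfolding f4 by (simp only: pol_upd_ops same) (simp add: piece_def)
        have old: "pol f4 (a + j * m) m = piece b j" if "j < Suc k" for j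
        proof -
          have "pol f4 (a + j * m) m = pol f3 (a + j * m) m"
            unfolding f4 by (rule pol_upd_outside) (use mult_le_mono1[of "Suc j" "Suc k" m] that in simp)
          then show ?thesis using q that by simp
        qed
        show ?case
          unfolding wp_prims wp_Nil J_def
        proof (intro conjI allI impI)
          fix j assume "j < Suc (Suc k)"
          then show "pol f4 (a + j * m) m = piece b j"
            using new old less_Suc_eq by metis
        next
          fix y assume y: "y < a \<or> a + n \<le> y"
          have "f4 y = f3 y" unfolding f4 by (rule upd_arr_outside) (use y k in auto)
          then show "f4 y = f1 y" using q y by simp
        next
          show "Suc (Suc (Suc (Suc t4))) \<le> t1 + 22 + 28 * (Suc (Suc k) * m)"
            using 7(1) q r3 m by simp
        qed (use i4 in \<open>simp_all add: algebra_simps\<close>)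
      qed (use q r3 k ca an ck in auto)
      then show ?case using q r3 k m by simp
    next
      case (3 i3 f3 t3)
      note q = 3(1)[unfolded J_def]
      have st: "Suc (t - 1) = t" using m by simp
      have r3: "i3 36 = a + n" using 3(2)[of 36] r2 by simp
      have "pol f3 (oth + b' * n) n = (\<Sum>j<t. xp (m * j) * piece b' j)" if "b' < Suc b" for b'
      proof (cases "b' = b")
        case True
        then show ?thesis
          using q pol_rows[of f3 a t m] unfolding st by (simp add: a_def n_def)
      next
        case False
        then have "b' < b" using that by simp
        then have "pol f3 (oth + b' * n) n = pol f1 (oth + b' * n) n"
          by (intro pol_cong) (use q mult_le_mono1[of "Suc b'" b n] in \<open>auto simp: a_def\<close>)
        then show ?thesis using p \<open>b' < b\<close> by simp
      qed
      moreover have "f3 y = f y" if "y < oth \<or> oth + B * n \<le> y" for y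
        using p q that b by (auto simp: a_def)
      moreover have "Suc (Suc t3) \<le> T0 + 6 + 60 * (Suc b * n)"
      proof -
        have "t3 \<le> t1 + 22 + 28 * (Suc (t - 1) * m)" "t1 \<le> T0 + 6 + 60 * (b * n)" using p q by blast+
        moreover have "Suc (t - 1) * m = n" by (simp only: st n_def)
        moreover have "Suc b * n = b * n + n" by simp
        ultimately show ?thesis using nm m by linarith
      qed
      ultimately show ?case
        using q r3 unfolding st I_def by (auto simp: a_def c_def n_def algebra_simps)
    qed
    \<comment> \<open>The upper half of the last row is the last \<open>m\<close> cells of the
      block, an address reached without multiplication.\<close>
    have t1m: "(t - 1) * (2 * m) + m = 2 * n - m"
      using m by (cases t) (auto simp: n_def)
    have "wp body (\<lambda>i f t. I (Suc b) i f (Suc t)) i1 f1 (Suc t1)"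
      unfolding body_def wp_Seq wp_prims wp_Nil
    proof (rule wp_conseq[OF arr_specs(4)[OF _ _ _ _ _ _ refl]], goal_cases)
      case (7 i2 f2 t2)
      have f2: "f2 = upd_arr f1 a m (\<lambda>x. f1 (c + x) - f1 (c + (2 * n - m) + x))"
        using 7(1) p r nm by (simp add: a_def c_def)
      have i2: "i2 29 = a" "i2 31 = c" "i2 36 = a + n" "i2 24 = m" "i2 23 = 2 * m"
        using 7(2) p r by (simp_all add: a_def c_def)
      have out2: "f2 y = f1 y" if "y < a \<or> a + n \<le> y" for y
        unfolding f2 by (rule upd_arr_outside) (use that nm in linarith)
      have t2: "t2 \<le> t1 + 4 + 12 * m + 10" using 7(1) r by simp
      have "pol f2 a m = piece b 0"
      proof -
        have e: "c + (2 * n - m) = c + (t - 1) * (2 * m) + m" unfolding t1m[symmetric] by simp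
        show ?thesis
          unfolding f2 pol_upd_ops e using LH(1)[of 0] LH(2)[of "t - 1"] m by (simp add: piece_def)
      qed
      then show ?case
        unfolding wp_prims wp_Nil
        by (intro inner) (use i2 t2 out2 in \<open>auto simp: J_def\<close>)
    qed (use p r b nm ca in \<open>auto simp: a_def c_def\<close>)
    then show ?case using p r b nm m 2(1) by simp
  next
    case (3 i1 f1 t1)
    have "i1 35 = oth + B * n"
      using 3(2)[of 35] regs by simp
    then show ?case using 3(1) by (simp add: I_def)
  qed
  have fin: "[Z = (\<Sum>j<t. xp (m * j) * pol f (cur + (b * t + j) * (2 * m)) (2 * m))] (mod mu n)"
    if "Z = (\<Sum>j<t. xp (m * j) * piece b j)" for b Z
    unfolding n_def
  proof (rule unlift_cong[OF _ m(2)])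
    show "pol f (cur + (b * t + j) * (2 * m)) (2 * m) = L b j + xp m * H b j" for j
      using pol_append[of f "cur + (b * t + j) * (2 * m)" m m] by (simp add: L_def H_def mult_2)
    show "Z = (\<Sum>j<t. xp (m * j) * (if j = 0 then L b 0 - H b (t - 1) else L b j + H b (j - 1)))"
      using that by (simp add: piece_def)
  qed
  have "wp unlift (\<lambda>i' f' t'.
    (\<forall>b<B. pol f' (oth + b * n) n = (\<Sum>j<t. xp (m * j) * piece b j)) \<and>
    (\<forall>y. y < oth \<or> oth + B * n \<le> y \<longrightarrow> f' y = f y) \<and> t' \<le> T0 + 60 * (B * n) + 10) i f T0"
    unfolding unlift_def using W regs by (simp add: body_def inner_def n_def)
  then show ?thesis
    unfolding n_def[symmetric] by (rule wp_conseq) (use fin in auto)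
qed

section \<open>Schoolbook products for the smallest sizes\<close>

definition base_row :: com where
  "base_row = arr op_scale 30 30 32 22 ;;
    Instrs [ISub 45 22 34, IAdd 46 29 34, IAdd 47 30 45] ;;
    arr op_add 46 46 30 45 ;; arr op_sub 29 29 47 34 ;; Instrs (inc 34 @ inc 59)"

text \<open>The product is stored in both slots of its pair. The number of blocks is therefore
  unchanged, and the inverse levels run on the same geometry as the forward ones.\<close>

definition base_mult :: com where
  "base_mult = Instrs (mov 29 21 @ mov 31 20 @ [IAdd 35 31 43, IAdd 30 29 22]) ;;
    While 31 35 (
      Instrs [IAdd 32 31 22] ;; arr op_zero 29 29 29 22 ;; Instrs (mov 59 31 @ [IConst 34 0]) ;;
      While 34 22 base_row ;;
      arr op_copy 30 29 29 22 ;;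
      Instrs [IAdd 29 30 22, IAdd 30 29 22, IAdd 31 32 22])"

lemma wr_base [simp]:
  "wr base_row = {34, 45, 46, 47, 59, 60, 61, 62, 63, 64, 99}"
  "wr base_mult = {29, 30, 31, 32, 34, 35, 45, 46, 47, 59, 60, 61, 62, 63, 64, 99}"
  by (auto simp: base_mult_def base_row_def)

text \<open>One row of the schoolbook scheme: the scaled factor is parked in the cells after the
  accumulator and added from there, rotated by \<open>p\<close> with the sign of the wrap.\<close>

lemma base_row_pol:
  fixes f1 :: "nat \<Rightarrow> 'k::field"
  assumes n: "n = p + e"
    and f2: "f2 = upd_arr f1 (a + n) n (\<lambda>k. x * f1 (y + k))"
    and f3: "f3 = upd_arr f2 (a + p) e (\<lambda>k. f2 (a + p + k) + f2 (a + n + k))"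
    and f4: "f4 = upd_arr f3 a p (\<lambda>k. f3 (a + k) - f3 (a + n + e + k))"
  shows "[pol f4 a n = pol f1 a n + xp p * smult x (pol f1 y n)] (mod mu n)"
    and "\<And>z. z < a \<or> a + 2 * n \<le> z \<Longrightarrow> f4 z = f1 z"
proof -
  have T: "pol f2 (a + n) n = smult x (pol f1 y n)"
    by (simp add: f2 pol_upd_ops)
  have Ts: "pol f2 (a + n) n = pol f2 (a + n) e + xp e * pol f2 (a + n + e) p"
    by (rule rotate_split) (simp add: n)
  have A: "pol f1 a n = pol f1 a p + xp p * pol f1 (a + p) e"
    by (rule rotate_split[OF n])
  have N: "pol f4 a n = pol f4 a p + xp p * pol f4 (a + p) e"
    by (rule rotate_split[OF n])
  have 1: "pol f4 (a + p) e = pol f1 (a + p) e + pol f2 (a + n) e"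
  proof -
    have "pol f4 (a + p) e = pol f3 (a + p) e"
      unfolding f4 by (rule pol_upd_outside) simp
    also have "\<dots> = pol f2 (a + p) e + pol f2 (a + n) e"
      unfolding f3 pol_upd_ops ..
    also have "pol f2 (a + p) e = pol f1 (a + p) e"
      unfolding f2 by (rule pol_upd_outside) (simp add: n)
    finally show ?thesis .
  qed
  have 2: "pol f4 a p = pol f1 a p - pol f2 (a + n + e) p"
  proof -
    have "pol f4 a p = pol f3 a p - pol f3 (a + n + e) p"
      unfolding f4 pol_upd_ops ..
    also have "pol f3 a p = pol f2 a p"
      unfolding f3 by (rule pol_upd_outside) simp
    also have "pol f2 a p = pol f1 a p"
      unfolding f2 by (rule pol_upd_outside) (simp add: n)
    also have "pol f3 (a + n + e) p = pol f2 (a + n + e) p"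
      unfolding f3 by (rule pol_upd_outside) (simp add: n)
    finally show ?thesis .
  qed
  have xn: "xp n = (xp p * xp e :: 'k poly)" by (simp add: n xp_add)
  show "[pol f4 a n = pol f1 a n + xp p * smult x (pol f1 y n)] (mod mu n)"
    by (rule cong_mu_I[of _ _ _ "- pol f2 (a + n + e) p"])
      (unfold N A T[symmetric] Ts 1 2 mu_def xn, simp add: algebra_simps)
  show "f4 z = f1 z" if "z < a \<or> a + 2 * n \<le> z" for z
  proof -
    have "f4 z = f3 z" unfolding f4 by (rule upd_arr_outside) (use that n in linarith)
    also have "\<dots> = f2 z" unfolding f3 by (rule upd_arr_outside) (use that n in linarith)
    also have "\<dots> = f1 z" unfolding f2 by (rule upd_arr_outside) (use that n in linarith)
    finally show ?thesis .
  qed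
qed

lemma base_row_spec:
  fixes f :: "nat \<Rightarrow> 'k::field"
  assumes r: "i 29 = a" "i 30 = a + n" "i 32 = y" "i 22 = n" "i 34 = p" "i 59 = x"
    and p: "p < n" and y: "y + n \<le> a \<or> a + 2 * n \<le> y" and x: "x < a \<or> a + 2 * n \<le> x"
  shows "wp base_row (\<lambda>i' f' t'.
      [pol f' a n = pol f a n + xp p * smult (f x) (pol f y n)] (mod mu n) \<and>
      (\<forall>z. z < a \<or> a + 2 * n \<le> z \<longrightarrow> f' z = f z) \<and>
      i' 34 = Suc p \<and> i' 59 = Suc x \<and> t' \<le> t + 24 * n + 40) i f t"
proof -
  define e where "e = n - p"
  have n: "n = p + e" using p by (simp add: e_def)
  show ?thesis
    unfolding base_row_def wp_Seq
  proof (rule wp_conseq[OF arr_specs(7)[OF _ _ _ _ _ _ refl]], goal_cases)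
    case (8 i1 f1 t1)
    have f1: "f1 = upd_arr f (a + n) n (\<lambda>k. f x * f (y + k))"
      using 8(1) r by simp
    have i1: "i1 29 = a" "i1 30 = a + n" "i1 22 = n" "i1 34 = p" "i1 59 = x"
      using 8(2) r by simp_all
    show ?case
      unfolding wp_prims wp_Nil
    proof (rule wp_conseq[OF arr_specs(3)[OF _ _ _ _ _ _ refl]], goal_cases)
      case (7 i2 f2 t2)
      have f2: "f2 = upd_arr f1 (a + p) e (\<lambda>k. f1 (a + p + k) + f1 (a + n + k))"
        using 7(1) i1 by (simp add: e_def)
      have i2: "i2 29 = a" "i2 47 = a + n + e" "i2 34 = p" "i2 59 = x"
        using 7(2) i1 by (simp_all add: e_def)
      have t2: "t2 \<le> t + 12 * n + 10 + 3 + 12 * e + 10"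
        using 7(1) 8(1) r i1 by (simp add: e_def)
      show ?case
      proof (rule wp_conseq[OF arr_specs(4)[OF _ _ _ _ _ _ refl]], goal_cases)
        case (7 i3 f3 t3)
        have f3: "f3 = upd_arr f2 a p (\<lambda>k. f2 (a + k) - f2 (a + n + e + k))"
          using 7(1) i2 by simp
        have "t3 \<le> t + 24 * n + 34" using 7(1) t2 i2 n by simp
        then show ?case
          using base_row_pol[OF n f1 f2 f3] 7(2) i2 by simp
      qed (use i2 n in simp_all)
    qed (use i1 p in simp_all)
  qed (use r x y in auto)
qed

lemma base_mult_spec:
  fixes f :: "nat \<Rightarrow> 'k::field"
  assumes regs: "i 20 = cur" "i 21 = oth" "i 22 = n" "i 43 = K * (2 * n)"
    and n: "0 < n" "n \<le> 4"
    and disj: "cur + K * (2 * n) \<le> oth \<or> oth + K * (2 * n) \<le> cur"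
  shows "wp base_mult (\<lambda>i' f' t'.
    (\<forall>k<K. [pol f' (oth + k * (2 * n)) n = pol f (cur + k * (2 * n)) n * pol f (cur + k * (2 * n) + n) n] (mod mu n) \<and>
      [pol f' (oth + k * (2 * n) + n) n = pol f (cur + k * (2 * n)) n * pol f (cur + k * (2 * n) + n) n] (mod mu n)) \<and>
    (\<forall>y. y < oth \<or> oth + K * (2 * n) \<le> y \<longrightarrow> f' y = f y) \<and> t' \<le> t + 1000 * (K * (2 * n)) + 10) i f t"
proof -
  define body where "body = Instrs [IAdd 32 31 22] ;; arr op_zero 29 29 29 22 ;; Instrs (mov 59 31 @ [IConst 34 0]) ;;
      While 34 22 base_row ;; arr op_copy 30 29 29 22 ;; Instrs [IAdd 29 30 22, IAdd 30 29 22, IAdd 31 32 22]"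
  have wrb [simp]: "wr body = {29, 30, 31, 32, 34, 45, 46, 47, 59, 60, 61, 62, 63, 64, 99}" by (auto simp: body_def)
  define P where "P = (\<lambda>k. pol f (cur + k * (2 * n)) n * pol f (cur + k * (2 * n) + n) n)"
  define I where "I = (\<lambda>k i' f' t'. i' 29 = oth + k * (2 * n) \<and> i' (30::nat) = oth + k * (2 * n) + n \<and>
    i' 31 = cur + k * (2 * n) \<and>
    (\<forall>j<k. [pol f' (oth + j * (2 * n)) n = P j] (mod mu n) \<and> [pol f' (oth + j * (2 * n) + n) n = P j] (mod mu n)) \<and>
    (\<forall>y. y < oth \<or> oth + K * (2 * n) \<le> y \<longrightarrow> f' y = f y) \<and> t' \<le> t + 7 + 1000 * (k * (2 * n)))"
  have W: "wp (While 31 35 body) (\<lambda>i' f' t'.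
    (\<forall>k<K. [pol f' (oth + k * (2 * n)) n = P k] (mod mu n) \<and> [pol f' (oth + k * (2 * n) + n) n = P k] (mod mu n)) \<and>
    (\<forall>y. y < oth \<or> oth + K * (2 * n) \<le> y \<longrightarrow> f' y = f y) \<and> t' \<le> t + 1000 * (K * (2 * n)) + 10)
    (i(29 := oth, 31 := cur, 35 := cur + K * (2 * n), 30 := oth + n)) f (Suc (Suc (Suc (Suc (Suc (Suc t))))))"
  proof (rule wp_while[where n = K and I = I], goal_cases)
    case 1
    then show ?case by (simp add: I_def)
  next
    case (2 k i1 f1 t1)
    note p = 2(2)[unfolded I_def]
    have r: "i1 22 = n" "i1 35 = cur + K * (2 * n)"
      using 2(3)[of 22] 2(3)[of 35] regs by simp_all
    have k: "k * (2 * n) + 2 * n \<le> K * (2 * n)" using 2(1) mult_le_mono1[of "Suc k" K "2 * n"] by simp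
    define a where "a = oth + k * (2 * n)"
    define c where "c = cur + k * (2 * n)"
    have ca: "c + 2 * n \<le> oth \<or> oth + K * (2 * n) \<le> c"
      using disj k by (auto simp: c_def)
    have ck: "cur \<le> c" "c + 2 * n \<le> cur + K * (2 * n)" "oth \<le> a" "a + 2 * n \<le> oth + K * (2 * n)"
      using k by (auto simp: c_def a_def)
    have fc: "f1 y = f y" if "c \<le> y" "y < c + 2 * n" for y
      using p that ca by auto
    have Pk: "P k = pol f c n * pol f (c + n) n"
      by (simp add: P_def c_def)
    have "wp body (\<lambda>i f t. I (Suc k) i f (Suc t)) i1 f1 (Suc t1)"
      unfolding body_def wp_Seq wp_prims wp_Nil
    proof (rule wp_conseq[OF arr_specs(2)[OF _ _ _ _ _ _ refl]], goal_cases)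
      case (7 i2 f2 t2)
      have f2: "f2 = upd_arr f1 a n (\<lambda>k. 0)" using 7(1) p r by (simp add: a_def)
      have i2: "i2 29 = a" "i2 30 = a + n" "i2 31 = c" "i2 32 = c + n" "i2 22 = n"
        using 7(2) p r by (simp_all add: a_def c_def)
      have t2: "t2 \<le> t1 + 2 + 12 * n + 10" using 7(1) r by simp
      show ?case
        unfolding append_Cons append_Nil wp_prims wp_Nil
      proof (rule wp_while[where n = n and I = "\<lambda>p i' f' t'. i' 34 = p \<and> i' 59 = c + p \<and>
          [pol f' a n = pol f c p * pol f (c + n) n] (mod mu n) \<and>
          (\<forall>z. z < a \<or> a + 2 * n \<le> z \<longrightarrow> f' z = f1 z) \<and> t' \<le> t2 + 3 + p * (24 * n + 42)"], goal_cases)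
        case 1
        have "pol f2 a n = 0" by (simp add: f2 pol_upd_ops)
        then show ?case using i2 by (auto simp: f2 upd_arr_outside)
      next
        case (2 q i3 f3 t3)
        have i3: "i3 29 = a" "i3 30 = a + n" "i3 32 = c + n" "i3 22 = n" "i3 34 = q" "i3 59 = c + q"
          using 2(2) 2(3)[of 29] 2(3)[of 30] 2(3)[of 32] 2(3)[of 22] i2 by simp_all
        have f3c: "f3 y = f y" if "c \<le> y" "y < c + 2 * n" for y
        proof -
          have "f3 y = f1 y" using 2(2) ca ck that by auto
          then show ?thesis using fc that by simp
        qed
        have Y: "pol f3 (c + n) n = pol f (c + n) n" by (rule pol_cong) (simp add: f3c)
        have x: "f3 (c + q) = f (c + q)" using f3c[of "c + q"] 2(1) by simp
        have "wp base_row (\<lambda>i' f' t'.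
            [pol f' a n = pol f3 a n + xp q * smult (f3 (c + q)) (pol f3 (c + n) n)] (mod mu n) \<and>
            (\<forall>z. z < a \<or> a + 2 * n \<le> z \<longrightarrow> f' z = f3 z) \<and>
            i' 34 = Suc q \<and> i' 59 = Suc (c + q) \<and> t' \<le> Suc t3 + 24 * n + 40) i3 f3 (Suc t3)"
          by (rule base_row_spec[OF i3]) (use 2(1) ca ck in auto)
        then have "wp base_row (\<lambda>i' f' t'. i' 34 = Suc q \<and> i' 59 = c + Suc q \<and>
          [pol f' a n = pol f c (Suc q) * pol f (c + n) n] (mod mu n) \<and>
          (\<forall>z. z < a \<or> a + 2 * n \<le> z \<longrightarrow> f' z = f1 z) \<and> Suc t' \<le> t2 + 3 + Suc q * (24 * n + 42)) i3 f3 (Suc t3)"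
        proof (rule wp_conseq, goal_cases)
          case (1 i4 f4 t4)
          have "[pol f3 a n + xp q * smult (f3 (c + q)) (pol f3 (c + n) n) =
            pol f c q * pol f (c + n) n + xp q * smult (f (c + q)) (pol f (c + n) n)] (mod mu n)"
            unfolding x Y by (intro cong_add cong_refl) (use 2(2) in auto)
          also have "pol f c q * pol f (c + n) n + xp q * smult (f (c + q)) (pol f (c + n) n) =
            pol f c (Suc q) * pol f (c + n) n"
            by (simp add: pol_Suc monom_xp[of "f (c + q)"] distrib_right)
          finally have "[pol f4 a n = pol f c (Suc q) * pol f (c + n) n] (mod mu n)"
            using 1(1) cong_trans by blast
          then show ?case using 1 2(2) by auto
        qed
        then show ?case using 2(1) i3 by simp
      next
        case (3 i3 f3 t3)
        have i3: "i3 29 = a" "i3 30 = a + n" "i3 32 = c + n" "i3 31 = c" "i3 22 = n"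
          using 3(2)[of 29] 3(2)[of 30] 3(2)[of 32] 3(2)[of 31] 3(2)[of 22] i2 by simp_all
        have fr3: "\<And>z. z < a \<or> a + 2 * n \<le> z \<Longrightarrow> f3 z = f1 z" using 3(1) by blast
        have t3: "t3 \<le> t2 + 3 + n * (24 * n + 42)" using 3(1) by blast
        have P3: "[pol f3 a n = P k] (mod mu n)" using 3(1) by (simp add: Pk)
        have C: "wp (arr op_copy 30 29 29 22 ;; Instrs [IAdd 29 30 22, IAdd 30 29 22, IAdd 31 32 22])
          (\<lambda>i f t. I (Suc k) i f (Suc t)) i3 f3 (Suc t3)"
          unfolding wp_Seq
        proof (rule wp_conseq[OF arr_specs(1)[OF _ _ _ _ _ _ refl]], goal_cases)
          case (7 i4 f4 t4)
          have f4: "f4 = upd_arr f3 (a + n) n (\<lambda>k. f3 (a + k))" using 7(1) i3 by simp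
          have i4: "i4 30 = a + n" "i4 32 = c + n" "i4 22 = n"
            using 7(2) i3 by simp_all
          have new: "[pol f4 a n = P k] (mod mu n)" "[pol f4 (a + n) n = P k] (mod mu n)"
            using P3 by (simp_all add: f4 pol_upd_ops pol_upd_outside)
          have out: "f4 z = f1 z" if "z < a \<or> a + 2 * n \<le> z" for z
          proof -
            have "f4 z = f3 z" unfolding f4 by (rule upd_arr_outside) (use that in linarith)
            then show ?thesis using fr3 that by simp
          qed
          have old: "[pol f4 (oth + j * (2 * n)) n = P j] (mod mu n) \<and> [pol f4 (oth + j * (2 * n) + n) n = P j] (mod mu n)"
            if "j < k" for j
          proof -
            have j: "oth + j * (2 * n) + 2 * n \<le> a"
              using mult_le_mono1[of "Suc j" k "2 * n"] that by (simp add: a_def)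
            have "pol f4 (oth + j * (2 * n)) n = pol f1 (oth + j * (2 * n)) n"
              "pol f4 (oth + j * (2 * n) + n) n = pol f1 (oth + j * (2 * n) + n) n"
              by (rule pol_cong, rule out, use j in simp)+
            then show ?thesis using p that by simp
          qed
          \<comment> \<open>Here the bound 4 on the size enters: \<open>24 * 4 + 42 = 138\<close>,
            which makes the quadratic work linear in the data.\<close>
          have n2: "n * (24 * n + 42) \<le> n * 138" using n(2) by (intro mult_le_mono2) simp
          have "t4 \<le> t3 + 12 * n + 11" using 7(1) i3 by simp
          then have "Suc (Suc (Suc (Suc t4))) \<le> t1 + 1000 * (2 * n)"
            using t3 t2 n(1) n2 by linarith
          then have tt: "Suc (Suc (Suc (Suc t4))) \<le> t + 7 + 1000 * (Suc k * (2 * n))"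
            using p by (simp add: distrib_right)
          show ?case
            unfolding wp_prims wp_Nil I_def
          proof (intro conjI allI impI)
            fix j assume "j < Suc k"
            then show "[pol f4 (oth + j * (2 * n)) n = P j] (mod mu n)"
              "[pol f4 (oth + j * (2 * n) + n) n = P j] (mod mu n)"
              using new old[of j] by (cases "j = k"; simp add: a_def)+
          next
            fix y assume y: "y < oth \<or> oth + K * (2 * n) \<le> y"
            have "f4 y = f1 y" by (rule out) (use y ck in linarith)
            then show "f4 y = f y" using p y by simp
          qed (use i4 tt in \<open>simp_all add: a_def c_def\<close>)
        qed (use i3 in auto)
        have "i3 22 \<le> i3 34" using 3(1) i3 by simp
        then show ?case
          by (intro conjI, assumption) (rule wp_conseq[OF C[unfolded wp_Seq]], simp)
      qed
    qed (use p r in auto)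
    then show ?case using p r k n 2(1) by simp
  next
    case (3 i1 f1 t1)
    have "i1 35 = cur + K * (2 * n)"
      using 3(2)[of 35] regs by simp
    then show ?case using 3(1) by (simp add: I_def)
  qed
  show ?thesis
    unfolding base_mult_def using W regs by (simp add: body_def P_def)
qed

section \<open>Sizes of the recursion levels\<close>

lemma clock_simps: "t + 3 = Suc (Suc (Suc t))" "t + 11 = Suc (Suc (Suc (Suc (Suc (Suc (Suc (Suc (Suc (Suc (Suc (t)))))))))))"
  "t + 7 = Suc (Suc (Suc (Suc (Suc (Suc (Suc (t)))))))" "t + 9 = Suc (Suc (Suc (Suc (Suc (Suc (Suc (Suc (Suc (t)))))))))"
  by simp_all

text \<open>A square root by doubling. While 41 is multiplied by 4, 44 is multiplied by 2, so 44
  ends as \<open>2^(s - s div 2)\<close>; register 24 then collects the doublings missing from there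
  to \<open>2^s\<close>.\<close>

definition find_sizes :: com where
  "find_sizes = Instrs [IConst 44 1, IConst 41 1] ;;
    While 41 22 (Instrs [IAdd 41 41 41, IAdd 41 41 41, IAdd 44 44 44]) ;;
    Instrs (IConst 24 1 # mov 41 44) ;;
    While 41 22 (Instrs [IAdd 41 41 41, IAdd 24 24 24]) ;;
    Instrs [IAdd 23 24 24]"

lemma wr_find_sizes [simp]: "wr find_sizes = {23, 24, 41, 44}"
  by (auto simp: find_sizes_def)

lemma find_sizes_spec:
  assumes "i 22 = 2 ^ s"
  shows "wp find_sizes (\<lambda>i' f' t'. i' 24 = 2 ^ (s div 2) \<and> i' 23 = 2 * 2 ^ (s div 2) \<and>
    f' = f \<and> t' \<le> t + 5 * s + 10) i f t"
proof -
  define R where "R = s - s div 2"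
  have lt1: "(2::nat) ^ (2 * k) < 2 ^ s \<longleftrightarrow> k < R" for k
    by (simp add: R_def) linarith
  have sR: "s = R + s div 2" by (simp add: R_def)
  have W2: "wp (While 41 22 (Instrs [IAdd 41 41 41, IAdd 24 24 24]) ;; Instrs [IAdd 23 24 24])
    (\<lambda>i' f' t'. i' 24 = 2 ^ (s div 2) \<and> i' 23 = 2 * 2 ^ (s div 2) \<and> f' = f \<and> t' \<le> t + 5 * s + 10) i' f t'"
    if i: "i' 22 = 2 ^ s" "i' 41 = 2 ^ R" "i' 24 = 1" "t' \<le> t + 5 * R + 6" for i' t'
    unfolding wp_Seq
  proof (rule wp_while[where n = "s div 2" and I = "\<lambda>k i' f' t'. i' 41 = 2 ^ (R + k) \<and> i' 24 = 2 ^ k \<and>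
      f' = f \<and> t' \<le> t + 5 * R + 6 + 4 * k"], goal_cases)
    case 1
    then show ?case using i by simp
  next
    case (2 k i1 f1 t1)
    have "R + k < s" using 2(1) sR by simp
    then have "(2::nat) ^ (R + k) < 2 ^ s" by simp
    then show ?case using 2(2) 2(3)[of 22] i by (simp add: power_add)
  next
    case (3 i1 f1 t1)
    have "R + s div 2 = s" using sR by simp
    then show ?case using 3(1) 3(2)[of 22] i by simp
  qed
  show ?thesis
    unfolding find_sizes_def wp_Seq wp_prims wp_Nil
  proof (rule wp_while[where n = R and I = "\<lambda>k i' f' t'. i' 41 = 2 ^ (2 * k) \<and> i' 44 = 2 ^ k \<and>
      f' = f \<and> t' \<le> t + 2 + 5 * k"], goal_cases)
    case 1
    then show ?case by simp
  next
    case (2 k i1 f1 t1)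
    then show ?case using 2(3)[of 22] assms lt1[of k] by simp
  next
    case (3 i1 f1 t1)
    have a: "i1 22 = 2 ^ s" using 3(2)[of 22] assms by simp
    have b: "\<not> (2::nat) ^ (2 * R) < 2 ^ s" using lt1[of R] by blast
    have "i1 22 \<le> i1 41" using a b 3(1) by (simp del: power_strict_increasing_iff power_increasing_iff)
    moreover have W3: "wp (While 41 22 (Instrs [IAdd 41 41 41, IAdd 24 24 24]) ;; Instrs [IAdd 23 24 24])
      (\<lambda>i' f' t'. i' 24 = 2 ^ (s div 2) \<and> i' 23 = 2 * 2 ^ (s div 2) \<and> f' = f \<and> t' \<le> t + 5 * s + 10)
      (i1(24 := Suc 0, 41 := 2 ^ R)) f (Suc (Suc (Suc (Suc t1))))"
      by (rule W2) (use a 3(1) in auto)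
    ultimately show ?case using 3(1) by simp (rule wp_conseq[OF W3[unfolded wp_Seq]], simp)
  qed
qed

text \<open>Level \<open>l\<close> of the recursion multiplies \<open>blks s l div 2\<close> pairs of polynomials modulo
  \<open>X^(2^lsz s l) + 1\<close>.\<close>

fun lsz :: "nat \<Rightarrow> nat \<Rightarrow> nat" where
  "lsz s 0 = s"
| "lsz s (Suc l) = lsz s l div 2 + 1"

definition lrad :: "nat \<Rightarrow> nat" where
  "lrad s = s - s div 2"

fun blks :: "nat \<Rightarrow> nat \<Rightarrow> nat" where
  "blks s 0 = 2"
| "blks s (Suc l) = 2 ^ lrad (lsz s l) * blks s l"

text \<open>Chosen so that \<open>w = 2^R v\<close> for the row width \<open>w\<close> and
  \<open>2^R\<close> rows, which makes \<open>X^v\<close> a \<open>2^R\<close>-th root of -1 modulo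
  \<open>X^w + 1\<close>. The value is 2 for even and 1 for odd \<open>s\<close>.\<close>

definition lv :: "nat \<Rightarrow> nat" where
  "lv s = 2 ^ (s div 2 + 1 - lrad s)"

lemma lsizes:
  "(2::nat) * 2 ^ (s div 2) = 2 ^ lrad s * lv s" "(2::nat) ^ s = 2 ^ lrad s * 2 ^ (s div 2)" "lrad s \<le> s"
proof -
  have "s div 2 + 1 = lrad s + (s div 2 + 1 - lrad s)" by (simp add: lrad_def)
  then have "(2::nat) ^ (s div 2 + 1) = 2 ^ lrad s * lv s" unfolding lv_def by (metis power_add)
  then show "(2::nat) * 2 ^ (s div 2) = 2 ^ lrad s * lv s" by simp
  have "s = lrad s + s div 2" by (simp add: lrad_def)
  then show "(2::nat) ^ s = 2 ^ lrad s * 2 ^ (s div 2)" by (metis power_add)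
qed (simp add: lrad_def)

lemma blks_power: "\<exists>\<beta>. blks s l = 2 * 2 ^ \<beta>"
  by (induction l) (auto simp flip: power_add intro: exI[of _ 0])

text \<open>Splitting preserves the amount of data; the padding of \<open>lift\<close> doubles it,
  once per level.\<close>

lemma blks_size: "blks s l * 2 ^ lsz s l = 2 ^ l * (2 * 2 ^ s)"
proof (induction l)
  case (Suc l)
  have "blks s (Suc l) * 2 ^ lsz s (Suc l) = blks s l * (2 * (2 ^ lrad (lsz s l) * 2 ^ (lsz s l div 2)))"
    by simp
  also have "\<dots> = 2 * (blks s l * 2 ^ lsz s l)"
    using lsizes(2)[of "lsz s l"] by simp
  finally show ?case using Suc by simp
qed simp

text \<open>The size map \<open>s div 2 + 1\<close> at least halves the distance to its fixed point
  2, and from 3 on this distance is at least a third of the value. The estimate compensates the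
  doubling in \<open>blks_size\<close>.\<close>

lemma lsz_bound: "3 \<le> lsz s l \<Longrightarrow> 2 ^ l * lsz s l \<le> 3 * s"
proof -
  have "2 ^ l * (lsz s l - 2) \<le> s - 2"
  proof (induction l)
    case (Suc l)
    have "2 * (lsz s (Suc l) - 2) \<le> lsz s l - 2" by simp
    then have "2 ^ l * (2 * (lsz s (Suc l) - 2)) \<le> 2 ^ l * (lsz s l - 2)"
      by (rule mult_le_mono2)
    moreover have "2 ^ Suc l * (lsz s (Suc l) - 2) = 2 ^ l * (2 * (lsz s (Suc l) - 2))"
      by (simp del: lsz.simps)
    ultimately show ?case using Suc by linarith
  qed simp
  moreover assume "3 \<le> lsz s l"
  then have "2 ^ l * lsz s l \<le> 2 ^ l * (3 * (lsz s l - 2))" by (intro mult_le_mono2) simp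
  then have "2 ^ l * lsz s l \<le> 3 * (2 ^ l * (lsz s l - 2))" by (simp only: mult.left_commute)
  ultimately show ?thesis by linarith
qed

text \<open>Since 2 is a fixed point of the size map, the recursion has to stop there, that is at
  size at most 4. The bound on \<open>2^L\<close> limits the total growth of the data.\<close>

lemma levels_exist:
  "\<exists>L. lsz s L \<le> 2 \<and> (\<forall>l<L. 3 \<le> lsz s l) \<and> L \<le> s \<and> 2 ^ L \<le> 2 * s + 1"
proof -
  have ex: "\<exists>L. lsz s L \<le> 2"
  proof (rule ccontr)
    assume "\<not> ?thesis"
    then have "3 \<le> lsz s (3 * s)" by (metis not_less_eq_eq numeral_2_eq_2 numeral_3_eq_3)
    from lsz_bound[OF this] this have "2 ^ (3 * s) * 3 \<le> 3 * s"
      using mult_le_mono2[of 3 "lsz s (3 * s)" "2 ^ (3 * s)"] by linarith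
    moreover have "3 * s < 2 ^ (3 * s)" by (rule less_exp)
    ultimately show False by linarith
  qed
  define L where "L = (LEAST L. lsz s L \<le> 2)"
  have L: "lsz s L \<le> 2" unfolding L_def by (rule LeastI_ex[OF ex])
  have less: "3 \<le> lsz s l" if "l < L" for l
    using not_less_Least[of l "\<lambda>L. lsz s L \<le> 2"] that unfolding L_def by simp
  have "L \<le> s \<and> 2 ^ L \<le> 2 * s + 1"
  proof (cases L)
    case (Suc l)
    have "3 \<le> lsz s l" by (rule less) (simp add: Suc)
    from lsz_bound[OF this] this have "2 ^ l * 3 \<le> 3 * s"
      using mult_le_mono2[of 3 "lsz s l" "2 ^ l"] by linarith
    moreover have "l < 2 ^ l" by (rule less_exp)
    ultimately show ?thesis unfolding Suc power_Suc by linarith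
  qed simp
  with L less show ?thesis by blast
qed

section \<open>One level of the recursion, downwards and upwards\<close>

definition level_rel :: "nat \<Rightarrow> nat \<Rightarrow> (nat \<Rightarrow> 'k::field poly) \<Rightarrow> (nat \<Rightarrow> 'k poly) \<Rightarrow> bool" where
  "level_rel s B A A' \<longleftrightarrow> (\<exists>X. \<forall>b<B.
     A b = (\<Sum>j<2 ^ lrad s. xp (2 ^ (s div 2) * j) * X b j) \<and>
     (\<forall>j<2 ^ lrad s. degree (X b j) < 2 ^ (s div 2)) \<and>
     (\<forall>g<2 ^ lrad s. [A' (g * B + b) = (\<Sum>j<2 ^ lrad s. xp ((2 * g + 1) * lv s * j) * X b j)]
        (mod mu (2 * 2 ^ (s div 2)))))"

definition level_fwd :: com where
  "level_fwd = find_sizes ;; Instrs (mov 25 43 @ [IAdd 43 43 43]) ;; lift ;; swap_bufs ;;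
     Instrs (mov 26 43 @ [IAdd 27 22 22] @ mov 28 23) ;; fft_fwd ;;
     Instrs ([IStore 39 26] @ inc 39 @ [IStore 39 28] @ inc 39 @ [IStore 39 22] @ inc 39 @ mov 22 23)"

lemma wr_level_fwd: "r \<in> wr level_fwd \<Longrightarrow> 20 \<le> r \<and> r \<noteq> 57 \<and> r \<noteq> 58"
  by (auto simp: level_fwd_def swap_bufs_def)

text \<open>The rows are overwritten by their transforms, so \<open>level_rel\<close> remembers them
  existentially. Their degree bound is kept as well, since it will make the decoding of the products
  unique.\<close>

lemma level_fwd_spec:
  fixes f :: "nat \<Rightarrow> 'k::field"
  assumes regs: "i 20 = cur" "i 21 = oth" "i 22 = 2 ^ s" "i 43 = B * 2 ^ s" "i 39 = sp"
    and sp: "100 \<le> sp" and s: "3 \<le> s" and B: "B = 2 * 2 ^ \<beta>"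
    and co: "cur = U \<and> oth = U + H \<or> cur = U + H \<and> oth = U" and H: "2 * (B * 2 ^ s) \<le> H"
  shows "wp level_fwd (\<lambda>i' f' t'.
    level_rel s B (\<lambda>b. pol f (cur + b * 2 ^ s) (2 ^ s)) (\<lambda>b. pol f' (i' 20 + b * 2 ^ (s div 2 + 1)) (2 ^ (s div 2 + 1))) \<and>
    (\<forall>y<U. f' y = f y) \<and> (i' 20 = U \<and> i' 21 = U + H \<or> i' 20 = U + H \<and> i' 21 = U) \<and>
    i' 22 = 2 ^ (s div 2 + 1) \<and> i' 43 = 2 * (B * 2 ^ s) \<and> i' 39 = sp + 3 \<and>
    i' sp = B * 2 ^ (s div 2 + 1) \<and> i' (sp + 1) = lv s \<and> i' (sp + 2) = 2 ^ s \<and>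
    (\<forall>r. 100 \<le> r \<and> r < sp \<longrightarrow> i' r = i r) \<and>
    t' \<le> t + 300 * (s * (B * 2 ^ s))) i f t"
proof -
  define m where "m = (2::nat) ^ (s div 2)"
  define R where "R = lrad s"
  have m: "0 < m" by (simp add: m_def)
  have s2: "(2::nat) ^ s = 2 ^ R * m" using lsizes(2)[of s] by (simp add: R_def m_def)
  have w: "2 * m = 2 ^ R * lv s" using lsizes(1)[of s] by (simp add: R_def m_def)
  have w2: "2 ^ (s div 2 + 1) = 2 * m" by (simp add: m_def)
  have KM: "B * 2 ^ s = (B * 2 ^ R) * m" by (simp add: s2)
  have Bp: "0 < B" using B by simp
  have d: "cur + 2 * (B * 2 ^ s) \<le> oth \<or> oth + 2 * (B * 2 ^ s) \<le> cur" using co H by auto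
  have tot: "2 ^ R * (B * (2 * m)) = 2 * (B * 2 ^ s)" by (simp add: s2)
  have U: "U \<le> cur" "U \<le> oth" using co by auto
  have Rs: "R \<le> s" using lsizes(3)[of s] by (simp add: R_def)
  have T1: "1 \<le> B * 2 ^ s" using Bp by simp
  define X where "X = (\<lambda>b j. pol f (cur + (b * 2 ^ R + j) * m) m)"
  define Q where "Q = (\<lambda>i' f' t'.
    level_rel s B (\<lambda>b. pol f (cur + b * 2 ^ s) (2 ^ s)) (\<lambda>b. pol f' (i' 20 + b * (2 * m)) (2 * m)) \<and>
    (\<forall>y<U. f' y = f y) \<and> (i' 20 = U \<and> i' 21 = U + H \<or> i' 20 = U + H \<and> i' 21 = U) \<and>
    i' 22 = 2 * m \<and> i' 43 = 2 * (B * 2 ^ s) \<and> i' 39 = sp + 3 \<and>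
    i' sp = B * (2 * m) \<and> i' (sp + 1) = lv s \<and> i' (sp + 2) = 2 ^ s \<and>
    (\<forall>r. 100 \<le> r \<and> r < sp \<longrightarrow> i' r = i r) \<and>
    t' \<le> t + 300 * (s * (B * 2 ^ s)))"
  \<comment> \<open>Each \<open>K\<close> names the precondition that the remaining code demands,
    which keeps the intermediate goals small.\<close>
  define K4 where "K4 = wp (Instrs ([IStore 39 26] @ inc 39 @ [IStore 39 28] @ inc 39 @ [IStore 39 22] @ inc 39 @ mov 22 23)) Q"
  define K3 where "K3 = wp (Instrs (mov 26 43 @ [IAdd 27 22 22] @ mov 28 23)) (wp fft_fwd K4)"
  define K2 where "K2 = wp swap_bufs K3"
  define K1 where "K1 = wp (Instrs (mov 25 43 @ [IAdd 43 43 43])) (wp lift K2)"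
  have "wp find_sizes K1 i f t"
  proof (rule wp_conseq[OF find_sizes_spec[of i s, OF regs(3)]], goal_cases)
    case (1 i1 f1 t1)
    have i1: "i1 24 = m" "i1 23 = 2 * m" "i1 20 = cur" "i1 21 = oth" "i1 22 = 2 ^ s" "i1 43 = B * 2 ^ s" "i1 39 = sp"
      using 1(1) 1(2) regs by (simp_all add: m_def)
    have f1: "f1 = f" and t1: "t1 \<le> t + 5 * s + 10" using 1(1) by auto
    have hi1: "i1 r = i r" if "100 \<le> r" for r using 1(2)[of r] that by simp
    have "wp lift K2 (i1(25 := B * 2 ^ s, 43 := 2 * (B * 2 ^ s))) f1 (t1 + 3)"
    proof (rule wp_conseq[OF lift_spec[where K = "B * 2 ^ R" and m = m and cur = cur and oth = oth]], goal_cases)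
      case 4
      show ?case using i1 by (simp add: KM)
    next
      case 6
      show ?case using d unfolding KM by auto
    next
      case (7 i2 f2 t2)
      have i2: "i2 24 = m" "i2 23 = 2 * m" "i2 20 = cur" "i2 21 = oth" "i2 22 = 2 ^ s"
        "i2 43 = 2 * (B * 2 ^ s)" "i2 25 = B * 2 ^ s" "i2 39 = sp"
        using 7(2) i1 by simp_all
      have hi2: "i2 r = i r" if "100 \<le> r" for r using 7(2)[of r] hi1[OF that] that by simp
      have rows: "pol f2 (oth + r * (2 * m)) (2 * m) = pol f (cur + r * m) m" if "r < B * 2 ^ R" for r
        using 7(1) that f1 by auto
      have out2: "f2 y = f y" if "y < U" for y
        using 7(1) that U f1 by auto
      have t2: "t2 \<le> t + 5 * s + 23 + 60 * (B * 2 ^ s)"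
        using 7(1) t1 unfolding KM[symmetric] by auto
      have "wp fft_fwd (\<lambda>i' f' t'.
        (\<forall>g b. g < 2 ^ R \<longrightarrow> b < B \<longrightarrow>
          [pol f' (i' 20 + (g * B + b) * (2 * m)) (2 * m) = (\<Sum>l<2 ^ R. xp ((2 * g + 1) * lv s * l) * X b l)] (mod mu (2 * m))) \<and>
        (\<forall>y. (y < cur \<or> cur + 2 ^ R * (B * (2 * m)) \<le> y) \<longrightarrow> (y < oth \<or> oth + 2 ^ R * (B * (2 * m)) \<le> y) \<longrightarrow> f' y = f2 y) \<and>
        (i' 20 = oth \<and> i' 21 = cur \<or> i' 20 = cur \<and> i' 21 = oth) \<and>
        i' 26 = B * (2 * m) \<and> i' 27 = 2 * m \<and> i' 28 = lv s \<and> t' \<le> t2 + 20 + R * (170 * (B * 2 ^ s)) + 1)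
        (i2(40 := cur, 20 := oth, 21 := cur, 26 := 2 * (B * 2 ^ s), 27 := 2 * 2 ^ s, 28 := 2 * m)) f2 (t2 + 11)" (is "wp _ ?Q _ _ _")
      proof (rule wp_conseq[OF fft_fwd_spec[where cur = oth and oth = cur and R = R and B = B and w = "2 * m" and
              v = "lv s" and X = X and \<beta> = "Suc \<beta>" and \<nu> = "s div 2 + 1 - lrad s"]], goal_cases)
        case 10
        show ?case by (rule w)
      next
        case 11
        show ?case using d[folded tot] by blast
      next
        case (12 b j)
        have "0 * B + b < 1 * B" using 12 by simp
        then have "b * 2 ^ R + j < B * 2 ^ R" using index_bound[of 0 1 b B j "2 ^ R"] 12 by simp
        then show ?case using rows by (simp add: X_def)
      next
        case (13 i' f' t')
        then show ?case using i2 by auto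
      qed (use i2 tot in \<open>simp_all add: B lv_def s2 R_def\<close>)
      then have "wp fft_fwd K4 (i2(40 := cur, 20 := oth, 21 := cur, 26 := 2 * (B * 2 ^ s), 27 := 2 * 2 ^ s, 28 := 2 * m)) f2 (t2 + 11)"
      proof (rule wp_conseq)
        fix i3 f3 t3
        assume p: "?Q i3 f3 t3" "\<And>r. r \<notin> wr fft_fwd \<Longrightarrow>
          i3 r = (i2(40 := cur, 20 := oth, 21 := cur, 26 := 2 * (B * 2 ^ s), 27 := 2 * 2 ^ s, 28 := 2 * m)) r"
        show "K4 i3 f3 t3"
        proof -
          have i3: "i3 22 = 2 ^ s" "i3 23 = 2 * m" "i3 39 = sp" "i3 43 = 2 * (B * 2 ^ s)"
            using p(2) i2 by simp_all
          have hi3: "i3 r = i r" if "100 \<le> r" for r using p(2)[of r] hi2[OF that] that by simp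
          have "level_rel s B (\<lambda>b. pol f (cur + b * 2 ^ s) (2 ^ s)) (\<lambda>b. pol f3 (i3 20 + b * (2 * m)) (2 * m))"
            unfolding level_rel_def m_def[symmetric] R_def[symmetric]
          proof (intro exI[of _ X] allI impI conjI)
            fix b
            have "pol f (cur + b * 2 ^ s) (2 ^ s) = (\<Sum>l<2 ^ R. xp (m * l) * pol f (cur + b * 2 ^ s + l * m) m)"
              unfolding s2 by (rule pol_rows)
            then show "pol f (cur + b * 2 ^ s) (2 ^ s) = (\<Sum>j<2 ^ R. xp (m * j) * X b j)"
              by (simp add: X_def s2 algebra_simps)
          next
            fix b j show "degree (X b j) < m" unfolding X_def by (rule degree_pol[OF m])
          qed (use p(1) in simp)
          moreover have "f3 y = f y" if "y < U" for y
            using p(1) that U out2 by auto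
          moreover have "t3 + 11 \<le> t + 300 * (s * (B * 2 ^ s))"
          proof -
            have "t3 \<le> t2 + 21 + R * (170 * (B * 2 ^ s))" using p(1) by simp
            moreover have "R * (170 * (B * 2 ^ s)) \<le> s * (170 * (B * 2 ^ s))" using Rs by (rule mult_le_mono1)
            moreover have "3 * (B * 2 ^ s) \<le> s * (B * 2 ^ s)" using s by (rule mult_le_mono1)
            moreover have "s * 1 \<le> s * (B * 2 ^ s)" using T1 by (rule mult_le_mono2)
            ultimately show ?thesis using t2 s T1 by linarith
          qed
          ultimately show ?thesis
            unfolding K4_def using p(1) co i3 hi3 sp by (auto simp: Q_def)
        qed
      qed
      then show ?case
        using i2 unfolding K2_def by (simp add: swap_bufs_def K3_def mult_2 clock_simps)
    qed (use i1 m in simp_all)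
    then show ?case
      using i1 unfolding K1_def by (simp add: mult_2 clock_simps)
  qed
  then show ?thesis
    unfolding K1_def K2_def K3_def K4_def Q_def level_fwd_def wp_Seq w2 .
qed

definition level_inv :: com where
  "level_inv = Instrs [IConst 99 1, ISub 39 39 99, ILoad 44 39, ISub 39 39 99, ILoad 28 39, ISub 39 39 99, ILoad 26 39] ;;
     halve 43 ;; Instrs (mov 25 43 @ mov 23 22 @ mov 27 22 @ [IAdd 38 44 44] @ mov 24 23) ;;
     fft_inv ;; halve 24 ;; unlift ;; swap_bufs ;; Instrs (mov 22 44)"

lemma wr_level_inv: "r \<in> wr level_inv \<Longrightarrow> 20 \<le> r \<and> r \<noteq> 57 \<and> r \<noteq> 58 \<and> r < 100"
  by (auto simp: level_inv_def swap_bufs_def)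

text \<open>The recursion delivers products of transforms. These are the transforms of the
  negacyclic products \<open>C\<close> of the rows, so the inverse transform yields
  \<open>C\<close>, and the overlapping addition of its rows yields the product at this
  level.\<close>

lemma level_inv_spec:
  fixes f :: "nat \<Rightarrow> 'k::field_char_0"
  assumes regs: "i 20 = cur" "i 21 = oth" "i 22 = 2 ^ (s div 2 + 1)" "i 43 = 2 * (B * 2 ^ s)" "i 39 = sp + 3"
      "i sp = B * 2 ^ (s div 2 + 1)" "i (sp + 1) = lv s" "i (sp + 2) = 2 ^ s"
    and half: "f (i 10) + f (i 10) = 1" "i 10 < U"
    and sp: "100 \<le> sp" and s: "3 \<le> s" and B: "B = 2 * 2 ^ \<beta>"
    and co: "cur = U \<and> oth = U + H \<or> cur = U + H \<and> oth = U" and H: "2 * (B * 2 ^ s) \<le> H"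
    and rel: "level_rel s B A A'"
    and Z: "\<And>b. b < 2 ^ lrad s * B \<Longrightarrow>
      [pol f (cur + b * 2 ^ (s div 2 + 1)) (2 ^ (s div 2 + 1)) = A' (2 * (b div 2)) * A' (2 * (b div 2) + 1)]
        (mod mu (2 ^ (s div 2 + 1)))"
  shows "wp level_inv (\<lambda>i' f' t'.
    (\<forall>b<B. [pol f' (i' 20 + b * 2 ^ s) (2 ^ s) = A (2 * (b div 2)) * A (2 * (b div 2) + 1)] (mod mu (2 ^ s))) \<and>
    (\<forall>y<U. f' y = f y) \<and> (i' 20 = U \<and> i' 21 = U + H \<or> i' 20 = U + H \<and> i' 21 = U) \<and>
    i' 22 = 2 ^ s \<and> i' 43 = B * 2 ^ s \<and> i' 39 = sp \<and>
    t' \<le> t + 300 * (s * (B * 2 ^ s))) i f t"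
proof -
  define m where "m = (2::nat) ^ (s div 2)"
  define R where "R = lrad s"
  define T where "T = B * 2 ^ s"
  have m: "0 < m" by (simp add: m_def)
  have s2: "(2::nat) ^ s = 2 ^ R * m" using lsizes(2)[of s] by (simp add: R_def m_def)
  have w: "2 * m = 2 ^ R * lv s" using lsizes(1)[of s] by (simp add: R_def m_def)
  have w2: "2 ^ (s div 2 + 1) = 2 * m" by (simp add: m_def)
  have Bp: "0 < B" using B by simp
  have Tk: "T = 2 ^ (Suc \<beta> + s)" by (simp add: T_def B power_add)
  have d: "cur + 2 * T \<le> oth \<or> oth + 2 * T \<le> cur" using co H by (auto simp: T_def)
  have tot: "2 ^ R * (B * (2 * m)) = 2 * T" by (simp add: s2 T_def)
  have U: "U \<le> cur" "U \<le> oth" using co by auto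
  have Rs: "R \<le> s" using lsizes(3)[of s] by (simp add: R_def)
  have T1: "1 \<le> T" using Bp by (simp add: T_def)
  obtain X where X: "\<And>b. b < B \<Longrightarrow> A b = (\<Sum>j<2 ^ R. xp (m * j) * X b j)"
    "\<And>b j. b < B \<Longrightarrow> j < 2 ^ R \<Longrightarrow> degree (X b j) < m"
    "\<And>b g. b < B \<Longrightarrow> g < 2 ^ R \<Longrightarrow>
      [A' (g * B + b) = (\<Sum>j<2 ^ R. xp ((2 * g + 1) * lv s * j) * X b j)] (mod mu (2 * m))"
    using rel unfolding level_rel_def R_def[symmetric] m_def[symmetric] by blast
  define C where "C = (\<lambda>b. negc (2 ^ R) (X (2 * (b div 2))) (X (2 * (b div 2) + 1)))"
  have pair: "2 * (b div 2) < B" "2 * (b div 2) + 1 < B" if "b < B" for b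
  proof -
    have "b div 2 < 2 ^ \<beta>" using that B by simp
    then show "2 * (b div 2) < B" "2 * (b div 2) + 1 < B" unfolding B by linarith+
  qed
  note TP = transform_product[of "2 * m" m "2 ^ R" "lv s", OF refl w m]
  have C1: "[pol f (cur + (g * B + b) * (2 * m)) (2 * m) = (\<Sum>l<2 ^ R. xp ((2 * g + 1) * lv s * l) * C b l)] (mod mu (2 * m))"
    if g: "g < 2 ^ R" and b: "b < B" for g b
  proof -
    \<comment> \<open>\<open>B\<close> is even, so the two members of a pair stay adjacent within
      every group.\<close>
    have e: "2 * ((g * B + b) div 2) = g * B + 2 * (b div 2)"
    proof -
      have "g * B + b = b + 2 * (g * 2 ^ \<beta>)" by (simp add: B)
      then have "(g * B + b) div 2 = (b + 2 * (g * 2 ^ \<beta>)) div 2" by (simp only:)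
      also have "\<dots> = b div 2 + g * 2 ^ \<beta>" by simp
      finally have "(g * B + b) div 2 = b div 2 + g * 2 ^ \<beta>" .
      then show ?thesis by (simp add: B)
    qed
    have "(g * B + b) * 1 + 0 < 2 ^ R * B * 1"
      by (rule index_bound[OF g b]) simp
    then have "[pol f (cur + (g * B + b) * (2 * m)) (2 * m) =
        A' (g * B + 2 * (b div 2)) * A' (g * B + (2 * (b div 2) + 1))] (mod mu (2 * m))"
      using Z[of "g * B + b"] unfolding w2 e R_def[symmetric] by (simp add: add.assoc)
    moreover have "[A' (g * B + 2 * (b div 2)) * A' (g * B + (2 * (b div 2) + 1)) =
      (\<Sum>j<2 ^ R. xp ((2 * g + 1) * lv s * j) * X (2 * (b div 2)) j) *
      (\<Sum>j<2 ^ R. xp ((2 * g + 1) * lv s * j) * X (2 * (b div 2) + 1) j)] (mod mu (2 * m))"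
      by (intro cong_mult X(3) g pair b)
    moreover have "[(\<Sum>l<2 ^ R. xp ((2 * g + 1) * lv s * l) * C b l) =
      (\<Sum>j<2 ^ R. xp ((2 * g + 1) * lv s * j) * X (2 * (b div 2)) j) *
      (\<Sum>j<2 ^ R. xp ((2 * g + 1) * lv s * j) * X (2 * (b div 2) + 1) j)] (mod mu (2 * m))"
      unfolding C_def by (rule TP(1)) (use X(2) pair[OF b] in blast)+
    ultimately show ?thesis by (meson cong_sym cong_trans)
  qed
  have C2: "[(\<Sum>j<2 ^ R. xp (m * j) * C b j) = A (2 * (b div 2)) * A (2 * (b div 2) + 1)] (mod mu (2 ^ R * m))"
    if b: "b < B" for b
    unfolding X(1)[OF pair(1)[OF b]] X(1)[OF pair(2)[OF b]] C_def
    by (rule TP(2)) (use X(2) pair[OF b] in blast)+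
  have C3: "degree (C b j) < 2 * m" if b: "b < B" for b j
    unfolding C_def by (rule TP(3)) (use X(2) pair[OF b] in blast)+
  define Q where "Q = (\<lambda>i' f' t'.
    (\<forall>b<B. [pol f' (i' 20 + b * 2 ^ s) (2 ^ s) = A (2 * (b div 2)) * A (2 * (b div 2) + 1)] (mod mu (2 ^ s))) \<and>
    (\<forall>y<U. f' y = f y) \<and> (i' 20 = U \<and> i' 21 = U + H \<or> i' 20 = U + H \<and> i' 21 = U) \<and>
    i' (22::nat) = 2 ^ s \<and> i' 43 = B * 2 ^ s \<and> i' 39 = sp \<and>
    t' \<le> t + 300 * (s * (B * 2 ^ s)))"
  define K5 where "K5 = wp swap_bufs (wp (Instrs (mov 22 44)) Q)"
  define K4 where "K4 = wp (halve 24) (wp unlift K5)"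
  define K3 where "K3 = wp (Instrs (mov 25 43 @ mov 23 22 @ mov 27 22 @ [IAdd 38 44 44] @ mov 24 23)) (wp fft_inv K4)"
  have "wp (halve 43) K3 (i(99 := 1, 44 := 2 ^ s, 28 := lv s, 39 := sp, 26 := B * (2 * m))) f (t + 7)"
  proof (rule wp_conseq[OF halve_spec[where k = "Suc \<beta> + s"]], goal_cases)
    case 1
    show ?case using regs(4) Tk by (simp add: T_def[symmetric])
  next
    case (4 i1 f1 t1)
    have i1: "i1 20 = cur" "i1 21 = oth" "i1 22 = 2 * m" "i1 43 = T" "i1 39 = sp" "i1 44 = 2 ^ s"
      "i1 28 = lv s" "i1 26 = B * (2 * m)" "i1 10 = i 10"
      using 4(1) 4(2) regs Tk by (simp_all add: m_def)
    have f1: "f1 = f" and t1: "t1 \<le> t + 4 * T + 12" using 4(1) Tk by auto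
    have "wp fft_inv K4 (i1(25 := T, 23 := 2 * m, 27 := 2 * m, 38 := 2 * 2 ^ s, 24 := 2 * m)) f (t1 + 9)"
    proof (rule wp_conseq[OF fft_inv_spec[where cur = cur and oth = oth and R = R and B = B and w = "2 * m" and
              v = "lv s" and X = C]], goal_cases)
      case 13 show ?case by (simp add: lv_def)
    next
      case 14 show ?case by (rule w)
    next
      case 15 show ?case using d unfolding tot by blast
    next
      case (16 g b) then show ?case using C1 by blast
    next
      case (17 i2 f2 t2)
      have i2: "i2 23 = 2 * m" "i2 24 = 2 * m" "i2 25 = T" "i2 38 = 2 * 2 ^ s" "i2 44 = 2 ^ s" "i2 43 = T" "i2 39 = sp"
        using 17(2) i1 by simp_all
      have t2: "t2 \<le> t + 4 * T + 22 + R * (170 * T)" using 17(1) t1 by simp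
      obtain cur' oth' where co': "i2 20 = cur'" "i2 21 = oth'"
        "cur' = cur \<and> oth' = oth \<or> cur' = oth \<and> oth' = cur"
        using 17(1) by blast
      have f2: "f2 y = f y" if "y < U" for y using 17(1) that U by auto
      \<comment> \<open>Both sides have degree below \<open>2 m\<close>, so the congruence is an
        equality. This is essential, as the next step works modulo a different polynomial.\<close>
      have rows: "pol f2 (cur' + (b * 2 ^ R + j) * (2 * m)) (2 * m) = C b j" if "b < B" "j < 2 ^ R" for b j
        using 17(1) that co' C3 m by (intro cong_mu_eq[where w = "2 * m"] degree_pol) auto
      show ?case
        unfolding K4_def
      proof (rule wp_conseq[OF halve_spec[where k = "s div 2"]], goal_cases)
        case 1 show ?case by (simp add: i2 m_def)
      next
        case (4 i3 f3 t3)
        have i3: "i3 20 = cur'" "i3 21 = oth'" "i3 23 = 2 * m" "i3 24 = m" "i3 25 = T" "i3 38 = 2 * 2 ^ s"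
          "i3 44 = 2 ^ s" "i3 43 = T" "i3 39 = sp"
          using 4 i2 co' by (simp_all add: m_def)
        have f3: "f3 = f2" and t3: "t3 \<le> t2 + 4 * m + 5" using 4 by (auto simp: m_def)
        have TT: "B * (2 ^ R * m) = T" by (simp add: T_def s2)
        show ?case
        proof (rule wp_conseq[OF unlift_spec[where cur = cur' and oth = oth' and B = B and t = "2 ^ R" and m = m]], goal_cases)
          case 10 show ?case using d co' unfolding TT by auto
        next
          case (11 i4 f4 t4)
          have i4: "i4 20 = cur'" "i4 21 = oth'" "i4 44 = 2 ^ s" "i4 43 = T" "i4 39 = sp"
            using 11(2) i3 by simp_all
          have Zb: "[pol f4 (oth' + b * 2 ^ s) (2 ^ s) = A (2 * (b div 2)) * A (2 * (b div 2) + 1)] (mod mu (2 ^ s))"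
            if b: "b < B" for b
          proof -
            have e1: "[pol f4 (oth' + b * (2 ^ R * m)) (2 ^ R * m) =
              (\<Sum>j<2 ^ R. xp (m * j) * pol f2 (cur' + (b * 2 ^ R + j) * (2 * m)) (2 * m))] (mod mu (2 ^ R * m))"
              using 11(1) b f3 by blast
            have e2: "(\<Sum>j<2 ^ R. xp (m * j) * pol f2 (cur' + (b * 2 ^ R + j) * (2 * m)) (2 * m)) =
                (\<Sum>j<2 ^ R. xp (m * j) * C b j)"
              by (rule sum.cong) (use rows b in auto)
            show ?thesis using cong_trans[OF e1[unfolded e2] C2[OF b]] unfolding s2 .
          qed
          have f4: "f4 y = f y" if "y < U" for y
            using 11(1) that U co' f2 f3 by auto
          have tt: "t4 + 8 \<le> t + 300 * (s * T)"
          proof -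
            have "t4 \<le> t3 + 60 * T + 10" using 11(1) TT by simp
            moreover have "R * (170 * T) \<le> s * (170 * T)" using Rs by (rule mult_le_mono1)
            moreover have "3 * T \<le> s * T" using s by (rule mult_le_mono1)
            moreover have "m \<le> T" unfolding TT[symmetric] using Bp by simp
            ultimately show ?thesis using t2 t3 s T1 by linarith
          qed
          have bufs: "oth' = U \<and> cur' = U + H \<or> oth' = U + H \<and> cur' = U" using co co' by auto
          show ?case
            unfolding K5_def
            using Zb f4 tt bufs by (simp add: swap_bufs_def Q_def i4 T_def)
        qed (use i3 m in \<open>simp_all add: s2 TT\<close>)
      qed simp_all
    qed (use i1 half U f1 Bp tot s2 in \<open>auto simp: T_def\<close>)
    then show ?case
      unfolding K3_def using i1 f1 by (simp add: mult_2 clock_simps)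
  qed simp_all
  then have "wp (Instrs [IConst 99 1, ISub 39 39 99, ILoad 44 39, ISub 39 39 99, ILoad 28 39, ISub 39 39 99, ILoad 26 39])
     (wp (halve 43) K3) i f t"
    using regs sp by (simp add: clock_simps m_def)
  then show ?thesis
    unfolding K3_def K4_def K5_def Q_def level_inv_def wp_Seq .
qed

section \<open>The complete negacyclic multiplication\<close>

definition mult_init :: com where
  "mult_init = Instrs ([IConst 41 1, IAdd 43 22 22] @ mov 42 43) ;;
     While 41 43 (Instrs [IAdd 41 41 41, IAdd 42 42 42]) ;;
     Instrs (mov 20 12 @ [IAdd 21 20 42, IConst 57 4, IConst 39 100, IConst 58 100])"

text \<open>Registers: 20 and 21 hold the addresses of the current and of the other buffer, 22 to 24 the
  sizes \<open>n\<close>, \<open>w\<close>, \<open>m\<close> of the current level, and 39 the top of a stack of sizes in the index cells from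
  100 on; 12 is the address of the free memory, and 10 that of the constant 1/2.\<close>

definition mult :: com where
  "mult = mult_init ;; While 57 22 level_fwd ;; base_mult ;; swap_bufs ;; While 58 39 level_inv"

lemma wr_mult: "r \<in> wr mult \<Longrightarrow> 20 \<le> r"
  using wr_level_fwd[of r] wr_level_inv[of r] by (auto simp: mult_def mult_init_def swap_bufs_def)

text \<open>The two buffers are \<open>(2 * 2^s)^2\<close> cells apart, a square obtained by
  doubling \<open>2 * 2^s\<close> as often as 1 must be doubled to reach \<open>2 * 2^s\<close>.
  This exceeds the data of every level; untouched addresses cost nothing.\<close>

lemma mult_init_spec:
  assumes "i 22 = 2 ^ s" "i 12 = U"
  shows "wp mult_init (\<lambda>i' f' t'. i' 20 = U \<and> i' 21 = U + (2 * 2 ^ s) * (2 * 2 ^ s) \<and> i' 43 = 2 * 2 ^ s \<and>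
    i' 57 = 4 \<and> i' 39 = 100 \<and> i' 58 = 100 \<and> f' = f \<and> t' \<le> t + 4 * s + 20) i f t"
proof -
  have "wp (While 41 43 (Instrs [IAdd 41 41 41, IAdd 42 42 42]))
    (wp (Instrs (mov 20 12 @ [IAdd 21 20 42, IConst 57 4, IConst 39 100, IConst 58 100]))
     (\<lambda>i' f' t'. i' 20 = U \<and> i' 21 = U + (2 * 2 ^ s) * (2 * 2 ^ s) \<and> i' 43 = 2 * 2 ^ s \<and>
      i' 57 = 4 \<and> i' 39 = 100 \<and> i' 58 = 100 \<and> f' = f \<and> t' \<le> t + 4 * s + 20)) i' f t'"
    if i: "i' 41 = 1" "i' 42 = 2 * 2 ^ s" "i' 43 = 2 * 2 ^ s" "i' 12 = U" "t' \<le> t + 4" for i' t'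
  proof (rule wp_while[where n = "Suc s" and I = "\<lambda>k i' f' t'. i' 41 = 2 ^ k \<and> i' 42 = 2 * 2 ^ s * 2 ^ k \<and>
      f' = f \<and> t' \<le> t + 4 + 4 * k"], goal_cases)
    case 1
    then show ?case using i by simp
  next
    case (2 k i1 f1 t1)
    have "(2::nat) ^ k < 2 * 2 ^ s" using 2(1) power_strict_increasing[of k "Suc s" "2::nat"] by simp
    then show ?case using 2(2) 2(3)[of 43] i by simp
  next
    case (3 i1 f1 t1)
    then show ?case using 3(1) 3(2)[of 43] 3(2)[of 12] i by simp
  qed
  note W = this
  show ?thesis
    unfolding mult_init_def wp_Seq
    using assms by (simp add: mult_2[symmetric]) (rule wp_conseq[OF W]; simp add: mult_2 algebra_simps)
qed

text \<open>All subproducts of a level are treated side by side, so the recursion becomes two loops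
  over the levels, one down and one up, with the sizes kept on a stack.\<close>

lemma mult_spec:
  fixes f :: "nat \<Rightarrow> 'k::field_char_0"
  assumes regs: "i 22 = 2 ^ s" "i 12 = U" and half: "f (i 10) + f (i 10) = 1" "i 10 < U"
  shows "wp mult (\<lambda>i' f' t'.
    [pol f' (i' 20) (2 ^ s) = pol f U (2 ^ s) * pol f (U + 2 ^ s) (2 ^ s)] (mod mu (2 ^ s)) \<and>
    U \<le> i' 20 \<and> (\<forall>y<U. f' y = f y) \<and> (\<forall>r<20. i' r = i r) \<and>
    t' \<le> t + 10000 * (Suc s * Suc s * 2 ^ s)) i f t"
proof -
  obtain L where L: "lsz s L \<le> 2" "\<And>l. l < L \<Longrightarrow> 3 \<le> lsz s l" "L \<le> s" "2 ^ L \<le> 2 * s + 1"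
    using levels_exist[of s] by blast
  define H where "H = (2 * 2 ^ s) * (2 * 2 ^ s :: nat)"
  have ss: "s < 2 ^ s" by (rule less_exp)
  have size: "blks s l * 2 ^ lsz s l \<le> H" if "l \<le> L" for l
  proof -
    have "(2::nat) ^ l \<le> 2 ^ L" using that by (rule power_increasing) simp
    then have "(2::nat) ^ l \<le> 2 * 2 ^ s" using L(4) ss by linarith
    then show ?thesis unfolding blks_size H_def by (rule mult_le_mono1)
  qed
  have H: "2 * (blks s l * 2 ^ lsz s l) \<le> H" if "l < L" for l
    using size[of "Suc l"] that unfolding blks_size by simp
  \<comment> \<open>The data have doubled \<open>l\<close> times and the exponent has about halved
    as often: by \<open>lsz_bound\<close> all levels cost about the same.\<close>
  have cost: "300 * (lsz s l * (blks s l * 2 ^ lsz s l)) \<le> 1800 * (s * 2 ^ s)" if "l < L" for l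
  proof -
    have "(2 ^ l * lsz s l) * (2 * 2 ^ s) \<le> (3 * s) * (2 * 2 ^ s)"
      by (rule mult_le_mono1[OF lsz_bound[OF L(2)[OF that]]])
    then show ?thesis unfolding blks_size by (simp add: mult_ac)
  qed
  have loop_cost: "k * (1800 * (s * 2 ^ s) + 2) \<le> 1802 * (s * s * 2 ^ s) + 2" if "k \<le> L" for k
  proof -
    have "k * (1800 * (s * 2 ^ s) + 2) \<le> s * (1800 * (s * 2 ^ s) + 2)"
      using that L(3) by (intro mult_le_mono1) simp
    moreover have "s * s * 1 \<le> s * s * 2 ^ s" by (intro mult_le_mono2) simp
    moreover have "s \<le> s * s" by (rule le_square)
    moreover have "s * (1800 * (s * 2 ^ s) + 2) = 1800 * (s * s * 2 ^ s) + 2 * s" by (simp add: algebra_simps)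
    ultimately show ?thesis by linarith
  qed
  define stack where "stack = (\<lambda>l (i' :: nat \<Rightarrow> nat). \<forall>k<l. i' (100 + 3 * k) = blks s k * 2 ^ (lsz s k div 2 + 1) \<and>
    i' (100 + 3 * k + 1) = lv (lsz s k) \<and> i' (100 + 3 * k + 2) = 2 ^ lsz s k)"
  define bufs where "bufs = (\<lambda>i' :: nat \<Rightarrow> nat. i' 20 = U \<and> i' 21 = U + H \<or> i' 20 = U + H \<and> i' 21 = U)"
  have bufsD: "i' 20 = i' 20 \<Longrightarrow> bufs i' \<Longrightarrow> U \<le> i' 20" for i' by (auto simp: bufs_def)
  \<comment> \<open>\<open>A l\<close> is a ghost copy of the block values at level
    \<open>l\<close>. The memory no longer contains them when the upward loop refers to
    them.\<close>
  define FIA where "FIA = (\<lambda>A l i' f' t'. (\<forall>b. A 0 b = pol f (U + b * 2 ^ s) (2 ^ s)) \<and>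
    (\<forall>k<l. level_rel (lsz s k) (blks s k) (A k) (A (Suc k))) \<and>
    (\<forall>b. A l b = pol f' (i' 20 + b * 2 ^ lsz s l) (2 ^ lsz s l)) \<and>
    (\<forall>y<U. f' y = f y) \<and> bufs i' \<and> stack l i' \<and> i' 22 = 2 ^ lsz s l \<and>
    i' 43 = blks s l * 2 ^ lsz s l \<and> i' 39 = 100 + 3 * l \<and>
    t' \<le> t + 4 * s + 20 + l * (1800 * (s * 2 ^ s) + 2))"
  define FI where "FI = (\<lambda>l i' f' t'. \<exists>A. FIA A l i' f' t')"
  define K4 where "K4 = wp (While 58 39 level_inv) (\<lambda>i' f' t'.
    [pol f' (i' 20) (2 ^ s) = pol f U (2 ^ s) * pol f (U + 2 ^ s) (2 ^ s)] (mod mu (2 ^ s)) \<and>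
    U \<le> i' 20 \<and> (\<forall>y<U. f' y = f y) \<and> (\<forall>r<20. i' r = i r) \<and>
    t' \<le> t + 10000 * (Suc s * Suc s * 2 ^ s))"
  have inv: "K4 i1 f1 t1"
    if A0: "\<And>b. A 0 b = pol f (U + b * 2 ^ s) (2 ^ s)"
      and A: "\<And>k. k < L \<Longrightarrow> level_rel (lsz s k) (blks s k) (A k) (A (Suc k))"
      and Z: "\<And>b. b < blks s L \<Longrightarrow> [pol f1 (i1 20 + b * 2 ^ lsz s L) (2 ^ lsz s L) =
        A L (2 * (b div 2)) * A L (2 * (b div 2) + 1)] (mod mu (2 ^ lsz s L))"
      and f1: "\<And>y. y < U \<Longrightarrow> f1 y = f y" and b1: "bufs i1" "stack L i1"
      and i1: "i1 22 = 2 ^ lsz s L" "i1 43 = blks s L * 2 ^ lsz s L" "i1 39 = 100 + 3 * L" "i1 58 = 100"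
      and lo: "\<And>r. r < 20 \<Longrightarrow> i1 r = i r"
      and t1: "t1 \<le> t + 7000 * (Suc s * Suc s * 2 ^ s)"
    for A i1 f1 t1
    unfolding K4_def
  proof (rule wp_while[where n = L and I = "\<lambda>k i' f' t'.
      (\<forall>b<blks s (L - k). [pol f' (i' 20 + b * 2 ^ lsz s (L - k)) (2 ^ lsz s (L - k)) =
        A (L - k) (2 * (b div 2)) * A (L - k) (2 * (b div 2) + 1)] (mod mu (2 ^ lsz s (L - k)))) \<and>
      (\<forall>y<U. f' y = f y) \<and> bufs i' \<and> i' 22 = 2 ^ lsz s (L - k) \<and>
      i' 43 = blks s (L - k) * 2 ^ lsz s (L - k) \<and> i' 39 = 100 + 3 * (L - k) \<and>
      t' \<le> t1 + k * (1800 * (s * 2 ^ s) + 2)"], goal_cases)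
    case 1
    show ?case using Z f1 b1 i1 by simp
  next
    case (2 k i2 f2 t2)
    note p = 2(2)
    define l where "l = L - Suc k"
    have l: "L - k = Suc l" "l < L" using 2(1) by (auto simp: l_def)
    have fr: "i2 r = i1 r" if "r < 20 \<or> r = 57 \<or> r = 58 \<or> 100 \<le> r" for r
      using 2(3)[of r] wr_level_inv[of r] that by (cases "r \<in> wr level_inv") auto
    have st: "i2 (100 + 3 * l) = blks s l * 2 ^ (lsz s l div 2 + 1)" "i2 (100 + 3 * l + 1) = lv (lsz s l)"
      "i2 (100 + 3 * l + 2) = 2 ^ lsz s l"
      using b1(2) l(2) by (simp_all add: stack_def fr)
    obtain \<beta> where \<beta>: "blks s l = 2 * 2 ^ \<beta>" using blks_power by blast
    have lsz': "lsz s (Suc l) = lsz s l div 2 + 1" by simp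
    have i43: "i2 43 = 2 * (blks s l * 2 ^ lsz s l)"
      using p unfolding l by (simp only: blks_size) simp
    have "wp level_inv (\<lambda>i' f' t'.
      (\<forall>b<blks s l. [pol f' (i' 20 + b * 2 ^ lsz s l) (2 ^ lsz s l) = A l (2 * (b div 2)) * A l (2 * (b div 2) + 1)] (mod mu (2 ^ lsz s l))) \<and>
      (\<forall>y<U. f' y = f2 y) \<and> (i' 20 = U \<and> i' 21 = U + H \<or> i' 20 = U + H \<and> i' 21 = U) \<and>
      i' 22 = 2 ^ lsz s l \<and> i' 43 = blks s l * 2 ^ lsz s l \<and> i' 39 = 100 + 3 * l \<and>
      t' \<le> Suc t2 + 300 * (lsz s l * (blks s l * 2 ^ lsz s l))) i2 f2 (Suc t2)"
    proof (rule level_inv_spec[where A' = "A (Suc l)" and \<beta> = \<beta>])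
      show "i2 20 = i2 20" "i2 21 = i2 21" by simp_all
      show "i2 20 = U \<and> i2 21 = U + H \<or> i2 20 = U + H \<and> i2 21 = U" using p by (simp add: bufs_def)
      show "3 \<le> lsz s l" by (rule L(2)[OF l(2)])
      show "level_rel (lsz s l) (blks s l) (A l) (A (Suc l))" by (rule A[OF l(2)])
      show "2 * (blks s l * 2 ^ lsz s l) \<le> H" by (rule H[OF l(2)])
      show "i2 39 = 100 + 3 * l + 3" using p l by simp
      show "[pol f2 (i2 20 + b * 2 ^ (lsz s l div 2 + 1)) (2 ^ (lsz s l div 2 + 1)) =
          A (Suc l) (2 * (b div 2)) * A (Suc l) (2 * (b div 2) + 1)] (mod mu (2 ^ (lsz s l div 2 + 1)))"
        if "b < 2 ^ lrad (lsz s l) * blks s l" for b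
        using p that unfolding l lsz'[symmetric] blks.simps(2)[symmetric] by blast
      show "i2 22 = 2 ^ (lsz s l div 2 + 1)" using p unfolding l by simp
      show "f2 (i2 10) + f2 (i2 10) = 1" "i2 10 < U" using p half fr[of 10] lo[of 10] by simp_all
    qed (use st i43 \<beta> in simp_all)
    then have "wp level_inv (\<lambda>i' f' t'.
      (\<forall>b<blks s l. [pol f' (i' 20 + b * 2 ^ lsz s l) (2 ^ lsz s l) = A l (2 * (b div 2)) * A l (2 * (b div 2) + 1)] (mod mu (2 ^ lsz s l))) \<and>
      (\<forall>y<U. f' y = f y) \<and> bufs i' \<and> i' 22 = 2 ^ lsz s l \<and> i' 43 = blks s l * 2 ^ lsz s l \<and> i' 39 = 100 + 3 * l \<and>
      Suc t' \<le> t1 + Suc k * (1800 * (s * 2 ^ s) + 2)) i2 f2 (Suc t2)"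
    proof (rule wp_conseq, goal_cases)
      case (1 i' f' t')
      have "t' \<le> Suc t2 + 300 * (lsz s l * (blks s l * 2 ^ lsz s l))" using 1(1) by blast
      moreover have "t2 \<le> t1 + k * (1800 * (s * 2 ^ s) + 2)" using p by blast
      moreover have "Suc k * (1800 * (s * 2 ^ s) + 2) = k * (1800 * (s * 2 ^ s) + 2) + (1800 * (s * 2 ^ s) + 2)"
        by simp
      ultimately have tt: "Suc t' \<le> t1 + Suc k * (1800 * (s * 2 ^ s) + 2)"
        using cost[OF l(2)] by linarith
      have "f' y = f y" if "y < U" for y using 1(1) p that by simp
      then show ?case using 1(1) tt unfolding bufs_def by blast
    qed
    then show ?case using p l fr[of 58] i1 unfolding l_def[symmetric] by simp
  next
    case (3 i2 f2 t2)
    have fr: "i2 r = i1 r" if "r < 20 \<or> r = 58" for r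
      using 3(2)[of r] wr_level_inv[of r] that by (cases "r \<in> wr level_inv") auto
    have "t2 \<le> t1 + (1802 * (s * s * 2 ^ s) + 2)" using 3(1) loop_cost[of L] by simp
    moreover have "s * s * 2 ^ s \<le> Suc s * Suc s * 2 ^ s" by (intro mult_le_mono) auto
    moreover have "1 \<le> Suc s * Suc s * 2 ^ s" unfolding One_nat_def Suc_le_eq by simp
    ultimately have "Suc t2 \<le> t + 10000 * (Suc s * Suc s * 2 ^ s)" using t1 by linarith
    moreover have "[pol f2 (i2 20) (2 ^ s) = pol f U (2 ^ s) * pol f (U + 2 ^ s) (2 ^ s)] (mod mu (2 ^ s))"
    proof -
      have "[pol f2 (i2 20 + 0 * 2 ^ s) (2 ^ s) = A 0 (2 * (0 div 2)) * A 0 (2 * (0 div 2) + 1)] (mod mu (2 ^ s))"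
        using 3(1) by (metis diff_self_eq_0 blks.simps(1) lsz.simps(1) zero_less_numeral)
      then show ?thesis by (simp add: A0)
    qed
    ultimately show ?case using 3(1) fr lo i1 bufsD[of i2] by simp
  qed
  define K3 where "K3 = wp base_mult (wp swap_bufs K4)"
  have base: "K3 i1 f1 t1"
    if fi: "FI L i1 f1 t1'" and t1: "t1 \<le> t1' + 1" and lo: "\<And>r. r < 20 \<Longrightarrow> i1 r = i r" and i58: "i1 58 = 100"
      for i1 f1 t1 t1'
  proof -
    obtain A where  FIA: "FIA A L i1 f1 t1'"
      using fi unfolding FI_def by blast
    have A: "\<And>b. A 0 b = pol f (U + b * 2 ^ s) (2 ^ s)"
      "\<And>k. k < L \<Longrightarrow> level_rel (lsz s k) (blks s k) (A k) (A (Suc k))"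
      "\<And>b. A L b = pol f1 (i1 20 + b * 2 ^ lsz s L) (2 ^ lsz s L)"
      using FIA unfolding FIA_def by blast+
    have p: "\<And>y. y < U \<Longrightarrow> f1 y = f y" "bufs i1" "stack L i1" "i1 22 = 2 ^ lsz s L"
      "i1 43 = blks s L * 2 ^ lsz s L" "i1 39 = 100 + 3 * L"
      "t1' \<le> t + 4 * s + 20 + L * (1800 * (s * 2 ^ s) + 2)"
            using FIA unfolding FIA_def by blast+
    obtain \<beta> where \<beta>: "blks s L = 2 * 2 ^ \<beta>" using blks_power by blast
    define n where "n = (2::nat) ^ lsz s L"
    have n: "0 < n" "n \<le> 4"
    proof -
      have "n \<le> 2 ^ 2" unfolding n_def by (rule power_increasing[OF L(1)]) simp
      then show "0 < n" "n \<le> 4" by (simp_all add: n_def)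
    qed
    have tot: "2 ^ \<beta> * (2 * n) = blks s L * 2 ^ lsz s L" by (simp add: \<beta> n_def)
    show ?thesis
      unfolding K3_def
    proof (rule wp_conseq[OF base_mult_spec[where n = n and K = "2 ^ \<beta>", OF refl refl]], goal_cases)
      case 1 show ?case by (simp add: p n_def)
    next
      case 2 show ?case by (simp add: p tot)
    next
      case 5 show ?case using p(2) size[of L] unfolding tot by (auto simp: bufs_def)
    next
      case (6 i2 f2 t2)
      have i2: "i2 20 = i1 20" "i2 21 = i1 21" "i2 22 = n" "i2 43 = blks s L * 2 ^ lsz s L" "i2 39 = 100 + 3 * L" "i2 58 = 100"
        using 6(2) p i58 by (simp_all add: n_def)
      have lo2: "i2 r = i r" if "r < 20" for r using 6(2)[of r] lo[OF that] that by simp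
      have hi2: "i2 r = i1 r" if "100 \<le> r" for r using 6(2)[of r] that by simp
      have Z: "[pol f2 (i1 21 + b * n) n = A L (2 * (b div 2)) * A L (2 * (b div 2) + 1)] (mod mu n)"
        if b: "b < blks s L" for b
      proof -
        have k: "b div 2 < 2 ^ \<beta>" using b \<beta> by simp
        have P: "pol f1 (i1 20 + b div 2 * (2 * n)) n * pol f1 (i1 20 + b div 2 * (2 * n) + n) n =
          A L (2 * (b div 2)) * A L (2 * (b div 2) + 1)"
          by (simp add: A(3) n_def[symmetric] algebra_simps)
        define q where "q = b div 2"
        have "b = 2 * q \<or> b = 2 * q + 1" unfolding q_def by presburger
        then have bn: "b * n = q * (2 * n) \<or> b * n = q * (2 * n) + n"
          by (elim disjE) simp_all
        have e: "[pol f2 (i1 21 + q * (2 * n)) n = A L (2 * q) * A L (2 * q + 1)] (mod mu n)"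
          "[pol f2 (i1 21 + q * (2 * n) + n) n = A L (2 * q) * A L (2 * q + 1)] (mod mu n)"
          using 6(1) k unfolding q_def[symmetric] P[folded q_def, symmetric] by blast+
        show ?thesis
          using bn e unfolding q_def[symmetric] by (elim disjE) (simp_all only: add.assoc)
      qed
      have "K4 (i2(40 := i1 20, 20 := i1 21, 21 := i1 20)) f2 (Suc (Suc (Suc (Suc (Suc (Suc t2))))))"
      proof (rule inv[where A = A])
        show "f2 y = f y" if "y < U" for y
          using 6(1) that p(1,2) by (auto simp: bufs_def)
        show "stack L (i2(40 := i1 20, 20 := i1 21, 21 := i1 20))"
          using p(3) by (simp add: stack_def hi2)
        show "Suc (Suc (Suc (Suc (Suc (Suc t2))))) \<le> t + 7000 * (Suc s * Suc s * 2 ^ s)"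
        proof -
          have "t2 \<le> t1 + 1000 * (2 ^ L * (2 * 2 ^ s)) + 10"
            using 6(1) unfolding tot blks_size by simp
          moreover have "2 ^ L * (2 * 2 ^ s) \<le> (2 * s + 1) * (2 * 2 ^ s)"
            by (rule mult_le_mono1[OF L(4)])
          moreover have "(2 * s + 1) * (2 * 2 ^ s) \<le> 4 * (Suc s * Suc s * 2 ^ s)"
            by (simp add: algebra_simps)
          moreover have "s * s * 2 ^ s + s + 1 \<le> Suc s * Suc s * 2 ^ s"
          proof -
            have "(2 * s + 1) * 1 \<le> (2 * s + 1) * 2 ^ s" by (intro mult_le_mono2) simp
            then have "s + 1 \<le> (2 * s + 1) * 2 ^ s" by (rule order_trans[rotated]) simp
            then show ?thesis by (simp add: algebra_simps)
          qed
          ultimately show ?thesis using p(7) t1 loop_cost[of L] by linarith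
        qed
      qed (use A p(2) i2 lo2 Z in \<open>auto simp: bufs_def n_def\<close>)
      then show ?case
        by (simp add: swap_bufs_def i2)
    qed (use n in simp_all)
  qed
  define K2 where "K2 = wp (While 57 22 level_fwd) K3"
  have fwd: "K2 i0 f t0"
    if i0: "i0 20 = U" "i0 21 = U + H" "i0 43 = 2 * 2 ^ s" "i0 57 = 4" "i0 39 = 100" "i0 58 = 100"
      "i0 22 = 2 ^ s" and lo: "\<And>r. r < 20 \<Longrightarrow> i0 r = i r" and t0: "t0 \<le> t + 4 * s + 20"
    for i0 t0
    unfolding K2_def
  proof (rule wp_while[where n = L and I = "\<lambda>l i' f' t'. FI l i' f' t'"], goal_cases)
    case 1
    show ?case
      unfolding FI_def FIA_def using i0 t0
      by (intro exI[of _ "\<lambda>_ b. pol f (U + b * 2 ^ s) (2 ^ s)"]) (auto simp: bufs_def stack_def)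
  next
    case (2 l i1 f1 t1)
    have fr: "i1 r = i0 r" if "r < 20 \<or> r = 57 \<or> r = 58" for r
      using 2(3)[of r] wr_level_fwd[of r] that by (cases "r \<in> wr level_fwd") auto
    obtain A where  FIA: "FIA A l i1 f1 t1"
      using 2(2) unfolding FI_def by blast
    have A: "\<And>b. A 0 b = pol f (U + b * 2 ^ s) (2 ^ s)"
      "\<And>k. k < l \<Longrightarrow> level_rel (lsz s k) (blks s k) (A k) (A (Suc k))"
      "\<And>b. A l b = pol f1 (i1 20 + b * 2 ^ lsz s l) (2 ^ lsz s l)"
      using FIA unfolding FIA_def by blast+
    have p: "\<And>y. y < U \<Longrightarrow> f1 y = f y" "bufs i1" "stack l i1" "i1 22 = 2 ^ lsz s l"
      "i1 43 = blks s l * 2 ^ lsz s l" "i1 39 = 100 + 3 * l"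
      "t1 \<le> t + 4 * s + 20 + l * (1800 * (s * 2 ^ s) + 2)"
            using FIA unfolding FIA_def by blast+
    obtain \<beta> where \<beta>: "blks s l = 2 * 2 ^ \<beta>" using blks_power by blast
    have l3: "3 \<le> lsz s l" by (rule L(2)[OF 2(1)])
    have "(2::nat) ^ 3 \<le> 2 ^ lsz s l" by (rule power_increasing[OF l3]) simp
    then have gt: "i1 57 < i1 22" using fr[of 57] i0 p(4) by simp
    have blk': "2 * (blks s l * 2 ^ lsz s l) = blks s (Suc l) * 2 ^ lsz s (Suc l)"
      by (simp only: blks_size) simp
    have "wp level_fwd (\<lambda>i f t. FI (Suc l) i f (Suc t)) i1 f1 (Suc t1)"
    proof (rule wp_conseq[OF level_fwd_spec[where s = "lsz s l" and B = "blks s l" and \<beta> = \<beta>, OF refl refl p(4,5,6) _ l3 \<beta> p(2)[unfolded bufs_def] H[OF 2(1)]]], goal_cases)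
      case (2 i2 f2 t2)
      define A' where "A' = A(Suc l := (\<lambda>b. pol f2 (i2 20 + b * 2 ^ lsz s (Suc l)) (2 ^ lsz s (Suc l))))"
      have Al: "A l = (\<lambda>b. pol f1 (i1 20 + b * 2 ^ lsz s l) (2 ^ lsz s l))" using A(3) by auto
      have "level_rel (lsz s k) (blks s k) (A' k) (A' (Suc k))" if "k < Suc l" for k
        using that 2(1) A(2)[of k] by (cases "k = l") (auto simp: A'_def Al)
      moreover have "stack (Suc l) i2"
        unfolding stack_def
      proof (intro allI impI)
        fix k assume "k < Suc l"
        then show "i2 (100 + 3 * k) = blks s k * 2 ^ (lsz s k div 2 + 1) \<and>
          i2 (100 + 3 * k + 1) = lv (lsz s k) \<and> i2 (100 + 3 * k + 2) = 2 ^ lsz s k"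
          using 2(1) p(3) unfolding stack_def by (cases "k = l") auto
      qed
      moreover have "Suc t2 \<le> t + 4 * s + 20 + Suc l * (1800 * (s * 2 ^ s) + 2)"
      proof -
        have "t2 \<le> Suc t1 + 300 * (lsz s l * (blks s l * 2 ^ lsz s l))" using 2(1) by blast
        moreover have "Suc l * (1800 * (s * 2 ^ s) + 2) = l * (1800 * (s * 2 ^ s) + 2) + (1800 * (s * 2 ^ s) + 2)"
          by simp
        ultimately show ?thesis using cost[OF \<open>l < L\<close>] p(7) by linarith
      qed
      ultimately show ?case
        unfolding FI_def FIA_def using 2(1) A(1) p(1) blk' by (intro exI[of _ A']) (auto simp: bufs_def A'_def)
    qed simp
    then show ?case using gt by simp
  next
    case (3 i1 f1 t1)
    have fr: "i1 r = i0 r" if "r < 20 \<or> r = 57 \<or> r = 58" for r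
      using 3(2)[of r] wr_level_fwd[of r] that by (cases "r \<in> wr level_fwd") auto
    have "(2::nat) ^ lsz s L \<le> 2 ^ 2" by (rule power_increasing[OF L(1)]) simp
    then have "i1 22 \<le> i1 57" using 3(1) fr[of 57] i0 by (auto simp: FI_def FIA_def)
    moreover have "K3 i1 f1 (Suc t1)"
      by (rule base[of _ _ t1]) (use 3(1) fr lo i0 in simp_all)
    ultimately show ?case by simp
  qed
  have "wp mult_init K2 i f t"
  proof (rule wp_conseq[OF mult_init_spec[of i s U, OF regs]], goal_cases)
    case (1 i1 f1 t1)
    have "K2 i1 f t1"
      by (rule fwd) (use 1(1) 1(2)[of 22] 1(2) regs in \<open>auto simp: H_def mult_init_def\<close>)
    then show ?case using 1(1) by simp
  qed
  then show ?thesis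
    unfolding mult_def wp_Seq K2_def K3_def K4_def .
qed

section \<open>The exponential of a power series\<close>

text \<open>The largest power of two dividing \<open>x\<close>, set to 1 at 0. It is the block
  length in the online schedule.\<close>

fun lpw :: "nat \<Rightarrow> nat" where
  "lpw x = (if x = 0 \<or> odd x then 1 else 2 * lpw (x div 2))"

declare lpw.simps [simp del]

lemma lpw_power: "\<exists>v. lpw x = 2 ^ v"
proof (induction x rule: lpw.induct)
  case (1 x)
  show ?case
  proof (cases "x = 0 \<or> odd x")
    case True
    then show ?thesis by (subst lpw.simps) (auto intro: exI[of _ 0])
  next
    case False
    then obtain v where "lpw (x div 2) = 2 ^ v" using 1 by blast
    then show ?thesis using False by (subst lpw.simps) (auto intro: exI[of _ "Suc v"])
  qed
qed

lemma lpw_pos [simp]: "0 < lpw x"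
  using lpw_power[of x] by auto

lemma lpw_double: "0 < x \<Longrightarrow> lpw (2 * x) = 2 * lpw x"
  by (subst lpw.simps) simp

lemma lpw_odd_mult: "lpw (2 ^ v * (2 * k + 1)) = 2 ^ v"
proof (induction v)
  case (Suc v)
  have "lpw (2 * (2 ^ v * (2 * k + 1))) = 2 * lpw (2 ^ v * (2 * k + 1))"
    by (rule lpw_double) simp
  then show ?case unfolding Suc power_Suc mult.assoc .
qed (simp add: lpw.simps)

lemma odd_decomp: "0 < x \<Longrightarrow> \<exists>v k. x = 2 ^ v * (2 * k + 1 :: nat)"
proof (induction x rule: less_induct)
  case (less x)
  show ?case
  proof (cases "even x")
    case True
    then obtain y where y: "x = 2 * y" by blast
    have "\<exists>v k. y = 2 ^ v * (2 * k + 1)" by (rule less.IH) (use y less.prems in simp_all)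
    then obtain v k where "y = 2 ^ v * (2 * k + 1)" by blast
    then have "x = 2 ^ Suc v * (2 * k + 1)" using y by simp
    then show ?thesis by blast
  next
    case False
    then obtain k where "x = 2 * k + 1" by (rule oddE)
    then have "x = 2 ^ 0 * (2 * k + 1)" by simp
    then show ?thesis by blast
  qed
qed

lemma lpw_le: "0 < x \<Longrightarrow> lpw x \<le> x"
  using odd_decomp[of x] lpw_odd_mult by force

text \<open>Even indices repeat the whole pattern with doubled lengths, and every odd index
  contributes 1: the sum satisfies \<open>f (s + 1) = 2 f s + 2^s\<close>. This is the logarithmic
  overhead of the online schedule.\<close>

lemma lpw_sum: "(\<Sum>x<2 ^ s. if x = 0 then 0 else lpw x) \<le> s * 2 ^ s"
proof (induction s)
  case (Suc s)
  have "(\<Sum>x<2 * 2 ^ s. if x = 0 then 0 else lpw x) =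
      (\<Sum>x<2 ^ s. (if 2 * x = 0 then 0 else lpw (2 * x)) + (if 2 * x + 1 = 0 then 0 else lpw (2 * x + 1)))"
    by (rule sum_even_odd)
  also have "\<dots> = (\<Sum>x<2 ^ s. 2 * (if x = 0 then 0 else lpw x) + 1)"
  proof (rule sum.cong[OF refl])
    fix x
    have "lpw (2 * x) = 2 * lpw x" if "0 < x" using that by (rule lpw_double)
    moreover have "lpw (2 * x + 1) = 1" by (subst lpw.simps) simp
    ultimately show "(if 2 * x = 0 then 0 else lpw (2 * x)) + (if 2 * x + 1 = 0 then 0 else lpw (2 * x + 1)) =
      2 * (if x = 0 then 0 else lpw x) + 1" by auto
  qed
  also have "\<dots> = 2 * (\<Sum>x<2 ^ s. if x = 0 then 0 else lpw x) + 2 ^ s"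
    by (simp only: sum.distrib sum_distrib_left[symmetric]) simp
  also have "\<dots> \<le> 2 * (s * 2 ^ s) + 2 ^ s" using Suc by simp
  finally show ?case by simp
qed simp

text \<open>\<open>added x m\<close> is the number of terms that have been added to entry \<open>m\<close> once blocks \<open>1, \<dots>, x\<close>
  have been processed. Block \<open>x\<close> adds the terms \<open>x - lpw x, \<dots>, x - 1\<close> to the entries
  \<open>x, \<dots>, x + lpw x - 1\<close>.\<close>

fun added :: "nat \<Rightarrow> nat \<Rightarrow> nat" where
  "added 0 m = 0"
| "added (Suc x) m = (if m < Suc x + lpw (Suc x) then Suc x else added x m)"

text \<open>Write \<open>x = 2^v (2 k + 1)\<close> and \<open>u = x - 2^v\<close>. If
  \<open>u\<close> is positive it is divisible by \<open>2^(v + 1)\<close>, so its block covers all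
  of \<open>x, ..., x + 2^v - 1\<close>. Indices strictly between \<open>u\<close> and
  \<open>x\<close> are divisible by lower powers of two only, and their blocks end by
  \<open>x\<close>.\<close>

lemma added_before:
  assumes x: "0 < x" and m: "x \<le> m" "m < x + lpw x"
  shows "added (x - 1) m = x - lpw x"
proof -
  obtain v k where xv: "x = 2 ^ v * (2 * k + 1)" using odd_decomp[OF x] by blast
  have p: "lpw x = 2 ^ v" unfolding xv by (rule lpw_odd_mult)
  define u where "u = x - 2 ^ v"
  have u: "u = 2 ^ v * (2 * k)" "x = u + 2 ^ v" by (simp_all add: u_def xv algebra_simps)
  have skip: "y + lpw y \<le> x" if y: "u < y" "y < x" for y
  proof -
    obtain b l where yb: "y = 2 ^ b * (2 * l + 1)" using odd_decomp[of y] y by auto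
    have ly: "lpw y = 2 ^ b" unfolding yb by (rule lpw_odd_mult)
    have bv: "b < v"
    proof (rule ccontr)
      assume "\<not> b < v"
      then have "2 ^ v dvd y" unfolding yb by (simp add: le_imp_power_dvd)
      then obtain z where "y = 2 ^ v * z" by blast
      then have "2 ^ v * (2 * k) < 2 ^ v * z" "2 ^ v * z < 2 ^ v * (2 * k + 1)"
        using y u(1) xv by (simp_all only:)
      then have "2 * k < z" "z < 2 * k + 1" by (simp_all only: mult_less_cancel1)
      then show False by simp
    qed
    then have "2 ^ b dvd x" unfolding xv by (simp add: le_imp_power_dvd)
    then obtain z where z: "x = 2 ^ b * z" by blast
    with y yb have "2 ^ b * (2 * l + 1) < 2 ^ b * z" by (simp only:)
    then have "2 * l + 1 < z" by (simp only: mult_less_cancel1)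
    then have "2 ^ b * Suc (2 * l + 1) \<le> 2 ^ b * z" by (intro mult_le_mono2) simp
    moreover have "y + 2 ^ b = 2 ^ b * Suc (2 * l + 1)" by (simp add: yb)
    ultimately show ?thesis unfolding ly z by (simp only:)
  qed
  have "added (u + j) m = u" if "j < 2 ^ v" for j
    using that
  proof (induction j)
    case 0
    show ?case
    proof (cases u)
      case (Suc u')
      then have k: "0 < k" using u(1) by (cases k) auto
      then obtain c l where kc: "k = 2 ^ c * (2 * l + 1)" using odd_decomp by blast
      have "u = 2 ^ (Suc v + c) * (2 * l + 1)" unfolding u(1) kc by (simp add: power_add algebra_simps)
      then have "lpw u = 2 ^ (Suc v + c)" using lpw_odd_mult by metis
      moreover have "2 * 2 ^ v \<le> (2::nat) ^ (Suc v + c)" by simp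
      ultimately have "m < u + lpw u" using m u(2) p by linarith
      then show ?thesis by (simp add: Suc)
    qed simp
  next
    case (Suc j)
    have "u + Suc j + lpw (u + Suc j) \<le> x" by (rule skip) (use Suc.prems u(2) in simp_all)
    then show ?case using Suc m by simp
  qed
  from this[of "2 ^ v - 1"] show ?thesis using u(2) p by simp
qed

lemma added_step:
  "0 < x \<Longrightarrow> added x m = (if m < x + lpw x then x else added (x - 1) m)"
  by (cases x) auto

text \<open>The coefficients of the exponential of \<open>\<Sum>n\<ge>1. a n x^n / n\<close>;
  differentiating gives the recurrence.\<close>

fun exp_seq :: "(nat \<Rightarrow> 'k::field) \<Rightarrow> nat \<Rightarrow> 'k" where
  "exp_seq a n = (if n = 0 then 1 else (\<Sum>k<n. a (n - k) * exp_seq a k) / of_nat n)"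

declare exp_seq.simps [simp del]

text \<open>A middle product: \<open>x * y\<close> has degree at most \<open>3 p - 2\<close>, so the
  wrap modulo \<open>X^(2 p) + 1\<close> reaches only indices below \<open>p\<close>, and the upper
  half is exact. The size \<open>2 p\<close> therefore suffices.\<close>

lemma negacyclic_upper_coeff:
  fixes x y r :: "'k::field poly"
  assumes r: "[r = x * y] (mod mu (2 * p))" "degree r < 2 * p" and p: "0 < p" "j < p"
    and x: "\<And>i. p \<le> i \<Longrightarrow> coeff x i = 0" and y: "\<And>i. 2 * p \<le> i \<Longrightarrow> coeff y i = 0"
  shows "coeff r (p + j) = (\<Sum>i<p. coeff x i * coeff y (p + j - i))"
proof -
  define lo where "lo = (\<Sum>k<2 * p. monom (coeff (x * y) k) k)"
  define hi where "hi = (\<Sum>k<p. monom (coeff (x * y) (2 * p + k)) k)"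
  have clo: "coeff lo k = (if k < 2 * p then coeff (x * y) k else 0)" for k
    by (auto simp: lo_def coeff_sum)
  have chi: "coeff hi k = (if k < p then coeff (x * y) (2 * p + k) else 0)" for k
    by (auto simp: hi_def coeff_sum)
  have high: "coeff (x * y) k = 0" if "3 * p \<le> Suc k" for k
    unfolding coeff_mult
  proof (rule sum.neutral, intro ballI)
    fix i assume "i \<in> {..k}"
    then show "coeff x i * coeff y (k - i) = 0"
      using x[of i] y[of "k - i"] that by (cases "p \<le> i") auto
  qed
  have "x * y = lo + xp (2 * p) * hi"
  proof (rule poly_eqI)
    fix k
    have "coeff (xp (2 * p) * hi) k = (if k < 2 * p then 0 else coeff hi (k - 2 * p))"
      by (simp add: coeff_monom_mult)
    then show "coeff (x * y) k = coeff (lo + xp (2 * p) * hi) k"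
      using high[of k] by (auto simp: clo chi)
  qed
  then have "[x * y = lo - hi] (mod mu (2 * p))"
    by (intro cong_mu_I[of _ _ _ hi]) (simp add: mu_def algebra_simps)
  with r(1) have c: "[r = lo - hi] (mod mu (2 * p))" by (rule cong_trans)
  have "degree (lo - hi) < 2 * p"
    using p by (intro degree_lessI) (auto simp: clo chi)
  from cong_mu_eq[OF c r(2) this] have "r = lo - hi" .
  then have "coeff r (p + j) = coeff (x * y) (p + j)"
    using p by (simp add: clo chi)
  also have "\<dots> = (\<Sum>i\<le>p + j. coeff x i * coeff y (p + j - i))"
    by (rule coeff_mult)
  also have "\<dots> = (\<Sum>i<p. coeff x i * coeff y (p + j - i))"
    by (rule sum.mono_neutral_right) (auto simp: x)
  finally show ?thesis .
qed

text \<open>Without bit operations, the highest power of two is subtracted again and again; the last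
  one subtracted is the lowest set bit. The time, quadratic in the number of bits, is dominated by
  the multiplication of the block.\<close>

definition find_lpw :: com where
  "find_lpw = Instrs (mov 50 16 @ [IConst 53 0]) ;;
    While 53 50 (
      Instrs ([IConst 11 1, IConst 51 2] @ mov 52 50 @ inc 52) ;;
      While 51 52 (Instrs [IAdd 11 11 11, IAdd 51 11 11]) ;;
      Instrs [ISub 50 50 11])"

lemma wr_find_lpw [simp]: "wr find_lpw = {11, 50, 51, 52, 53, 99}"
  by (auto simp: find_lpw_def)

lemma top_bit: "0 < (y::nat) \<Longrightarrow> \<exists>b. 2 ^ b \<le> y \<and> y < 2 * 2 ^ b"
  using ex_power_ivl1[of 2 y] by auto

lemma find_lpw_spec:
  assumes x: "i 16 = x" "0 < x" "x < 2 ^ s"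
  shows "wp find_lpw (\<lambda>i' f' t'. i' 11 = lpw x \<and> f' = f \<and> t' \<le> t + 20 * (Suc s * Suc s)) i f t"
proof -
  define body where "body = Instrs ([IConst 11 1, IConst 51 2] @ mov 52 50 @ inc 52) ;;
      While 51 52 (Instrs [IAdd 11 11 11, IAdd 51 11 11]) ;;
      Instrs [ISub 50 50 11]"
  have wb: "wr body = {11, 50, 51, 52, 99}" by (auto simp: body_def)
  have step: "wp body (\<lambda>i' f' t'. i' 11 = 2 ^ b \<and> i' 50 = y - 2 ^ b \<and> f' = f \<and> t' \<le> tt + 4 * b + 8) ii f tt"
    if y: "ii 50 = y" "2 ^ b \<le> y" "y < 2 * 2 ^ b" for ii tt y b
  proof -
    have W: "wp (While 51 52 (Instrs [IAdd 11 11 11, IAdd 51 11 11]))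
      (\<lambda>i' f' t'. i' 11 = 2 ^ b \<and> i' 50 = y \<and> f' = f \<and> t' \<le> tt + 4 * b + 7)
      (ii(11 := Suc 0, 51 := 2, 99 := Suc 0, 52 := Suc y)) f (Suc (Suc (Suc (Suc (Suc (Suc tt))))))"
    proof (rule wp_while[where n = b and I = "\<lambda>k i' f' t'. i' 11 = 2 ^ k \<and> i' 51 = 2 * 2 ^ k \<and> f' = f \<and>
        t' \<le> tt + 6 + 4 * k"], goal_cases)
      case 1
      then show ?case by simp
    next
      case (2 k i' f' t')
      have "(2::nat) ^ Suc k \<le> 2 ^ b" by (rule power_increasing) (use 2(1) in auto)
      then have "2 * 2 ^ k < Suc y" using y(2) by simp
      then show ?case using 2(2) 2(3)[of 52] by simp
    next
      case (3 i' f' t')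
      then show ?case using 3(2)[of 52] 3(2)[of 50] y by simp
    qed
    show ?thesis
      unfolding body_def using y(1) by simp (rule wp_conseq[OF W], simp)
  qed
  \<comment> \<open>The number of rounds is the number of set bits, so the loop is unrolled by
    induction on the remainder \<open>y\<close> instead. That \<open>2^r\<close> divides
    \<open>x - y\<close> says that only bits from \<open>r\<close> on have been removed, and
    \<open>r (4 s + 14)\<close> is the time reserved for the bits below.\<close>
  have W: "wp (While 53 50 body) (\<lambda>i' f' t'. i' 11 = lpw x \<and> f' = f \<and> t' \<le> t + 20 * (Suc s * Suc s))
      i0 f0 t0"
    if "i0 50 = y" "i0 53 = 0" "f0 = f" "y < 2 ^ r" "r \<le> s" "t0 + r * (4 * s + 14) \<le> t + 3 + s * (4 * s + 14)"
      "y = 0 \<and> i0 11 = lpw x \<or> 0 < y \<and> y \<le> x \<and> 2 ^ r dvd x - y" for y r i0 f0 t0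
    using that
  proof (induction y arbitrary: r i0 f0 t0 rule: less_induct)
    case (less y)
    show ?case
    proof (cases "y = 0")
      case True
      have "3 + s * (4 * s + 14) + 1 \<le> 20 * (Suc s * Suc s)" by (simp add: algebra_simps)
      then show ?thesis
        using less.prems True by (intro wp_while[where n = 0 and I = "\<lambda>_ i' f' t'. i' = i0 \<and> f' = f0 \<and> t' = t0"]) auto
    next
      case False
      then obtain b where b: "2 ^ b \<le> y" "y < 2 * 2 ^ b" using top_bit by blast
      have "(2::nat) ^ b < 2 ^ r" using b(1) less.prems(4) by linarith
      then have br: "b < r" by simp
      have xy: "y \<le> x" "2 ^ r dvd x - y" using less.prems(7) False by auto
      have "2 * 2 ^ b dvd (2::nat) ^ r" using le_imp_power_dvd[of "Suc b" r 2] br by simp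
      then have "2 * 2 ^ b dvd x - y" using xy(2) dvd_trans by blast
      then obtain z where z: "x - y = 2 * 2 ^ b * z" by blast
      have "wp (While 53 50 body) (\<lambda>i' f' t'. i' 11 = lpw x \<and> f' = f \<and> t' \<le> t + 20 * (Suc s * Suc s)) i1 f1 (Suc t1)"
        if p: "i1 11 = 2 ^ b \<and> i1 50 = y - 2 ^ b \<and> f1 = f \<and> t1 \<le> Suc t0 + 4 * b + 8" and fr: "i1 53 = i0 53"
        for i1 f1 t1
      proof (rule less.IH[where r = b])
        show "y - 2 ^ b < y" "y - 2 ^ b < 2 ^ b" using b by simp_all
        show "b \<le> s" using br less.prems(5) by simp
        show "Suc t1 + b * (4 * s + 14) \<le> t + 3 + s * (4 * s + 14)"
        proof -
          have "Suc b * (4 * s + 14) \<le> r * (4 * s + 14)" using br by (intro mult_le_mono1) simp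
          then show ?thesis using p less.prems(5,6) br by simp
        qed
        show "y - 2 ^ b = 0 \<and> i1 11 = lpw x \<or> 0 < y - 2 ^ b \<and> y - 2 ^ b \<le> x \<and> 2 ^ b dvd x - (y - 2 ^ b)"
        proof (cases "y = 2 ^ b")
          case True
          have "x = 2 ^ b * (2 * z + 1)" using z xy(1) True by (simp add: algebra_simps)
          then have "lpw x = 2 ^ b" using lpw_odd_mult by metis
          then show ?thesis using p True by simp
        next
          case False
          have "x - (y - 2 ^ b) = 2 ^ b * (2 * z + 1)" using z b(1) xy(1) by (simp add: algebra_simps)
          then show ?thesis using False b(1) xy(1) by simp
        qed
      qed (use p fr less.prems in simp_all)
      note next_step = this
      show ?thesis
      proof -
        have "wp body (\<lambda>i1 f1 t1. wp (While 53 50 body)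
          (\<lambda>i' f' t'. i' 11 = lpw x \<and> f' = f \<and> t' \<le> t + 20 * (Suc s * Suc s)) i1 f1 (Suc t1)) i0 f0 (Suc t0)"
          unfolding less.prems(3)
        proof (rule wp_conseq[OF step[where ii = i0 and y = y and b = b and tt = "Suc t0", OF less.prems(1) b]], goal_cases)
          case (1 i1 f1 t1)
          show ?case by (rule next_step[OF 1(1)]) (use 1(2)[of 53] wb in simp)
        qed
        then obtain i1 f1 u where r1: "run body i0 f0 u i1 f1" and
          w1: "wp (While 53 50 body) (\<lambda>i' f' t'. i' 11 = lpw x \<and> f' = f \<and> t' \<le> t + 20 * (Suc s * Suc s)) i1 f1 (Suc (Suc t0 + u))"
          unfolding wp_def[of body] by blast
        then obtain i2 f2 v where r2: "run (While 53 50 body) i1 f1 v i2 f2" and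
          q: "i2 11 = lpw x \<and> f2 = f \<and> Suc (Suc t0 + u) + v \<le> t + 20 * (Suc s * Suc s)"
          unfolding wp_def by blast
        have "i0 53 < i0 50" using less.prems False by simp
        from run_loop[OF this r1 r2] q show ?thesis
          unfolding wp_def by (intro exI[of _ i2] exI[of _ f2] exI[of _ "u + v + 2"]) simp
      qed
    qed
  qed
  have "wp (While 53 50 body) (\<lambda>i' f' t'. i' 11 = lpw x \<and> f' = f \<and> t' \<le> t + 20 * (Suc s * Suc s))
      (i(50 := x, 53 := 0)) f (Suc (Suc (Suc t)))"
    by (rule W[where y = x and r = s]) (use x in simp_all)
  then show ?thesis
    unfolding find_lpw_def body_def using x(1) by simp
qed

text \<open>Register 13 holds the address of the coefficients \<open>a\<close>, register 14 that of the result, register 15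
  that of the accumulators, and register 16 the loop counter \<open>x\<close>, whose value as a field element
  is in the cell addressed by register 17.\<close>

definition exp_block :: com where
  "exp_block = find_lpw ;;
     Instrs ([IAdd 22 11 11, IAdd 50 14 16, ISub 50 50 11, IAdd 51 12 11, IAdd 52 12 22]) ;;
     arr op_copy 12 50 50 11 ;; arr op_zero 51 51 51 11 ;; arr op_copy 52 13 13 22 ;;
     mult ;;
     Instrs [IAdd 50 15 16, IAdd 51 20 11] ;;
     arr op_add 50 50 51 11"

definition exp_step :: com where
  "exp_step = exp_block ;;
     Instrs [FAdd 17 17 18, IAdd 50 15 16, IAdd 51 14 16, FDiv 51 50 17] ;; Instrs (inc 16)"

definition exp_prog :: com where
  "exp_prog = Instrs [IAdd 50 8 8] ;; arr op_zero 15 15 15 50 ;;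
     Instrs [FZero 17, FOne 14, IConst 16 1] ;; While 16 8 exp_step"

lemma wr_exp_step: "r \<in> wr exp_step \<Longrightarrow> r = 11 \<or> r = 16 \<or> 20 \<le> r"
  using wr_mult[of r] by (auto simp: exp_step_def exp_block_def)

text \<open>Every factor taken from the result has index below \<open>x\<close> and is thus already
  known, and the indices of \<open>a\<close> run from 1 to \<open>2 p - 1\<close>: exactly the
  situation of the middle product with factors of lengths \<open>p\<close> and
  \<open>2 p\<close>.\<close>

lemma exp_block_spec:
  fixes f :: "nat \<Rightarrow> 'k::field_char_0"
  assumes regs: "i 12 = U" "i 13 = a" "i 14 = e" "i 15 = acc" "i 16 = x"
    and half: "f (i 10) + f (i 10) = 1" "i 10 < U"
    and x: "0 < x" "x < 2 ^ s" "x < N"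
    and lay: "a + 2 * N \<le> U" "e + N \<le> U" "acc + 2 * N \<le> U"
    and p: "p = lpw x"
  shows "wp exp_block (\<lambda>i' f' t'.
    (\<forall>j<p. f' (acc + x + j) = f (acc + x + j) + (\<Sum>k<p. f (e + (x - p) + k) * f (a + (p + j - k)))) \<and>
    (\<forall>y<U. (y < acc + x \<or> acc + x + p \<le> y) \<longrightarrow> f' y = f y) \<and>
    (\<forall>r<20. r \<noteq> 11 \<longrightarrow> i' r = i r) \<and>
    t' \<le> t + 30000 * (Suc (Suc s) * Suc (Suc s) * p)) i f t"
proof -
  obtain v where v: "p = 2 ^ v" using lpw_power[of x] p by auto
  have px: "p \<le> x" "0 < p" using lpw_le[OF x(1)] p by auto
  have vs: "v < s"
  proof -
    have "(2::nat) ^ v < 2 ^ s" using px(1) x(2) unfolding v by linarith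
    then show ?thesis by simp
  qed
  have p2: "p + p = 2 ^ Suc v" by (simp add: v)
  define Q where "Q = (\<lambda>i' f' t'.
    (\<forall>j<p. f' (acc + x + j) = f (acc + x + j) + (\<Sum>k<p. f (e + (x - p) + k) * f (a + (p + j - k)))) \<and>
    (\<forall>y<U. (y < acc + x \<or> acc + x + p \<le> y) \<longrightarrow> f' y = f y) \<and>
    (\<forall>r<20. r \<noteq> (11::nat) \<longrightarrow> i' r = (i r :: nat)) \<and>
    t' \<le> t + 30000 * (Suc (Suc s) * Suc (Suc s) * p))"
  define K3 where "K3 = wp (Instrs [IAdd 50 15 16, IAdd 51 20 11]) (wp (arr op_add 50 50 51 11) Q)"
  define K2 where "K2 = wp (arr op_copy 12 50 50 11) (wp (arr op_zero 51 51 51 11) (wp (arr op_copy 52 13 13 22) (wp mult K3)))"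
  define K1 where "K1 = wp (Instrs ([IAdd 22 11 11, IAdd 50 14 16, ISub 50 50 11, IAdd 51 12 11, IAdd 52 12 22])) K2"
  have "wp find_lpw K1 i f t"
  proof (rule wp_conseq[OF find_lpw_spec[of i x s, OF regs(5) x(1,2)]], goal_cases)
    case (1 i1 f1 t1)
    define i2 where "i2 = i1(22 := p + p, 50 := e + (x - p), 51 := U + p, 52 := U + (p + p))"
    have f1: "f1 = f" and t1: "t1 \<le> t + 20 * (Suc s * Suc s)" using 1(1) by auto
    have i1: "i1 r = i r" if "r < 20" "r \<noteq> 11" for r using 1(2)[of r] that by simp
    have i2: "i2 22 = p + p" "i2 50 = e + (x - p)" "i2 51 = U + p" "i2 52 = U + (p + p)" "i2 11 = p" "i2 12 = U" "i2 13 = a"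
      using 1(1) i1 regs p by (simp_all add: i2_def)
    have i2r: "i2 r = i r" if "r < 20" "r \<noteq> 11" for r using i1[OF that] that by (simp add: i2_def)
    have "K2 i2 f (Suc (Suc (Suc (Suc (Suc t1)))))"
      unfolding K2_def
    proof (rule wp_conseq[OF arr_specs(1)[OF _ _ _ _ _ _ refl]], goal_cases)
      case (7 i3 f3 t3)
      have f3: "f3 = upd_arr f U p (\<lambda>k. f (e + (x - p) + k))" and t3: "t3 \<le> t1 + 5 + 12 * p + 10"
        using 7(1) i2 by simp_all
      have i3: "i3 22 = p + p" "i3 51 = U + p" "i3 52 = U + (p + p)" "i3 11 = p" "i3 13 = a"
        using 7(2) i2 by simp_all
      have i3r: "i3 r = i r" if "r < 20" "r \<noteq> 11" for r using 7(2)[of r] i2r[OF that] that by simp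
      show ?case
      proof (rule wp_conseq[OF arr_specs(2)[OF _ _ _ _ _ _ refl]], goal_cases)
        case (7 i4 f4 t4)
        have f4: "f4 = upd_arr f3 (U + p) p (\<lambda>k. 0)" and t4: "t4 \<le> t3 + 12 * p + 10"
          using 7(1) i3 by simp_all
        have i4: "i4 22 = p + p" "i4 52 = U + (p + p)" "i4 11 = p" "i4 13 = a"
          using 7(2) i3 by simp_all
        have i4r: "i4 r = i r" if "r < 20" "r \<noteq> 11" for r using 7(2)[of r] i3r[OF that] that by simp
        show ?case
        proof (rule wp_conseq[OF arr_specs(1)[OF _ _ _ _ _ _ refl]], goal_cases)
          case 5 show ?case using i4 lay px x by simp
        next
          case 6 show ?case using i4 lay px x by simp
        next
          case (7 i5 f5 t5)
          have f5: "f5 = upd_arr f4 (U + (p + p)) (p + p) (\<lambda>k. f4 (a + k))" and t5: "t5 \<le> t4 + 24 * p + 10"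
            using 7(1) i4 by simp_all
          have i5: "i5 22 = p + p" "i5 11 = p" using 7(2) i4 by simp_all
          have i5r: "i5 r = i r" if "r < 20" "r \<noteq> 11" for r using 7(2)[of r] i4r[OF that] that by simp
          have low: "f5 y = f y" if "y < U" for y
            using that by (simp add: f5 f4 f3 upd_arr_outside)
          define X where "X = pol f5 U (2 * p)"
          define Y where "Y = pol f5 (U + 2 * p) (2 * p)"
          have X: "coeff X k = (if k < p then f (e + (x - p) + k) else 0)" for k
          proof -
            have "f5 (U + k) = f4 (U + k)" if "k < 2 * p" for k
              unfolding f5 by (rule upd_arr_outside) (use that in simp)
            moreover have "f4 (U + k) = (if k < p then f (e + (x - p) + k) else 0)" if "k < 2 * p" for k
              using that by (auto simp: f4 f3 upd_arr_def)
            ultimately show ?thesis by (auto simp: X_def coeff_pol)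
          qed
          have Y: "coeff Y k = f (a + k)" if "k < 2 * p" for k
          proof -
            have "f5 (U + (p + p) + k) = f4 (a + k)"
              unfolding f5 by (rule upd_arr_inside) (use that in simp)
            moreover have "f4 (a + k) = f (a + k)"
              unfolding f4 f3 using that lay px x by (simp add: upd_arr_outside)
            ultimately show ?thesis using that by (simp add: Y_def coeff_pol mult_2)
          qed
          show ?case
          proof (rule wp_conseq[OF mult_spec[where s = "Suc v" and U = U]], goal_cases)
            case 1 show ?case using i5 p2 by simp
          next
            case 2 show ?case using i5r[of 12] regs by simp
          next
            case 3 show ?case using i5r[of 10] half low by simp
          next
            case 4 show ?case using i5r[of 10] half by simp
          next
            case (5 i6 f6 t6)
            have i6: "i6 r = i r" if "r < 20" "r \<noteq> 11" for r using 5(1) i5r[OF that] that by simp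
            have i611: "i6 11 = p" using 5(1) i5 by simp
            define c where "c = i6 20"
            have cU: "U \<le> c" using 5(1) by (simp add: c_def)
            have f6: "f6 y = f y" if "y < U" for y using 5(1) low that by simp
            define R where "R = pol f6 c (2 * p)"
            have RXY: "[R = X * Y] (mod mu (2 * p))"
              using 5(1) unfolding R_def X_def Y_def c_def mult_2 p2 by blast
            have R: "f6 (c + p + j) = (\<Sum>k<p. f (e + (x - p) + k) * f (a + (p + j - k)))" if j: "j < p" for j
            proof -
              have "f6 (c + p + j) = coeff R (p + j)"
                using j by (simp add: R_def coeff_pol add_ac)
              also have "\<dots> = (\<Sum>i<p. coeff X i * coeff Y (p + j - i))"
                by (rule negacyclic_upper_coeff[OF RXY _ px(2) j])
                  (use px in \<open>auto simp: R_def X Y_def coeff_pol degree_pol\<close>)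
              also have "\<dots> = (\<Sum>k<p. f (e + (x - p) + k) * f (a + (p + j - k)))"
                by (rule sum.cong) (use j in \<open>auto simp: X Y\<close>)
              finally show ?thesis .
            qed
            have t6: "t6 \<le> t5 + 10000 * (Suc (Suc v) * Suc (Suc v) * (p + p))"
              using 5(1) unfolding p2 by blast
            have "wp (arr op_add 50 50 51 11) Q (i6(50 := acc + x, 51 := c + p)) f6 (Suc (Suc t6))"
            proof (rule wp_conseq[OF arr_specs(3)[OF _ _ _ _ _ _ refl]], goal_cases)
              case 6 show ?case using cU lay px x i611 by simp
            next
              case (7 i7 f7 t7)
              have f7: "f7 = upd_arr f6 (acc + x) p (\<lambda>k. f6 (acc + x + k) + f6 (c + p + k))"
                and t7: "t7 \<le> t6 + 2 + 12 * p + 10"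
                using 7(1) i611 by simp_all
              have "t7 \<le> t + 30000 * (Suc (Suc s) * Suc (Suc s) * p)"
              proof -
                have "Suc (Suc v) * Suc (Suc v) * (p + p) \<le> Suc s * Suc s * (p + p)"
                  using vs by (intro mult_le_mono) auto
                moreover have "Suc s * Suc s * (p + p) \<le> 2 * (Suc (Suc s) * Suc (Suc s) * p)"
                  by (simp add: algebra_simps)
                moreover have "Suc s * Suc s * 1 \<le> Suc (Suc s) * Suc (Suc s) * p"
                  using px(2) by (intro mult_le_mono) auto
                moreover have "4 * p \<le> Suc (Suc s) * Suc (Suc s) * p"
                  by (simp add: algebra_simps)
                ultimately show ?thesis using t1 t3 t4 t5 t6 t7 px(2) by linarith
              qed
              moreover have "f7 (acc + x + j) = f (acc + x + j) + (\<Sum>k<p. f (e + (x - p) + k) * f (a + (p + j - k)))"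
                if j: "j < p" for j
              proof -
                have "f7 (acc + x + j) = f6 (acc + x + j) + f6 (c + p + j)"
                  unfolding f7 by (rule upd_arr_inside[OF j])
                moreover have "acc + x + j < U" using j px x lay by simp
                ultimately show ?thesis using f6 R[OF j] by simp
              qed
              moreover have "f7 y = f y" if "y < U" "y < acc + x \<or> acc + x + p \<le> y" for y
                using that f6 by (simp add: f7 upd_arr_outside)
              moreover have "i7 r = i r" if "r < 20" "r \<noteq> 11" for r
                using 7(2)[of r] i6[OF that] that by simp
              ultimately show ?case unfolding Q_def by blast
            qed simp_all
            then show ?case
              unfolding K3_def using i6[of 15] i6[of 16] i611 regs by (simp add: c_def)
          qed
        qed simp_all
      qed (use i3 in simp_all)
    qed (use i2 lay px x in auto)
    then show ?case
      unfolding K1_def using 1(1) i1 regs p px f1 by (simp add: i2_def)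
  qed
  then show ?thesis
    unfolding K1_def K2_def K3_def Q_def exp_block_def wp_Seq .
qed

lemma sum_split_lessThan: "(\<Sum>k<a + b. g k) = (\<Sum>k<a. g k) + (\<Sum>k<b. g (a + k :: nat) :: 'a::comm_monoid_add)"
  by (induction b) (simp_all add: add_ac)

text \<open>The blocks up to \<open>x\<close> have supplied entry \<open>x\<close> with all its
  terms, as \<open>added x x = x\<close>, so dividing by \<open>x\<close> completes it. The time is
  governed by the sum of the block lengths, bounded by \<open>lpw_sum\<close>.\<close>

lemma exp_prog_spec:
  fixes f :: "nat \<Rightarrow> 'k::field_char_0"
  assumes regs: "i 8 = N" "i 12 = U" "i 13 = a" "i 14 = e" "i 15 = acc" "i 17 = fc"
    and half: "f (i 10) + f (i 10) = 1" and one: "f (i 18) = 1"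
    and cells: "i 10 < a" "i 18 < a" "fc < a" "fc \<noteq> i 10" "fc \<noteq> i 18"
    and lay: "a + 2 * N \<le> e" "e + N \<le> acc" "acc + 2 * N \<le> U" and N: "1 \<le> N" "N \<le> 2 ^ s"
  shows "wp exp_prog (\<lambda>i' f' t'.
    (\<forall>n<N. f' (e + n) = exp_seq (\<lambda>q. f (a + q)) n) \<and> i' 14 = e \<and>
    t' \<le> t + 40000 * (Suc (Suc s) * Suc (Suc s) * Suc (Suc s) * 2 ^ s)) i f t"
proof -
  define A where "A = (\<lambda>q. f (a + q))"
  define E where "E = exp_seq A"
  define S where "S = Suc (Suc s) * Suc (Suc s)"
  have S1: "4 \<le> S" by (simp add: S_def)
  define Q where "Q = (\<lambda>i' f' t'. (\<forall>n<N. f' (e + n) = E n) \<and> i' (14::nat) = e \<and>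
    t' \<le> t + 40000 * (Suc (Suc s) * Suc (Suc s) * Suc (Suc s) * 2 ^ s))"
  define W where "W = (\<lambda>x. \<Sum>y<x. if y = 0 then 0 else 30010 * (S * lpw y))"
  \<comment> \<open>Accumulators up to \<open>2 N\<close> are tracked because a block that begins
    below \<open>N\<close> has length at most its start and may reach that far.\<close>
  define I where "I = (\<lambda>k i' f' t'. let x = Suc k in (\<forall>j<x. f' (e + j) = E j) \<and>
    (\<forall>m. x \<le> m \<longrightarrow> m < 2 * N \<longrightarrow> f' (acc + m) = (\<Sum>j<added k m. A (m - j) * E j)) \<and>
    f' fc = of_nat k \<and> (\<forall>y<e. y \<noteq> fc \<longrightarrow> f' y = f y) \<and> i' 16 = x \<and>
    (\<forall>r<20. r \<noteq> 11 \<longrightarrow> r \<noteq> 16 \<longrightarrow> i' r = i r) \<and> t' \<le> t + 24 * N + 20 + W x)"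
  have wN: "(if y = 0 then 0 else 30010 * (S * lpw y)) = 30010 * S * (if y = 0 then 0 else lpw y)" for y
    by simp
  have WN: "W N \<le> 30010 * (S * (s * 2 ^ s))"
  proof -
    have "W N \<le> W (2 ^ s)" unfolding W_def by (rule sum_mono2) (use N in auto)
    also have "\<dots> = 30010 * S * (\<Sum>y<2 ^ s. if y = 0 then 0 else lpw y)"
      unfolding W_def wN sum_distrib_left ..
    also have "\<dots> \<le> 30010 * S * (s * 2 ^ s)" by (intro mult_le_mono2 lpw_sum)
    finally show ?thesis by simp
  qed
  have loop: "wp (While 16 8 exp_step) Q i0 f0 t0" if I0: "I 0 i0 f0 t0" for i0 f0 t0
  proof (rule wp_while[where n = "N - 1" and I = I], goal_cases)
    case 1
    show ?case by (rule I0)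
  next
    case (2 k i1 f1 t1)
    define x where "x = Suc k"
    note p = 2(2)[unfolded I_def Let_def, folded x_def]
    define q where "q = lpw x"
    have x: "0 < x" "x < N" using 2(1) by (auto simp: x_def)
    have qx: "q \<le> x" "0 < q" using lpw_le[OF x(1)] by (auto simp: q_def)
    have ir: "i1 r = i r" if "r < 20" "r \<noteq> 11" "r \<noteq> 16" for r using p that by simp
    have "wp exp_block (\<lambda>i' f' t'.
      (\<forall>j<q. f' (acc + x + j) = f1 (acc + x + j) + (\<Sum>k<q. f1 (e + (x - q) + k) * f1 (a + (q + j - k)))) \<and>
      (\<forall>y<U. (y < acc + x \<or> acc + x + q \<le> y) \<longrightarrow> f' y = f1 y) \<and>
      (\<forall>r<20. r \<noteq> 11 \<longrightarrow> i' r = i1 r) \<and>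
      t' \<le> Suc t1 + 30000 * (Suc (Suc s) * Suc (Suc s) * q)) i1 f1 (Suc t1)"
      by (rule exp_block_spec[OF _ _ _ _ _ _ _ x(1) _ x(2)])
        (use p ir regs half cells lay x N in \<open>auto simp: q_def\<close>)
    then have "wp exp_step (\<lambda>i f t. I (Suc k) i f (Suc t)) i1 f1 (Suc t1)"
      unfolding exp_step_def wp_Seq
    proof (rule wp_conseq, goal_cases)
      case (1 i2 f2 t2)
      have i2r: "i2 r = i r" if "r < 20" "r \<noteq> 11" "r \<noteq> 16" for r using 1(1) ir that by simp
      have i2: "i2 16 = x" using 1(1) p by simp
      have f2: "f2 y = f1 y" if "y < U" "y < acc + x \<or> acc + x + q \<le> y" for y using 1(1) that by blast
      \<comment> \<open>Inside the block, \<open>added_before\<close> says that the terms below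
        \<open>x - q\<close> are present; the product contributes precisely the next
        \<open>q\<close>.\<close>
      have acc2: "f2 (acc + m) = (\<Sum>j<added x m. A (m - j) * E j)" if m: "x \<le> m" "m < 2 * N" for m
      proof (cases "m < x + q")
        case True
        define j where "j = m - x"
        have j: "j < q" "m = x + j" using m True by (auto simp: j_def)
        have "f2 (acc + m) = f1 (acc + m) + (\<Sum>k<q. f1 (e + (x - q) + k) * f1 (a + (q + j - k)))"
          using 1(1) j by (simp add: add.assoc)
        also have "f1 (acc + m) = (\<Sum>j<x - q. A (m - j) * E j)"
          using p m added_before[of x m] x True by (simp add: x_def q_def)
        also have "(\<Sum>k<q. f1 (e + (x - q) + k) * f1 (a + (q + j - k))) = (\<Sum>k<q. A (m - (x - q + k)) * E (x - q + k))"
        proof (rule sum.cong[OF refl])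
          fix l assume "l \<in> {..<q}"
          then have l: "l < q" by simp
          have ej: "f1 (e + j) = E j" if "j < x" for j using p that by blast
          have "f1 (e + (x - q + l)) = E (x - q + l)" by (rule ej) (use l qx in simp)
          moreover have "f1 (a + (q + j - l)) = A (q + j - l)"
            using p lay cells l j x qx by (simp add: A_def)
          moreover have "m - (x - q + l) = q + j - l" using l j qx by simp
          ultimately show "f1 (e + (x - q) + l) * f1 (a + (q + j - l)) = A (m - (x - q + l)) * E (x - q + l)"
            by (simp add: add.assoc mult.commute)
        qed
        also have "(\<Sum>j<x - q. A (m - j) * E j) + (\<Sum>k<q. A (m - (x - q + k)) * E (x - q + k)) =
          (\<Sum>j<x. A (m - j) * E j)"
          using sum_split_lessThan[of "\<lambda>j. A (m - j) * E j" "x - q" q] qx by simp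
        finally show ?thesis using True by (simp add: added_step[OF x(1)] q_def)
      next
        case False
        then have "f2 (acc + m) = f1 (acc + m)" using m lay by (intro f2) auto
        then show ?thesis using p m False by (simp add: added_step[OF x(1)] q_def x_def)
      qed
      have cellU: "fc < U" "i 18 < U" "fc < acc" "i 18 < acc" "fc < e" "i 18 < e" using cells lay by auto
      have fc2: "f2 fc = of_nat k" "f2 (i 18) = 1"
        using f2[of fc] f2[of "i 18"] cellU p cells one by auto
      have accx: "f2 (acc + x) = (\<Sum>j<x. A (x - j) * E j)"
        using acc2[of x] x by (simp add: added_step[OF x(1)])
      have Ex: "f2 (acc + x) / of_nat x = E x"
        unfolding accx E_def by (subst (2) exp_seq.simps) (use x in simp)
      define f3 where "f3 = f2(fc := of_nat x, e + x := f2 (acc + x) / of_nat x)"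
      have ne: "e + x \<noteq> fc" "acc + x \<noteq> fc" using cellU by auto
      have "I (Suc k) (i2(50 := acc + x, 51 := e + x, 99 := Suc 0, 16 := Suc x)) f3 (Suc (Suc (Suc (Suc (Suc (Suc (Suc t2)))))))"
        unfolding I_def Let_def x_def[symmetric]
      proof (intro conjI allI impI)
        fix j assume j: "j < Suc x"
        show "f3 (e + j) = E j"
        proof (cases "j = x")
          case False
          then have jx: "j < x" using j by simp
          have "f2 (e + j) = f1 (e + j)" by (rule f2) (use jx x lay in auto)
          then show ?thesis using p jx cellU by (simp add: f3_def)
        qed (simp add: f3_def Ex)
      next
        fix m assume m: "Suc x \<le> m" "m < 2 * N"
        have "acc + m \<noteq> e + x" "acc + m \<noteq> fc" using lay x cellU by auto
        then show "f3 (acc + m) = (\<Sum>j<added x m. A (m - j) * E j)"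
          using acc2[of m] m by (simp add: f3_def)
      next
        fix y assume y: "y < e" "y \<noteq> fc"
        have "f2 y = f1 y" by (rule f2) (use y lay in auto)
        then show "f3 y = f y" using p y by (simp add: f3_def)
      next
        have "t2 \<le> Suc t1 + 30000 * (S * q)" using 1(1) by (simp add: S_def)
        moreover have "W (Suc x) = W x + 30010 * (S * q)" using x by (simp add: W_def q_def)
        moreover have "1 * 4 \<le> S * q" using S1 qx(2) by (metis Suc_leI mult_le_mono One_nat_def mult.commute)
        ultimately show "Suc (Suc (Suc (Suc (Suc (Suc (Suc t2)))))) \<le> t + 24 * N + 20 + W (Suc x)" using p by linarith
      next
        show "f3 fc = of_nat x" using ne by (simp add: f3_def)
      qed (use i2r in auto)
      moreover have "of_nat x \<noteq> (0 :: 'k)" using x by simp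
      moreover have "of_nat k + (1 :: 'k) = of_nat x" by (simp add: x_def)
      ultimately show ?case
        using i2r[of 17] i2r[of 18] i2r[of 14] i2r[of 15] regs i2 fc2 ne by (simp add: f3_def)
    qed
    then show ?case using p ir[of 8] regs x by simp
  next
    case (3 i1 f1 t1)
    have "Suc (N - 1) = N" using N by simp
    note p = 3(1)[unfolded I_def Let_def this]
    have "24 * N + 21 + W N \<le> 40000 * (Suc (Suc s) * Suc (Suc s) * Suc (Suc s) * 2 ^ s)"
    proof -
      have "S * (s * 2 ^ s) + S * (2 * 2 ^ s) = Suc (Suc s) * Suc (Suc s) * Suc (Suc s) * 2 ^ s"
        by (simp add: S_def algebra_simps)
      moreover have "4 * (1 * 2 ^ s) \<le> S * (2 * 2 ^ s)" using S1 by (intro mult_le_mono) auto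
      moreover have "(1::nat) \<le> 2 ^ s" by simp
      ultimately show ?thesis using WN N(2) by linarith
    qed
    then show ?case using p regs N by (simp add: Q_def)
  qed
  have "wp (arr op_zero 15 15 15 50) (wp (Instrs [FZero 17, FOne 14, IConst 16 1]) (wp (While 16 8 exp_step) Q))
      (i(50 := N + N)) f (Suc t)"
  proof (rule wp_conseq[OF arr_specs(2)[OF _ _ _ _ _ _ refl]], goal_cases)
    case (7 i1 f1 t1)
    have f1: "f1 = upd_arr f acc (N + N) (\<lambda>k. 0)" and t1: "t1 \<le> t + 24 * N + 11" using 7(1) regs by simp_all
    have i1: "i1 r = i r" if "r < 20" for r using 7(2)[of r] that by simp
    have "I 0 (i1(16 := Suc 0)) (f1(fc := 0, e := 1)) (Suc (Suc (Suc t1)))"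
      unfolding I_def Let_def
    proof (intro conjI allI impI)
      fix m assume "Suc 0 \<le> m" "m < 2 * N"
      then show "(f1(fc := 0, e := 1)) (acc + m) = (\<Sum>j<added 0 m. A (m - j) * E j)"
        using lay cells by (simp add: f1 upd_arr_inside)
    next
      fix y assume "y < e" "y \<noteq> fc"
      then show "(f1(fc := 0, e := 1)) y = f y" using lay by (simp add: f1 upd_arr_outside)
    qed (use lay cells t1 i1 in \<open>auto simp: E_def exp_seq.simps W_def\<close>)
    from loop[OF this] show ?case using i1[of 17] i1[of 14] regs by simp
  qed simp_all
  then have "wp (Instrs [IAdd 50 8 8]) (wp (arr op_zero 15 15 15 50)
      (wp (Instrs [FZero 17, FOne 14, IConst 16 1]) (wp (While 16 8 exp_step) Q))) i f t"
    using regs by simp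
  then show ?thesis
    unfolding exp_prog_def wp_Seq Q_def E_def A_def .
qed

section \<open>Counting walks\<close>

text \<open>The last step is peeled off, with \<open>h\<close> the final altitude. \<open>P\<close>
  is tested at every point but the start, which is why the link to walks assumes
  \<open>P 0\<close>.\<close>

fun count_walks :: "int set \<Rightarrow> (int \<Rightarrow> bool) \<Rightarrow> nat \<Rightarrow> int \<Rightarrow> 'k::comm_ring_1" where
  "count_walks V P 0 h = (if h = 0 then 1 else 0)"
| "count_walks V P (Suc n) h = (if P h then \<Sum>u\<in>V. count_walks V P n (h - u) else 0)"

abbreviation "walkn V \<equiv> count_walks V (\<lambda>_. True)"
abbreviation "meann V \<equiv> count_walks V (\<lambda>h. 0 \<le> h)"

definition altitudes :: "point set \<Rightarrow> int set" where
  "altitudes S = {u. (1, u) \<in> S}"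

lemma step_set_altitudes:
  assumes "step_set S"
  shows "finite (altitudes S)" "S = Pair 1 ` altitudes S"
proof -
  show "S = Pair 1 ` altitudes S"
    using assms by (force simp: step_set_def altitudes_def)
  have "altitudes S \<subseteq> snd ` S" by (force simp: altitudes_def)
  then show "finite (altitudes S)"
    using assms finite_surj by (auto simp: step_set_def)
qed

definition restricted_walks :: "point set \<Rightarrow> (int \<Rightarrow> bool) \<Rightarrow> nat \<Rightarrow> int \<Rightarrow> point list set" where
  "restricted_walks S P n h = {A \<in> walks S n. (\<forall>p\<in>set A. P (snd p)) \<and> final_altitude A = h}"

lemma walks_snoc:
  assumes "length A = Suc n"
  shows "A @ [a] \<in> walks S (Suc n) \<longleftrightarrow> A \<in> walks S n \<and> a - last A \<in> S"
proof -
  have l: "last A = A ! n" using assms by (metis diff_Suc_1 last_conv_nth length_0_conv nat.distinct(1))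
  have n: "{1..Suc n} = insert (Suc n) {1..n}" by auto
  show ?thesis
    using assms unfolding walks_def n by (auto simp: nth_append l)
qed

lemma restricted_walks_Suc:
  assumes "P h"
  shows "restricted_walks S P (Suc n) h =
    (\<Union>s\<in>S. (\<lambda>A. A @ [last A + s]) ` restricted_walks S P n (h - snd s))"
proof (intro set_eqI iffI)
  fix B assume B: "B \<in> restricted_walks S P (Suc n) h"
  then have "length B = Suc (Suc n)" by (simp add: restricted_walks_def walks_def)
  then obtain A a where AB: "B = A @ [a]" "length A = Suc n" by (metis length_Suc_conv_rev)
  have A: "A \<in> walks S n" "a - last A \<in> S" "snd a = h" "\<forall>p\<in>set A. P (snd p)"
    using B walks_snoc[OF AB(2), of a S] by (auto simp: restricted_walks_def AB(1) final_altitude_def)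
  then have "A \<in> restricted_walks S P n (h - snd (a - last A))"
    by (simp add: restricted_walks_def final_altitude_def)
  moreover have "B = A @ [last A + (a - last A)]" by (simp add: AB)
  ultimately show "B \<in> (\<Union>s\<in>S. (\<lambda>A. A @ [last A + s]) ` restricted_walks S P n (h - snd s))"
    using A(2) by blast
next
  fix B assume "B \<in> (\<Union>s\<in>S. (\<lambda>A. A @ [last A + s]) ` restricted_walks S P n (h - snd s))"
  then obtain s A where s: "s \<in> S" "A \<in> restricted_walks S P n (h - snd s)" "B = A @ [last A + s]" by blast
  have "length A = Suc n" using s(2) by (simp add: restricted_walks_def walks_def)
  from walks_snoc[OF this, of "last A + s" S] s assms show "B \<in> restricted_walks S P (Suc n) h"
    by (auto simp: restricted_walks_def final_altitude_def)
qed

lemma restricted_walks_count: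
  assumes S: "step_set S" and P: "P 0"
  shows "finite (restricted_walks S P n h) \<and>
    of_nat (card (restricted_walks S P n h)) = (count_walks (altitudes S) P n h :: 'k::comm_ring_1)"
proof (induction n arbitrary: h)
  case 0
  have "restricted_walks S P 0 h = (if h = 0 then {[(0, 0)]} else {})"
    using P by (auto simp: restricted_walks_def walks_def final_altitude_def length_Suc_conv)
  then show ?case by auto
next
  case (Suc n)
  show ?case
  proof (cases "P h")
    case False
    have "restricted_walks S P (Suc n) h = {}"
    proof -
      have "A \<noteq> []" if "A \<in> walks S (Suc n)" for A using that by (auto simp: walks_def)
      then show ?thesis using False last_in_set by (fastforce simp: restricted_walks_def final_altitude_def)
    qed
    then show ?thesis using False by simp
  next
    case True
    have fS: "finite S" using S by (simp add: step_set_def)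
    define F where "F = (\<lambda>s. (\<lambda>A. A @ [last A + s]) ` restricted_walks S P n (h - snd s))"
    have inj: "inj_on (\<lambda>A. A @ [last A + s]) X" for s and X :: "point list set"
      by (rule inj_onI) simp
    have disj: "F s \<inter> F t = {}" if "s \<noteq> t" for s t
      using that by (auto simp: F_def)
    have fin: "finite (F s)" for s unfolding F_def using Suc by simp
    have "card (\<Union>s\<in>S. F s) = (\<Sum>s\<in>S. card (F s))"
      by (rule card_UN_disjoint) (use fS fin disj in auto)
    also have "\<dots> = (\<Sum>s\<in>S. card (restricted_walks S P n (h - snd s)))"
      unfolding F_def by (simp add: card_image[OF inj])
    finally have "of_nat (card (\<Union>s\<in>S. F s)) = (\<Sum>s\<in>S. count_walks (altitudes S) P n (h - snd s) :: 'k)"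
      using Suc by simp
    also have "\<dots> = (\<Sum>u\<in>altitudes S. count_walks (altitudes S) P n (h - u))"
      by (subst step_set_altitudes(2)[OF S]) (simp add: sum.reindex inj_on_def)
    finally show ?thesis
      using restricted_walks_Suc[of P h S n] True fS fin unfolding F_def by simp
  qed
qed

lemma bridges_count: "step_set S \<Longrightarrow> of_nat (card (bridges S n)) = (walkn (altitudes S) n 0 :: 'k::comm_ring_1)"
  using restricted_walks_count[of S "\<lambda>_. True" n 0, where 'k = 'k]
  by (simp add: bridges_def restricted_walks_def)

lemma excursions_count: "step_set S \<Longrightarrow> of_nat (card (excursions S n)) = (meann (altitudes S) n 0 :: 'k::comm_ring_1)"
proof -
  have "excursions S n = restricted_walks S (\<lambda>h. 0 \<le> h) n 0"
    by (auto simp: excursions_def bridges_def meanders_def restricted_walks_def)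
  then show "step_set S \<Longrightarrow> ?thesis"
    using restricted_walks_count[of S "\<lambda>h. 0 \<le> h" n 0, where 'k = 'k] by simp
qed

lemma count_walks_upper:
  assumes "\<And>u. u \<in> V \<Longrightarrow> u \<le> int m"
  shows "int (n * m) < h \<Longrightarrow> count_walks V P n h = (0 :: 'k::comm_ring_1)"
proof (induction n arbitrary: h)
  case (Suc n)
  have "count_walks V P n (h - u) = (0 :: 'k)" if "u \<in> V" for u
    by (rule Suc.IH) (use Suc.prems assms[OF that] in \<open>simp add: algebra_simps\<close>)
  then show ?case by simp
qed simp

lemma meann_negative: "h < 0 \<Longrightarrow> meann V n h = 0"
  by (cases n) auto

text \<open>No walk of length \<open>n\<close> ends above \<open>n m\<close>, which makes the union
  over the final altitudes finite.\<close>

lemma meanders_count: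
  assumes S: "step_set S" and m: "\<And>u. u \<in> altitudes S \<Longrightarrow> u \<le> int m"
  shows "of_nat (card (meanders S n)) = (\<Sum>h\<le>n * m. meann (altitudes S) n (int h) :: 'k::field_char_0)"
proof -
  define R where "R = restricted_walks S (\<lambda>h. 0 \<le> h) n"
  have R: "finite (R h)" "of_nat (card (R h)) = (meann (altitudes S) n h :: 'k)" for h
    using restricted_walks_count[OF S, of "\<lambda>h. 0 \<le> h"] unfolding R_def by auto
  have M: "meanders S n = (\<Union>h\<le>n * m. R (int h))"
  proof (intro set_eqI iffI)
    fix A assume A: "A \<in> meanders S n"
    define h where "h = final_altitude A"
    have AR: "A \<in> R h" using A by (simp add: R_def restricted_walks_def meanders_def h_def)
    have "A \<noteq> []" using A by (auto simp: meanders_def walks_def)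
    then have h0: "0 \<le> h" using A by (simp add: h_def final_altitude_def meanders_def)
    have "h \<le> int (n * m)"
    proof (rule ccontr)
      assume "\<not> h \<le> int (n * m)"
      then have "(meann (altitudes S) n h :: 'k) = 0"
        using count_walks_upper[of "altitudes S" m n h] m by simp
      then have "R h = {}" using R[of h] by simp
      then show False using AR by simp
    qed
    then have "nat h \<le> n * m" by (simp only: nat_le_iff)
    then show "A \<in> (\<Union>h\<le>n * m. R (int h))"
      using AR h0 by (intro UN_I[of "nat h"]) auto
  qed (auto simp: R_def restricted_walks_def meanders_def)
  have "card (\<Union>h\<le>n * m. R (int h)) = (\<Sum>h\<le>n * m. card (R (int h)))"
    by (rule card_UN_disjoint) (use R in \<open>auto simp: R_def restricted_walks_def\<close>)
  then show ?thesis using R by (simp add: M)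
qed

text \<open>By symmetry, every step of a walk contributes the same to the altitudes of all walks that end
  at height \<open>h\<close>.\<close>

lemma walkn_cyclic:
  "of_int h * walkn V (Suc n) h = of_nat (Suc n) * (\<Sum>u\<in>V. of_int u * (walkn V n (h - u) :: 'k::comm_ring_1))"
proof (induction n arbitrary: h)
  case 0
  show ?case
    by (simp only: count_walks.simps if_True sum_distrib_left, rule sum.cong) auto
next
  case (Suc n)
  have "of_int h * (walkn V (Suc (Suc n)) h :: 'k) =
      (\<Sum>v\<in>V. of_int (h - v) * walkn V (Suc n) (h - v)) + (\<Sum>v\<in>V. of_int v * walkn V (Suc n) (h - v))"
    unfolding count_walks.simps(2)[of V _ "Suc n" h] by (simp add: sum_distrib_left algebra_simps flip: sum.distrib)
  also have "(\<Sum>v\<in>V. of_int (h - v) * (walkn V (Suc n) (h - v) :: 'k)) =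
      of_nat (Suc n) * (\<Sum>v\<in>V. \<Sum>u\<in>V. of_int u * walkn V n (h - v - u))"
    unfolding Suc sum_distrib_left[symmetric] ..
  also have "(\<Sum>v\<in>V. \<Sum>u\<in>V. of_int u * (walkn V n (h - v - u) :: 'k)) =
      (\<Sum>u\<in>V. of_int u * walkn V (Suc n) (h - u))"
    by (subst sum.swap) (simp add: sum_distrib_left algebra_simps)
  finally show ?case by (simp add: algebra_simps)
qed

section \<open>The factorization of walks\<close>

text \<open>The identity \<open>1 / (1 - x P(y)) = M(x, y) / D(x, y)\<close> splits the logarithmic derivative
  \<open>\<Sum>n\<ge>1. x^n P(y)^n\<close> into its parts with nonnegative and with negative exponents of \<open>y\<close>: \<open>M\<close> involves
  only nonnegative exponents, and \<open>D - 1\<close> only negative ones.\<close>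

definition emb :: "'k::field_char_0 poly \<Rightarrow> 'k fls" where
  "emb p = fps_to_fls (fps_of_poly p)"

lemma emb_nth: "fls_nth (emb p) h = (if h < 0 then 0 else coeff p (nat h))"
  by (simp add: emb_def)

lemma emb_add: "emb (p + q) = emb p + emb q"
  by (simp add: emb_def fps_of_poly_add)

lemma emb_mult: "emb (p * q) = emb p * emb q"
  by (simp add: emb_def fps_of_poly_mult fls_times_fps_to_fls)

lemma emb_diff: "emb (p - q) = emb p - emb q"
  by (simp add: emb_def fps_of_poly_diff)

lemma emb_0: "emb 0 = 0" and emb_1: "emb 1 = 1"
  by (simp_all add: emb_def)

lemma emb_of_nat: "emb (of_nat n) = of_nat n"
  by (induction n) (simp_all add: emb_0 emb_1 emb_add)

lemmas emb_hom = emb_mult emb_diff emb_0 emb_1 emb_of_nat emb_add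

lemma emb_sum: "emb (sum f A) = (\<Sum>x\<in>A. emb (f x))"
  by (induction A rule: infinite_finite_induct) (simp_all add: emb_hom)

lemma emb_eq_0: "emb p = 0 \<Longrightarrow> p = 0"
  by (simp add: emb_def)

definition neg_part :: "'k::field_char_0 fls \<Rightarrow> bool" where
  "neg_part f \<longleftrightarrow> (\<forall>h\<ge>0. fls_nth f h = 0)"

lemma neg_part_mult:
  assumes "neg_part f" "neg_part g"
  shows "neg_part (f * g)"
  unfolding neg_part_def fls_times_nth(2)
proof (intro allI impI sum.neutral ballI)
  fix h i :: int assume "0 \<le> h"
  then show "fls_nth f i * fls_nth g (h - i) = 0"
    using assms unfolding neg_part_def by (cases "0 \<le> i") auto
qed

lemma neg_part_add: "neg_part f \<Longrightarrow> neg_part g \<Longrightarrow> neg_part (f + g)"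
  by (simp add: neg_part_def)

lemma neg_part_of_nat: "neg_part f \<Longrightarrow> neg_part (of_nat n * f)"
  by (induction n) (simp_all add: distrib_right neg_part_add, simp add: neg_part_def)

lemma neg_part_sum: "(\<And>x. x \<in> A \<Longrightarrow> neg_part (f x)) \<Longrightarrow> neg_part (sum f A)"
  by (induction A rule: infinite_finite_induct) (auto simp: neg_part_def)

definition step_fls :: "int set \<Rightarrow> 'k::field_char_0 fls" where
  "step_fls V = (\<Sum>u\<in>V. fls_X_intpow u)"

lemma step_fls_mult_nth:
  "fls_nth (step_fls V * f) h = (\<Sum>u\<in>V. fls_nth f (h - u))"
  unfolding step_fls_def sum_distrib_right
  by (induction V rule: infinite_finite_induct) (simp_all add: fls_X_intpow_times_conv_shift)

lemma step_fls_power_nth: "finite V \<Longrightarrow> fls_nth (step_fls V ^ n) h = (walkn V n h :: 'k::field_char_0)"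
  by (induction n arbitrary: h) (auto simp: step_fls_mult_nth)

context
  fixes V :: "int set" and m :: nat
  assumes V: "finite V" "\<And>u. u \<in> V \<Longrightarrow> u \<le> int m"
begin

definition mpoly :: "nat \<Rightarrow> 'k::field_char_0 poly" where
  "mpoly n = (\<Sum>h\<le>n * m. monom (meann V n (int h)) h)"

definition gpoly :: "nat \<Rightarrow> 'k::field_char_0 poly" where
  "gpoly n = (\<Sum>h\<le>n * m. monom (walkn V n (int h)) h)"

lemma coeff_mpoly: "coeff (mpoly n) h = meann V n (int h)"
proof (cases "h \<le> n * m")
  case False
  then have "int (n * m) < int h" by (simp only: of_nat_less_iff)
  from count_walks_upper[OF V(2) this] False show ?thesis by (simp add: mpoly_def coeff_sum)
qed (simp add: mpoly_def coeff_sum)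

lemma coeff_gpoly: "coeff (gpoly n) h = walkn V n (int h)"
proof (cases "h \<le> n * m")
  case False
  then have "int (n * m) < int h" by (simp only: of_nat_less_iff)
  from count_walks_upper[OF V(2) this] False show ?thesis by (simp add: gpoly_def coeff_sum)
qed (simp add: gpoly_def coeff_sum)

text \<open>A Wiener-Hopf factorization. With \<open>th\<close> the derivation
  \<open>x d/dx\<close>, the relations \<open>th W = W (W - 1)\<close> and \<open>M = D W\<close>
  replace logarithms, and all quotients are cleared before exponents are compared.\<close>

theorem walk_factorization:
  "of_nat n * mpoly n = (\<Sum>k=1..n. gpoly k * (mpoly (n - k) :: 'k::field_char_0 poly))"
proof -
  define P where "P = (step_fls V :: 'k fls)"
  define M where "M = Abs_fps (\<lambda>n. emb (mpoly n :: 'k poly))"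
  define D where "D = M * (1 - fps_const P * fps_X)"
  define W where "W = Abs_fps (\<lambda>n. P ^ n)"
  define G where "G = Abs_fps (\<lambda>n. if n = 0 then 0 else emb (gpoly n :: 'k poly))"
  define H where "H = Abs_fps (\<lambda>n. if n = 0 then 0 else P ^ n - emb (gpoly n :: 'k poly))"
  define th where "th = (\<lambda>F :: 'k fls fps. fps_X * fps_deriv F)"
  have th_nth: "th F $ n = of_nat n * F $ n" for F n
    by (cases n) (simp_all add: th_def)
  have WX: "W = 1 + fps_const P * fps_X * W"
  proof (rule fps_ext)
    fix n show "W $ n = (1 + fps_const P * fps_X * W) $ n"
      by (cases n) (simp_all add: W_def mult.assoc)
  qed
  then have W1: "W * (1 - fps_const P * fps_X) = 1" by (simp add: algebra_simps)
  have "fps_deriv W = fps_deriv (1 + fps_const P * fps_X * W)" using WX by simp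
  also have "\<dots> = fps_const P * W + fps_const P * fps_X * fps_deriv W" by (simp add: algebra_simps)
  finally have d: "fps_deriv W = fps_const P * W + fps_const P * fps_X * fps_deriv W" .
  have "th W = fps_X * fps_const P * W + fps_const P * fps_X * th W"
    unfolding th_def by (subst d) (simp add: algebra_simps)
  then have e: "th W * (1 - fps_const P * fps_X) = fps_X * fps_const P * W" by (simp add: algebra_simps)
  have "W - 1 = (1 + fps_const P * fps_X * W) - 1" using WX by (rule arg_cong[where f = "\<lambda>x. x - 1"])
  then have "fps_X * fps_const P * W = W - 1" by (simp add: mult_ac)
  with e have "W * (th W * (1 - fps_const P * fps_X)) = W * (W - 1)" by simp
  moreover have "W * (th W * (1 - fps_const P * fps_X)) = th W * (W * (1 - fps_const P * fps_X))"
    by (simp only: mult_ac)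
  ultimately have thW: "th W = W * (W - 1)" unfolding W1 by simp
  have GH: "W - 1 = G + H" by (rule fps_ext) (simp add: W_def G_def H_def)
  have MDW: "M = D * W" 
  proof -
    have "D * W = M * (W * (1 - fps_const P * fps_X))" unfolding D_def by (simp only: mult_ac)
    then show ?thesis unfolding W1 by simp
  qed
  have "th M = th D * W + D * th W" unfolding MDW th_def by (simp add: algebra_simps)
  then have "th M = th D * W + M * (G + H)" unfolding thW GH MDW by (simp add: algebra_simps)
  then have "D * th M = th D * M + D * (M * (G + H))" unfolding MDW by (simp add: algebra_simps)
  \<comment> \<open>This is \<open>th M / M - G = th D / D + H\<close>, multiplied by
    \<open>D M\<close>.\<close>
  then have key: "D * (th M - G * M) = M * (th D + H * D)" by (simp add: algebra_simps)
  define R where "R = th M - G * M"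
  define T where "T = th D + H * D"
  have Dn: "D $ Suc n = emb (mpoly (Suc n)) - P * emb (mpoly n)" for n
  proof -
    have "D = M - M * fps_const P * fps_X" by (simp add: D_def algebra_simps)
    then show ?thesis by (simp add: M_def mult.commute)
  qed
  have m0: "mpoly 0 = (1 :: 'k poly)" by (simp add: mpoly_def)
  have M0: "M $ 0 = 1" by (simp add: M_def m0 emb_hom)
  have D0: "D $ 0 = 1" by (simp add: D_def M0)
  \<comment> \<open>A meander extended by one step is a meander unless it ends below 0. In
    \<open>D\<close> the former cancel, and only the first descents below 0 remain.\<close>
  have Dneg: "neg_part (D $ Suc n)" for n
    unfolding neg_part_def Dn
  proof (intro allI impI)
    fix h :: int assume h: "0 \<le> h"
    have "fls_nth (emb (mpoly n :: 'k poly)) (h - u) = meann V n (h - u)" for u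
      by (cases "h - u < 0") (simp_all add: emb_nth coeff_mpoly meann_negative)
    then show "fls_nth (emb (mpoly (Suc n)) - P * emb (mpoly n :: 'k poly)) h = 0"
      using h by (simp add: P_def step_fls_mult_nth emb_nth coeff_mpoly)
  qed
  have Hneg: "neg_part (H $ n)" for n
    using V(1) by (auto simp: neg_part_def H_def P_def step_fls_power_nth emb_nth coeff_gpoly)
  have Tneg: "neg_part (T $ n)" for n
  proof -
    have "neg_part (th D $ n)"
    proof (cases n)
      case (Suc k)
      show ?thesis unfolding th_nth unfolding Suc by (rule neg_part_of_nat[OF Dneg])
    qed (simp add: th_nth neg_part_def)
    moreover have "neg_part ((H * D) $ n)"
      unfolding fps_mult_nth
    proof (rule neg_part_sum)
      fix i
      show "neg_part (H $ i * D $ (n - i))"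
        using Hneg[of i] Dneg neg_part_mult by (cases "n - i") (auto simp: D0)
    qed
    ultimately show ?thesis by (simp add: T_def neg_part_add)
  qed
  define r where "r = (\<lambda>n. of_nat n * mpoly n - (\<Sum>k=0..n. (if k = 0 then 0 else gpoly k) * (mpoly (n - k) :: 'k poly)))"
  have Rn: "R $ n = emb (r n)" for n
    unfolding R_def r_def by (simp add: th_nth fps_mult_nth emb_hom emb_sum M_def G_def if_distrib[of emb] cong: if_cong)
  have "R $ n = 0 \<and> T $ n = 0" for n
  proof (induction n rule: less_induct)
    case (less n)
    have "(D * R) $ n = (\<Sum>i=0..n. if i = 0 then R $ n else 0)"
      unfolding fps_mult_nth by (rule sum.cong) (use less in \<open>auto simp: D0\<close>)
    moreover have "(M * T) $ n = (\<Sum>i=0..n. if i = 0 then T $ n else 0)"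
      unfolding fps_mult_nth by (rule sum.cong) (use less in \<open>auto simp: M0\<close>)
    ultimately have RT: "R $ n = T $ n" using key unfolding R_def[symmetric] T_def[symmetric] by simp
    \<comment> \<open>Both \<open>D\<close> and \<open>M\<close> start with 1, so equality of the
      products passes to \<open>R $ n = T $ n\<close>. One is a polynomial in \<open>y\<close>, the
      other has only negative exponents.\<close>
    have "fls_nth (R $ n) h = 0" for h
    proof (cases "h < 0")
      case True
      then show ?thesis by (simp add: Rn emb_nth)
    next
      case False
      then show ?thesis using Tneg[of n] unfolding RT by (simp add: neg_part_def)
    qed
    then show ?case using RT by (metis fls_eqI fls_zero_nth)
  qed
  then have "r n = 0" using Rn emb_eq_0 by metis
  moreover have "(\<Sum>k=0..n. (if k = 0 then 0 else gpoly k) * (mpoly (n - k) :: 'k poly)) =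
    (\<Sum>k=1..n. gpoly k * mpoly (n - k))"
    by (rule sum.mono_neutral_cong_right) auto
  ultimately show ?thesis by (simp add: r_def)
qed

text \<open>Taking the constant coefficient in \<open>y\<close> is a ring homomorphism on
  polynomials; it selects the walks that return to altitude 0.\<close>

corollary meann_zero_rec:
  "of_nat n * meann V n 0 = (\<Sum>k=1..n. walkn V k 0 * (meann V (n - k) 0 :: 'k::field_char_0))"
proof -
  have "coeff (of_nat n * mpoly n) 0 = (\<Sum>k=1..n. coeff (gpoly k * (mpoly (n - k) :: 'k poly)) 0)"
    unfolding walk_factorization coeff_sum ..
  then show ?thesis by (simp add: coeff_mult_0 coeff_mpoly coeff_gpoly of_nat_poly)
qed

text \<open>Evaluation at \<open>y = 1\<close> is another such homomorphism, and it sums over all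
  final altitudes.\<close>

corollary meann_sum_rec:
  "of_nat n * (\<Sum>h\<le>n * m. meann V n (int h)) =
    (\<Sum>k=1..n. (\<Sum>h\<le>k * m. walkn V k (int h)) * (\<Sum>h\<le>(n - k) * m. meann V (n - k) (int h) :: 'k::field_char_0))"
proof -
  have "poly (of_nat n * mpoly n) 1 = (\<Sum>k=1..n. poly (gpoly k * (mpoly (n - k) :: 'k poly)) 1)"
    unfolding walk_factorization poly_sum ..
  then show ?thesis by (simp add: mpoly_def gpoly_def poly_sum poly_monom)
qed

end

section \<open>Expansion of bridges\<close>

abbreviation dec :: "nat \<Rightarrow> instr list" where
  "dec a \<equiv> [IConst 99 (Suc 0), ISub a a 99]"

text \<open>A dot product with linearly varying weights. One subtraction per term maintains the
  weight, because the loop index cannot be turned into a field element; at the end its cell holds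
  the weight of the next index.\<close>

definition dotk :: com where
  "dotk = While 24 26 (Instrs ([FMul 9 24 25, FMul 9 9 7, FAdd 19 19 9, FSub 7 7 4] @ inc 24 @ dec 25))"

definition dot :: com where
  "dot = While 24 26 (Instrs ([FMul 9 24 25, FAdd 19 19 9] @ inc 24 @ dec 25))"

lemma wr_dots [simp]: "wr dotk = {24, 25, 99}" "wr dot = {24, 25, 99}"
  by (auto simp: dotk_def dot_def)

lemma dotk_spec:
  fixes f :: "nat \<Rightarrow> 'k::field"
  assumes regs: "i 24 = a" "i 26 = a + len" "i 25 = v" "len \<le> Suc v"
    and cells: "i 9 = tmp" "i 7 = K" "i 19 = acc" "i 4 = N1"
    and distinct: "tmp \<noteq> K" "tmp \<noteq> acc" "K \<noteq> acc" "N1 \<notin> {tmp, K, acc}"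
    and outside: "\<And>k. k < len \<Longrightarrow> a + k \<notin> {tmp, K, acc}" "\<And>k. k < len \<Longrightarrow> v - k \<notin> {tmp, K, acc}"
  shows "wp dotk (\<lambda>i' f' t'.
    f' acc = f acc + (\<Sum>k<len. f (a + k) * f (v - k) * (f K - of_nat k * f N1)) \<and>
    f' K = f K - of_nat len * f N1 \<and> (\<forall>y. y \<notin> {tmp, K, acc} \<longrightarrow> f' y = f y) \<and>
    t' \<le> t + 10 * len + 1) i f t"
  unfolding dotk_def
proof (rule wp_while[where n = len and I = "\<lambda>m i' f' t'. i' 24 = a + m \<and> i' 25 = v - m \<and>
    f' acc = f acc + (\<Sum>k<m. f (a + k) * f (v - k) * (f K - of_nat k * f N1)) \<and>
    f' K = f K - of_nat m * f N1 \<and> (\<forall>y. y \<notin> {tmp, K, acc} \<longrightarrow> f' y = f y) \<and> t' \<le> t + 10 * m"], goal_cases)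
  case 1
  then show ?case using regs by simp
next
  case (2 m i' f' t')
  have r: "i' 26 = a + len" "i' 9 = tmp" "i' 7 = K" "i' 19 = acc" "i' 4 = N1"
    using 2(3) regs cells by simp_all
  have "f' (a + m) = f (a + m)" "f' (v - m) = f (v - m)" "f' N1 = f N1"
    using 2 outside distinct by auto
  moreover have "f K - of_nat m * f N1 - f N1 = f K - (1 + of_nat m) * f N1"
    by (simp add: algebra_simps)
  ultimately show ?case
    using 2(1,2) r distinct by (simp add: add.assoc)
next
  case (3 i' f' t')
  then show ?case using regs 3(2)[of 26] by simp
qed

lemma dot_spec:
  fixes f :: "nat \<Rightarrow> 'k::field"
  assumes regs: "i 24 = a" "i 26 = a + len" "i 25 = v" "len \<le> Suc v"
    and cells: "i 9 = tmp" "i 19 = acc"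
    and distinct: "tmp \<noteq> acc"
    and outside: "\<And>k. k < len \<Longrightarrow> a + k \<notin> {tmp, acc}" "\<And>k. k < len \<Longrightarrow> v - k \<notin> {tmp, acc}"
  shows "wp dot (\<lambda>i' f' t'.
    f' acc = f acc + (\<Sum>k<len. f (a + k) * f (v - k)) \<and>
    (\<forall>y. y \<notin> {tmp, acc} \<longrightarrow> f' y = f y) \<and> t' \<le> t + 8 * len + 1) i f t"
  unfolding dot_def
proof (rule wp_while[where n = len and I = "\<lambda>m i' f' t'. i' 24 = a + m \<and> i' 25 = v - m \<and>
    f' acc = f acc + (\<Sum>k<m. f (a + k) * f (v - k)) \<and>
    (\<forall>y. y \<notin> {tmp, acc} \<longrightarrow> f' y = f y) \<and> t' \<le> t + 8 * m"], goal_cases)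
  case 1
  then show ?case using regs by simp
next
  case (2 m i' f' t')
  have r: "i' 26 = a + len" "i' 9 = tmp" "i' 19 = acc"
    using 2(3) regs cells by simp_all
  have "f' (a + m) = f (a + m)" "f' (v - m) = f (v - m)"
    using 2 outside distinct by auto
  then show ?case
    using 2(1,2) r distinct by (simp add: algebra_simps)
next
  case (3 i' f' t')
  then show ?case using regs 3(2)[of 26] by simp
qed

text \<open>Field cells from address \<open>z = d + 1\<close> on: the constant 1, the constant 1/2, the counter of the
  exponential, \<open>n + 1\<close>, \<open>c n\<close>, the number of walks ending at height \<open>\<ge> 0\<close>, four temporaries, the
  window of \<open>2 d\<close> counts of walks of length \<open>n\<close>, and the \<open>d\<close> counts from which it is extended.\<close>

definition core_regs :: "nat \<Rightarrow> nat \<Rightarrow> nat \<Rightarrow> (nat \<Rightarrow> nat) \<Rightarrow> bool" where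
  "core_regs c e z i \<longleftrightarrow> i 1 = e \<and> i 2 = c \<and> i 3 = c + e \<and> i 18 = z \<and> i 4 = z + 3 \<and> i 5 = z + 4 \<and> i 6 = z + 5 \<and>
     i 7 = z + 6 \<and> i 19 = z + 7 \<and> i 9 = z + 8 \<and> i 22 = z + 9 \<and> i 50 = z + 10 \<and> i 51 = z + 10 + 2 * (c + e) \<and>
     i 52 = z + 10 + 3 * (c + e) \<and> i 57 = z + 9 + 3 * (c + e) \<and> i 20 = z + 10 + e \<and> i 27 = c + e + 1 \<and> i 29 = c + 1"

text \<open>The unknown entry has the last index \<open>d\<close>. After the \<open>d\<close> known
  terms, the weight cell left by \<open>dotk\<close> is exactly its coefficient, the outer
  coefficient of the step polynomial being 1.\<close>

definition down_step :: com where
  "down_step = Instrs (dec 23 @ [FZero 19, FCopy 7 22, IConst 24 0, IAdd 25 23 3] @ mov 26 3) ;; dotk ;;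
     Instrs [FDiv 9 19 7, FZero 19, FSub 23 19 9, FSub 22 22 18]"

definition down :: com where
  "down = Instrs ([FCopy 22 5] @ mov 23 20) ;; While 50 23 down_step"

text \<open>Here the unknown has index 0 and coefficient \<open>h + n c\<close>, kept in the cell of
  register 5. The sum starts at index 1, hence the weight reduced by \<open>n + 1\<close>.\<close>

definition up_step :: com where
  "up_step = Instrs ([FAdd 5 5 18, FZero 19, FSub 7 5 4, IConst 24 1] @ mov 25 23 @ dec 25 @ mov 26 27) ;; dotk ;;
     Instrs ([FDiv 9 19 5, FZero 19, FSub 23 19 9] @ inc 23)"

definition up :: com where
  "up = Instrs [IAdd 23 20 3] ;; While 23 51 up_step"

lemma wr_updown [simp]:
  "wr down_step = {23, 24, 25, 26, 99}" "wr down = {23, 24, 25, 26, 99}"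
  "wr up_step = {23, 24, 25, 26, 99}" "wr up = {23, 24, 25, 26, 99}"
  by (auto simp: down_step_def down_def up_step_def up_def)

lemma core_regs_frame:
  "core_regs c e z i \<Longrightarrow>
   (\<And>r. r \<in> {1, 2, 3, 18, 4, 5, 6, 7, 19, 9, 22, 50, 51, 52, 57, 20, 27, 29} \<Longrightarrow> i' r = i r) \<Longrightarrow>
   core_regs c e z i'"
  by (simp add: core_regs_def)

context
  fixes V :: "int set" and c e :: nat
  assumes V: "V \<subseteq> {- int c..int e}" "- int c \<in> V" "int e \<in> V" and ce: "0 < c" "0 < e"
begin

text \<open>Coefficients of \<open>y^c P(y)\<close>, the polynomial given as input; they turn sums
  over steps into convolutions along the window.\<close>

definition qcoef :: "nat \<Rightarrow> 'k::field_char_0" where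
  "qcoef k = (if int k - int c \<in> V then 1 else 0)"

lemma qcoef_ends: "qcoef 0 = 1" "qcoef (c + e) = 1"
  using V by (simp_all add: qcoef_def)

lemma sum_qcoef: "(\<Sum>u\<in>V. F u) = (\<Sum>k<Suc (c + e). qcoef k * (F (int k - int c) :: 'k::field_char_0))"
proof -
  have "(\<Sum>u\<in>V. F u) = (\<Sum>k\<in>{k. k < Suc (c + e) \<and> int k - int c \<in> V}. F (int k - int c))"
    by (rule sum.reindex_bij_witness[where i = "\<lambda>k. int k - int c" and j = "\<lambda>u. nat (u + int c)"]) (use V(1) in auto)
  also have "\<dots> = (\<Sum>k<Suc (c + e). qcoef k * F (int k - int c))"
    by (rule sum.mono_neutral_cong_left) (auto simp: qcoef_def)
  finally show ?thesis .
qed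

abbreviation "w n h \<equiv> walkn V n h :: 'k::field_char_0"

text \<open>The coefficient of the lowest entry vanishes for no \<open>h < 0\<close>, that of the highest for no \<open>h > 0\<close>; hence
  the window is extended downwards below height 0 and upwards above it.\<close>

lemma window_rec:
  "(\<Sum>k<Suc (c + e). qcoef k * walkn V n (h + int c - int k) *
     (of_int (h + int (Suc n) * int c) - of_nat k * of_nat (Suc n))) = (0 :: 'k::field_char_0)"
proof -
  have "(\<Sum>u\<in>V. of_int h * walkn V n (h - u)) = (of_nat (Suc n) * (\<Sum>u\<in>V. of_int u * walkn V n (h - u)) :: 'k)"
    using walkn_cyclic[of h V n, where 'k = 'k] by (simp add: sum_distrib_left)
  then have "(\<Sum>u\<in>V. walkn V n (h - u) * (of_int h - of_nat (Suc n) * of_int u)) = (0 :: 'k)"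
    by (simp add: sum_subtractf sum_distrib_left algebra_simps)
  then have "(\<Sum>k<Suc (c + e). qcoef k * (walkn V n (h - (int k - int c)) *
      (of_int h - of_nat (Suc n) * of_int (int k - int c)))) = (0 :: 'k)"
    unfolding sum_qcoef .
  then show ?thesis by (simp add: algebra_simps)
qed

lemma window_down:
  assumes "h < 0"
  shows "walkn V n h = - (\<Sum>k<c + e. qcoef k * walkn V n (h + int (c + e) - int k) *
     (of_int (h + int e + int (Suc n) * int c) - of_nat k * of_nat (Suc n))) /
     (of_int (h + int e + int (Suc n) * int c) - of_nat (c + e) * of_nat (Suc n) :: 'k::field_char_0)"
    and "of_int (h + int e + int (Suc n) * int c) - of_nat (c + e) * of_nat (Suc n) \<noteq> (0 :: 'k::field_char_0)"
proof -
  \<comment> \<open>The pivot simplifies to \<open>h - n e\<close>, negative for negative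
    \<open>h\<close>.\<close>
  have e: "of_int (h + int e + int (Suc n) * int c) - of_nat (c + e) * of_nat (Suc n) = (of_int (h - int n * int e) :: 'k)"
    by (simp add: algebra_simps)
  have "h - int n * int e < 0" using assms by (simp add: add_strict_increasing2 less_le_trans)
  then show n: "of_int (h + int e + int (Suc n) * int c) - of_nat (c + e) * of_nat (Suc n) \<noteq> (0 :: 'k)"
    unfolding e of_int_eq_0_iff by simp
  show "walkn V n h = - (\<Sum>k<c + e. qcoef k * walkn V n (h + int (c + e) - int k) *
     (of_int (h + int e + int (Suc n) * int c) - of_nat k * of_nat (Suc n))) /
     (of_int (h + int e + int (Suc n) * int c) - of_nat (c + e) * of_nat (Suc n) :: 'k)"
    using window_rec[of n "h + int e", where 'k = 'k] n
    by (simp add: qcoef_ends field_simps eq_neg_iff_add_eq_0 sum.lessThan_Suc del: of_nat_Suc)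
qed

lemma window_up:
  assumes "0 < h"
  shows "walkn V n h = - (\<Sum>k<c + e. qcoef (Suc k) * walkn V n (h - 1 - int k) *
     (of_int (h + int n * int c) - of_nat (Suc n) - of_nat k * of_nat (Suc n))) /
     (of_int (h + int n * int c) :: 'k::field_char_0)"
    and "of_int (h + int n * int c) \<noteq> (0 :: 'k::field_char_0)"
proof -
  have "0 < h + int n * int c" using assms by (simp add: add_pos_nonneg)
  then show n: "of_int (h + int n * int c) \<noteq> (0 :: 'k)" unfolding of_int_eq_0_iff by simp
  have "(\<Sum>k<Suc (c + e). qcoef k * walkn V n (h - int k) *
     (of_int (h + int n * int c) - of_nat k * of_nat (Suc n))) = (0 :: 'k)"
    using window_rec[of n "h - int c", where 'k = 'k] by (simp add: algebra_simps)
  then have "of_int (h + int n * int c) * walkn V n h + (\<Sum>k<c + e. qcoef (Suc k) * walkn V n (h - 1 - int k) *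
     (of_int (h + int n * int c) - of_nat (Suc n) - of_nat k * of_nat (Suc n))) = (0 :: 'k)"
    unfolding sum.lessThan_Suc_shift by (simp add: qcoef_ends algebra_simps)
  then show "walkn V n h = - (\<Sum>k<c + e. qcoef (Suc k) * walkn V n (h - 1 - int k) *
     (of_int (h + int n * int c) - of_nat (Suc n) - of_nat k * of_nat (Suc n))) /
     (of_int (h + int n * int c) :: 'k)"
    using n by (simp add: field_simps eq_neg_iff_add_eq_0)
qed

end

text \<open>With \<open>T(a)\<close> the number of walks of length \<open>n\<close> that end at height \<open>\<ge> a\<close>: \<open>tail_part\<close> descends from
  \<open>T(0)\<close> to \<open>T(c + 1)\<close>, and then sums \<open>T(-u)\<close> over the steps \<open>u\<close> while it climbs back.\<close>

definition tail_part :: com where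
  "tail_part = Instrs ([FCopy 19 6, IConst 24 0] @ mov 25 51 @ dec 25) ;;
     While 24 29 (Instrs ([FSub 19 19 25] @ dec 25 @ inc 24)) ;;
     Instrs ([FZero 6, IConst 24 0] @ mov 25 51 @ dec 25) ;;
     While 24 27 (Instrs ([FAdd 19 19 25, FMul 9 24 19, FAdd 6 6 9] @ inc 24 @ dec 25))"

definition shift_part :: com where
  "shift_part = Instrs (mov 23 51 @ [IAdd 31 50 3]) ;;
     While 23 52 (Instrs ([FZero 19, IConst 24 0] @ mov 25 31 @ mov 26 27) ;; dot ;;
       Instrs ([FCopy 23 19] @ inc 23 @ inc 31))"

lemma wr_tail_shift [simp]: "wr tail_part = {24, 25, 99}" "wr shift_part = {23, 24, 25, 26, 31, 99}"
  by (auto simp: tail_part_def shift_part_def)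

lemma core_regsD:
  assumes "core_regs c e z i"
  shows "i 1 = e" "i (Suc 0) = e" "i 2 = c" "i 3 = c + e" "i 18 = z" "i 4 = z + 3" "i 5 = z + 4" "i 6 = z + 5"
    "i 7 = z + 6" "i 19 = z + 7" "i 9 = z + 8" "i 22 = z + 9" "i 50 = z + 10" "i 51 = z + 10 + 2 * (c + e)"
    "i 52 = z + 10 + 3 * (c + e)" "i 57 = z + 9 + 3 * (c + e)" "i 20 = z + 10 + e" "i 27 = c + e + 1" "i 29 = c + 1"
  using assms by (simp_all add: core_regs_def)

section \<open>Correctness of the sweeps over the window\<close>

context
  fixes V :: "int set" and c e :: nat
  assumes V: "V \<subseteq> {- int c..int e}" "- int c \<in> V" "int e \<in> V" and ce: "0 < c" "0 < e"
begin

abbreviation "q \<equiv> qcoef V c"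

text \<open>The altitude of window cell \<open>x\<close>. With \<open>d = c + e\<close>, the cells
  cover \<open>1 - d - e, ..., c\<close>: these are the \<open>2 d\<close> altitudes from which one
  step can reach \<open>1 - d, ..., 0\<close>, the part carried over to the next row.\<close>

definition alt :: "nat \<Rightarrow> int" where
  "alt x = int c - 2 * int (c + e) + 1 + int x"

definition core_mem :: "nat \<Rightarrow> nat \<Rightarrow> (nat \<Rightarrow> 'k::field_char_0) \<Rightarrow> bool" where
  "core_mem z n f \<longleftrightarrow> f z = 1 \<and> f (z + 3) = of_nat (Suc n) \<and> (\<forall>k<Suc (c + e). f k = q k)"

lemma core_mem_frame:
  "core_mem z n f \<Longrightarrow> (\<And>y. y \<le> z + 3 \<Longrightarrow> f' y = f y) \<Longrightarrow> z = c + e + 1 \<Longrightarrow> core_mem z n f'"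
  by (auto simp: core_mem_def)

lemma down_step_spec:
  fixes f :: "nat \<Rightarrow> 'k::field_char_0"
  assumes regs: "core_regs c e z i" "i 23 = z + 10 + Suc x" and z: "z = c + e + 1" and mem: "core_mem z n f"
    and x: "x < e" and J: "f (z + 9) = of_int (alt x + int e + int (Suc n) * int c)"
    and win: "\<And>y. x < y \<Longrightarrow> y \<le> x + (c + e) \<Longrightarrow> f (z + 10 + y) = walkn V n (alt y)"
  shows "wp down_step (\<lambda>i' f' t'. i' 23 = z + 10 + x \<and> f' (z + 10 + x) = walkn V n (alt x) \<and>
    f' (z + 9) = f (z + 9) - 1 \<and> (\<forall>y. y < z + 6 \<or> z + 10 \<le> y \<and> y \<noteq> z + 10 + x \<longrightarrow> f' y = f y) \<and>
    t' \<le> t + 10 * (c + e) + 20) i f t"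
proof -
  note r [simp] = core_regsD[OF regs(1)]
  define f1 where "f1 = f(z + 7 := 0, z + 6 := f (z + 9))"
  define d where "d = c + e"
  have K: "f1 (z + 6) = of_int (alt x + int e + int (Suc n) * int c)" "f1 (z + 3) = of_nat (Suc n)"
    using J mem by (simp_all add: f1_def core_mem_def)
  have q: "f1 k = q k" if "k < Suc d" for k using that mem z by (simp add: f1_def core_mem_def d_def)
  have f1o: "f1 (z + 10 + y) = f (z + 10 + y)" for y by (simp add: f1_def)
  have vx: "f1 (z + 10 + x + d - k) = walkn V n (alt x + int d - int k)" if "k < d" for k
  proof -
    have "f1 (z + 10 + (x + d - k)) = walkn V n (alt (x + d - k))"
      unfolding f1o by (rule win) (use that in \<open>simp_all add: d_def\<close>)
    moreover have "alt (x + d - k) = alt x + int d - int k" using that by (simp add: alt_def of_nat_diff)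
    ultimately show ?thesis using that by (simp add: add.assoc)
  qed
  have ax: "alt x < 0" using x by (simp add: alt_def)
  define s where "s = (\<Sum>k<d. f1 (0 + k) * f1 (z + 10 + x + d - k) * (f1 (z + 6) - of_nat k * f1 (z + 3)))"
  have s: "s = (\<Sum>k<c + e. q k * walkn V n (alt x + int (c + e) - int k) *
     (of_int (alt x + int e + int (Suc n) * int c) - of_nat k * of_nat (Suc n)))"
    unfolding s_def d_def[symmetric] by (rule sum.cong) (use q vx K in auto)
  have "wp dotk (\<lambda>i' f' t'. f' (z + 7) = f1 (z + 7) + s \<and> f' (z + 6) = f1 (z + 6) - of_nat d * f1 (z + 3) \<and>
    (\<forall>y. y \<notin> {z + 8, z + 6, z + 7} \<longrightarrow> f' y = f1 y) \<and> t' \<le> t + 8 + 10 * d + 1)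
    (i(99 := Suc 0, 23 := z + 10 + x, 24 := 0, 25 := z + 10 + x + d, 26 := d)) f1
    (Suc (Suc (Suc (Suc (Suc (Suc (Suc (Suc t))))))))"
    by (rule wp_conseq[OF dotk_spec[where a = 0 and len = d and v = "z + 10 + x + d" and tmp = "z + 8" and
          K = "z + 6" and acc = "z + 7" and ?N1.0 = "z + 3"]]) (use z in \<open>auto simp: s_def d_def\<close>)
  then have "wp dotk (wp (Instrs [FDiv 9 19 7, FZero 19, FSub 23 19 9, FSub 22 22 18])
    (\<lambda>i' f' t'. i' 23 = z + 10 + x \<and> f' (z + 10 + x) = walkn V n (alt x) \<and>
    f' (z + 9) = f (z + 9) - 1 \<and> (\<forall>y. y < z + 6 \<or> z + 10 \<le> y \<and> y \<noteq> z + 10 + x \<longrightarrow> f' y = f y) \<and>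
    t' \<le> t + 10 * (c + e) + 20))
    (i(99 := Suc 0, 23 := z + 10 + x, 24 := 0, 25 := z + 10 + x + d, 26 := d)) f1
    (Suc (Suc (Suc (Suc (Suc (Suc (Suc (Suc t))))))))"
  proof (rule wp_conseq, goal_cases)
    case (1 i' f' t')
    have i': "i' 9 = z + 8" "i' 19 = z + 7" "i' 7 = z + 6" "i' 23 = z + 10 + x" "i' 22 = z + 9" "i' 18 = z"
      using 1(2) by simp_all
    have f7: "f' (z + 7) = s" and f6: "f' (z + 6) = of_int (alt x + int e + int (Suc n) * int c) - of_nat (c + e) * of_nat (Suc n)"
      using 1(1) K by (simp_all add: f1_def d_def)
    have fo: "f' y = f y" if "y \<notin> {z + 6, z + 7, z + 8}" for y using 1(1) that by (simp add: f1_def)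
    have fz: "f' z = 1" using fo[of z] mem by (simp add: core_mem_def)
    have nz: "f' (z + 6) \<noteq> 0" unfolding f6 by (rule window_down(2)[OF V ce ax])
    have val: "- (f' (z + 7) / f' (z + 6)) = walkn V n (alt x)"
      unfolding f6 f7 s using window_down(1)[OF V ce ax, of n, where 'k = 'k] by simp
    show ?case
      using 1(1) i' fo fz nz val by (simp add: d_def)
  qed
  then show ?thesis
    unfolding down_step_def wp_Seq using regs(2) by (simp add: f1_def d_def add_ac)
qed

text \<open>The first unknown altitude is \<open>- d\<close>, where the initial weight
  \<open>h + e + (n + 1) c\<close> equals \<open>n c\<close>. The stored \<open>n c\<close>
  therefore starts this sweep as well as the upward one.\<close>

lemma down_spec:
  fixes f :: "nat \<Rightarrow> 'k::field_char_0"
  assumes regs: "core_regs c e z i" and z: "z = c + e + 1" and mem: "core_mem z n f"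
    and M: "f (z + 4) = of_nat (n * c)"
    and win: "\<And>y. e \<le> y \<Longrightarrow> y < e + (c + e) \<Longrightarrow> f (z + 10 + y) = walkn V n (alt y)"
  shows "wp down (\<lambda>i' f' t'. (\<forall>y < e + (c + e). f' (z + 10 + y) = walkn V n (alt y)) \<and>
    (\<forall>y. y < z + 6 \<or> z + 10 + e \<le> y \<longrightarrow> f' y = f y) \<and>
    t' \<le> t + e * (10 * (c + e) + 22) + 4) i f t"
proof -
  note r [simp] = core_regsD[OF regs(1)]
  have "wp (While 50 23 down_step) (\<lambda>i' f' t'. (\<forall>y < e + (c + e). f' (z + 10 + y) = walkn V n (alt y)) \<and>
    (\<forall>y. y < z + 6 \<or> z + 10 + e \<le> y \<longrightarrow> f' y = f y) \<and>
    t' \<le> t + e * (10 * (c + e) + 22) + 4) (i(23 := z + 10 + e)) (f(z + 9 := f (z + 4))) (Suc (Suc (Suc t)))"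
  proof (rule wp_while[where n = e and I = "\<lambda>k i' f' t'. i' 23 = z + 10 + (e - k) \<and>
      f' (z + 9) = of_nat (n * c) - of_nat k \<and>
      (\<forall>y. e - k \<le> y \<longrightarrow> y < e + (c + e) \<longrightarrow> f' (z + 10 + y) = walkn V n (alt y)) \<and>
      (\<forall>y. y < z + 6 \<or> z + 10 + e \<le> y \<longrightarrow> f' y = f y) \<and>
      t' \<le> t + 3 + k * (10 * (c + e) + 22)"], goal_cases)
    case 1
    show ?case using M win by simp
  next
    case (2 k i1 f1 t1)
    note p = 2(2)
    define x where "x = e - Suc k"
    have x: "e - k = Suc x" "x < e" "int x = int e - 1 - int k" using 2(1) by (auto simp: x_def)
    have cr: "core_regs c e z i1"
      by (rule core_regs_frame[OF regs(1)]) (use 2(3) in auto)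
    have cm: "core_mem z n f1"
      by (rule core_mem_frame[OF mem _ z]) (use p in auto)
    have J: "f1 (z + 9) = of_int (alt x + int e + int (Suc n) * int c)"
      using p by (simp add: alt_def x(3) algebra_simps)
    have S: "wp down_step (\<lambda>i' f' t'. i' 23 = z + 10 + x \<and> f' (z + 10 + x) = walkn V n (alt x) \<and>
      f' (z + 9) = f1 (z + 9) - 1 \<and> (\<forall>y. y < z + 6 \<or> z + 10 \<le> y \<and> y \<noteq> z + 10 + x \<longrightarrow> f' y = f1 y) \<and>
      t' \<le> Suc t1 + 10 * (c + e) + 20) i1 f1 (Suc t1)"
      by (rule down_step_spec[OF cr _ z cm x(2) J]) (use p x in auto)
    have "wp down_step (\<lambda>i' f' t'. i' 23 = z + 10 + (e - Suc k) \<and>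
      f' (z + 9) = of_nat (n * c) - of_nat (Suc k) \<and>
      (\<forall>y. e - Suc k \<le> y \<longrightarrow> y < e + (c + e) \<longrightarrow> f' (z + 10 + y) = walkn V n (alt y)) \<and>
      (\<forall>y. y < z + 6 \<or> z + 10 + e \<le> y \<longrightarrow> f' y = f y) \<and>
      Suc t' \<le> t + 3 + Suc k * (10 * (c + e) + 22)) i1 f1 (Suc t1)"
    proof (rule wp_conseq[OF S], goal_cases)
      case (1 i2 f2 t2)
      have "f2 (z + 10 + y) = walkn V n (alt y)" if "x \<le> y" "y < e + (c + e)" for y
      proof (cases "y = x")
        case False
        then have "f2 (z + 10 + y) = f1 (z + 10 + y)" using 1(1) by simp
        then show ?thesis using p x False that by simp
      qed (use 1(1) in simp)
      moreover have "f2 y = f y" if "y < z + 6 \<or> z + 10 + e \<le> y" for y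
        using 1(1) p x(2) that by auto
      ultimately show ?case using 1(1) p unfolding x_def[symmetric] by simp
    qed
    then show ?case using p x 2(3)[of 50] by simp
  next
    case (3 i1 f1 t1)
    then show ?case using 3(2)[of 50] by simp
  qed
  then show ?thesis
    unfolding down_def by simp
qed

lemma up_step_spec:
  fixes f :: "nat \<Rightarrow> 'k::field_char_0"
  assumes regs: "core_regs c e z i" "i 23 = z + 10 + x" and z: "z = c + e + 1" and mem: "core_mem z n f"
    and x: "e + (c + e) \<le> x" "x < 2 * (c + e)" and M: "f (z + 4) = of_int (alt x + int n * int c) - 1"
    and win: "\<And>y. x \<le> y + (c + e) \<Longrightarrow> y < x \<Longrightarrow> f (z + 10 + y) = walkn V n (alt y)"
  shows "wp up_step (\<lambda>i' f' t'. i' 23 = z + 10 + Suc x \<and> f' (z + 10 + x) = walkn V n (alt x) \<and>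
    f' (z + 4) = f (z + 4) + 1 \<and> (\<forall>y. y < z + 4 \<or> y = z + 5 \<or> z + 9 \<le> y \<and> y \<noteq> z + 10 + x \<longrightarrow> f' y = f y) \<and>
    t' \<le> t + 10 * (c + e) + 20) i f t"
proof -
  note r [simp] = core_regsD[OF regs(1)]
  have fz: "f z = 1" and fN: "f (z + 3) = of_nat (Suc n)" using mem by (simp_all add: core_mem_def)
  define f1 where "f1 = f(z + 4 := f (z + 4) + 1, z + 7 := 0, z + 6 := f (z + 4) + 1 - of_nat (Suc n))"
  define d where "d = c + e"
  have K: "f1 (z + 6) = of_int (alt x + int n * int c) - of_nat (Suc n)" "f1 (z + 3) = of_nat (Suc n)"
    "f1 (z + 4) = of_int (alt x + int n * int c)"
    using M fN by (simp_all add: f1_def)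
  have q: "f1 k = q k" if "k < Suc d" for k using that mem z by (simp add: f1_def core_mem_def d_def)
  have xd: "d \<le> x" using x by (simp add: d_def)
  have f1o: "f1 (z + 10 + y) = f (z + 10 + y)" for y by (simp add: f1_def)
  have vx: "f1 (z + 9 + x - k) = walkn V n (alt x - 1 - int k)" if "k < d" for k
  proof -
    have "f1 (z + 10 + (x - 1 - k)) = walkn V n (alt (x - 1 - k))"
      unfolding f1o by (rule win) (use that xd in \<open>simp_all add: d_def\<close>)
    moreover have "alt (x - 1 - k) = alt x - 1 - int k" using that xd by (simp add: alt_def of_nat_diff)
    moreover have "z + 10 + (x - 1 - k) = z + 9 + x - k" using that xd by simp
    ultimately show ?thesis by (simp only:)
  qed
  have ax: "0 < alt x" using x by (simp add: alt_def)
  define s where "s = (\<Sum>k<d. f1 (1 + k) * f1 (z + 9 + x - k) * (f1 (z + 6) - of_nat k * f1 (z + 3)))"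
  have s: "s = (\<Sum>k<c + e. q (Suc k) * walkn V n (alt x - 1 - int k) *
     (of_int (alt x + int n * int c) - of_nat (Suc n) - of_nat k * of_nat (Suc n)))"
    unfolding s_def d_def[symmetric] by (rule sum.cong) (use q vx K in auto)
  have "wp dotk (\<lambda>i' f' t'. f' (z + 7) = f1 (z + 7) + s \<and> f' (z + 6) = f1 (z + 6) - of_nat d * f1 (z + 3) \<and>
    (\<forall>y. y \<notin> {z + 8, z + 6, z + 7} \<longrightarrow> f' y = f1 y) \<and> t' \<le> t + 10 + 10 * d + 1)
    (i(24 := Suc 0, 99 := Suc 0, 25 := z + 9 + x, 26 := Suc d)) f1
    (Suc (Suc (Suc (Suc (Suc (Suc (Suc (Suc (Suc (Suc t))))))))))"
    by (rule wp_conseq[OF dotk_spec[where a = 1 and len = d and v = "z + 9 + x" and tmp = "z + 8" and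
          K = "z + 6" and acc = "z + 7" and ?N1.0 = "z + 3"]]) (use z xd in \<open>auto simp: s_def d_def\<close>)
  then have "wp dotk (wp (Instrs ([FDiv 9 19 5, FZero 19, FSub 23 19 9] @ inc 23))
    (\<lambda>i' f' t'. i' 23 = z + 10 + Suc x \<and> f' (z + 10 + x) = walkn V n (alt x) \<and>
    f' (z + 4) = f (z + 4) + 1 \<and> (\<forall>y. y < z + 4 \<or> y = z + 5 \<or> z + 9 \<le> y \<and> y \<noteq> z + 10 + x \<longrightarrow> f' y = f y) \<and>
    t' \<le> t + 10 * (c + e) + 20))
    (i(24 := Suc 0, 99 := Suc 0, 25 := z + 9 + x, 26 := Suc d)) f1
    (Suc (Suc (Suc (Suc (Suc (Suc (Suc (Suc (Suc (Suc t))))))))))"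
  proof (rule wp_conseq, goal_cases)
    case (1 i' f' t')
    have i': "i' 9 = z + 8" "i' 19 = z + 7" "i' 5 = z + 4" "i' 23 = z + 10 + x"
      using 1(2) regs(2) by simp_all
    have f7: "f' (z + 7) = s" and f4: "f' (z + 4) = of_int (alt x + int n * int c)"
      using 1(1) K by (simp_all add: f1_def)
    have f4': "f' (z + 4) = f (z + 4) + 1" unfolding f4 M by simp
    have fo: "f' y = f y" if "y \<notin> {z + 4, z + 6, z + 7, z + 8}" for y using 1(1) that by (simp add: f1_def)
    have nz: "f' (z + 4) \<noteq> 0" unfolding f4 by (rule window_up(2)[OF V ce ax])
    have val: "- (f' (z + 7) / f' (z + 4)) = walkn V n (alt x)"
      unfolding f4 f7 s using window_up(1)[OF V ce ax, of n, where 'k = 'k] by simp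
    show ?case
      using 1(1) i' fo nz val f4' by (simp add: d_def)
  qed
  then show ?thesis
    unfolding up_step_def wp_Seq using regs(2) fz fN by (simp add: f1_def d_def add_ac)
qed

text \<open>At the first unknown altitude, 1, the pivot is \<open>n c + 1\<close>. The
  \<open>c\<close> increments leave \<open>(n + 1) c\<close> behind, the value required for the next
  row.\<close>

lemma up_spec:
  fixes f :: "nat \<Rightarrow> 'k::field_char_0"
  assumes regs: "core_regs c e z i" and z: "z = c + e + 1" and mem: "core_mem z n f"
    and M: "f (z + 4) = of_nat (n * c)"
    and win: "\<And>y. y < e + (c + e) \<Longrightarrow> f (z + 10 + y) = walkn V n (alt y)"
  shows "wp up (\<lambda>i' f' t'. (\<forall>y < 2 * (c + e). f' (z + 10 + y) = walkn V n (alt y)) \<and>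
    f' (z + 4) = of_nat (Suc n * c) \<and>
    (\<forall>y. y < z + 4 \<or> y = z + 5 \<or> z + 10 + 2 * (c + e) \<le> y \<longrightarrow> f' y = f y) \<and>
    t' \<le> t + c * (10 * (c + e) + 22) + 2) i f t"
proof -
  note r [simp] = core_regsD[OF regs(1)]
  define x0 where "x0 = e + (c + e)"
  have "wp (While 23 51 up_step) (\<lambda>i' f' t'. (\<forall>y < 2 * (c + e). f' (z + 10 + y) = walkn V n (alt y)) \<and>
    f' (z + 4) = of_nat (Suc n * c) \<and>
    (\<forall>y. y < z + 4 \<or> y = z + 5 \<or> z + 10 + 2 * (c + e) \<le> y \<longrightarrow> f' y = f y) \<and>
    t' \<le> t + c * (10 * (c + e) + 22) + 2) (i(23 := z + 10 + x0)) f (Suc t)"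
  proof (rule wp_while[where n = c and I = "\<lambda>k i' f' t'. i' 23 = z + 10 + (x0 + k) \<and>
      f' (z + 4) = of_nat (n * c) + of_nat k \<and>
      (\<forall>y. y < x0 + k \<longrightarrow> f' (z + 10 + y) = walkn V n (alt y)) \<and>
      (\<forall>y. y < z + 4 \<or> y = z + 5 \<or> z + 10 + 2 * (c + e) \<le> y \<longrightarrow> f' y = f y) \<and>
      t' \<le> t + 1 + k * (10 * (c + e) + 22)"], goal_cases)
    case 1
    show ?case using M win by (simp add: x0_def)
  next
    case (2 k i1 f1 t1)
    note p = 2(2)
    define x where "x = x0 + k"
    have x: "e + (c + e) \<le> x" "x < 2 * (c + e)" using 2(1) by (auto simp: x_def x0_def)
    have cr: "core_regs c e z i1"
      by (rule core_regs_frame[OF regs(1)]) (use 2(3) in auto)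
    have cm: "core_mem z n f1"
      by (rule core_mem_frame[OF mem _ z]) (use p in auto)
    have M1: "f1 (z + 4) = of_int (alt x + int n * int c) - 1"
      using p by (simp add: alt_def x_def x0_def algebra_simps)
    have S: "wp up_step (\<lambda>i' f' t'. i' 23 = z + 10 + Suc x \<and> f' (z + 10 + x) = walkn V n (alt x) \<and>
      f' (z + 4) = f1 (z + 4) + 1 \<and> (\<forall>y. y < z + 4 \<or> y = z + 5 \<or> z + 9 \<le> y \<and> y \<noteq> z + 10 + x \<longrightarrow> f' y = f1 y) \<and>
      t' \<le> Suc t1 + 10 * (c + e) + 20) i1 f1 (Suc t1)"
      by (rule up_step_spec[OF cr _ z cm x M1]) (use p in \<open>auto simp: x_def\<close>)
    have "wp up_step (\<lambda>i' f' t'. i' 23 = z + 10 + (x0 + Suc k) \<and>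
      f' (z + 4) = of_nat (n * c) + of_nat (Suc k) \<and>
      (\<forall>y. y < x0 + Suc k \<longrightarrow> f' (z + 10 + y) = walkn V n (alt y)) \<and>
      (\<forall>y. y < z + 4 \<or> y = z + 5 \<or> z + 10 + 2 * (c + e) \<le> y \<longrightarrow> f' y = f y) \<and>
      Suc t' \<le> t + 1 + Suc k * (10 * (c + e) + 22)) i1 f1 (Suc t1)"
    proof (rule wp_conseq[OF S], goal_cases)
      case (1 i2 f2 t2)
      have "f2 (z + 10 + y) = walkn V n (alt y)" if "y < Suc x" for y
      proof (cases "y = x")
        case False
        then have "f2 (z + 10 + y) = f1 (z + 10 + y)" using 1(1) by simp
        then show ?thesis using p False that by (simp add: x_def)
      qed (use 1(1) in simp)
      moreover have "f2 y = f y" if "y < z + 4 \<or> y = z + 5 \<or> z + 10 + 2 * (c + e) \<le> y" for y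
        using 1(1) p x(2) that by auto
      ultimately show ?case using 1(1) p by (simp add: x_def)
    qed
    then show ?case using p x 2(3)[of 51] by (simp add: x_def)
  next
    case (3 i1 f1 t1)
    then show ?case using 3(2)[of 51] by (simp add: x0_def)
  qed
  then show ?thesis
    unfolding up_def by (simp add: x0_def add_ac)
qed

text \<open>\<open>T\<close> is kept abstract, given by its recurrence and its value at 0, so that
  no range of summation enters the loop invariants.\<close>

lemma tail_part_spec:
  fixes f :: "nat \<Rightarrow> 'k::field_char_0" and T :: "int \<Rightarrow> 'k"
  assumes regs: "core_regs c e z i" and z: "z = c + e + 1" and mem: "core_mem z n f"
    and T: "\<And>a. T a = walkn V n a + T (a + 1)" "f (z + 5) = T 0"
    and win: "\<And>m. m \<le> c + e \<Longrightarrow> f (z + 9 + 2 * (c + e) - m) = walkn V n (int c - int m)"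
  shows "wp tail_part (\<lambda>i' f' t'. f' (z + 5) = (\<Sum>k<Suc (c + e). q k * T (int c - int k)) \<and>
    (\<forall>y. y \<notin> {z + 5, z + 7, z + 8} \<longrightarrow> f' y = f y) \<and> t' \<le> t + 20 * (c + e) + 40) i f t"
proof -
  note r [simp] = core_regsD[OF regs]
  define d where "d = c + e"
  define D where "D = z + 9 + 2 * d"
  have D: "z + 10 + 2 * d - Suc 0 = D" by (simp add: D_def)
  have D': "9 + (z + (2 * c + 2 * e)) = D" by (simp add: D_def d_def)
  have win: "f (D - m) = walkn V n (int c - int m)" if "m \<le> d" for m
    unfolding D_def d_def using win[of m] that by (simp add: d_def)
  have Dm: "D - m \<notin> {z + 5, z + 7, z + 8}" if "m \<le> d" for m using that ce by (auto simp: D_def d_def)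
  have DS: "D - m - Suc 0 = D - Suc m" for m by simp
  define Q where "Q = (\<lambda>(i' :: nat \<Rightarrow> nat) f' t'. f' (z + 5) = (\<Sum>k<Suc d. q k * T (int c - int k)) \<and>
    (\<forall>y. y \<notin> {z + 5, z + 7, z + 8} \<longrightarrow> f' y = f y) \<and> t' \<le> t + 20 * d + 40)"
  define P where "P = wp (While 24 27 (Instrs ([FAdd 19 19 25, FMul 9 24 19, FAdd 6 6 9] @ inc 24 @ dec 25))) Q"
  have P: "P i1 f1 t1" if "i1 24 = 0" "i1 25 = D" "f1 (z + 7) = T (int c + 1)" "f1 (z + 5) = 0"
    "\<And>y. y \<notin> {z + 5, z + 7, z + 8} \<Longrightarrow> f1 y = f y" "t1 \<le> t + 7 * c + 25" "core_regs c e z i1" for i1 f1 t1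
  proof -
    note r1 [simp] = core_regsD[OF that(7)]
    show ?thesis unfolding P_def
    proof (rule wp_while[where n = "Suc d" and I = "\<lambda>m i' f' t'. i' 24 = m \<and> i' 25 = D - m \<and>
        f' (z + 7) = T (int c + 1 - int m) \<and> f' (z + 5) = (\<Sum>k<m. q k * T (int c - int k)) \<and>
        (\<forall>y. y \<notin> {z + 5, z + 7, z + 8} \<longrightarrow> f' y = f y) \<and> t' \<le> t + 7 * c + 25 + m * 9"], goal_cases)
      case 1
      show ?case using that by simp
    next
      case (2 m i2 f2 t2)
      note p = 2(2)
      have rr: "i2 19 = z + 7" "i2 9 = z + 8" "i2 6 = z + 5" "i2 27 = Suc d" using 2(3) by (simp_all add: d_def)
      have m: "m \<le> d" using 2(1) by simp
      have a1: "f2 (D - m) = walkn V n (int c - int m)" using p Dm[OF m] win[OF m] by simp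
      have a2: "f2 m = q m" using p m z mem by (simp add: d_def core_mem_def)
      have a3: "T (int c - int m) = T (int c + 1 - int m) + walkn V n (int c - int m)"
        using T(1)[of "int c - int m"] by (simp add: algebra_simps)
      have mz: "m \<noteq> z + 7" using m z by (simp add: d_def)
      have i2: "i2 24 = m" "i2 25 = D - m" and t2: "t2 \<le> t + 7 * c + 25 + m * 9"
        and f27: "f2 (z + 7) = T (int c + 1 - int m)" and f25: "f2 (z + 5) = (\<Sum>k<m. q k * T (int c - int k))"
        and f2y: "\<And>y. y \<notin> {z + 5, z + 7, z + 8} \<Longrightarrow> f2 y = f y"
        using p by auto
      show ?case using 2(1) t2 by (simp add: i2 rr a1 a2 mz f27 f25 f2y a3 algebra_simps)
    next
      case (3 i2 f2 t2)
      have "i2 27 = Suc d" using 3(2)[of 27] by (simp add: d_def)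
      then show ?case using 3(1) unfolding Q_def by (auto simp: d_def)
    qed
  qed
  define K where "K = wp (Instrs ([FZero 6, IConst 24 0] @ mov 25 51 @ dec 25)) P"
  \<comment> \<open>Cells are subtracted from altitude \<open>c\<close> downwards, so the
    intermediate values are not tails; only after \<open>c + 1\<close> rounds does
    \<open>T(c + 1)\<close> remain.\<close>
  have "wp (While 24 29 (Instrs ([FSub 19 19 25] @ dec 25 @ inc 24))) K
    (i(24 := 0, 99 := Suc 0, 25 := D)) (f(z + 7 := T 0)) (Suc (Suc (Suc (Suc (Suc (Suc t))))))"
  proof (rule wp_while[where n = "Suc c" and I = "\<lambda>m i' f' t'. i' 24 = m \<and> i' 25 = D - m \<and>
        f' (z + 7) = T 0 - T (int c + 1 - int m) + T (int c + 1) \<and>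
        (\<forall>y. y \<notin> {z + 5, z + 7, z + 8} \<longrightarrow> f' y = f y) \<and> t' \<le> t + 6 + m * 7"], goal_cases)
    case 1
    show ?case by simp
  next
    case (2 m i2 f2 t2)
    note p = 2(2)
    have rr: "i2 19 = z + 7" "i2 29 = Suc c" using 2(3) by simp_all
    have m: "m \<le> d" using 2(1) by (simp add: d_def)
    have a1: "f2 (D - m) = walkn V n (int c - int m)" using p Dm[OF m] win[OF m] by simp
    have a3: "T (int c - int m) = T (int c + 1 - int m) + walkn V n (int c - int m)"
      using T(1)[of "int c - int m"] by (simp add: algebra_simps)
    have i2: "i2 24 = m" "i2 25 = D - m" and t2: "t2 \<le> t + 6 + m * 7"
      and f27: "f2 (z + 7) = T 0 - T (int c + 1 - int m) + T (int c + 1)"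
      and f2y: "\<And>y. y \<notin> {z + 5, z + 7, z + 8} \<Longrightarrow> f2 y = f y"
      using p by auto
    show ?case using 2(1) t2 by (simp add: i2 rr a1 f27 f2y a3 algebra_simps)
  next
    case (3 i2 f2 t2)
    note p = 3(1)
    have cr: "core_regs c e z i2" by (rule core_regs_frame[OF regs]) (use 3(2) in auto)
    note r2 [simp] = core_regsD[OF cr]
    have "P (i2(24 := 0, 99 := Suc 0, 25 := D)) (f2(z + 5 := 0)) (Suc (Suc (Suc (Suc (Suc (Suc (Suc t2)))))))"
    proof (rule P)
      show "core_regs c e z (i2(24 := 0, 99 := Suc 0, 25 := D))"
        by (rule core_regs_frame[OF cr]) auto
    qed (use p in auto)
    then show ?case using p by (simp add: K_def D[unfolded d_def] D')
  qed
  then show ?thesis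
    unfolding tail_part_def wp_Seq_eq using T(2)
    by (simp add: K_def P_def Q_def D[unfolded d_def] D' d_def)
qed

text \<open>Peeling off the last step makes each of the \<open>d\<close> carried entries of row
  \<open>n + 1\<close> a convolution of length \<open>d + 1\<close> with the window of row
  \<open>n\<close>.\<close>

lemma shift_part_spec:
  fixes f :: "nat \<Rightarrow> 'k::field_char_0"
  assumes regs: "core_regs c e z i" and z: "z = c + e + 1" and mem: "core_mem z n f"
    and win: "\<And>y. y < 2 * (c + e) \<Longrightarrow> f (z + 10 + y) = walkn V n (alt y)"
  shows "wp shift_part (\<lambda>i' f' t'.
    (\<forall>y < c + e. f' (z + 10 + 2 * (c + e) + y) = walkn V (Suc n) (int y - int (c + e) + 1)) \<and>
    (\<forall>y. y \<notin> {z + 7, z + 8} \<longrightarrow> \<not> (z + 10 + 2 * (c + e) \<le> y \<and> y < z + 10 + 3 * (c + e)) \<longrightarrow> f' y = f y) \<and>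
    t' \<le> t + (c + e) * (8 * (c + e) + 30) + 5) i f t"
proof -
  note r [simp] = core_regsD[OF regs]
  define d where "d = c + e"
  define s where "s = (\<lambda>y. walkn V (Suc n) (int y - int d + 1) :: 'k)"
  have s: "s y = (\<Sum>k<Suc d. f k * f (z + 10 + (d + y - k)))" if "y < d" for y
  proof -
    have "s y = (\<Sum>k<Suc d. q k * walkn V n (int y - int d + 1 - (int k - int c)))"
      unfolding s_def count_walks.simps if_True sum_qcoef[OF V ce] by (simp only: d_def)
    also have "\<dots> = (\<Sum>k<Suc d. f k * f (z + 10 + (d + y - k)))"
    proof (rule sum.cong[OF refl])
      fix k assume k: "k \<in> {..<Suc d}"
      have "f (z + 10 + (d + y - k)) = walkn V n (alt (d + y - k))"
        by (rule win) (use k that in \<open>simp add: d_def\<close>)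
      moreover have "alt (d + y - k) = int y - int d + 1 - (int k - int c)"
        using k by (simp add: alt_def of_nat_diff d_def)
      moreover have "f k = q k" using mem k by (simp add: core_mem_def d_def)
      ultimately show "q k * walkn V n (int y - int d + 1 - (int k - int c)) = f k * f (z + 10 + (d + y - k))"
        by (simp only:)
    qed
    finally show ?thesis .
  qed
  have "wp (While 23 52 (Instrs ([FZero 19, IConst 24 0] @ mov 25 31 @ mov 26 27) ;; dot ;;
       Instrs ([FCopy 23 19] @ inc 23 @ inc 31))) (\<lambda>i' f' t'. (\<forall>y < d. f' (z + 10 + 2 * d + y) = s y) \<and>
    (\<forall>y. y \<notin> {z + 7, z + 8} \<longrightarrow> \<not> (z + 10 + 2 * d \<le> y \<and> y < z + 10 + 3 * d) \<longrightarrow> f' y = f y) \<and>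
    t' \<le> t + d * (8 * d + 30) + 5) (i(23 := z + 10 + 2 * d, 31 := z + 10 + d)) f (Suc (Suc (Suc t)))"
  proof (rule wp_while[where n = d and I = "\<lambda>m i' f' t'. i' 23 = z + 10 + 2 * d + m \<and> i' 31 = z + 10 + d + m \<and>
    (\<forall>y < m. f' (z + 10 + 2 * d + y) = s y) \<and>
    (\<forall>y. y \<notin> {z + 7, z + 8} \<longrightarrow> \<not> (z + 10 + 2 * d \<le> y \<and> y < z + 10 + 3 * d) \<longrightarrow> f' y = f y) \<and>
    t' \<le> t + 3 + m * (8 * d + 30)"], goal_cases)
    case 1
    show ?case by simp
  next
    case (2 m i1 f1 t1)
    note p = 2(2)
    have cr: "core_regs c e z i1" by (rule core_regs_frame[OF regs]) (use 2(3) in auto)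
    note r1 [simp] = core_regsD[OF cr]
    define f2 where "f2 = f1(z + 7 := 0)"
    define v where "v = z + 10 + d + m"
    have i1: "i1 23 = z + 10 + 2 * d + m" "i1 31 = v" and t1: "t1 \<le> t + 3 + m * (8 * d + 30)"
      and f1s: "\<And>y. y < m \<Longrightarrow> f1 (z + 10 + 2 * d + y) = s y"
      and f1o: "\<And>y. y \<notin> {z + 7, z + 8} \<Longrightarrow> \<not> (z + 10 + 2 * d \<le> y \<and> y < z + 10 + 3 * d) \<Longrightarrow> f1 y = f y"
      using p by (auto simp: v_def)
    have f1s': "f1 (y + (z + (d * 2 + 10))) = s y" if "y < m" for y using f1s[OF that] by (simp add: algebra_simps)
    have f2o: "f2 y = f y" if "y < z \<or> z + 10 \<le> y \<and> y < z + 10 + 2 * d" for y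
      unfolding f2_def using f1o[of y] that by auto
    have sm: "(\<Sum>k<Suc d. f2 (0 + k) * f2 (v - k)) = s m"
    proof -
      have "f2 (0 + k) * f2 (v - k) = f k * f (z + 10 + (d + m - k))" if "k < Suc d" for k
      proof -
        have e: "v - k = z + 10 + (d + m - k)" using that by (simp add: v_def)
        have "f2 k = f k" by (rule f2o) (use that z in \<open>simp add: d_def\<close>)
        moreover have "f2 (z + 10 + (d + m - k)) = f (z + 10 + (d + m - k))" by (rule f2o) (use 2(1) in simp)
        ultimately show ?thesis by (simp only: e add_0)
      qed
      then show ?thesis unfolding s[OF 2(1)] by (intro sum.cong) auto
    qed
    define K where "K = wp (Instrs ([FCopy 23 19] @ inc 23 @ inc 31)) (\<lambda>i' f' t'.
      i' 23 = z + 10 + 2 * d + Suc m \<and> i' 31 = z + 10 + d + Suc m \<and>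
      (\<forall>y < Suc m. f' (z + 10 + 2 * d + y) = s y) \<and>
      (\<forall>y. y \<notin> {z + 7, z + 8} \<longrightarrow> \<not> (z + 10 + 2 * d \<le> y \<and> y < z + 10 + 3 * d) \<longrightarrow> f' y = f y) \<and>
      Suc t' \<le> t + 3 + Suc m * (8 * d + 30))"
    have "wp dot (\<lambda>i' f' t'. f' (z + 7) = f2 (z + 7) + (\<Sum>k<Suc d. f2 (0 + k) * f2 (v - k)) \<and>
      (\<forall>y. y \<notin> {z + 8, z + 7} \<longrightarrow> f' y = f2 y) \<and> t' \<le> Suc (Suc (Suc (Suc (Suc (Suc (Suc t1)))))) + 8 * Suc d + 1)
      (i1(24 := 0, 25 := v, 26 := Suc d)) f2 (Suc (Suc (Suc (Suc (Suc (Suc (Suc t1)))))))"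
      by (rule dot_spec) (use z in \<open>auto simp: v_def d_def\<close>)
    then have "wp dot K (i1(24 := 0, 25 := v, 26 := Suc d)) f2 (Suc (Suc (Suc (Suc (Suc (Suc (Suc t1)))))))"
    proof (rule wp_conseq, goal_cases)
      case (1 i3 f3 t3)
      have i3: "i3 23 = z + 10 + 2 * d + m" "i3 31 = v" "i3 19 = z + 7" using 1(2) i1 by simp_all
      have f3: "f3 (z + 7) = s m" using 1(1) sm by (simp add: f2_def)
      have f3o: "f3 y = f1 y" if "y \<notin> {z + 7, z + 8}" for y using 1(1) that by (simp add: f2_def)
      have t3: "t3 \<le> t1 + 8 * d + 16" using 1(1) by simp
      have dd: "m < d" by (rule 2(1))
      show ?case unfolding K_def
        using dd t1 t3 by (auto simp: i3 f3 f3o f1s' f1o v_def less_Suc_eq algebra_simps)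
    qed
    moreover have "i1 23 < i1 52" using i1 2(1) by (simp add: d_def)
    ultimately show ?case using i1 by (simp add: K_def f2_def d_def)
  next
    case (3 i1 f1 t1)
    have "i1 52 = z + 10 + 3 * d" using 3(2)[of 52] by (simp add: d_def)
    then show ?case using 3(1) by simp
  qed
  then show ?thesis
    unfolding shift_part_def by (simp add: s_def d_def)
qed

end

section \<open>Memory layout and the loop over the rows\<close>

definition layout :: com where
  "layout = Instrs (mov 8 0 @ [IAdd 3 1 2, IConst 98 (Suc 0), IAdd 18 3 98] @ mov 27 18 @
     [IAdd 29 2 98, IAdd 10 18 98, IAdd 17 10 98, IAdd 4 17 98, IAdd 5 4 98, IAdd 6 5 98, IAdd 7 6 98,
      IAdd 19 7 98, IAdd 9 19 98, IAdd 22 9 98, IAdd 50 22 98, IAdd 20 50 1, IAdd 51 50 3, IAdd 51 51 3,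
      IAdd 52 51 3, ISub 57 52 98] @ mov 54 52 @ [IAdd 55 52 8, IAdd 53 55 8] @ mov 56 53 @
     [IAdd 14 53 8, IAdd 14 14 8, IAdd 15 14 8, IAdd 12 15 8, IAdd 12 12 8,
      FOne 18, FAdd 10 18 18, FDiv 10 18 10, FOne 4, FZero 5, FOne 6]) ;;
   arr op_zero 51 51 51 3 ;; Instrs [FOne 57]"

text \<open>The two numbers of row \<open>n\<close> are recorded before the window moves on, so
  \<open>N\<close> rounds produce the indices 0 to \<open>N - 1\<close>.\<close>

definition core_body :: com where
  "core_body = Instrs [FCopy 54 57, FCopy 56 6] ;; arr op_copy 20 51 51 3 ;; down ;; up ;; tail_part ;; shift_part ;;
     Instrs ([FAdd 4 4 18] @ inc 54 @ inc 56)"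

definition core :: com where
  "core = layout ;; While 54 55 core_body"

lemma wr_core_body [simp]: "wr core_body = {23, 24, 25, 26, 31, 54, 56, 60, 61, 62, 63, 64, 99}"
  by (auto simp: core_body_def)

context
  fixes V :: "int set" and c e :: nat
  assumes V: "V \<subseteq> {- int c..int e}" "- int c \<in> V" "int e \<in> V" and ce: "0 < c" "0 < e"
begin

lemmas core_memD = core_mem_def[OF V ce]

text \<open>The tail \<open>T(a)\<close> of row \<open>n\<close>. Counts above \<open>n e\<close>
  vanish, so the finite sum obeys the tail recurrence for every \<open>a\<close>.\<close>

definition tl :: "nat \<Rightarrow> int \<Rightarrow> 'k::field_char_0" where
  "tl n a = (\<Sum>h\<in>{a..int (n * e)}. walkn V n h)"

lemma walkn_upper: "int (n * e) < h \<Longrightarrow> walkn V n h = (0 :: 'k::field_char_0)"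
  by (rule count_walks_upper) (use V in auto)

lemma tl_rec: "tl n a = walkn V n a + (tl n (a + 1) :: 'k::field_char_0)"
proof (cases "a \<le> int (n * e)")
  case True
  then have "{a..int (n * e)} = insert a {a + 1..int (n * e)}" by auto
  then show ?thesis by (simp add: tl_def)
next
  case False
  then show ?thesis using walkn_upper[of n a, where 'k = 'k] by (simp add: tl_def)
qed

text \<open>Summing over final altitudes at least 0 and removing the last step \<open>u\<close>
  leaves the tail from \<open>- u\<close>; with \<open>u = k - c\<close> this is the tail from
  \<open>c - k\<close>.\<close>

lemma tl_Suc: "tl (Suc n) 0 = (\<Sum>k<Suc (c + e). qcoef V c k * (tl n (int c - int k) :: 'k::field_char_0))"
proof -
  have "(\<Sum>h\<in>{0..int (Suc n * e)}. walkn V n (h - u)) = (tl n (- u) :: 'k)" if u: "u \<in> V" for u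
  proof -
    have "(\<Sum>h\<in>{0..int (Suc n * e)}. walkn V n (h - u)) = (\<Sum>h\<in>{- u..int (Suc n * e) - u}. walkn V n h :: 'k)"
      by (rule sum.reindex_bij_witness[where i = "\<lambda>h. h + u" and j = "\<lambda>h. h - u"]) auto
    also have "\<dots> = tl n (- u)"
      unfolding tl_def
    proof (rule sum.mono_neutral_right)
      have "u \<le> int e" using u V by auto
      then show "{- u..int (n * e)} \<subseteq> {- u..int (Suc n * e) - u}" by auto
      show "\<forall>h\<in>{- u..int (Suc n * e) - u} - {- u..int (n * e)}. walkn V n h = (0 :: 'k)"
        by (intro ballI walkn_upper) auto
    qed simp
    finally show ?thesis .
  qed
  then have "tl (Suc n) 0 = (\<Sum>u\<in>V. tl n (- u) :: 'k)"
    unfolding tl_def[of "Suc n"] count_walks.simps if_True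
    by (subst sum.swap) (intro sum.cong, auto)
  then show ?thesis unfolding sum_qcoef[OF V ce] by simp
qed

lemma tl_eq: "tl n 0 = (\<Sum>h\<le>n * e. walkn V n (int h) :: 'k::field_char_0)"
  unfolding tl_def
  by (rule sum.reindex_bij_witness[where i = int and j = nat]) (auto simp: nat_le_iff simp flip: of_nat_mult)

definition core_cells :: "nat \<Rightarrow> nat \<Rightarrow> 'k \<Rightarrow> nat \<Rightarrow> nat \<Rightarrow> (nat \<Rightarrow> 'k::field_char_0) \<Rightarrow> bool" where
  "core_cells z p h m n f \<longleftrightarrow> core_mem V c e z n f \<and> f (z + 1) = h \<and>
     (\<forall>j<m. f (z + 10 + 3 * (c + e) + j) = walkn V j 0 \<and> f (p + j) = tl j 0)"

definition core_inv :: "nat \<Rightarrow> nat \<Rightarrow> 'k \<Rightarrow> nat \<Rightarrow> (nat \<Rightarrow> nat) \<Rightarrow> (nat \<Rightarrow> 'k::field_char_0) \<Rightarrow> bool" where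
  "core_inv z p h n i f \<longleftrightarrow> core_regs c e z i \<and> i 54 = z + 10 + 3 * (c + e) + n \<and> i 56 = p + n \<and>
     core_cells z p h n n f \<and> f (z + 4) = of_nat (n * c) \<and> f (z + 5) = tl n 0 \<and>
     (\<forall>y<c + e. f (z + 10 + 2 * (c + e) + y) = walkn V n (int y - int (c + e) + 1))"

lemma core_cells_frame:
  assumes "core_cells z p h m n f" "\<And>y. y < z + 4 \<or> z + 10 + 3 * (c + e) \<le> y \<Longrightarrow> f' y = f y"
    "z = c + e + 1" "z + 10 + 3 * (c + e) \<le> p"
  shows "core_cells z p h m n f'"
  using assms by (auto simp: core_cells_def core_memD)

lemma core_step_spec:
  fixes f :: "nat \<Rightarrow> 'k::field_char_0"
  assumes inv: "core_inv z p h n i f" and z: "z = c + e + 1" and p: "z + 10 + 3 * (c + e) + n < p"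
  shows "wp core_body (\<lambda>i' f' t'. core_inv z p h (Suc n) i' f' \<and> t' \<le> t + 98 * ((c + e) * (c + e))) i f t"
proof -
  define d where "d = c + e"
  define b where "b = z + 10 + 3 * d"
  have d2: "2 \<le> d" using ce by (simp add: d_def)
  define R where "R = (\<lambda>i. core_regs c e z i \<and> i 54 = b + n \<and> i 56 = p + n)"
  have Rf: "R i'" if "R i1" "\<And>r. r \<in> {1, 2, 3, 18, 4, 5, 6, 7, 19, 9, 22, 50, 51, 52, 57, 20, 27, 29, 54, 56} \<Longrightarrow> i' r = i1 r" for i1 i'
    using that core_regs_frame[of c e z i1 i'] by (auto simp: R_def)
  note dbs = d_def[symmetric] b_def[symmetric]
  have i0: "R i" "core_cells z p h n n f" "f (z + 4) = of_nat (n * c)" "f (z + 5) = tl n 0"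
    "\<And>y. y < d \<Longrightarrow> f (z + 10 + 2 * d + y) = walkn V n (int y - int d + 1)"
    using inv by (simp_all add: core_inv_def R_def d_def b_def)
  define F where "F = f(b + n := f (z + 9 + 3 * d), p + n := f (z + 5))"
  \<comment> \<open>The last carried cell belongs to altitude 0, so the bridge number is read off
    there.\<close>
  have bz: "z + 9 + 3 * d = z + 10 + 2 * d + (d - 1)" using d2 by simp
  have fb: "f (z + 9 + 3 * d) = walkn V n 0"
    unfolding bz using i0(5)[of "d - 1"] d2 by simp
  have FG: "core_cells z p h (Suc n) n F"
    using i0(2,4) fb p z unfolding core_cells_def core_memD F_def b_def d_def
    by (auto simp: less_Suc_eq)
  have Fo: "F y = f y" if "y < b" for y using that p by (simp add: F_def b_def d_def)
  have F4: "F (z + 4) = of_nat (n * c)" "F (z + 5) = tl n 0" using Fo i0(3,4) by (simp_all add: b_def)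
  have Fw: "F (z + 10 + 2 * d + y) = walkn V n (int y - int d + 1)" if "y < d" for y
    using Fo[of "z + 10 + 2 * d + y"] i0(5)[OF that] that by (simp add: b_def)
  note cf = core_cells_frame[OF _ _ z, where p = p]
  have bp: "z + 10 + 3 * (c + e) \<le> p" using p by simp
  have cm: "core_mem V c e z n f'" if "core_cells z p h (Suc n) n f'" for f' using that by (simp add: core_cells_def)
  define Q where "Q = (\<lambda>i' f' t'. core_inv z p h (Suc n) i' f' \<and> t' \<le> t + 98 * ((c + e) * (c + e)))"
  define K6 where "K6 = wp (Instrs ([FAdd 4 4 18] @ inc 54 @ inc 56)) Q"
  define K5 where "K5 = wp shift_part K6"
  define K4 where "K4 = wp tail_part K5"
  define K3 where "K3 = wp up K4"
  define K2 where "K2 = wp down K3"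
  define w where "w = (\<lambda>x. walkn V n (alt c e x) :: 'k)"
  define s where "s = (\<lambda>y. walkn V (Suc n) (int y - int (c + e) + 1) :: 'k)"
  have K6: "K6 i' f' t'" if "R i'" "core_cells z p h (Suc n) n f'" "f' (z + 4) = of_nat (Suc n * c)"
    "f' (z + 5) = tl (Suc n) 0" "\<forall>y<c + e. f' (z + 10 + 2 * (c + e) + y) = s y"
    "t' \<le> t + 18 * (d * d) + 84 * d + 63" for i' f' t'
  proof -
    have R: "core_regs c e z i'" "i' 54 = b + n" "i' 56 = p + n" using that(1) by (simp_all add: R_def)
    note r [simp] = core_regsD[OF R(1)]
    have f: "f' z = 1" "f' (z + 3) = of_nat (Suc n)" using that(2) by (simp_all add: core_cells_def core_memD)
    have cr: "core_regs c e z (i'(99 := Suc 0, 54 := Suc (b + n), 56 := Suc (p + n)))"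
      by (rule core_regs_frame[OF R(1)]) auto
    have cc: "core_cells z p h (Suc n) (Suc n) (f'(z + 3 := 1 + of_nat (Suc n)))"
      using that(2) z bp unfolding core_cells_def core_memD by auto
    \<comment> \<open>Both extreme steps are positive, so \<open>d\<close> is at least 2, and linear
      and constant terms are absorbed by \<open>d^2\<close>.\<close>
    have "2 * d \<le> d * d" "4 \<le> d * d" using mult_le_mono[OF d2 d2] mult_le_mono1[OF d2, of d] by auto
    then have "t' + 5 \<le> t + 98 * (d * d)" using that(6) d2 by linarith
    then have "core_inv z p h (Suc n) (i'(99 := Suc 0, 54 := Suc (b + n), 56 := Suc (p + n)))
        (f'(z + 3 := 1 + of_nat (Suc n))) \<and> t' + 5 \<le> t + 98 * ((c + e) * (c + e))"
      using cr cc that(3-5) by (simp add: core_inv_def b_def d_def s_def)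
    then show ?thesis
      unfolding K6_def Q_def using f R(2,3) by (simp add: fun_upd_twist add.commute)
  qed
  have K5: "K5 i' f' t'" if "R i'" "core_cells z p h (Suc n) n f'" "f' (z + 4) = of_nat (Suc n * c)"
    "f' (z + 5) = tl (Suc n) 0" "\<forall>y<2 * (c + e). f' (z + 10 + y) = w y"
    "t' \<le> t + 10 * (d * d) + 54 * d + 58" for i' f' t'
  proof -
    have R: "core_regs c e z i'" using that(1) by (simp_all add: R_def)
    show ?thesis unfolding K5_def
    proof (rule wp_conseq[OF shift_part_spec[OF V ce R z cm[OF that(2)]]], goal_cases)
      case (1 y)
      then show ?case using that(5) by (simp add: w_def)
    next
      case (2 i1 f1 t1)
      show ?case
      proof (rule K6)
        show "R i1" by (rule Rf[OF that(1)]) (use 2(2) in auto)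
        show "core_cells z p h (Suc n) n f1"
          by (rule cf[OF that(2) _ bp]) (use 2(1) in auto)
        show "t1 \<le> t + 18 * (d * d) + 84 * d + 63"
        proof -
          have "t1 \<le> t' + (d * (8 * d + 30) + 5)" using 2(1) by (simp add: d_def)
          moreover have "d * (8 * d + 30) = 8 * (d * d) + 30 * d" by (simp add: algebra_simps)
          ultimately show ?thesis using that(6) by linarith
        qed
      qed (use 2(1) that in \<open>auto simp: s_def\<close>)
    qed
  qed
  have K4: "K4 i' f' t'" if "R i'" "core_cells z p h (Suc n) n f'" "f' (z + 4) = of_nat (Suc n * c)"
    "f' (z + 5) = tl n 0" "\<forall>y<2 * (c + e). f' (z + 10 + y) = w y"
    "t' \<le> t + 10 * (d * d) + 34 * d + 18" for i' f' t'
  proof -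
    have R: "core_regs c e z i'" using that(1) by (simp_all add: R_def)
    have win: "f' (z + 9 + 2 * (c + e) - m) = walkn V n (int c - int m)" if "m \<le> c + e" for m
    proof -
      define y where "y = 2 * (c + e) - 1 - m"
      have y: "y < 2 * (c + e)" "z + 9 + 2 * (c + e) - m = z + 10 + y" "alt c e y = int c - int m"
        using that ce by (auto simp: y_def alt_def[OF V ce] of_nat_diff)
      show ?thesis unfolding y(2) using y(1,3) \<open>\<forall>y<2 * (c + e). f' (z + 10 + y) = w y\<close> by (simp add: w_def)
    qed
    show ?thesis unfolding K4_def
    proof (rule wp_conseq[OF tail_part_spec[OF V ce R z cm[OF that(2)] tl_rec that(4) win]], goal_cases)
      case (2 i1 f1 t1)
      show ?case
      proof (rule K5)
        show "R i1" by (rule Rf[OF that(1)]) (use 2(2) in auto)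
        show "core_cells z p h (Suc n) n f1"
          by (rule cf[OF that(2) _ bp]) (use 2(1) in auto)
        show "f1 (z + 5) = tl (Suc n) 0" using 2(1) by (simp only: tl_Suc)
      qed (use 2(1) that in \<open>auto simp: d_def\<close>)
    qed
  qed
  have K3: "K3 i' f' t'" if "R i'" "core_cells z p h (Suc n) n f'" "f' (z + 4) = of_nat (n * c)"
    "f' (z + 5) = tl n 0" "\<forall>y<e + (c + e). f' (z + 10 + y) = w y"
    "t' \<le> t + e * (10 * d + 22) + 12 * d + 16" for i' f' t'
  proof -
    have R: "core_regs c e z i'" using that(1) by (simp_all add: R_def)
    show ?thesis unfolding K3_def
    proof (rule wp_conseq[OF up_spec[OF V ce R z cm[OF that(2)] that(3)]], goal_cases)
      case (1 y)
      then show ?case using that(5) by (simp add: w_def)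
    next
      case (2 i1 f1 t1)
      show ?case
      proof (rule K4)
        show "R i1" by (rule Rf[OF that(1)]) (use 2(2) in auto)
        show "core_cells z p h (Suc n) n f1"
          by (rule cf[OF that(2) _ bp]) (use 2(1) in auto)
        show "t1 \<le> t + 10 * (d * d) + 34 * d + 18"
        proof -
          have "t1 \<le> t' + (c * (10 * d + 22) + 2)" using 2(1) by (simp add: d_def)
          moreover have "c * (10 * d + 22) + e * (10 * d + 22) = 10 * (d * d) + 22 * d"
            by (simp add: d_def algebra_simps)
          ultimately show ?thesis using that(6) by linarith
        qed
      qed (use 2(1) that in \<open>auto simp: w_def\<close>)
    qed
  qed
  have K2: "K2 i' f' t'" if "R i'" "core_cells z p h (Suc n) n f'" "f' (z + 4) = of_nat (n * c)"
    "f' (z + 5) = tl n 0" "\<And>y. e \<le> y \<Longrightarrow> y < e + (c + e) \<Longrightarrow> f' (z + 10 + y) = w y"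
    "t' \<le> t + 12 * d + 12" for i' f' t'
  proof -
    have R: "core_regs c e z i'" using that(1) by (simp_all add: R_def)
    show ?thesis unfolding K2_def
    proof (rule wp_conseq[OF down_spec[OF V ce R z cm[OF that(2)] that(3)]], goal_cases)
      case (1 y)
      then show ?case using that(5) by (simp add: w_def)
    next
      case (2 i1 f1 t1)
      show ?case
      proof (rule K3)
        show "R i1" by (rule Rf[OF that(1)]) (use 2(2) in auto)
        show "core_cells z p h (Suc n) n f1"
          by (rule cf[OF that(2) _ bp]) (use 2(1) in auto)
      qed (use 2(1) that in \<open>auto simp: w_def d_def\<close>)
    qed
  qed
  have R: "core_regs c e z i" "i 54 = b + n" "i 56 = p + n" using i0(1) by (simp_all add: R_def)
  note r [simp] = core_regsD[OF R(1)]
  have "wp (arr op_copy 20 51 51 3) K2 i F (Suc (Suc t))"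
  proof (rule wp_conseq[OF arr_specs(1)[where i = i, OF _ _ _ _ _ _ refl]], goal_cases)
    case (7 i1 f1 t1)
    have f1: "f1 = upd_arr F (z + 10 + e) d (\<lambda>k. F (z + 10 + 2 * d + k))" "t1 \<le> Suc (Suc t) + 12 * d + 10"
      using 7(1) by (simp_all add: d_def)
    have f1o: "f1 y = F y" if "y < z + 10 \<or> b \<le> y" for y
      using that ce unfolding f1 by (auto simp: upd_arr_def b_def d_def)
    show ?case
    proof (rule K2)
      show "R i1" by (rule Rf[OF i0(1)]) (use 7(2) in auto)
      show "core_cells z p h (Suc n) n f1"
        by (rule cf[OF FG _ bp]) (use f1o in \<open>auto simp: b_def d_def\<close>)
      show "f1 (z + 10 + y) = w y" if "e \<le> y" "y < e + (c + e)" for y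
      proof -
        define x where "x = y - e"
        then have x: "y = e + x" using that(1) by simp
        have xd: "x < d" using that x by (simp add: d_def)
        have "f1 (z + 10 + y) = F (z + 10 + 2 * d + x)" using xd unfolding f1 x by (simp add: upd_arr_def)
        also have "\<dots> = walkn V n (int x - int d + 1)" by (rule Fw[OF xd])
        also have "int x - int d + 1 = alt c e y" by (simp add: alt_def[OF V ce] x d_def)
        finally show ?thesis by (simp add: w_def)
      qed
    qed (use f1o F4 f1(2) in auto)
  qed (auto simp: z)
  moreover have "z + 5 \<noteq> b + n" by (simp add: b_def)
  ultimately show ?thesis
    unfolding core_body_def wp_Seq_eq K2_def K3_def K4_def K5_def K6_def Q_def[symmetric]
    using R(2,3) by (simp add: F_def d_def)
qed

text \<open>Both coefficient arrays receive \<open>2 N\<close> cells, because block products read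
  that far ahead, and so do the accumulators, because blocks may reach beyond \<open>N\<close>. Row
  0 has a single nonzero count, at altitude 0, to which register 57 points.\<close>

lemma layout_spec:
  fixes f :: "nat \<Rightarrow> 'k::field_char_0"
  assumes i: "i 0 = N" "i 1 = e" "i 2 = c" and f: "\<And>k. k \<le> c + e \<Longrightarrow> f k = qcoef V c k"
    and z: "z = c + e + 1" and b: "b = z + 10 + 3 * (c + e)"
  shows "wp layout (\<lambda>i' f' t'. core_inv z (b + 2 * N) (1 / 2) 0 i' f' \<and> i' 8 = N \<and> i' 10 = z + 1 \<and> i' 12 = b + 7 * N \<and>
    i' 14 = b + 4 * N \<and> i' 15 = b + 5 * N \<and> i' 17 = z + 2 \<and> i' 53 = b + 2 * N \<and> i' 55 = b + N \<and>
    t' \<le> t + 60 + 12 * (c + e)) i f t"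
proof -
  define d where "d = c + e"
  have d2: "2 \<le> d" using ce by (simp add: d_def)
  define Q where "Q = (\<lambda>i' f' t'. core_inv z (b + 2 * N) (1 / 2 :: 'k) 0 i' f' \<and> i' 8 = N \<and> i' 10 = z + 1 \<and> i' 12 = b + 7 * N \<and>
    i' 14 = b + 4 * N \<and> i' 15 = b + 5 * N \<and> i' 17 = z + 2 \<and> i' 53 = b + 2 * N \<and> i' 55 = b + N \<and>
    t' \<le> t + 60 + 12 * d)"
  note i' = i(2)[unfolded One_nat_def]
  define K where "K = wp (arr op_zero 51 51 51 3) (wp (Instrs [FOne 57]) Q)"
  have K: "K i' f' t'" if R: "core_regs c e z i'" "i' 54 = b" "i' 56 = b + 2 * N" "i' 8 = N" "i' 10 = z + 1" "i' 12 = b + 7 * N"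
    "i' 14 = b + 4 * N" "i' 15 = b + 5 * N" "i' 17 = z + 2" "i' 53 = b + 2 * N" "i' 55 = b + N"
    and F: "core_cells z (b + 2 * N) (1 / 2) 0 0 f'" "f' (z + 4) = 0" "f' (z + 5) = 1" and t: "t' \<le> t + 49" for i' f' t'
  proof -
    note r [simp] = core_regsD[OF R(1)]
    show ?thesis unfolding K_def
    proof (rule wp_conseq[OF arr_specs(2)[where i = i', OF _ _ _ _ _ _ refl]], goal_cases)
      case (7 i1 f1 t1)
      have f1: "f1 = upd_arr f' (z + 10 + 2 * d) d (\<lambda>k. 0)" "t1 \<le> t' + 12 * d + 10"
        using 7(1) by (simp_all add: d_def)
      have cr: "core_regs c e z i1" by (rule core_regs_frame[OF R(1)]) (use 7(2) in auto)
      have i1: "i1 8 = N" "i1 10 = z + 1" "i1 12 = b + 7 * N" "i1 54 = b" "i1 56 = b + 2 * N" "i1 57 = z + 9 + 3 * d"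
        "i1 14 = b + 4 * N" "i1 15 = b + 5 * N" "i1 17 = z + 2" "i1 53 = b + 2 * N" "i1 55 = b + N"
        using 7(2) R by (simp_all add: d_def)
      define f2 where "f2 = f1(z + 9 + 3 * d := 1)"
      have f2o: "f2 y = f' y" if "y < z + 10" for y using that d2 unfolding f2_def f1 by (auto simp: upd_arr_def)
      have cc: "core_cells z (b + 2 * N) (1 / 2) 0 0 f2"
        using F(1) f2o z by (auto simp: core_cells_def core_memD)
      have w: "f2 (z + 10 + 2 * d + y) = walkn V 0 (int y - int d + 1)" if "y < d" for y
        using that unfolding f2_def f1 by (auto simp: upd_arr_def)
      have "core_inv z (b + 2 * N) (1 / 2) 0 i1 f2"
        unfolding core_inv_def using cr i1 cc w f2o[of "z + 4"] f2o[of "z + 5"] F(2,3)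
        by (simp add: b d_def tl_def)
      then show ?case using i1 f1(2) t by (simp add: Q_def f2_def)
    qed (auto simp: z)
  qed
  have "wp (Instrs (mov 8 0 @ [IAdd 3 1 2, IConst 98 (Suc 0), IAdd 18 3 98] @ mov 27 18 @
     [IAdd 29 2 98, IAdd 10 18 98, IAdd 17 10 98, IAdd 4 17 98, IAdd 5 4 98, IAdd 6 5 98, IAdd 7 6 98,
      IAdd 19 7 98, IAdd 9 19 98, IAdd 22 9 98, IAdd 50 22 98, IAdd 20 50 1, IAdd 51 50 3, IAdd 51 51 3,
      IAdd 52 51 3, ISub 57 52 98] @ mov 54 52 @ [IAdd 55 52 8, IAdd 53 55 8] @ mov 56 53 @
     [IAdd 14 53 8, IAdd 14 14 8, IAdd 15 14 8, IAdd 12 15 8, IAdd 12 12 8,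
      FOne 18, FAdd 10 18 18, FDiv 10 18 10, FOne 4, FZero 5, FOne 6])) K i f t"
    apply (simp add: i i')
    apply (rule K)
    apply (simp_all add: core_regs_def core_cells_def core_memD z b i i' f)
    done
  then show ?thesis
    unfolding layout_def wp_Seq_eq Q_def[unfolded d_def, symmetric] K_def .
qed

lemma core_spec:
  fixes f :: "nat \<Rightarrow> 'k::field_char_0"
  assumes i: "i 0 = N" "i 1 = e" "i 2 = c" and f: "\<And>k. k \<le> c + e \<Longrightarrow> f k = qcoef V c k"
    and z: "z = c + e + 1" and b: "b = z + 10 + 3 * (c + e)" and N: "1 \<le> N"
  shows "wp core (\<lambda>i' f' t'. (\<forall>j<N. f' (b + j) = walkn V j 0 \<and> f' (b + 2 * N + j) = tl j 0) \<and>
    f' (i' 10) + f' (i' 10) = 1 \<and> f' (i' 18) = 1 \<and> i' 8 = N \<and> i' 10 = z + 1 \<and> i' 12 = b + 7 * N \<and>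
    i' 14 = b + 4 * N \<and> i' 15 = b + 5 * N \<and> i' 17 = z + 2 \<and> i' 18 = z \<and> i' 52 = b \<and> i' 53 = b + 2 * N \<and>
    t' \<le> t + 200 * ((c + e) * (c + e)) * N) i f t"
  unfolding core_def wp_Seq_eq
proof (rule wp_conseq[OF layout_spec[OF i f z b]], goal_cases)
  case (2 i1 f1 t1)
  define d where "d = c + e"
  have d2: "2 \<le> d" using ce by (simp add: d_def)
  note p = 2(1)
  show ?case
  proof (rule wp_while[where n = N and I = "\<lambda>n i' f' t'. core_inv z (b + 2 * N) (1 / 2) n i' f' \<and>
      t' \<le> t1 + n * (98 * (d * d) + 2)"], goal_cases)
    case 1
    show ?case using p by simp
  next
    case (2 n i2 f2 t2)
    have "i2 55 = b + N" using 2(3)[of 55] p by simp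
    moreover have "i2 54 = b + n" using 2(2) by (simp add: core_inv_def b)
    moreover have "wp core_body (\<lambda>i' f' t'. core_inv z (b + 2 * N) (1 / 2) (Suc n) i' f' \<and>
        Suc t' \<le> t1 + Suc n * (98 * (d * d) + 2)) i2 f2 (Suc t2)"
    proof (rule wp_conseq[OF core_step_spec[OF conjunct1[OF 2(2)] z]], goal_cases)
      case 1
      show ?case using 2(1) by (simp add: b)
    next
      case (2 i3 f3 t3)
      then show ?case using \<open>core_inv z (b + 2 * N) (1 / 2) n i2 f2 \<and> _\<close> by (simp add: d_def)
    qed
    ultimately show ?case using 2(1) by simp
  next
    case (3 i2 f2 t2)
    note q = 3(1)
    have r: "i2 8 = N" "i2 10 = z + 1" "i2 12 = b + 7 * N" "i2 14 = b + 4 * N" "i2 15 = b + 5 * N"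
      "i2 17 = z + 2" "i2 53 = b + 2 * N" "i2 55 = b + N"
      using 3(2) p by simp_all
    have cr: "core_regs c e z i2" "i2 54 = b + N" using q by (simp_all add: core_inv_def b)
    have cc: "core_cells z (b + 2 * N) (1 / 2) N N f2" using q by (simp add: core_inv_def)
    have "Suc t2 \<le> t + 200 * (d * d) * N"
    proof -
      have D: "4 \<le> d * d" "2 * d \<le> d * d" using mult_le_mono[OF d2 d2] mult_le_mono1[OF d2, of d] by auto
      have "Suc t2 \<le> t + (61 + 12 * d) + N * (98 * (d * d) + 2)" using q p by (simp add: d_def)
      also have "\<dots> \<le> t + (61 + 12 * d) * N + N * (98 * (d * d) + 2)" using N by simp
      also have "\<dots> = t + (63 + 12 * d + 98 * (d * d)) * N" by (simp add: algebra_simps)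
      also have "\<dots> \<le> t + 200 * (d * d) * N"
        by (intro add_left_mono mult_le_mono1) (use D in linarith)
      finally show ?thesis .
    qed
    moreover have h2: "f2 (z + 1) = 1 / 2" using cc by (simp add: core_cells_def)
    moreover have "f2 (z + 1) + f2 (z + 1) = 1" unfolding h2 by simp
    moreover have "f2 z = 1" using cc by (simp add: core_cells_def core_memD)
    moreover have "f2 (b + j) = walkn V j 0 \<and> f2 (b + 2 * N + j) = tl j 0" if "j < N" for j
      using cc that by (simp add: core_cells_def b)
    ultimately show ?case
      using r cr(2) core_regsD(5,15)[OF cr(1)] by (simp add: d_def b)
  qed
qed simp

end

section \<open>The programs for the three series\<close>

definition bridge_prog :: com where
  "bridge_prog = core ;; Instrs (mov 0 52)"

text \<open>The exponential formula for both series is of the type of Spitzer's identity.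
  \<open>r\<close> is the register with the address of the exponent data, 52 for bridge numbers and
  53 for tails.\<close>

definition spitzer_prog :: "nat \<Rightarrow> com" where
  "spitzer_prog r = core ;; Instrs (mov 13 r) ;; exp_prog ;; Instrs (mov 0 14)"

text \<open>At \<open>n\<close> the recurrence involves \<open>a\<close> at the indices 1 to
  \<open>n\<close> only, so agreement of the memory with \<open>a\<close> below \<open>N\<close>
  determines the first \<open>N\<close> results.\<close>

lemma exp_seq_unique:
  fixes m :: "nat \<Rightarrow> 'k::field_char_0"
  assumes m: "m 0 = 1" "\<And>n. of_nat n * m n = (\<Sum>k=1..n. a k * m (n - k))"
    and a': "\<And>j. j < N \<Longrightarrow> a' j = a j" and "n < N"
  shows "exp_seq a' n = m n"
  using assms(4)
proof (induction n rule: less_induct)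
  case (less n)
  show ?case
  proof (cases "n = 0")
    case False
    have "(\<Sum>k<n. a' (n - k) * exp_seq a' k) = (\<Sum>k<n. a (n - k) * m k)"
      by (rule sum.cong) (use less a' in auto)
    also have "\<dots> = (\<Sum>k=1..n. a k * m (n - k))"
      by (rule sum.reindex_bij_witness[where i = "\<lambda>k. n - k" and j = "\<lambda>k. n - k"]) auto
    finally have "(\<Sum>k<n. a' (n - k) * exp_seq a' k) = of_nat n * m n" unfolding m(2) .
    then show ?thesis using False by (subst exp_seq.simps) simp
  qed (subst exp_seq.simps, simp add: m)
qed

context
  fixes V :: "int set" and c e :: nat
  assumes V: "V \<subseteq> {- int c..int e}" "- int c \<in> V" "int e \<in> V" and ce: "0 < c" "0 < e"
begin

lemma bridge_prog_spec:
  fixes f :: "nat \<Rightarrow> 'k::field_char_0"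
  assumes i: "i 0 = N" "i 1 = e" "i 2 = c" and f: "\<And>k. k \<le> c + e \<Longrightarrow> f k = qcoef V c k" and N: "1 \<le> N"
  shows "wp bridge_prog (\<lambda>i' f' t'. (\<forall>n<N. f' (i' 0 + n) = walkn V n 0) \<and>
    t' \<le> t + 200 * ((c + e) * (c + e)) * N + 2) i f t"
  unfolding bridge_prog_def wp_Seq
proof (rule wp_conseq[OF core_spec[OF V ce i f refl refl N]], goal_cases)
  case (2 i1 f1 t1)
  then show ?case by simp
qed

lemma spitzer_prog_spec:
  fixes f :: "nat \<Rightarrow> 'k::field_char_0"
  assumes i: "i 0 = N" "i 1 = e" "i 2 = c" and f: "\<And>k. k \<le> c + e \<Longrightarrow> f k = qcoef V c k" and N: "1 \<le> N" "N \<le> 2 ^ s"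
    and ra: "r = 52 \<and> a = (\<lambda>j. walkn V j 0) \<or> r = 53 \<and> a = (\<lambda>j. tl V e j 0)"
    and m: "m 0 = 1" "\<And>n. of_nat n * m n = (\<Sum>k=1..n. a k * m (n - k))"
  shows "wp (spitzer_prog r) (\<lambda>i' f' t'. (\<forall>n<N. f' (i' 0 + n) = m n) \<and>
    t' \<le> t + 200 * ((c + e) * (c + e)) * N + 40000 * (Suc (Suc s) * Suc (Suc s) * Suc (Suc s) * 2 ^ s) + 4) i f t"
  unfolding spitzer_prog_def wp_Seq_eq
proof (rule wp_conseq[OF core_spec[OF V ce i f refl refl N(1)]], goal_cases)
  case (2 i1 f1 t1)
  define z where "z = c + e + 1"
  define b where "b = z + 10 + 3 * (c + e)"
  note p = 2(1)[folded z_def, folded b_def]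
  define A where "A = (if r = 52 then b else b + 2 * N)"
  have A: "i1 r = A" "\<And>j. j < N \<Longrightarrow> f1 (A + j) = a j" using p ra by (auto simp: A_def)
  have h: "f1 (z + 1) + f1 (z + 1) = 1" "f1 z = 1" "i1 10 = z + 1" "i1 18 = z" using p by auto
  have Ab: "b \<le> A" "A \<le> b + 2 * N" by (simp_all add: A_def)
  have "wp exp_prog (\<lambda>i' f' t'.
      (\<forall>n<N. f' (b + 4 * N + n) = exp_seq (\<lambda>q. f1 (A + q)) n) \<and> i' 14 = b + 4 * N \<and>
      t' \<le> t1 + 2 + 40000 * (Suc (Suc s) * Suc (Suc s) * Suc (Suc s) * 2 ^ s)) (i1(13 := A)) f1 (t1 + 2)"
    by (rule exp_prog_spec[where U = "b + 7 * N" and acc = "b + 5 * N" and fc = "z + 2"])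
      (use p h Ab N in \<open>simp_all add: b_def\<close>)
  then have "wp exp_prog (wp (Instrs (mov 0 14)) (\<lambda>i' f' t'. (\<forall>n<N. f' (i' 0 + n) = m n) \<and>
      t' \<le> t + 200 * ((c + e) * (c + e)) * N + 40000 * (Suc (Suc s) * Suc (Suc s) * Suc (Suc s) * 2 ^ s) + 4))
      (i1(13 := A)) f1 (t1 + 2)"
  proof (rule wp_conseq, goal_cases)
    case (1 i2 f2 t2)
    have "f2 (b + 4 * N + n) = m n" if "n < N" for n
      using 1(1) that exp_seq_unique[where a' = "\<lambda>q. f1 (A + q)", OF m A(2) that] by simp
    moreover have "i2 14 = b + 4 * N" using 1(1) by simp
    moreover have "t2 + 2 \<le> t + 200 * ((c + e) * (c + e)) * N + 40000 * (Suc (Suc s) * Suc (Suc s) * Suc (Suc s) * 2 ^ s) + 4"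
      using 1(1) p by linarith
    ultimately show ?case by simp
  qed
  moreover have "r \<noteq> 13" using ra by auto
  ultimately show ?case using A(1) by (simp del: mult_Suc mult_Suc_right)
qed

end

lemma expands_withinI:
  fixes s :: "'k::field_char_0 state"
  assumes "wp p (\<lambda>i' f' t'. (\<forall>n<N. f' (i' 0 + n) = fps_nth F n) \<and> t' \<le> T) ((idx s)(0 := N)) (fld s) 0"
    and "real T \<le> C"
  shows "expands_within (comp 0 p) s N F C"
proof -
  obtain i' f' u where r: "run p ((idx s)(0 := N)) (fld s) u i' f'" "\<forall>n<N. f' (i' 0 + n) = fps_nth F n" "u \<le> T"
    using assms(1) unfolding wp_def by auto
  have "s\<lparr>pc := 0, idx := (idx s)(0 := N)\<rparr> = \<lparr>pc = 0, idx = (idx s)(0 := N), fld = fld s\<rparr>"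
    by (cases s) simp
  note eq = this
  have "real u \<le> C" using r(3) assms(2) by simp
  then show ?thesis
    unfolding expands_within_def using run_exec[OF r(1), folded eq] r(2)
    by (intro exI[of _ u] exI[of _ "\<lparr>pc = csize p, idx = i', fld = f'\<rparr>"]) simp
qed

text \<open>The maxima are attained on a finite nonempty set; the two extreme steps provide the
  outer coefficients 1 that the recurrences divide out.\<close>

lemma altitudes_range:
  assumes S: "step_set S" "S \<noteq> {}" and pos: "u_minus S > 0" "u_plus S > 0"
  defines "c \<equiv> nat (u_minus S)" and "e \<equiv> nat (u_plus S)"
  shows "altitudes S \<subseteq> {- int c..int e}" "- int c \<in> altitudes S" "int e \<in> altitudes S" "0 < c" "0 < e"
proof -
  have fin: "finite (altitudes S)" and ne: "altitudes S \<noteq> {}"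
    using step_set_altitudes[OF S(1)] S(2) by auto
  have "{u. (1, - u) \<in> S} = uminus ` altitudes S" by (force simp: altitudes_def)
  then have m: "u_minus S = Max (uminus ` altitudes S)" by (simp add: u_minus_def)
  have p: "u_plus S = Max (altitudes S)" by (simp add: u_plus_def altitudes_def)
  have c: "int c = u_minus S" and e: "int e = u_plus S" using pos by (simp_all add: c_def e_def)
  have "- u \<le> u_minus S" if "u \<in> altitudes S" for u unfolding m using fin that by (intro Max_ge) auto
  moreover have "u \<le> u_plus S" if "u \<in> altitudes S" for u unfolding p using fin that by (intro Max_ge) auto
  ultimately show "altitudes S \<subseteq> {- int c..int e}" unfolding c e by force
  have "u_minus S \<in> uminus ` altitudes S" unfolding m using fin ne by (intro Max_in) auto
  then show "- int c \<in> altitudes S" unfolding c by auto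
  show "int e \<in> altitudes S" unfolding e p using fin ne by (intro Max_in)
  show "0 < c" "0 < e" using pos by (simp_all add: c_def e_def)
qed

section \<open>Numerical estimates and the conclusion\<close>

lemma power_of_two_near: "1 \<le> N \<Longrightarrow> \<exists>s. N \<le> 2 ^ s \<and> (2::nat) ^ s \<le> 2 * N"
proof (induction N rule: nat_induct_at_least)
  case base
  show ?case by (rule exI[of _ 0]) simp
next
  case (Suc N)
  then obtain s where s: "N \<le> 2 ^ s" "(2::nat) ^ s \<le> 2 * N" by blast
  show ?case
  proof (cases "Suc N \<le> 2 ^ s")
    case True
    then show ?thesis using s by (intro exI[of _ s]) simp
  next
    case False
    then have "2 ^ s = N" using s by simp
    then show ?thesis using Suc.hyps by (intro exI[of _ "Suc s"]) simp
  qed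
qed

text \<open>Constants and terms free of logarithms must be absorbed by powers of a logarithm that
  may be below 1; its argument is at least 2, and \<open>e\<close> is at most 4.\<close>

lemma half_le_ln: "2 \<le> x \<Longrightarrow> 1 / 2 \<le> ln (x :: real)"
proof -
  assume x: "2 \<le> x"
  have "exp (1 / 2) ^ 2 = exp (1 :: real)" by (simp add: exp_of_nat_mult[symmetric])
  also have "\<dots> \<le> 2 ^ 2" using exp_le by simp
  finally have "exp (1 / 2) \<le> (2 :: real)" by (rule power2_le_imp_le) simp
  then show ?thesis using x ln_ge_iff[of x "1 / 2"] by linarith
qed

text \<open>From \<open>2^s \<le> 2 N \<le> d N\<close> and \<open>ln 2 \<ge> 1/2\<close>, the
  number \<open>s + 2\<close> is at most 6 times the logarithm.\<close>

lemma cost_bound: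
  assumes d: "2 \<le> d" and N: "1 \<le> N" and s: "(2::nat) ^ s \<le> 2 * N"
  shows "real (200 * (d * d) * N + 40000 * (Suc (Suc s) * Suc (Suc s) * Suc (Suc s) * 2 ^ s) + 4)
    \<le> 20000000 * real d ^ 2 * real N * ln (real d * real N) ^ 3"
proof -
  define L where "L = ln (real d * real N)"
  have dN: "2 * real N \<le> real d * real N" using d by (intro mult_right_mono) auto
  have l2: "1 / 2 \<le> ln (2 :: real)" by (rule half_le_ln) simp
  have "1 \<le> real N" using N by simp
  then have "2 \<le> real d * real N" using dN by linarith
  then have "ln 2 \<le> L" unfolding L_def by simp
  have "real s * ln 2 = ln (2 ^ s)" by (simp add: ln_realpow)
  also have "\<dots> \<le> L"
  proof -
    have "real (2 ^ s) \<le> real (2 * N)" using s by (simp only: of_nat_le_iff)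
    then have "(2::real) ^ s \<le> real d * real N" using dN by simp
    then show ?thesis unfolding L_def by (intro ln_mono) auto
  qed
  finally have "real (Suc (Suc s)) * ln 2 \<le> 3 * L" using \<open>ln 2 \<le> L\<close> by (simp add: algebra_simps)
  moreover have "real (Suc (Suc s)) * (1 / 2) \<le> real (Suc (Suc s)) * ln 2" by (rule mult_left_mono[OF l2]) simp
  ultimately have "real (Suc (Suc s)) * (1 / 2) \<le> 3 * L" by (rule order.trans[rotated])
  then have s6: "real (Suc (Suc s)) \<le> 6 * L" by simp
  have "real (Suc (Suc s)) ^ 3 \<le> (6 * L) ^ 3" by (rule power_mono[OF s6]) simp
  then have s3: "real (Suc (Suc s)) ^ 3 \<le> 216 * L ^ 3" by (simp add: power_mult_distrib)
  have "(1 / 2) ^ 3 \<le> L ^ 3" using l2 \<open>ln 2 \<le> L\<close> by (intro power_mono) auto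
  then have L3: "1 \<le> 8 * L ^ 3" by (simp add: power3_eq_cube)
  have X: "1 \<le> real d ^ 2" using d by simp
  define Y where "Y = real d ^ 2 * real N"
  have Y: "1 \<le> Y" "real N \<le> Y" using X N mult_mono[of 1 "real d ^ 2" 1 "real N"] mult_right_mono[OF X, of "real N"]
    by (simp_all add: Y_def)
  have "real (2 ^ s) \<le> real (2 * N)" using s by (simp only: of_nat_le_iff)
  then have "real (Suc (Suc s)) ^ 3 * 2 ^ s \<le> 216 * L ^ 3 * (2 * real N)"
    by (intro mult_mono s3) (use L3 l2 \<open>ln 2 \<le> L\<close> in auto)
  also have "\<dots> \<le> 216 * L ^ 3 * (2 * Y)" using Y L3 l2 \<open>ln 2 \<le> L\<close> by (intro mult_left_mono) auto
  finally have e: "real (Suc (Suc s)) ^ 3 * 2 ^ s \<le> 432 * (Y * L ^ 3)" by (simp add: mult_ac)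
  have y: "Y \<le> 8 * (Y * L ^ 3)" using mult_left_mono[OF L3, of Y] Y by (simp add: mult_ac)
  have "real (200 * (d * d) * N + 40000 * (Suc (Suc s) * Suc (Suc s) * Suc (Suc s) * 2 ^ s) + 4)
      = 200 * Y + 40000 * (real (Suc (Suc s)) ^ 3 * 2 ^ s) + 4"
    by (simp add: Y_def power2_eq_square power3_eq_cube algebra_simps)
  \<comment> \<open>The main term gives \<open>40000 * 432 = 17280000\<close>; by
    \<open>Y \<le> 8 Y L^3\<close> the other two add at most 1632.\<close>
  also have "\<dots> \<le> 20000000 * (Y * L ^ 3)" using e y Y(1) by linarith
  finally show ?thesis by (simp add: Y_def L_def mult.assoc)
qed

text \<open>The programs and constants are chosen before the step set, so they serve all
  \<open>S\<close> and \<open>N\<close>. The exponent 3 consists of two logarithms from the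
  multiplication and one from the online schedule.\<close>

theorem theorem18:
  "\<exists>(pre :: instr list) (prog_B :: instr list) (prog_E :: instr list) (prog_M :: instr list)
      (C :: real) (k :: nat).
     \<forall>S. step_set S \<and> S \<noteq> {} \<and> u_minus S > 0 \<and> u_plus S > 0 \<longrightarrow>
       (let d = real_of_int (u_minus S + u_plus S) in
        \<exists>t (s :: 'k::field_char_0 state).
          exec pre (step_set_input S) t s \<and>
          real t \<le> C * d ^ 5 * (ln d) ^ k \<and>
          (\<forall>N\<ge>1.
             expands_within prog_B s N (bridge_series S) (C * d ^ 2 * real N) \<and>
             expands_within prog_E s N (excursion_series S)
               (C * d ^ 2 * real N * (ln (d * real N)) ^ k) \<and>
             expands_within prog_M s N (meander_series S)
               (C * d ^ 2 * real N * (ln (d * real N)) ^ k)))"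
proof (rule exI[of _ "[IAdd 2 0 3]"], rule exI[of _ "comp 0 bridge_prog"],
    rule exI[of _ "comp 0 (spitzer_prog 52)"], rule exI[of _ "comp 0 (spitzer_prog 53)"],
    rule exI[of _ 20000000], rule exI[of _ 3], intro allI impI, unfold Let_def, elim conjE)
  fix S assume S: "step_set S" "S \<noteq> {}" and pos: "u_minus S > 0" "u_plus S > 0"
  define c e where "c = nat (u_minus S)" and "e = nat (u_plus S)"
  define V where "V = altitudes S"
  have V: "V \<subseteq> {- int c..int e}" "- int c \<in> V" "int e \<in> V" and ce: "0 < c" "0 < e"
    using altitudes_range[OF S pos] by (simp_all add: V_def c_def e_def)
  have finV: "finite V" using V(1) finite_subset by blast
  \<comment> \<open>Index cell 3 is 0 in the input, so the single \<open>IAdd\<close> acts as a copy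
    into cell 2, out of reach of \<open>N\<close>.\<close>
  define s where "s = \<lparr>pc = 1, idx = (idx (step_set_input S :: 'k state))(2 := c), fld = fld (step_set_input S :: 'k state)\<rparr>"
  define J where "J = (\<lambda>N. (idx s)(0 := N))"
  have i: "J N 0 = N" "J N 1 = e" "J N 2 = c" for N
    by (simp_all add: J_def s_def step_set_input_def e_def)
  have f: "fld s k = qcoef V c k" if "k \<le> c + e" for k
    using pos unfolding qcoef_def[OF V ce] by (simp add: s_def step_set_input_def V_def altitudes_def c_def)
  have pre: "exec [IAdd 2 0 3] (step_set_input S) (Suc 0) s"
    by (rule exec.step[rotated 2, OF exec.halt])
      (simp_all add: s_def step_set_input_def set_idx_def c_def)
  define d where "d = c + e"
  have d: "real_of_int (u_minus S + u_plus S) = real d" using pos by (simp add: d_def c_def e_def)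
  have d2: "2 \<le> d" using ce by (simp add: d_def)
  have "real (Suc 0) \<le> 20000000 * real d ^ 5 * ln (real d) ^ 3"
  proof -
    \<comment> \<open>Even one instruction has to be justified, since \<open>ln d\<close> is below 1
      for \<open>d = 2\<close>.\<close>
    have "(1 / 2) ^ 3 \<le> ln (real d) ^ 3" using half_le_ln[of "real d"] d2 by (intro power_mono) auto
    then have l: "1 \<le> 20000000 * ln (real d) ^ 3" by (simp add: power3_eq_cube)
    have "1 \<le> real d ^ 5" using d2 by (intro one_le_power) simp
    then have "1 * 1 \<le> real d ^ 5 * (20000000 * ln (real d) ^ 3)" using l by (intro mult_mono) auto
    then show ?thesis by (simp add: mult_ac)
  qed
  moreover have "expands_within (comp 0 bridge_prog) s N (bridge_series S) (20000000 * real d ^ 2 * real N)"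
    if N: "1 \<le> N" for N
  proof (rule expands_withinI[where s = s and T = "200 * (d * d) * N + 2", folded fun_cong[OF J_def]])
    show "wp bridge_prog (\<lambda>i' f' t'. (\<forall>n<N. f' (i' 0 + n) = fps_nth (bridge_series S) n) \<and>
        t' \<le> 200 * (d * d) * N + 2) (J N) (fld s) 0"
      using bridge_prog_spec[OF V ce i f N, of 0]
      by (simp add: bridge_series_def bridges_count[OF S(1)] V_def d_def)
    have "real 1 * 1 \<le> (real d * real d) * real N" using d2 N mult_mono[of 1 "real d" 1 "real d"] by (intro mult_mono) auto
    then show "real (200 * (d * d) * N + 2) \<le> 20000000 * real d ^ 2 * real N"
      by (simp add: power2_eq_square algebra_simps)
  qed
  moreover have "expands_within (comp 0 (spitzer_prog 52)) s N (excursion_series S)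
      (20000000 * real d ^ 2 * real N * ln (real d * real N) ^ 3)"
    "expands_within (comp 0 (spitzer_prog 53)) s N (meander_series S)
      (20000000 * real d ^ 2 * real N * ln (real d * real N) ^ 3)" if N: "1 \<le> N" for N
  proof -
    obtain r where r: "N \<le> 2 ^ r" "(2::nat) ^ r \<le> 2 * N" using power_of_two_near[OF N] by blast
    define T where "T = 200 * (d * d) * N + 40000 * (Suc (Suc r) * Suc (Suc r) * Suc (Suc r) * 2 ^ r) + 4"
    have T: "real T \<le> 20000000 * real d ^ 2 * real N * ln (real d * real N) ^ 3"
      unfolding T_def by (rule cost_bound[OF d2 N r(2)])
    define me where "me = (\<lambda>n. meann V n 0 :: 'k)"
    define mm where "mm = (\<lambda>n. \<Sum>h\<le>n * e. meann V n (int h) :: 'k)"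
    have ub: "\<And>u. u \<in> V \<Longrightarrow> u \<le> int e" using V(1) by auto
    have E: "wp (spitzer_prog 52) (\<lambda>i' f' t'. (\<forall>n<N. f' (i' 0 + n) = me n) \<and> t' \<le> T) (J N) (fld s) 0"
      unfolding T_def d_def add_0
      using spitzer_prog_spec[OF V ce i f N r(1), where r = 52 and a = "\<lambda>j. walkn V j 0" and m = me and t = 0]
        meann_zero_rec[OF finV ub, where 'k = 'k]
      by (simp add: me_def)
    have M: "wp (spitzer_prog 53) (\<lambda>i' f' t'. (\<forall>n<N. f' (i' 0 + n) = mm n) \<and> t' \<le> T) (J N) (fld s) 0"
      unfolding T_def d_def add_0
      using spitzer_prog_spec[OF V ce i f N r(1), where r = 53 and a = "\<lambda>j. tl V e j 0" and m = mm and t = 0]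
        meann_sum_rec[OF finV ub, where 'k = 'k]
      by (simp add: mm_def tl_eq[OF V ce])
    show "expands_within (comp 0 (spitzer_prog 52)) s N (excursion_series S)
      (20000000 * real d ^ 2 * real N * ln (real d * real N) ^ 3)"
      by (rule expands_withinI[where s = s, folded fun_cong[OF J_def], OF _ T])
        (use E in \<open>simp add: excursion_series_def excursions_count[OF S(1)] me_def V_def\<close>)
    show "expands_within (comp 0 (spitzer_prog 53)) s N (meander_series S)
      (20000000 * real d ^ 2 * real N * ln (real d * real N) ^ 3)"
      by (rule expands_withinI[where s = s, folded fun_cong[OF J_def], OF _ T])
        (use M ub in \<open>simp add: meander_series_def meanders_count[OF S(1), of e] mm_def V_def\<close>)
  qed
  ultimately show "\<exists>t (s :: 'k state). exec [IAdd 2 0 3] (step_set_input S) t s \<and>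
      real t \<le> 20000000 * real_of_int (u_minus S + u_plus S) ^ 5 * ln (real_of_int (u_minus S + u_plus S)) ^ 3 \<and>
      (\<forall>N\<ge>1.
         expands_within (comp 0 bridge_prog) s N (bridge_series S)
           (20000000 * real_of_int (u_minus S + u_plus S) ^ 2 * real N) \<and>
         expands_within (comp 0 (spitzer_prog 52)) s N (excursion_series S)
           (20000000 * real_of_int (u_minus S + u_plus S) ^ 2 * real N *
             ln (real_of_int (u_minus S + u_plus S) * real N) ^ 3) \<and>
         expands_within (comp 0 (spitzer_prog 53)) s N (meander_series S)
           (20000000 * real_of_int (u_minus S + u_plus S) ^ 2 * real N *
             ln (real_of_int (u_minus S + u_plus S) * real N) ^ 3))"
    unfolding d using pre by blast
qed

end
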